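(* Let $N\ge 1$, let $\Omega\subset\mathbb{R}^N$ be a bounded open set with Lipschitz continuous boundary, let $0<s<1$, $\delta\ge0$, $T>0$, and let $\mathcal{O}\subset\mathbb{R}^N\setminus\Omega$ be an arbitrary non-empty open set. For $g\in\mathcal{D}(\mathcal{O}\times(0,T))$ let $(u,u_t)$ be the unique weak solution of $$\begin{cases}u_{tt}+(-\Delta)^su+\delta(-\Delta)^su_t=0 & \text{in }\Omega\times(0,T),\\ u=g\chi_{\mathcal{O}\times(0,T)} & \text{in }(\mathbb{R}^N\setminus\Omega)\times(0,T),\\ u(\cdot,0)=0,\quad u_t(\cdot,0)=0 & \text{in }\Omega.\end{cases}$$ Then the system is approximately controllable at time $T$ with controls in $\mathcal{D}(\mathcal{O}\times(0,T))$, that is, the set $$\{(u(\cdot,T),u_t(\cdot,T)):\ g\in\mathcal{D}(\mathcal{O}\times(0,T))\}$$ is dense in $L^2(\Omega)\times W^{-s,2}(\overline\Omega)$.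
   Context: $\mathcal{D}(\mathcal{O}\times(0,T))$ is the space of $C^\infty$ functions with compact support in $\mathcal{O}\times(0,T)$; $u(\cdot,T)$ and $u_t(\cdot,T)$ are understood restricted to $\Omega$. Fractional Laplacian: $(-\Delta)^su(x)=C_{N,s}\,\mathrm{P.V.}\int_{\mathbb{R}^N}\frac{u(x)-u(y)}{|x-y|^{N+2s}}\,dy$, with $C_{N,s}=\frac{s2^{2s}\Gamma((2s+N)/2)}{\pi^{N/2}\Gamma(1-s)}$. Spaces: $W^{s,2}(\mathbb{R}^N)=\{u\in L^2(\mathbb{R}^N):\int_{\mathbb{R}^N}\int_{\mathbb{R}^N}\frac{|u(x)-u(y)|^2}{|x-y|^{N+2s}}dxdy<\infty\}$; $W_0^{s,2}(\overline\Omega)=\{u\in W^{s,2}(\mathbb{R}^N):u=0\text{ in }\mathbb{R}^N\setminus\Omega\}$; $W^{-s,2}(\overline\Omega)$ is the dual of $W_0^{s,2}(\overline\Omega)$, with duality pairing $\langle\cdot,\cdot\rangle_{-\frac12,\frac12}$ and the Gelfand triple $W_0^{s,2}(\overline\Omega)\hookrightarrow L^2(\Omega)\hookrightarrow W^{-s,2}(\overline\Omega)$. For $f\in W^{s,2}(\mathbb{R}^N)$ and $\zeta\in W_0^{s,2}(\overline\Omega)$, $\langle(-\Delta)^sf,\zeta\rangle_{-\frac12,\frac12}=\frac{C_{N,s}}{2}\int_{\mathbb{R}^N}\int_{\mathbb{R}^N}\frac{(f(x)-f(y))(\zeta(x)-\zeta(y))}{|x-y|^{N+2s}}dxdy$.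 Weak solution: $(u,u_t)$ is a weak solution of the system if $u\in C([0,T];L^2(\Omega))\cap C^1([0,T];W^{-s,2}(\overline\Omega))$, $u_{tt}\in C((0,T);W^{-s,2}(\overline\Omega))$; for every $\zeta\in W_0^{s,2}(\overline\Omega)$ and a.e. $t\in(0,T)$, $\langle u_{tt},\zeta\rangle_{-\frac12,\frac12}+\langle(-\Delta)^s(u+\delta u_t),\zeta\rangle_{-\frac12,\frac12}=0$; $u(\cdot,0)=u_t(\cdot,0)=0$ in $\Omega$; and $u=g\chi_{\mathcal{O}\times(0,T)}$ in $(\mathbb{R}^N\setminus\Omega)\times(0,T)$. For $g\in\mathcal{D}(\mathcal{O}\times(0,T))$ the weak solution satisfies $u\in C^\infty([0,T];W^{s,2}(\mathbb{R}^N))$. *)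

theory Defs
  imports "HOL-Analysis.Analysis"
begin

text \<open>Near each boundary point, \<open>\<Omega>\<close> is the strict epigraph, in some direction \<open>e\<close>, of a Lipschitz
  function \<open>\<gamma>\<close> on the hyperplane orthogonal to \<open>e\<close>; \<open>y - (y \<bullet> e) *\<^sub>R e\<close> is the orthogonal
  projection of \<open>y\<close> to that hyperplane.\<close>

definition lipschitz_boundary :: "('a::euclidean_space) set \<Rightarrow> bool" where
  "lipschitz_boundary \<Omega> \<longleftrightarrow>
     (\<forall>p\<in>frontier \<Omega>. \<exists>r>0. \<exists>e L. \<exists>\<gamma>::'a \<Rightarrow> real. norm e = 1 \<and>
        L-lipschitz_on {z. z \<bullet> e = 0} \<gamma> \<and>
        \<Omega> \<inter> ball p r = {y \<in> ball p r. \<gamma> (y - (y \<bullet> e) *\<^sub>R e) < y \<bullet> e})"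

fun k_times_cont_diff :: "nat \<Rightarrow> ('a::euclidean_space \<Rightarrow> real) \<Rightarrow> bool" where
  "k_times_cont_diff 0 f \<longleftrightarrow> continuous_on UNIV f"
| "k_times_cont_diff (Suc k) f \<longleftrightarrow> f differentiable_on UNIV \<and>
     (\<forall>b\<in>Basis. k_times_cont_diff k (\<lambda>x. frechet_derivative f (at x) b))"

text \<open>The elements of \<open>\<D>(W)\<close> are represented by their extensions by zero to the whole space.\<close>

definition test_functions :: "('a::euclidean_space) set \<Rightarrow> ('a \<Rightarrow> real) set" where
  "test_functions W = {g. (\<forall>k. k_times_cont_diff k g) \<and>
     compact (closure {z. g z \<noteq> 0}) \<and> closure {z. g z \<noteq> 0} \<subseteq> W}"

text \<open>Elements of the function spaces are represented by Borel functions on the whole of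
  \<open>\<real>\<^sup>N\<close>, without passing to classes modulo null sets; the norms are then seminorms. For elements
  of \<open>L\<^sup>2(\<Omega>)\<close> only the restriction to \<open>\<Omega>\<close> is relevant.\<close>

definition L2 :: "(real^'n) set \<Rightarrow> (real^'n \<Rightarrow> real) set" where
  "L2 A = {f. set_borel_measurable lborel A f \<and> set_integrable lborel A (\<lambda>x. (f x)\<^sup>2)}"

definition L2_norm :: "(real^'n) set \<Rightarrow> (real^'n \<Rightarrow> real) \<Rightarrow> real" where
  "L2_norm A f = sqrt (LINT x:A|lborel. (f x)\<^sup>2)"

text \<open>The diagonal causes no problem: there the integrands below have the form \<open>0 / 0 = 0\<close>.\<close>

definition sobolev :: "real \<Rightarrow> (real^'n \<Rightarrow> real) set" where
  "sobolev s = {u \<in> L2 UNIV.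
     integrable (lborel \<Otimes>\<^sub>M lborel)
       (\<lambda>(x, y). (u x - u y)\<^sup>2 / norm (x - y) powr (real CARD('n) + 2 * s))}"

definition sobolev_norm :: "real \<Rightarrow> (real^'n \<Rightarrow> real) \<Rightarrow> real" where
  "sobolev_norm s u = sqrt ((LINT x|lborel. (u x)\<^sup>2) +
     (LINT (x, y)|(lborel \<Otimes>\<^sub>M lborel).
        (u x - u y)\<^sup>2 / norm (x - y) powr (real CARD('n) + 2 * s)))"

definition sobolev0 :: "real \<Rightarrow> (real^'n) set \<Rightarrow> (real^'n \<Rightarrow> real) set" where
  "sobolev0 s \<Omega> = {u \<in> sobolev s. AE x in lborel. x \<notin> \<Omega> \<longrightarrow> u x = 0}"

text \<open>\<open>W\<^sup>-\<^sup>s\<^sup>,\<^sup>2\<close>: bounded linear functionals on \<open>sobolev0 s \<Omega>\<close>. The pairing is function application,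
  and the values of a functional outside \<open>sobolev0 s \<Omega>\<close> are irrelevant.\<close>

definition sobolev_dual :: "real \<Rightarrow> (real^'n) set \<Rightarrow> ((real^'n \<Rightarrow> real) \<Rightarrow> real) set" where
  "sobolev_dual s \<Omega> = {F.
     (\<forall>\<zeta>\<in>sobolev0 s \<Omega>. \<forall>\<eta>\<in>sobolev0 s \<Omega>. F (\<lambda>x. \<zeta> x + \<eta> x) = F \<zeta> + F \<eta>) \<and>
     (\<forall>\<zeta>\<in>sobolev0 s \<Omega>. \<forall>c. F (\<lambda>x. c * \<zeta> x) = c * F \<zeta>) \<and>
     (\<exists>K. \<forall>\<zeta>\<in>sobolev0 s \<Omega>. \<bar>F \<zeta>\<bar> \<le> K * sobolev_norm s \<zeta>)}"

definition sobolev_dual_norm ::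
    "real \<Rightarrow> (real^'n) set \<Rightarrow> ((real^'n \<Rightarrow> real) \<Rightarrow> real) \<Rightarrow> real" where
  "sobolev_dual_norm s \<Omega> F = (SUP \<zeta>\<in>{\<zeta> \<in> sobolev0 s \<Omega>. sobolev_norm s \<zeta> \<le> 1}. \<bar>F \<zeta>\<bar>)"

text \<open>The embedding of \<open>L\<^sup>2(\<Omega>)\<close> into the dual space in the Gelfand triple.\<close>

definition L2_to_dual :: "(real^'n) set \<Rightarrow> (real^'n \<Rightarrow> real) \<Rightarrow> (real^'n \<Rightarrow> real) \<Rightarrow> real" where
  "L2_to_dual \<Omega> f \<zeta> = (LINT x:\<Omega>|lborel. f x * \<zeta> x)"

definition dense_in_L2_dual ::
    "real \<Rightarrow> (real^'n) set \<Rightarrow> ((real^'n \<Rightarrow> real) \<times> ((real^'n \<Rightarrow> real) \<Rightarrow> real)) set \<Rightarrow> bool" where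
  "dense_in_L2_dual s \<Omega> R \<longleftrightarrow> R \<subseteq> L2 \<Omega> \<times> sobolev_dual s \<Omega> \<and>
     (\<forall>w\<in>L2 \<Omega>. \<forall>F\<in>sobolev_dual s \<Omega>. \<forall>\<epsilon>>0. \<exists>(v, G)\<in>R.
        L2_norm \<Omega> (\<lambda>x. v x - w x) < \<epsilon> \<and> sobolev_dual_norm s \<Omega> (\<lambda>\<zeta>. G \<zeta> - F \<zeta>) < \<epsilon>)"

definition frac_const :: "nat \<Rightarrow> real \<Rightarrow> real" where
  "frac_const N s = s * 2 powr (2 * s) * Gamma ((2 * s + real N) / 2) /
     (pi powr (real N / 2) * Gamma (1 - s))"

text \<open>\<open>(-\<Delta>)\<^sup>s f\<close>, for \<open>f \<in> sobolev s\<close>, acts on \<open>\<zeta> \<in> sobolev0 s \<Omega>\<close> through the symmetric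
  bilinear form of the singular integral operator, so no principal value is needed.\<close>

definition frac_laplacian :: "real \<Rightarrow> (real^'n \<Rightarrow> real) \<Rightarrow> (real^'n \<Rightarrow> real) \<Rightarrow> real" where
  "frac_laplacian s f \<zeta> = frac_const CARD('n) s / 2 *
     (LINT (x, y)|(lborel \<Otimes>\<^sub>M lborel).
        (f x - f y) * (\<zeta> x - \<zeta> y) / norm (x - y) powr (real CARD('n) + 2 * s))"

text \<open>Continuity and derivatives of curves in a space of functions on \<open>'b\<close> with (semi)norm \<open>nrm\<close>,
  used both for \<open>L\<^sup>2(\<Omega>)\<close> and for the dual space.\<close>

definition curve_continuous_on ::
    "(('b \<Rightarrow> real) \<Rightarrow> real) \<Rightarrow> real set \<Rightarrow> (real \<Rightarrow> 'b \<Rightarrow> real) \<Rightarrow> bool" where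
  "curve_continuous_on nrm I U \<longleftrightarrow>
     (\<forall>t\<in>I. ((\<lambda>r. nrm (\<lambda>z. U r z - U t z)) \<longlongrightarrow> 0) (at t within I))"

definition curve_has_derivative_on ::
    "(('b \<Rightarrow> real) \<Rightarrow> real) \<Rightarrow> real set \<Rightarrow> (real \<Rightarrow> 'b \<Rightarrow> real) \<Rightarrow> (real \<Rightarrow> 'b \<Rightarrow> real) \<Rightarrow> bool" where
  "curve_has_derivative_on nrm I U V \<longleftrightarrow>
     (\<forall>t\<in>I. ((\<lambda>r. nrm (\<lambda>z. (U r z - U t z) / (r - t) - V t z)) \<longlongrightarrow> 0) (at t within I))"

definition exterior_datum ::
    "(real^'n) set \<Rightarrow> real \<Rightarrow> ((real^'n) \<times> real \<Rightarrow> real) \<Rightarrow> real \<Rightarrow> real^'n \<Rightarrow> real" where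
  "exterior_datum \<O> T g t x = g (x, t) * indicator (\<O> \<times> {0<..<T}) (x, t)"

text \<open>\<open>weak_solution s \<delta> T \<Omega> \<O> g u v\<close>: the pair of \<open>u\<close>, with \<open>u t\<close> a function on \<open>\<real>\<^sup>N\<close>,
  and its time derivative \<open>v\<close>, with \<open>v t\<close> in the dual space, is a weak solution; \<open>a\<close> is the second
  time derivative. The term \<open>(-\<Delta>)\<^sup>s(u + \<delta> u\<^sub>t)\<close> is only meaningful if \<open>u(t) + \<delta> u\<^sub>t(t)\<close> is a function
  in \<open>sobolev s\<close>. This is the function \<open>f t\<close>: it represents the element
  \<open>u(t) + \<delta> u\<^sub>t(t)\<close> of the dual space in \<open>\<Omega>\<close>, and outside \<open>\<Omega>\<close> it is
  given by the exterior datum and its time derivative. For \<open>\<delta> = 0\<close> this just says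
  that \<open>f t = u t\<close> almost everywhere.\<close>

definition weak_solution ::
    "real \<Rightarrow> real \<Rightarrow> real \<Rightarrow> (real^'n) set \<Rightarrow> (real^'n) set \<Rightarrow> ((real^'n) \<times> real \<Rightarrow> real) \<Rightarrow>
     (real \<Rightarrow> real^'n \<Rightarrow> real) \<Rightarrow> (real \<Rightarrow> (real^'n \<Rightarrow> real) \<Rightarrow> real) \<Rightarrow> bool" where
  "weak_solution s \<delta> T \<Omega> \<O> g u v \<longleftrightarrow>
     (\<forall>t\<in>{0..T}. u t \<in> L2 \<Omega>) \<and> curve_continuous_on (L2_norm \<Omega>) {0..T} u \<and>
     (\<forall>t\<in>{0..T}. v t \<in> sobolev_dual s \<Omega>) \<and>
     curve_has_derivative_on (sobolev_dual_norm s \<Omega>) {0..T} (\<lambda>t. L2_to_dual \<Omega> (u t)) v \<and>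
     curve_continuous_on (sobolev_dual_norm s \<Omega>) {0..T} v \<and>
     (\<exists>a f.
        (\<forall>t\<in>{0<..<T}. a t \<in> sobolev_dual s \<Omega>) \<and>
        curve_has_derivative_on (sobolev_dual_norm s \<Omega>) {0<..<T} v a \<and>
        curve_continuous_on (sobolev_dual_norm s \<Omega>) {0<..<T} a \<and>
        (AE t in lborel. t \<in> {0<..<T} \<longrightarrow> f t \<in> sobolev s \<and>
           (\<forall>\<zeta>\<in>sobolev0 s \<Omega>. L2_to_dual \<Omega> (f t) \<zeta> = L2_to_dual \<Omega> (u t) \<zeta> + \<delta> * v t \<zeta>) \<and>
           (AE x in lborel. x \<notin> \<Omega> \<longrightarrow>
              f t x = exterior_datum \<O> T g t x + \<delta> * deriv (\<lambda>\<tau>. exterior_datum \<O> T g \<tau> x) t)) \<and>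
        (\<forall>\<zeta>\<in>sobolev0 s \<Omega>. AE t in lborel. t \<in> {0<..<T} \<longrightarrow>
           a t \<zeta> + frac_laplacian s (f t) \<zeta> = 0)) \<and>
     (AE x in lborel. x \<in> \<Omega> \<longrightarrow> u 0 x = 0) \<and> (\<forall>\<zeta>\<in>sobolev0 s \<Omega>. v 0 \<zeta> = 0) \<and>
     (\<forall>t\<in>{0<..<T}. AE x in lborel. x \<notin> \<Omega> \<longrightarrow> u t x = exterior_datum \<O> T g t x)"

definition reachable_set ::
    "real \<Rightarrow> real \<Rightarrow> real \<Rightarrow> (real^'n) set \<Rightarrow> (real^'n) set \<Rightarrow>
     ((real^'n \<Rightarrow> real) \<times> ((real^'n \<Rightarrow> real) \<Rightarrow> real)) set" where
  "reachable_set s \<delta> T \<Omega> \<O> = {(u T, v T) | u v.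
     \<exists>g\<in>test_functions (\<O> \<times> {0<..<T}). weak_solution s \<delta> T \<Omega> \<O> g u v}"

end

theory Submission
  imports Defs "HOL-Computational_Algebra.Fundamental_Theorem_Algebra"
begin

text \<open>Let \<open>A\<close> be the fractional Laplacian with exterior condition zero and \<open>B = (1 + A)\<^sup>-\<^sup>1\<close>, a self-adjoint
  operator on \<open>L\<^sup>2(\<Omega>)\<close> with \<open>0 \<le> B \<le> 1\<close>. A control \<open>g(x, t) = \<psi>(x) \<theta>(t)\<close> supported away from \<open>\<Omega>\<close> acts in \<open>\<Omega>\<close>
  as the smooth force \<open>(\<theta> + \<delta> \<theta>')(t) S\<^sub>\<psi>\<close> with \<open>S\<^sub>\<psi>(y) = C \<integral> \<psi>(x) |x - y|\<^sup>-\<^sup>N\<^sup>-\<^sup>2\<^sup>s dx\<close>, and the solution in \<open>\<Omega>\<close> is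
  \<open>W(t; B) S\<^sub>\<psi>\<close>, where \<open>W(t; \<mu>)\<close> solves the scalar equation
  \<open>\<mu> W'' + (1 - \<mu>) (\<delta> W' + W) = \<mu> (\<theta> + \<delta> \<theta>')\<close> and depends continuously on \<open>\<mu> \<in> [0, 1]\<close>.

  The functions \<open>S\<^sub>\<psi>\<close> span a dense subspace of \<open>L\<^sup>2(\<Omega>)\<close>: if \<open>\<phi>\<close> is orthogonal to all of them, then
  \<open>\<integral> \<phi>(y) |x - y|\<^sup>-\<^sup>p dy = 0\<close> for \<open>x\<close> in a ball and \<open>p = N + 2 s\<close>, hence (taking Laplacians in \<open>x\<close>) for
  \<open>p = N + 2 s + 2 k\<close>, hence (Weierstrass) with any radial kernel, in particular with Gaussians. Gaussians
  with centre in a ball span a point separating algebra, so \<open>\<phi> = 0\<close> by Stone--Weierstrass.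

  If \<open>(\<phi>, \<psi>)\<close> is orthogonal to all final states, it follows that \<open>W(T; B) \<phi> + W'(T; B) \<psi> = 0\<close> for every
  profile \<open>\<theta>\<close>. Letting \<open>\<theta>\<close> tend to the Dirac mass at \<open>T\<close> and to its derivative gives two polynomial
  relations in \<open>B\<close> with determinant \<open>- B\<^sup>5\<close>, and \<open>B\<close> is injective; so \<open>\<phi> = \<psi> = 0\<close>. Thus the final states are
  dense even in \<open>L\<^sup>2(\<Omega>) \<times> L\<^sup>2(\<Omega>)\<close>.\<close>

section \<open>The space of square integrable functions\<close>

text \<open>The fractional Laplacian \<open>A\<close> is unbounded, and for \<delta> > 0 the
  construction places only the combination w + \<delta> w' in its form domain. Both difficulties
  disappear when everything is written in terms of the bounded operator \<open>B\<close>: since BA =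
  1 - B, applying \<open>B\<close> to w'' + A (w + \<delta> w') = h gives an equation whose
  coefficients are polynomials in \<open>B\<close>. Functions of \<open>B\<close> are limits of
  polynomials, and the only estimate behind them is that p(B) is bounded by the supremum of |p| on
  [0, 1]. It comes from the factorisation of real polynomials, so no eigenfunctions or spectral
  measures enter. The price is paid at \<mu> = 0, where the leading coefficient vanishes: the final
  values produced by an impulse contain 1 / \<mu>. Multiplying by \<mu>^2 and \<mu>^3 makes the
  limits uniform on [0, 1]; as multiplication by \<mu> is the injective operator \<open>B\<close>,
  these factors can be removed at the end. Density in L2 x L2 is enough for the dual space too,
  because the range of the resolvent is dense in the form domain, whence L2 is dense in the
  dual.\<close>

definition square_integrable :: "('a::euclidean_space \<Rightarrow> real) \<Rightarrow> bool" where
  "square_integrable f \<longleftrightarrow> f \<in> borel_measurable lborel \<and> integrable lborel (\<lambda>x. (f x)\<^sup>2)"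

lemma square_integrable_measurable[measurable_dest]: "square_integrable f \<Longrightarrow> f \<in> borel_measurable lborel"
  by (simp add: square_integrable_def)

lemma square_integrable_integrable: "square_integrable f \<Longrightarrow> integrable lborel (\<lambda>x. (f x)\<^sup>2)"
  by (simp add: square_integrable_def)

lemma square_integrable_bound:
  assumes "g \<in> borel_measurable lborel" "square_integrable f" "AE x in lborel. \<bar>g x\<bar> \<le> \<bar>f x\<bar>"
  shows "square_integrable g"
  unfolding square_integrable_def
proof
  show "integrable lborel (\<lambda>x. (g x)\<^sup>2)"
  proof (rule Bochner_Integration.integrable_bound[OF square_integrable_integrable[OF assms(2)]])
    show "AE x in lborel. norm ((g x)\<^sup>2) \<le> norm ((f x)\<^sup>2)"
      using assms(3) by eventually_elim (simp add: abs_le_square_iff)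
  qed (use assms(1) in measurable)
qed (fact assms(1))

lemma square_integrable_mult_integrable:
  assumes "square_integrable f" "square_integrable g" shows "integrable lborel (\<lambda>x. f x * g x)"
proof (rule Bochner_Integration.integrable_bound
    [OF Bochner_Integration.integrable_add[OF square_integrable_integrable[OF assms(1)] square_integrable_integrable[OF assms(2)]]])
  show "(\<lambda>x. f x * g x) \<in> borel_measurable lborel"
    using assms[THEN square_integrable_measurable] by measurable
  show "AE x in lborel. norm (f x * g x) \<le> norm ((f x)\<^sup>2 + (g x)\<^sup>2)"
  proof (rule AE_I2)
    fix x
    have "2 * \<bar>f x * g x\<bar> \<le> (f x)\<^sup>2 + (g x)\<^sup>2"
      using sum_squares_bound[of "\<bar>f x\<bar>" "\<bar>g x\<bar>"] by (simp add: abs_mult)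
    then show "norm (f x * g x) \<le> norm ((f x)\<^sup>2 + (g x)\<^sup>2)" by simp
  qed
qed

lemma square_integrable_zero: "square_integrable (\<lambda>_. 0)"
  by (simp add: square_integrable_def)

lemma square_integrable_scale: "square_integrable f \<Longrightarrow> square_integrable (\<lambda>x. c * f x)"
  by (auto simp: square_integrable_def power_mult_distrib)

lemma square_integrable_add:
  assumes "square_integrable f" "square_integrable g" shows "square_integrable (\<lambda>x. f x + g x)"
proof -
  have "integrable lborel (\<lambda>x. (f x)\<^sup>2 + 2 * (f x * g x) + (g x)\<^sup>2)"
    by (intro Bochner_Integration.integrable_add integrable_mult_right
        square_integrable_integrable square_integrable_mult_integrable assms)
  then have "integrable lborel (\<lambda>x. (f x + g x)\<^sup>2)"
    by (simp add: power2_sum algebra_simps)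
  moreover have "(\<lambda>x. f x + g x) \<in> borel_measurable lborel"
    using assms[THEN square_integrable_measurable] by (rule borel_measurable_add)
  ultimately show ?thesis by (simp add: square_integrable_def)
qed

lemma square_integrable_diff: "square_integrable f \<Longrightarrow> square_integrable g \<Longrightarrow> square_integrable (\<lambda>x. f x - g x)"
  using square_integrable_add[of f "\<lambda>x. (-1) * g x"] square_integrable_scale[of g "-1"] by simp

lemma square_integrable_indicator:
  assumes "square_integrable f" "A \<in> sets borel" shows "square_integrable (\<lambda>x. indicator A x * f x)"
  using square_integrable_measurable[OF assms(1)] assms(2)
  by (intro square_integrable_bound[OF _ assms(1)]) (auto simp: indicator_def)

\<comment> \<open>Identifying functions that agree almost everywhere turns the seminorm into a norm,
  so that the general theory of inner product spaces applies. The relation is partial: a function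
  that is not square integrable is not related to itself and drops out of the type.\<close>
quotient_type (overloaded) 'a l2 = "'a::euclidean_space \<Rightarrow> real" /
    partial: "\<lambda>f g. square_integrable f \<and> square_integrable g \<and> (AE x in lborel. f x = g x)"
  morphisms rep_l2_class mk_l2
proof (rule part_equivpI)
  show "\<exists>x::'a \<Rightarrow> real. square_integrable x \<and> square_integrable x \<and> (AE y in lborel. x y = x y)"
    by (rule exI[of _ "\<lambda>_. 0"]) (simp add: square_integrable_zero)
qed (auto intro!: sympI transpI elim: eventually_elim2)

instantiation l2 :: (euclidean_space) real_vector
begin

lift_definition zero_l2 :: "'a l2" is "\<lambda>_. 0" by (simp add: square_integrable_zero)
lift_definition plus_l2 :: "'a l2 \<Rightarrow> 'a l2 \<Rightarrow> 'a l2" is "\<lambda>f g x. f x + g x"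
  by (auto simp: square_integrable_add elim: eventually_elim2)
lift_definition minus_l2 :: "'a l2 \<Rightarrow> 'a l2 \<Rightarrow> 'a l2" is "\<lambda>f g x. f x - g x"
  by (auto simp: square_integrable_diff elim: eventually_elim2)
lift_definition uminus_l2 :: "'a l2 \<Rightarrow> 'a l2" is "\<lambda>f x. (-1) * f x"
  by (intro conjI square_integrable_scale) auto
lift_definition scaleR_l2 :: "real \<Rightarrow> 'a l2 \<Rightarrow> 'a l2" is "\<lambda>c f x. c * f x"
  by (intro conjI square_integrable_scale) auto

instance
  by standard
    (transfer; intro conjI square_integrable_add square_integrable_diff square_integrable_scale square_integrable_zero; auto simp: algebra_simps intro: square_integrable_zero square_integrable_scale[of _ "-1", simplified])+

end

instantiation l2 :: (euclidean_space) real_inner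
begin

lift_definition inner_l2 :: "'a l2 \<Rightarrow> 'a l2 \<Rightarrow> real" is "\<lambda>f g. LINT x|lborel. f x * g x"
proof -
  fix f f' g g' :: "'a \<Rightarrow> real"
  assume f: "square_integrable f \<and> square_integrable f' \<and> (AE x in lborel. f x = f' x)"
    and g: "square_integrable g \<and> square_integrable g' \<and> (AE x in lborel. g x = g' x)"
  then have [measurable]: "f \<in> borel_measurable lborel" "f' \<in> borel_measurable lborel"
      "g \<in> borel_measurable lborel" "g' \<in> borel_measurable lborel"
    by (auto simp: square_integrable_def)
  show "(LINT x|lborel. f x * g x) = (LINT x|lborel. f' x * g' x)"
  proof (rule integral_cong_AE)
    show "AE x in lborel. f x * g x = f' x * g' x"
      using f g by (auto elim: eventually_elim2)
  qed measurable
qed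

definition norm_l2 :: "'a l2 \<Rightarrow> real" where "norm_l2 p = sqrt (p \<bullet> p)"
definition sgn_l2 :: "'a l2 \<Rightarrow> 'a l2" where "sgn_l2 p = p /\<^sub>R norm p"
definition dist_l2 :: "'a l2 \<Rightarrow> 'a l2 \<Rightarrow> real" where "dist_l2 p q = norm (p - q)"
definition uniformity_l2 :: "('a l2 \<times> 'a l2) filter" where
  "uniformity_l2 = (INF e\<in>{0 <..}. principal {(x, y). dist x y < e})"
definition open_l2 :: "'a l2 set \<Rightarrow> bool" where
  "open_l2 U \<longleftrightarrow> (\<forall>x\<in>U. \<forall>\<^sub>F (x', y) in uniformity. x' = x \<longrightarrow> y \<in> U)"

instance
proof
  fix p q r :: "'a l2" and c :: real
  show "p \<bullet> q = q \<bullet> p" by transfer (simp add: mult.commute)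
  show "(p + q) \<bullet> r = p \<bullet> r + q \<bullet> r"
    by transfer (simp add: distrib_right square_integrable_mult_integrable)
  show "(c *\<^sub>R p) \<bullet> q = c * (p \<bullet> q)"
    by transfer (simp add: mult.assoc)
  show "0 \<le> p \<bullet> p" by transfer simp
  show "p \<bullet> p = 0 \<longleftrightarrow> p = 0"
  proof transfer
    fix f :: "'a \<Rightarrow> real"
    assume f: "square_integrable f \<and> square_integrable f \<and> (AE x in lborel. f x = f x)"
    then have "integrable lborel (\<lambda>x. f x * f x)" by (simp add: square_integrable_mult_integrable)
    from integral_nonneg_eq_0_iff_AE[OF this]
    show "((LINT x|lborel. f x * f x) = 0) = (square_integrable f \<and> square_integrable (\<lambda>_. 0 :: real) \<and> (AE x in (lborel :: 'a measure). f x = 0))"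
      using f by (simp add: square_integrable_zero)
  qed
qed (simp_all add: norm_l2_def sgn_l2_def dist_l2_def uniformity_l2_def open_l2_def)

end

text \<open>A fixed square integrable representative of the class. Its values matter only almost
  everywhere, hence the \<open>AE\<close> form of the algebraic rules that follow.\<close>

definition rep_l2 :: "'a::euclidean_space l2 \<Rightarrow> 'a \<Rightarrow> real" where
  "rep_l2 p = (SOME f. square_integrable f \<and> mk_l2 f = p)"

lemma mk_l2_eq_iff: "square_integrable f \<Longrightarrow> square_integrable g \<Longrightarrow> mk_l2 f = mk_l2 g \<longleftrightarrow> (AE x in lborel. f x = g x)"
  using Quotient_rel[OF Quotient_l2, of f g] by auto

lemma rep_l2: "square_integrable (rep_l2 p)" "mk_l2 (rep_l2 p) = p"
proof -
  have "\<exists>f. square_integrable f \<and> mk_l2 f = p"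
    using Quotient_rep_reflp[OF Quotient_l2, of p] Quotient_abs_rep[OF Quotient_l2, of p] by blast
  from someI_ex[OF this] show "square_integrable (rep_l2 p)" "mk_l2 (rep_l2 p) = p"
    by (auto simp: rep_l2_def)
qed

lemma AE_rep_mk_l2: "square_integrable f \<Longrightarrow> AE x in lborel. rep_l2 (mk_l2 f) x = f x"
  using mk_l2_eq_iff[OF rep_l2(1), of f "mk_l2 f"] by (simp add: rep_l2(2))

lemma rep_l2_measurable[measurable]: "rep_l2 p \<in> borel_measurable lborel" 
  using rep_l2(1) by (rule square_integrable_measurable)

lemma mk_l2_add: "square_integrable f \<Longrightarrow> square_integrable g \<Longrightarrow> mk_l2 (\<lambda>x. f x + g x) = mk_l2 f + mk_l2 g"
  by (simp add: plus_l2.abs_eq)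

lemma mk_l2_diff: "square_integrable f \<Longrightarrow> square_integrable g \<Longrightarrow> mk_l2 (\<lambda>x. f x - g x) = mk_l2 f - mk_l2 g"
  by (simp add: minus_l2.abs_eq)

lemma mk_l2_scale: "square_integrable f \<Longrightarrow> mk_l2 (\<lambda>x. c * f x) = c *\<^sub>R mk_l2 f"
  by (simp add: scaleR_l2.abs_eq)

lemma mk_l2_zero: "mk_l2 (\<lambda>x. 0) = 0"
  by (simp add: zero_l2.abs_eq)

lemma inner_mk_l2: "square_integrable f \<Longrightarrow> square_integrable g \<Longrightarrow> mk_l2 f \<bullet> mk_l2 g = (LINT x|lborel. f x * g x)"
  by (simp add: inner_l2.abs_eq)

lemma norm_mk_l2: "square_integrable f \<Longrightarrow> (norm (mk_l2 f))\<^sup>2 = (LINT x|lborel. (f x)\<^sup>2)"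
  by (simp add: power2_norm_eq_inner inner_mk_l2 power2_eq_square[of "f _"])

lemma AE_rep_add: "AE x in lborel. rep_l2 (p + q) x = rep_l2 p x + rep_l2 q x"
  by (subst mk_l2_eq_iff[symmetric]) (simp_all add: rep_l2 square_integrable_add mk_l2_add)

lemma AE_rep_diff: "AE x in lborel. rep_l2 (p - q) x = rep_l2 p x - rep_l2 q x"
  by (subst mk_l2_eq_iff[symmetric]) (simp_all add: rep_l2 square_integrable_diff mk_l2_diff)

lemma AE_rep_scale: "AE x in lborel. rep_l2 (c *\<^sub>R p) x = c * rep_l2 p x"
  by (subst mk_l2_eq_iff[symmetric]) (simp_all add: rep_l2 square_integrable_scale mk_l2_scale)

lemma norm_l2_rep: "(norm p)\<^sup>2 = (LINT x|lborel. (rep_l2 p x)\<^sup>2)"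
  using norm_mk_l2[OF rep_l2(1), of p] by (simp add: rep_l2)


section \<open>Completeness of L2 (Riesz--Fischer)\<close>

lemma square_integrable_abs: "square_integrable f \<Longrightarrow> square_integrable (\<lambda>x. \<bar>f x\<bar>)"
  by (auto simp: square_integrable_def)

lemma square_integrable_sum: "(\<And>i. i \<in> I \<Longrightarrow> square_integrable (f i)) \<Longrightarrow> square_integrable (\<lambda>x. \<Sum>i\<in>I. f i x)"
  by (induction I rule: infinite_finite_induct) (auto simp: square_integrable_zero intro: square_integrable_add)

lemma mk_l2_sum: "(\<And>i. i \<in> I \<Longrightarrow> square_integrable (f i)) \<Longrightarrow> mk_l2 (\<lambda>x. \<Sum>i\<in>I. f i x) = (\<Sum>i\<in>I. mk_l2 (f i))"
  by (induction I rule: infinite_finite_induct) (auto simp: mk_l2_zero mk_l2_add square_integrable_sum)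

lemma norm_mk_l2_abs: "square_integrable f \<Longrightarrow> norm (mk_l2 (\<lambda>x. \<bar>f x\<bar>)) = norm (mk_l2 f)"
  by (rule power2_eq_imp_eq) (simp_all add: norm_mk_l2 square_integrable_abs)

lemma nn_integral_square_integrable:
  "square_integrable f \<Longrightarrow> (\<integral>\<^sup>+x. ennreal ((f x)\<^sup>2) \<partial>lborel) = ennreal ((norm (mk_l2 f))\<^sup>2)"
  by (subst nn_integral_eq_integral) (auto simp: square_integrable_integrable norm_mk_l2)

text \<open>The triangle inequality bounds the norms of the partial sums of the |p n| by the
  geometric series. Monotone convergence applied to their squares then gives an integrable supremum,
  which is finite almost everywhere.\<close>

lemma l2_AE_summable:
  fixes p :: "nat \<Rightarrow> 'a::euclidean_space l2"
  assumes "\<And>n. norm (p n) \<le> (1/2)^n"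
  shows "AE x in lborel. summable (\<lambda>n. \<bar>rep_l2 (p n) x\<bar>)"
proof -
  define S where "S N x = (\<Sum>n<N. \<bar>rep_l2 (p n) x\<bar>)" for N x
  have S: "square_integrable (S N)" for N
    unfolding S_def by (intro square_integrable_sum square_integrable_abs rep_l2)
  have "norm (mk_l2 (S N)) \<le> 2" for N
  proof -
    have "norm (mk_l2 (S N)) = norm (\<Sum>n<N. mk_l2 (\<lambda>x. \<bar>rep_l2 (p n) x\<bar>))"
      unfolding S_def by (subst mk_l2_sum) (auto intro: square_integrable_abs rep_l2)
    also have "\<dots> \<le> (\<Sum>n<N. norm (p n))"
      by (rule order_trans[OF norm_sum]) (simp add: norm_mk_l2_abs rep_l2)
    also have "\<dots> \<le> (\<Sum>n<N. (1/2)^n)"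
      by (intro sum_mono assms)
    also have "\<dots> \<le> 2" by (simp add: geometric_sum)
    finally show ?thesis .
  qed
  then have le: "(\<integral>\<^sup>+x. ennreal ((S N x)\<^sup>2) \<partial>lborel) \<le> ennreal 4" for N
    using power_mono[of "norm (mk_l2 (S N))" 2 2] unfolding nn_integral_square_integrable[OF S] by (intro ennreal_leI) simp
  have [measurable]: "S N \<in> borel_measurable lborel" for N
    using S by (rule square_integrable_measurable)
  have "(\<integral>\<^sup>+x. (SUP N. ennreal ((S N x)\<^sup>2)) \<partial>lborel) = (SUP N. \<integral>\<^sup>+x. ennreal ((S N x)\<^sup>2) \<partial>lborel)"
  proof (rule nn_integral_monotone_convergence_SUP)
    show "incseq (\<lambda>N x. ennreal ((S N x)\<^sup>2))"
      by (auto simp: incseq_def le_fun_def S_def intro!: ennreal_leI power_mono sum_mono2 sum_nonneg)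
  qed measurable
  also have "\<dots> \<le> ennreal 4" by (rule SUP_least) (rule le)
  finally have "(\<integral>\<^sup>+x. (SUP N. ennreal ((S N x)\<^sup>2)) \<partial>lborel) \<noteq> \<infinity>"
    by (auto simp: top_unique)
  then have "AE x in lborel. (SUP N. ennreal ((S N x)\<^sup>2)) \<noteq> \<infinity>"
    by (intro nn_integral_PInf_AE) auto
  then show ?thesis
  proof eventually_elim
    case (elim x)
    obtain c where c: "(SUP N. ennreal ((S N x)\<^sup>2)) = ennreal c" "c \<ge> 0"
      using elim by (cases "SUP N. ennreal ((S N x)\<^sup>2)") (auto simp: top_unique)
    have "(S N x)\<^sup>2 \<le> c" for N
    proof -
      have "ennreal ((S N x)\<^sup>2) \<le> ennreal c" unfolding c(1)[symmetric] by (rule SUP_upper) simp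
      then show ?thesis using c(2) by simp
    qed
    then have "S N x \<le> sqrt c" for N by (simp add: real_le_rsqrt)
    then have "(\<Sum>k\<le>n. \<bar>rep_l2 (p k) x\<bar>) \<le> sqrt c" for n
      by (simp only: S_def lessThan_Suc_atMost[symmetric])
    then show ?case
      by (intro bounded_imp_summable[of _ "sqrt c"]) auto
  qed
qed

text \<open>Along a subsequence whose k-th increment has norm below (1/2)^k the telescoping sum
  converges absolutely almost everywhere by \<open>l2_AE_summable\<close>.\<close>

lemma l2_Cauchy_subseq_AE:
  fixes X :: "nat \<Rightarrow> 'a::euclidean_space l2"
  assumes "Cauchy X"
  shows "\<exists>r. strict_mono r \<and> (AE x in lborel. convergent (\<lambda>n. rep_l2 (X (r n)) x))"
proof -
  have "\<exists>M. \<forall>m\<ge>M. \<forall>n\<ge>M. norm (X m - X n) < (1/2)^k" for k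
    using assms unfolding Cauchy_def dist_norm by (metis zero_less_power half_gt_zero_iff zero_less_one)
  then obtain M where M: "\<And>k m n. m \<ge> M k \<Longrightarrow> n \<ge> M k \<Longrightarrow> norm (X m - X n) < (1/2)^k"
    by metis
  \<comment> \<open>The recursion steps past both the previous index and the next threshold:
    \<open>Suc\<close> makes r strictly increasing, and the maximum keeps r k beyond M k.\<close>
  define r where "r = rec_nat (M 0) (\<lambda>k rk. Suc (max rk (M (Suc k))))"
  have rS: "r (Suc k) = Suc (max (r k) (M (Suc k)))" for k by (simp add: r_def)
  have mono: "strict_mono r" unfolding strict_mono_Suc_iff rS by (simp add: less_Suc_eq_le)
  have rM: "M k \<le> r k" for k by (cases k) (auto simp: r_def)
  define p where "p n = X (r (Suc n)) - X (r n)" for n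
  have "norm (p n) \<le> (1/2)^n" for n
    unfolding p_def using M[of n "r (Suc n)" "r n"] rM[of n] strict_mono_less[OF mono, of n "Suc n"] by simp
  then have 1: "AE x in lborel. summable (\<lambda>n. \<bar>rep_l2 (p n) x\<bar>)" by (rule l2_AE_summable)
  have 2: "AE x in lborel. \<forall>n. rep_l2 (p n) x = rep_l2 (X (r (Suc n))) x - rep_l2 (X (r n)) x"
    unfolding AE_all_countable p_def by (intro allI AE_rep_diff)
  have "AE x in lborel. convergent (\<lambda>n. rep_l2 (X (r n)) x)"
    using 1 2
  proof eventually_elim
    case (elim x)
    have "rep_l2 (X (r n)) x = rep_l2 (X (r 0)) x + (\<Sum>k<n. rep_l2 (p k) x)" for n
      by (induction n) (auto simp: elim(2))
    then have "(\<lambda>n. rep_l2 (X (r n)) x) = (\<lambda>n. rep_l2 (X (r 0)) x + (\<Sum>k<n. rep_l2 (p k) x))" by blast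
    moreover have "convergent (\<lambda>n. \<Sum>k<n. rep_l2 (p k) x)"
      using summable_rabs_cancel[OF elim(1)] by (simp add: summable_iff_convergent)
    ultimately show ?case
      using convergent_add[OF convergent_const] by simp
  qed
  with mono show ?thesis by blast
qed

text \<open>Fatou's lemma along the subsequence turns the Cauchy estimate into an estimate of F - X
  n. This yields at once that F is square integrable and that the whole sequence converges to
  it.\<close>

lemma l2_Cauchy_AE_limit:
  fixes X :: "nat \<Rightarrow> 'a::euclidean_space l2"
  assumes X: "Cauchy X" and r: "strict_mono r"
    and ae: "AE x in lborel. (\<lambda>n. rep_l2 (X (r n)) x) \<longlonglongrightarrow> F x"
    and [measurable]: "F \<in> borel_measurable lborel"
  shows "square_integrable F" "X \<longlonglongrightarrow> mk_l2 F"
proof -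
  have bound: "(\<integral>\<^sup>+x. ennreal ((F x - rep_l2 (X n) x)\<^sup>2) \<partial>lborel) \<le> ennreal (e\<^sup>2)"
    if e: "e > 0" and M: "\<And>m. m \<ge> M \<Longrightarrow> norm (X m - X n) < e" for n M e
  proof -
    have "(\<integral>\<^sup>+x. ennreal ((F x - rep_l2 (X n) x)\<^sup>2) \<partial>lborel) =
        (\<integral>\<^sup>+x. liminf (\<lambda>m. ennreal ((rep_l2 (X (r m)) x - rep_l2 (X n) x)\<^sup>2)) \<partial>lborel)"
    proof (rule nn_integral_cong_AE, use ae in eventually_elim)
      case (elim x)
      have "(\<lambda>m. ennreal ((rep_l2 (X (r m)) x - rep_l2 (X n) x)\<^sup>2)) \<longlonglongrightarrow> ennreal ((F x - rep_l2 (X n) x)\<^sup>2)"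
        by (intro tendsto_intros elim)
      from lim_imp_Liminf[OF _ this] show ?case by simp
    qed
    also have "\<dots> \<le> liminf (\<lambda>m. \<integral>\<^sup>+x. ennreal ((rep_l2 (X (r m)) x - rep_l2 (X n) x)\<^sup>2) \<partial>lborel)"
      by (rule nn_integral_liminf) measurable
    also have "\<dots> \<le> ennreal (e\<^sup>2)"
    proof (rule Liminf_le)
      show "\<forall>\<^sub>F m in sequentially. (\<integral>\<^sup>+x. ennreal ((rep_l2 (X (r m)) x - rep_l2 (X n) x)\<^sup>2) \<partial>lborel) \<le> ennreal (e\<^sup>2)"
      proof (rule eventually_sequentiallyI[of M])
        fix m assume "M \<le> m"
        then have "norm (X (r m) - X n) < e" using M[of "r m"] seq_suble[OF r, of m] by linarith
        then show "(\<integral>\<^sup>+x. ennreal ((rep_l2 (X (r m)) x - rep_l2 (X n) x)\<^sup>2) \<partial>lborel) \<le> ennreal (e\<^sup>2)"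
          by (simp add: nn_integral_square_integrable square_integrable_diff rep_l2 mk_l2_diff ennreal_leI power_mono)
      qed
    qed simp
    finally show ?thesis .
  qed
  have diff: "square_integrable (\<lambda>x. F x - rep_l2 (X n) x) \<and> norm (mk_l2 (\<lambda>x. F x - rep_l2 (X n) x)) \<le> e"
    if e: "e > 0" and M: "\<And>m. m \<ge> M \<Longrightarrow> norm (X m - X n) < e" for n M e
  proof -
    have b: "(\<integral>\<^sup>+x. ennreal ((F x - rep_l2 (X n) x)\<^sup>2) \<partial>lborel) \<le> ennreal (e\<^sup>2)"
      using e M by (rule bound)
    have "integrable lborel (\<lambda>x. (F x - rep_l2 (X n) x)\<^sup>2)"
    proof (rule integrableI_bounded)
      show "(\<integral>\<^sup>+x. ennreal (norm ((F x - rep_l2 (X n) x)\<^sup>2)) \<partial>lborel) < \<infinity>"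
        using b by (simp add: order_le_less_trans)
    qed measurable
    then have s: "square_integrable (\<lambda>x. F x - rep_l2 (X n) x)" by (simp add: square_integrable_def)
    from b have "(norm (mk_l2 (\<lambda>x. F x - rep_l2 (X n) x)))\<^sup>2 \<le> e\<^sup>2"
      unfolding nn_integral_square_integrable[OF s] by simp
    with s e power2_le_imp_le[OF this] show ?thesis by auto
  qed
  have ex: "\<exists>M. \<forall>m\<ge>M. \<forall>n\<ge>M. norm (X m - X n) < e" if "e > 0" for e
    using CauchyD[OF X that] .
  obtain M where M: "\<And>m n. m \<ge> M \<Longrightarrow> n \<ge> M \<Longrightarrow> norm (X m - X n) < 1"
    using ex[of 1] by auto
  have "square_integrable (\<lambda>x. F x - rep_l2 (X M) x)" using diff[of 1 M M] M by auto
  from square_integrable_add[OF this rep_l2(1)[of "X M"]] show F: "square_integrable F" by simp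
  show "X \<longlonglongrightarrow> mk_l2 F"
  proof (rule LIMSEQ_I)
    fix e :: real assume "e > 0"
    then obtain M where M: "\<And>m n. m \<ge> M \<Longrightarrow> n \<ge> M \<Longrightarrow> norm (X m - X n) < e/2"
      using ex[of "e/2"] by auto
    have "norm (X n - mk_l2 F) < e" if "n \<ge> M" for n
    proof -
      have "norm (mk_l2 (\<lambda>x. F x - rep_l2 (X n) x)) \<le> e/2"
        using diff[of "e/2" M n] M that \<open>e > 0\<close> by auto
      then show ?thesis using \<open>e > 0\<close> by (simp add: mk_l2_diff F rep_l2 norm_minus_commute)
    qed
    then show "\<exists>M. \<forall>n\<ge>M. norm (X n - mk_l2 F) < e" by blast
  qed
qed

text \<open>The pointwise limit of a good subsequence represents an L2 limit, which must be p. This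
  is how pointwise conditions, such as vanishing outside \<Omega>, survive norm limits.\<close>

lemma l2_tendsto_AE_subseq:
  fixes X :: "nat \<Rightarrow> 'a::euclidean_space l2"
  assumes "X \<longlonglongrightarrow> p"
  shows "\<exists>r. strict_mono r \<and> (AE x in lborel. (\<lambda>n. rep_l2 (X (r n)) x) \<longlonglongrightarrow> rep_l2 p x)"
proof -
  have C: "Cauchy X" using assms by (simp add: LIMSEQ_imp_Cauchy)
  obtain r where r: "strict_mono r" "AE x in lborel. convergent (\<lambda>n. rep_l2 (X (r n)) x)"
    using l2_Cauchy_subseq_AE[OF C] by blast
  define F where "F x = lim (\<lambda>n. rep_l2 (X (r n)) x)" for x
  have m: "F \<in> borel_measurable lborel"
    unfolding F_def by measurable
  have ae: "AE x in lborel. (\<lambda>n. rep_l2 (X (r n)) x) \<longlonglongrightarrow> F x"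
    using r(2) by eventually_elim (simp add: F_def convergent_LIMSEQ_iff)
  note lim = l2_Cauchy_AE_limit[OF C r(1) ae m]
  have "mk_l2 F = p" using LIMSEQ_unique[OF lim(2) assms] .
  then have "AE x in lborel. rep_l2 p x = F x" using AE_rep_mk_l2[OF lim(1)] by simp
  with ae have "AE x in lborel. (\<lambda>n. rep_l2 (X (r n)) x) \<longlonglongrightarrow> rep_l2 p x"
    by eventually_elim simp
  with r(1) show ?thesis by blast
qed

instance l2 :: (euclidean_space) complete_space
proof
  fix X :: "nat \<Rightarrow> 'a l2" assume C: "Cauchy X"
  obtain r where r: "strict_mono r" "AE x in lborel. convergent (\<lambda>n. rep_l2 (X (r n)) x)"
    using l2_Cauchy_subseq_AE[OF C] by blast
  define F where "F x = lim (\<lambda>n. rep_l2 (X (r n)) x)" for x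
  have m: "F \<in> borel_measurable lborel"
    unfolding F_def by measurable
  have ae: "AE x in lborel. (\<lambda>n. rep_l2 (X (r n)) x) \<longlonglongrightarrow> F x"
    using r(2) by eventually_elim (simp add: F_def convergent_LIMSEQ_iff)
  show "convergent X" using l2_Cauchy_AE_limit(2)[OF C r(1) ae m] by (auto simp: convergent_def)
qed

section \<open>Hilbert spaces and functional calculus\<close>

text \<open>A minimising sequence for the distance to S is Cauchy by the parallelogram law, since
  midpoints stay in S; the minimiser is orthogonal because moving it along r cannot shorten the
  distance.\<close>

lemma closed_subspace_projection:
  fixes S :: "'a::{real_inner, complete_space} set"
  assumes S: "subspace S" "closed S"
  shows "\<exists>p\<in>S. \<forall>q\<in>S. (x - p) \<bullet> q = 0"
proof -
  define D where "D = (\<lambda>q. (norm (x - q))\<^sup>2) ` S"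
  define d where "d = Inf D"
  have ne: "D \<noteq> {}" using subspace_0[OF S(1)] by (auto simp: D_def)
  have bdd: "bdd_below D" by (rule bdd_belowI[of _ 0]) (auto simp: D_def)
  have dle: "d \<le> (norm (x - q))\<^sup>2" if "q \<in> S" for q
    unfolding d_def using that by (intro cInf_lower bdd) (auto simp: D_def)
  have "\<exists>q\<in>S. (norm (x - q))\<^sup>2 < d + inverse (Suc n)" for n
    using cInf_lessD[OF ne, of "d + inverse (Suc n)"] by (auto simp: d_def D_def)
  then obtain q where q: "\<And>n. q n \<in> S" "\<And>n. (norm (x - q n))\<^sup>2 < d + inverse (Suc n)"
    by metis
  have par: "(norm (q m - q n))\<^sup>2 \<le> 2 * inverse (Suc m) + 2 * inverse (Suc n)" for m n
  proof -
    have "(1/2) *\<^sub>R (q m + q n) \<in> S" by (intro subspace_scale subspace_add S q)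
    from dle[OF this] have "d \<le> (norm (x - (1/2) *\<^sub>R (q m + q n)))\<^sup>2" .
    also have "4 * \<dots> = 2 * (norm (x - q m))\<^sup>2 + 2 * (norm (x - q n))\<^sup>2 - (norm (q m - q n))\<^sup>2"
      by (simp add: power2_norm_eq_inner inner_simps inner_commute algebra_simps)
    finally show ?thesis using q(2)[of m] q(2)[of n] by linarith
  qed
  have "Cauchy q"
  proof (rule metric_CauchyI)
    fix e :: real assume "e > 0"
    then obtain M where M: "inverse (Suc M) < e\<^sup>2 / 4"
      using reals_Archimedean[of "e\<^sup>2/4"] by auto
    have "dist (q m) (q n) < e" if "m \<ge> M" "n \<ge> M" for m n
    proof -
      have "inverse (Suc m) \<le> inverse (Suc M)" "inverse (Suc n) \<le> inverse (Suc M)"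
        using that by (auto intro!: le_imp_inverse_le)
      then have "(norm (q m - q n))\<^sup>2 < e\<^sup>2" using par[of m n] M by linarith
      then show ?thesis using \<open>e > 0\<close> by (simp add: dist_norm power2_less_imp_less)
    qed
    then show "\<exists>M. \<forall>m\<ge>M. \<forall>n\<ge>M. dist (q m) (q n) < e" by blast
  qed
  then obtain p where p: "q \<longlonglongrightarrow> p" using Cauchy_convergent convergent_def by blast
  have pS: "p \<in> S" using closed_sequentially[OF S(2) _ p] q by auto
  have "(\<lambda>n. d + inverse (Suc n)) \<longlonglongrightarrow> d + 0"
    by (intro tendsto_intros LIMSEQ_inverse_real_of_nat)
  moreover have "(\<lambda>n. (norm (x - q n))\<^sup>2) \<longlonglongrightarrow> (norm (x - p))\<^sup>2" by (intro tendsto_intros p)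
  ultimately have le: "(norm (x - p))\<^sup>2 \<le> d"
    using LIMSEQ_le[of "\<lambda>n. (norm (x - q n))\<^sup>2" _ "\<lambda>n. d + inverse (Suc n)" d] q(2)
    by (auto intro: less_imp_le)
  have "(x - p) \<bullet> r = 0" if r: "r \<in> S" for r
  proof (rule ccontr)
    assume nz: "(x - p) \<bullet> r \<noteq> 0"
    then have rr: "r \<bullet> r > 0" by auto
    \<comment> \<open>The step that minimises the distance from x to p + t r; it would lower the
      square by ((x - p) \<bullet> r)^2 / (r \<bullet> r).\<close>
    define t where "t = ((x - p) \<bullet> r) / (r \<bullet> r)"
    have "p + t *\<^sub>R r \<in> S" by (intro subspace_scale subspace_add S pS r)
    from order_trans[OF le dle[OF this]] have "(norm (x - p))\<^sup>2 \<le> (norm ((x - p) - t *\<^sub>R r))\<^sup>2"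
      by (simp only: diff_diff_eq)
    also have "\<dots> = (norm (x - p))\<^sup>2 - 2 * t * ((x - p) \<bullet> r) + t\<^sup>2 * (r \<bullet> r)"
      unfolding power2_norm_eq_inner
      by (simp add: inner_diff_left inner_diff_right inner_commute power2_eq_square algebra_simps)
    also have "\<dots> = (norm (x - p))\<^sup>2 - ((x - p) \<bullet> r)\<^sup>2 / (r \<bullet> r)"
      using rr by (simp add: t_def power2_eq_square)
    finally show False using rr nz by (simp add: divide_le_0_iff)
  qed
  with pS show ?thesis by blast
qed

lemma riesz_representation:
  fixes S :: "'a::{real_inner, complete_space} set" and F :: "'a \<Rightarrow> real"
  assumes S: "subspace S" "closed S"
    and add: "\<And>p q. p \<in> S \<Longrightarrow> q \<in> S \<Longrightarrow> F (p + q) = F p + F q"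
    and scale: "\<And>p c. p \<in> S \<Longrightarrow> F (c *\<^sub>R p) = c * F p"
    and bound: "\<And>p. p \<in> S \<Longrightarrow> \<bar>F p\<bar> \<le> K * norm p"
  shows "\<exists>z\<in>S. \<forall>q\<in>S. F q = z \<bullet> q"
proof (cases "\<forall>q\<in>S. F q = 0")
  case True
  then show ?thesis using subspace_0[OF S(1)] by (intro bexI[of _ 0]) auto
next
  case False
  then obtain x where x: "x \<in> S" "F x \<noteq> 0" by blast
  define Z where "Z = {q \<in> S. F q = 0}"
  have F0: "F 0 = 0" using scale[OF subspace_0[OF S(1)], of 0] by simp
  have diff: "F (p - q) = F p - F q" if "p \<in> S" "q \<in> S" for p q
    using add[of p "(-1) *\<^sub>R q"] scale[of q "-1"] subspace_scale[OF S(1), of q "-1"] that by simp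
  have Zs: "subspace Z"
    unfolding subspace_def Z_def using S(1) F0 by (auto simp: add scale subspace_0 subspace_add subspace_scale)
  have Zc: "closed Z"
    unfolding closed_sequential_limits
  proof safe
    fix q p assume q: "\<forall>n. q n \<in> Z" and lim: "q \<longlonglongrightarrow> p"
    have pS: "p \<in> S" using closed_sequentially[OF S(2) _ lim] q by (auto simp: Z_def)
    have "(\<lambda>n. K * norm (p - q n)) \<longlonglongrightarrow> K * norm (p - p)" by (intro tendsto_intros lim)
    moreover have "\<bar>F p\<bar> \<le> K * norm (p - q n)" for n
      using bound[of "p - q n"] diff[of p "q n"] q pS by (auto simp: Z_def subspace_diff S)
    ultimately have "\<bar>F p\<bar> \<le> 0" using LIMSEQ_le_const by fastforce
    with pS show "p \<in> Z" by (simp add: Z_def)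
  qed
  obtain p where p: "p \<in> Z" "\<forall>q\<in>Z. (x - p) \<bullet> q = 0"
    using closed_subspace_projection[OF Zs Zc] by blast
  \<comment> \<open>Inside S the vector y is orthogonal to the kernel of F. Every q in S differs
    from a multiple of y by the kernel element q - (F q / F y) y, so a multiple of y represents
    F.\<close>
  define y where "y = x - p"
  have yS: "y \<in> S" using p x by (auto simp: y_def Z_def subspace_diff S)
  have Fy: "F y = F x" using diff[of x p] p x by (auto simp: y_def Z_def)
  then have "y \<noteq> 0" using x F0 by auto
  then have yy: "y \<bullet> y > 0" by simp
  show ?thesis
  proof (rule bexI[of _ "(F y / (y \<bullet> y)) *\<^sub>R y"], rule ballI)
    fix q assume q: "q \<in> S"
    have mem: "q - (F q / F y) *\<^sub>R y \<in> S" by (intro subspace_diff subspace_scale S q yS)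
    have "F (q - (F q / F y) *\<^sub>R y) = 0"
      using diff[of q "(F q / F y) *\<^sub>R y"] scale[OF yS] q yS subspace_scale[OF S(1) yS] Fy x by simp
    with mem have "q - (F q / F y) *\<^sub>R y \<in> Z" by (simp add: Z_def)
    then have "y \<bullet> (q - (F q / F y) *\<^sub>R y) = 0" using p by (simp add: y_def)
    then have "y \<bullet> q = (F q / F y) * (y \<bullet> y)" by (simp add: inner_diff_right)
    then show "F q = (F y / (y \<bullet> y)) *\<^sub>R y \<bullet> q" using yy Fy x by (simp add: field_simps)
  qed (intro subspace_scale S yS)
qed

lemma subspace_closure:
  fixes S :: "'a::real_normed_vector set"
  assumes "subspace S" shows "subspace (closure S)"
  unfolding subspace_def
proof (intro conjI ballI allI)
  show "0 \<in> closure S" using subspace_0[OF assms] closure_subset by blast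
next
  fix x y assume "x \<in> closure S" "y \<in> closure S"
  then obtain f g where "\<And>n. f n \<in> S" "f \<longlonglongrightarrow> x" "\<And>n. g n \<in> S" "g \<longlonglongrightarrow> y"
    by (auto simp: closure_sequential)
  then show "x + y \<in> closure S"
    unfolding closure_sequential
    by (intro exI[of _ "\<lambda>n. f n + g n"]) (auto intro: tendsto_add subspace_add[OF assms])
next
  fix c x assume "x \<in> closure S"
  then obtain f where "\<And>n. f n \<in> S" "f \<longlonglongrightarrow> x" by (auto simp: closure_sequential)
  then show "c *\<^sub>R x \<in> closure S"
    unfolding closure_sequential
    by (intro exI[of _ "\<lambda>n. c *\<^sub>R f n"]) (auto intro: tendsto_scaleR subspace_scale[OF assms])
qed

text \<open>The difference between a point of S and its projection to the closure of M is orthogonal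
  to M. This reduces every density claim below to a uniqueness claim.\<close>

lemma dense_if_no_orthogonal:
  fixes S M :: "'a::{real_inner, complete_space} set"
  assumes "subspace M" "M \<subseteq> S" "subspace S" "closed S"
    and "\<And>x. x \<in> S \<Longrightarrow> (\<And>m. m \<in> M \<Longrightarrow> x \<bullet> m = 0) \<Longrightarrow> x = 0"
  shows "S \<subseteq> closure M"
proof
  fix x assume x: "x \<in> S"
  obtain p where p: "p \<in> closure M" "\<forall>q\<in>closure M. (x - p) \<bullet> q = 0"
    using closed_subspace_projection[OF subspace_closure[OF assms(1)] closed_closure] by blast
  have "closure M \<subseteq> S" using assms by (simp add: closure_minimal)
  then have "x - p \<in> S" using p x assms by (auto intro: subspace_diff)
  then have "x - p = 0" using p closure_subset[of M] by (intro assms(5)) auto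
  then show "x \<in> closure M" using p by simp
qed

section \<open>Real polynomials and their factors\<close>

definition complex_eval :: "real poly \<Rightarrow> complex \<Rightarrow> complex" where
  "complex_eval p z = poly (map_poly of_real p) z"

lemma complex_eval_pCons [simp]:
  "complex_eval (pCons a p) z = of_real a + z * complex_eval p z" "complex_eval 0 z = 0"
  by (simp_all add: complex_eval_def map_poly_pCons)

lemma complex_eval_add [simp]: "complex_eval (p + q) z = complex_eval p z + complex_eval q z"
proof (induction p arbitrary: q)
  case (pCons a p)
  then show ?case by (cases q) (simp add: algebra_simps)
qed simp

lemma complex_eval_smult [simp]: "complex_eval (smult c p) z = of_real c * complex_eval p z"
  by (induction p) (simp_all add: algebra_simps)

lemma complex_eval_mult [simp]: "complex_eval (p * q) z = complex_eval p z * complex_eval q z"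
  by (induction p) (simp_all add: algebra_simps)

lemma complex_eval_of_real: "complex_eval p (of_real t) = of_real (poly p t)"
  by (induction p) simp_all

text \<open>Take a complex root z. If z is not real, the remainder of p modulo the real quadratic
  with roots z and its conjugate is e + f X with real e, f and vanishes at z; the imaginary part
  forces f = 0, and then e = 0.\<close>

lemma real_poly_factor:
  fixes p :: "real poly"
  assumes "degree p > 0"
  shows "(\<exists>r q. p = [:-r, 1:] * q) \<or> (\<exists>a b q. b \<noteq> 0 \<and> p = [:a\<^sup>2 + b\<^sup>2, -2 * a, 1:] * q)"
proof -
  have "\<not> constant (poly (map_poly of_real p :: complex poly))"
    using assms by (simp add: constant_degree degree_map_poly)
  then obtain z where z: "complex_eval p z = 0"
    using fundamental_theorem_of_algebra unfolding complex_eval_def by blast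
  show ?thesis
  proof (cases "Im z = 0")
    case True
    then have "z = of_real (Re z)" by (simp add: complex_eq_iff)
    with z have "poly p (Re z) = 0" using complex_eval_of_real[of p "Re z"] by (metis of_real_eq_0_iff)
    then obtain q where "p = [:- Re z, 1:] * q" by (auto simp only: poly_eq_0_iff_dvd elim: dvdE)
    then show ?thesis by blast
  next
    case False
    define a b where "a = Re z" and "b = Im z"
    define d where "d = [:a\<^sup>2 + b\<^sup>2, -2 * a, 1:]"
    have dz: "complex_eval d z = 0"
      by (simp add: d_def a_def b_def complex_eq_iff power2_eq_square algebra_simps)
    define m where "m = p mod d"
    have p: "p = d * (p div d) + m" by (simp add: m_def)
    have "degree m < 2"
      using degree_mod_less[of d p] by (auto simp: m_def d_def)
    then obtain e f where m: "m = [:e, f:]"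
      using degree_eq_zeroE[of m] degree1_coeffs[of m]
      by (metis One_nat_def less_2_cases pCons_0_0 pCons_eq_iff)
    have "complex_eval m z = 0" using z p dz by (metis complex_eval_add complex_eval_mult add_0 mult_zero_left)
    then have "f = 0" "e = 0" using False by (auto simp: m complex_eq_iff)
    then have "p = d * (p div d)" using p m by simp
    then show ?thesis using False unfolding d_def b_def[symmetric] by blast
  qed
qed

text \<open>The quadratic form of a symmetric B lies between 0 and the squared norm. This plays the
  part of a spectrum contained in [0, 1], the interval on which functions of B are defined
  below.\<close>

locale positive_contraction =
  fixes B :: "'a::{real_inner, complete_space} \<Rightarrow> 'a"
  assumes bl: "bounded_linear B"
    and adj: "B x \<bullet> y = x \<bullet> B y"
    and pos: "0 \<le> B x \<bullet> x"
    and contr: "B x \<bullet> x \<le> x \<bullet> x"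
begin

text \<open>The vector p(B) x, evaluated by the Horner scheme.\<close>

definition poly_apply :: "real poly \<Rightarrow> 'a \<Rightarrow> 'a" where
  "poly_apply p = fold_coeffs (\<lambda>a f x. a *\<^sub>R x + B (f x)) p (\<lambda>x. 0)"

lemmas B_simps = linear_add[OF bounded_linear.linear[OF bl]] linear_0[OF bounded_linear.linear[OF bl]]
  linear_scale[OF bounded_linear.linear[OF bl]] linear_diff[OF bounded_linear.linear[OF bl]]

lemma poly_apply_0 [simp]: "poly_apply 0 x = 0" by (simp add: poly_apply_def)

lemma poly_apply_pCons [simp]: "poly_apply (pCons a p) x = a *\<^sub>R x + B (poly_apply p x)"
  by (cases "p = 0 \<and> a = 0") (auto simp: poly_apply_def B_simps)

lemma poly_apply_bounded_linear: "bounded_linear (poly_apply p)"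
proof (induction p)
  case 0
  have "poly_apply 0 = (\<lambda>x. 0)" by auto
  then show ?case by simp
next
  case (pCons a p)
  have "poly_apply (pCons a p) = (\<lambda>x. a *\<^sub>R x + B (poly_apply p x))" by auto
  then show ?case
    using bounded_linear_add[OF bounded_linear_scaleR_right[of a] bounded_linear_compose[OF bl pCons(2)]] by simp
qed

lemma poly_apply_linear: "poly_apply p (x + y) = poly_apply p x + poly_apply p y" "poly_apply p (c *\<^sub>R x) = c *\<^sub>R poly_apply p x"
  "poly_apply p (x - y) = poly_apply p x - poly_apply p y"
  using bounded_linear.linear[OF poly_apply_bounded_linear[of p]]
  by (auto simp: linear_add linear_scale linear_diff)

lemma poly_apply_add: "poly_apply (p + q) x = poly_apply p x + poly_apply q x"
proof (induction p arbitrary: q)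
  case (pCons a p)
  then show ?case by (cases q) (simp add: algebra_simps B_simps)
qed simp

lemma poly_apply_smult: "poly_apply (smult c p) x = c *\<^sub>R poly_apply p x"
  by (induction p) (simp_all add: algebra_simps B_simps)

lemma poly_apply_diff: "poly_apply (p - q) x = poly_apply p x - poly_apply q x"
  using poly_apply_add[of p "smult (-1) q" x] poly_apply_smult[of "-1" q x] by simp

lemma poly_apply_B: "poly_apply p (B x) = B (poly_apply p x)"
  by (induction p) (simp_all add: B_simps)

lemma poly_apply_mult: "poly_apply (p * q) x = poly_apply p (poly_apply q x)"
  by (induction p) (simp_all add: poly_apply_add poly_apply_smult B_simps)

lemma poly_apply_adj: "poly_apply p x \<bullet> y = x \<bullet> poly_apply p y"
  by (induction p arbitrary: x y) (simp_all add: inner_simps adj poly_apply_B)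

text \<open>Replaces the spectral mapping theorem. Each real factor of p is bounded below: B - r
  with r < 0 by \<open>pos\<close>, with r > 1 by \<open>contr\<close>, and (B - a)^2 + b^2 by b^2.
  Splitting off one factor at a time gives an induction on the degree.\<close>

lemma poly_apply_bounded_below:
  assumes "\<And>t. t \<in> {0..1} \<Longrightarrow> poly p t \<noteq> 0"
  shows "\<exists>c>0. \<forall>x. c * norm x \<le> norm (poly_apply p x)"
  using assms
proof (induction "degree p" arbitrary: p rule: less_induct)
  case less
  have compose: "\<exists>c>0. \<forall>x. c * norm x \<le> norm (poly_apply p x)"
    if p: "p = d * q" and d: "degree d > 0" and e: "e > 0" "\<And>x. e * norm x \<le> norm (poly_apply d x)" for d q e
  proof -
    have "p \<noteq> 0" using less(2)[of 0] by auto
    then have "degree q < degree p" using d by (auto simp: p degree_mult_eq)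
    moreover have "poly q t \<noteq> 0" if "t \<in> {0..1}" for t using less(2)[OF that] by (simp add: p)
    ultimately obtain c where c: "c > 0" "\<And>x. c * norm x \<le> norm (poly_apply q x)"
      using less(1) by blast
    have "e * c * norm x \<le> norm (poly_apply p x)" for x
    proof -
      have "e * (c * norm x) \<le> e * norm (poly_apply q x)" using c e by (intro mult_left_mono) auto
      also have "\<dots> \<le> norm (poly_apply p x)" using e(2)[of "poly_apply q x"] by (simp add: p poly_apply_mult)
      finally show ?thesis by (simp add: mult.assoc)
    qed
    then show ?thesis using c e by (intro exI[of _ "e * c"]) auto
  qed
  have inner_below: "e * norm x \<le> norm y" if "e * (x \<bullet> x) \<le> \<bar>y \<bullet> x\<bar>" for e and x y :: 'a
  proof (cases "x = 0")
    case False
    have "e * (norm x * norm x) \<le> norm y * norm x"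
      using that Cauchy_Schwarz_ineq2[of y x] by (simp add: power2_norm_eq_inner[symmetric] power2_eq_square)
    then show ?thesis using False by (simp add: mult.assoc[symmetric])
  qed simp
  show ?case
  proof (cases "degree p = 0")
    case True
    then obtain a where a: "p = [:a:]" by (rule degree_eq_zeroE)
    then have "a \<noteq> 0" using less(2)[of 0] by auto
    then show ?thesis by (intro exI[of _ "\<bar>a\<bar>"]) (simp add: a B_simps)
  next
    case False
    then consider r q where "p = [:-r, 1:] * q" | a b q where "b \<noteq> 0" "p = [:a\<^sup>2 + b\<^sup>2, -2 * a, 1:] * q"
      using real_poly_factor[of p] by auto
    then show ?thesis
    proof cases
      case (1 r q)
      then have "r < 0 \<or> r > 1" using less(2)[of r] by force
      then consider "r < 0" | "r > 1" by blast
      then show ?thesis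
      proof cases
        case r: 1
        show ?thesis
        proof (rule compose[OF 1, where e = "-r"])
          fix x
          have "(- r) * (x \<bullet> x) \<le> \<bar>poly_apply [:-r, 1:] x \<bullet> x\<bar>"
            using pos[of x] r by (simp add: B_simps inner_simps)
          then show "(- r) * norm x \<le> norm (poly_apply [:-r, 1:] x)" by (rule inner_below)
        qed (use r in auto)
      next
        case r: 2
        show ?thesis
        proof (rule compose[OF 1, where e = "r - 1"])
          fix x
          have "(r - 1) * (x \<bullet> x) \<le> \<bar>poly_apply [:-r, 1:] x \<bullet> x\<bar>"
            using contr[of x] r by (simp add: B_simps inner_simps algebra_simps)
          then show "(r - 1) * norm x \<le> norm (poly_apply [:-r, 1:] x)" by (rule inner_below)
        qed (use r in auto)
      qed
    next
      case (2 a b q)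
      show ?thesis
      proof (rule compose[OF 2(2), where e = "b\<^sup>2"])
        fix x
        have "poly_apply [:a\<^sup>2 + b\<^sup>2, -2 * a, 1:] x \<bullet> x = (B x - a *\<^sub>R x) \<bullet> (B x - a *\<^sub>R x) + b\<^sup>2 * (x \<bullet> x)"
          by (simp add: B_simps inner_simps adj algebra_simps power2_eq_square inner_commute)
        then have "b\<^sup>2 * (x \<bullet> x) \<le> \<bar>poly_apply [:a\<^sup>2 + b\<^sup>2, -2 * a, 1:] x \<bullet> x\<bar>" by simp
        then show "b\<^sup>2 * norm x \<le> norm (poly_apply [:a\<^sup>2 + b\<^sup>2, -2 * a, 1:] x)" by (rule inner_below)
      qed (use 2 in auto)
    qed
  qed
qed

text \<open>Suppose the operator norm N of p(B) exceeded M. Then N^2 - p^2 has no zero on [0, 1], so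
  N^2 - p(B)^2 is bounded below by some c > 0, and this improves the bound N on p(B) itself, against
  the minimality of N.\<close>

lemma poly_apply_norm:
  assumes M: "\<And>t. t \<in> {0..1} \<Longrightarrow> \<bar>poly p t\<bar> \<le> M"
  shows "norm (poly_apply p x) \<le> M * norm x"
proof -
  let ?T = "poly_apply p"
  define N where "N = onorm ?T"
  have N: "norm (?T x) \<le> N * norm x" for x
    unfolding N_def by (rule onorm[OF poly_apply_bounded_linear])
  have "N \<le> M"
  proof (rule ccontr)
    assume "\<not> N \<le> M"
    then have NM: "N > M" by simp
    have M0: "0 \<le> M" using M[of 0] by auto
    define q where "q = [:N\<^sup>2:] - p * p"
    have "poly q t \<noteq> 0" if "t \<in> {0..1}" for t
    proof -
      have "(poly p t)\<^sup>2 \<le> M\<^sup>2" using M[OF that] by (rule power2_le_iff_abs_le[THEN iffD2, OF M0])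
      also have "\<dots> < N\<^sup>2" using NM M0 by (simp add: power_strict_mono)
      finally show ?thesis by (simp add: q_def power2_eq_square)
    qed
    then obtain c where c: "c > 0" "\<And>x. c * norm x \<le> norm (poly_apply q x)" using poly_apply_bounded_below by blast
    have N0: "N > 0" using NM M0 by simp
    \<comment> \<open>The improved bound, strictly below N. The maximum only keeps the argument of
      the root nonnegative.\<close>
    define K where "K = sqrt (max 0 (N\<^sup>2 - c\<^sup>2 / N\<^sup>2))"
    have "norm (?T x) \<le> K * norm x" for x
    proof -
      have q: "poly_apply q x = N\<^sup>2 *\<^sub>R x - ?T (?T x)"
        by (simp add: q_def poly_apply_diff poly_apply_mult B_simps)
      \<comment> \<open>Expand the square of N^2 x - p(B)^2 x and bound its last term by N^2 times
        the square of p(B) x. What survives is a gap between N^2 |x|^2 and |p(B) x|^2 of size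
        proportional to c^2.\<close>
      have "(c * norm x)\<^sup>2 \<le> (norm (poly_apply q x))\<^sup>2" using c by (intro power_mono) auto
      also have "\<dots> = N^4 * (x \<bullet> x) - 2 * N\<^sup>2 * (?T x \<bullet> ?T x) + (norm (?T (?T x)))\<^sup>2"
        unfolding q power2_norm_eq_inner
        by (simp add: inner_diff_left inner_diff_right poly_apply_adj inner_commute algebra_simps power2_eq_square power4_eq_xxxx)
      also have "\<dots> \<le> N^4 * (x \<bullet> x) - 2 * N\<^sup>2 * (?T x \<bullet> ?T x) + (N * norm (?T x))\<^sup>2"
        using N[of "?T x"] by (intro add_left_mono power_mono) auto
      also have "\<dots> = N\<^sup>2 * (N\<^sup>2 * (norm x)\<^sup>2 - (norm (?T x))\<^sup>2)"
        by (simp add: power2_norm_eq_inner[symmetric] power_mult_distrib algebra_simps power2_eq_square power4_eq_xxxx)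
      finally have "c\<^sup>2 / N\<^sup>2 * (norm x)\<^sup>2 \<le> N\<^sup>2 * (norm x)\<^sup>2 - (norm (?T x))\<^sup>2"
        using N0 by (simp add: power_mult_distrib field_simps)
      then have "(norm (?T x))\<^sup>2 \<le> (N\<^sup>2 - c\<^sup>2 / N\<^sup>2) * (norm x)\<^sup>2" by (simp add: algebra_simps)
      also have "\<dots> \<le> (K * norm x)\<^sup>2" by (simp add: K_def power_mult_distrib mult_right_mono)
      finally show ?thesis by (rule power2_le_imp_le) (simp add: K_def)
    qed
    then have "N \<le> K" unfolding N_def by (intro onorm_bound) (auto simp: K_def)
    moreover have "K < N"
      unfolding K_def using c N0 by (intro real_less_lsqrt) (auto simp: max_def)
    ultimately show False by simp
  qed
  then show ?thesis using N[of x] mult_right_mono[of N M "norm x"] by simp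
qed


text \<open>The vector f(B) x for continuous f. It is singled out by its distance from p(B) x for
  all polynomials p at once, so no approximating sequence has to be fixed.\<close>

definition fcal :: "(real \<Rightarrow> real) \<Rightarrow> 'a \<Rightarrow> 'a" where
  "fcal f x = (SOME y. \<forall>p d. (\<forall>t\<in>{0..1}. \<bar>poly p t - f t\<bar> \<le> d) \<longrightarrow> norm (poly_apply p x - y) \<le> d * norm x)"

lemma ex_poly_approx:
  assumes "continuous_on {0..1} f" "e > 0"
  obtains p where "\<And>t. t \<in> {0..1::real} \<Longrightarrow> \<bar>poly p t - f t\<bar> \<le> e"
proof -
  obtain g where g: "real_polynomial_function g" "\<And>t. t \<in> {0..1} \<Longrightarrow> \<bar>f t - g t\<bar> < e"
    using Stone_Weierstrass_real_polynomial_function[OF _ assms(1) assms(2)] by auto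
  then obtain a n where "g = (\<lambda>x. \<Sum>i\<le>n. a i * x ^ i)" by (auto simp: real_polynomial_function_iff_sum)
  then have "poly (\<Sum>i\<le>n. monom (a i) i) = g" by (auto simp: poly_sum poly_monom)
  with g(2) show ?thesis
    by (intro that[of "\<Sum>i\<le>n. monom (a i) i"]) (auto simp: abs_minus_commute less_imp_le)
qed

text \<open>Weierstrass polynomials with error 1/(n+1) give a Cauchy sequence by
  \<open>poly_apply_norm\<close>. Comparing an arbitrary p with that sequence and passing to the
  limit proves the inequality, hence also that the choice in \<open>fcal\<close> succeeds.\<close>

lemma fcal:
  assumes f: "continuous_on {0..1} f" and p: "\<And>t. t \<in> {0..1} \<Longrightarrow> \<bar>poly p t - f t\<bar> \<le> d"
  shows "norm (poly_apply p x - fcal f x) \<le> d * norm x"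
proof -
  have "\<exists>p. \<forall>t\<in>{0..1::real}. \<bar>poly p t - f t\<bar> \<le> inverse (Suc n)" for n
    using ex_poly_approx[OF f, of "inverse (Suc n)"] by (metis inverse_positive_iff_positive of_nat_0_less_iff zero_less_Suc)
  then obtain q where q: "\<And>n t. t \<in> {0..1} \<Longrightarrow> \<bar>poly (q n) t - f t\<bar> \<le> inverse (Suc n)"
    by metis
  have diff: "norm (poly_apply p x - poly_apply (q n) x) \<le> (d + inverse (Suc n)) * norm x"
    if "\<And>t. t \<in> {0..1} \<Longrightarrow> \<bar>poly p t - f t\<bar> \<le> d" for p d n
    unfolding poly_apply_diff[symmetric]
  proof (rule poly_apply_norm)
    fix t :: real assume "t \<in> {0..1}"
    from that[OF this] q[OF this, of n] show "\<bar>poly (p - q n) t\<bar> \<le> d + inverse (Suc n)"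
      unfolding poly_diff by linarith
  qed
  have "Cauchy (\<lambda>n. poly_apply (q n) x)"
  proof (rule metric_CauchyI)
    fix e :: real assume "e > 0"
    obtain M where M: "inverse (Suc M) < e / (2 * (norm x + 1))"
      using reals_Archimedean[of "e / (2 * (norm x + 1))"] \<open>e > 0\<close> by (auto simp: add_nonneg_pos)
    have "dist (poly_apply (q m) x) (poly_apply (q n) x) < e" if "m \<ge> M" "n \<ge> M" for m n
    proof -
      have le: "inverse (Suc m) \<le> inverse (Suc M)" "inverse (Suc n) \<le> inverse (Suc M)"
        using that by (auto intro!: le_imp_inverse_le)
      have "(inverse (Suc m) + inverse (Suc n)) * norm x \<le> (e / (norm x + 1)) * norm x"
      proof (rule mult_right_mono)
        have "e / (norm x + 1) = 2 * (e / (2 * (norm x + 1)))" 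
          by (simp only: mult_divide_mult_cancel_left_if times_divide_eq_right) simp
        then show "inverse (real (Suc m)) + inverse (real (Suc n)) \<le> e / (norm x + 1)"
          using add_mono[OF order_trans[OF le(1) less_imp_le[OF M]] order_trans[OF le(2) less_imp_le[OF M]]]
          by (simp only: mult_2)
      qed simp
      also have "\<dots> < e" using \<open>e > 0\<close> by (simp add: field_simps add_pos_nonneg)
      finally show ?thesis using diff[OF q, of m n] by (simp add: dist_norm)
    qed
    then show "\<exists>M. \<forall>m\<ge>M. \<forall>n\<ge>M. dist (poly_apply (q m) x) (poly_apply (q n) x) < e" by blast
  qed
  then obtain y where y: "(\<lambda>n. poly_apply (q n) x) \<longlonglongrightarrow> y" using Cauchy_convergent convergent_def by blast
  have "norm (poly_apply p x - y) \<le> d * norm x"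
    if "\<And>t. t \<in> {0..1} \<Longrightarrow> \<bar>poly p t - f t\<bar> \<le> d" for p d
  proof (rule LIMSEQ_le)
    show "(\<lambda>n. norm (poly_apply p x - poly_apply (q n) x)) \<longlonglongrightarrow> norm (poly_apply p x - y)" by (intro tendsto_intros y)
    have "(\<lambda>n. (d + inverse (real (Suc n))) * norm x) \<longlonglongrightarrow> (d + 0) * norm x"
      by (intro tendsto_intros LIMSEQ_inverse_real_of_nat)
    then show "(\<lambda>n. (d + inverse (real (Suc n))) * norm x) \<longlonglongrightarrow> d * norm x" by simp
  qed (use diff[OF that] in auto)
  then have "\<exists>y. \<forall>p d. (\<forall>t\<in>{0..1}. \<bar>poly p t - f t\<bar> \<le> d) \<longrightarrow> norm (poly_apply p x - y) \<le> d * norm x" by blast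
  from someI_ex[OF this] p show ?thesis unfolding fcal_def by blast
qed

text \<open>To identify f(B) x it suffices to find polynomials that approximate f uniformly and
  whose values at B approach y at the same rate, up to one constant K. All algebraic rules for
  \<open>fcal\<close> are obtained in this way.\<close>

lemma fcal_eqI:
  assumes f: "continuous_on {0..1} f"
    and "\<And>e. e > 0 \<Longrightarrow> \<exists>p d. d \<le> e \<and> (\<forall>t\<in>{0..1}. \<bar>poly p t - f t\<bar> \<le> d) \<and> norm (poly_apply p x - y) \<le> K * e"
  shows "fcal f x = y"
proof -
  have "norm (fcal f x - y) \<le> (norm x + K) * e" if e: "e > 0" for e
  proof -
    obtain p d where p: "d \<le> e" "\<And>t. t \<in> {0..1} \<Longrightarrow> \<bar>poly p t - f t\<bar> \<le> d" "norm (poly_apply p x - y) \<le> K * e"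
      using assms(2)[OF e] by blast
    have "norm (poly_apply p x - fcal f x) \<le> e * norm x"
      using fcal[OF f p(2), of x] mult_right_mono[OF p(1), of "norm x"] by simp
    moreover have "norm (fcal f x - y) \<le> norm (poly_apply p x - fcal f x) + norm (poly_apply p x - y)"
      by (metis norm_minus_commute norm_triangle_ineq add.commute diff_add_cancel add_diff_eq)
    ultimately show ?thesis using p(3) by (simp add: algebra_simps)
  qed
  note * = this
  have "norm (fcal f x - y) \<le> 0"
  proof (rule field_le_epsilon)
    fix e :: real assume "e > 0"
    have "norm (fcal f x - y) \<le> (norm x + K) * (e / (\<bar>norm x + K\<bar> + 1))"
      using \<open>e > 0\<close> by (intro *) auto
    also have "\<dots> \<le> (\<bar>norm x + K\<bar> + 1) * (e / (\<bar>norm x + K\<bar> + 1))"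
      using \<open>e > 0\<close> by (intro mult_right_mono) auto
    also have "\<dots> = e" by simp
    finally show "norm (fcal f x - y) \<le> 0 + e" by simp
  qed
  then show ?thesis by simp
qed

lemma fcal_poly: "fcal (poly p) x = poly_apply p x"
proof (rule fcal_eqI[where K = 0])
  fix e :: real assume "e > 0"
  then show "\<exists>q d. d \<le> e \<and> (\<forall>t\<in>{0..1}. \<bar>poly q t - poly p t\<bar> \<le> d) \<and> norm (poly_apply q x - poly_apply p x) \<le> 0 * e"
    by (intro exI[of _ p] exI[of _ 0]) simp
qed (intro continuous_intros)

lemma fcal_norm:
  assumes f: "continuous_on {0..1} f" and M: "\<And>t. t \<in> {0..1} \<Longrightarrow> \<bar>f t\<bar> \<le> M"
  shows "norm (fcal f x) \<le> M * norm x"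
proof (rule field_le_epsilon)
  fix e :: real assume "e > 0"
  define d where "d = e / (2 * (norm x + 1))"
  have d: "d > 0" using \<open>e > 0\<close> by (simp add: d_def add_nonneg_pos)
  obtain p where p: "\<And>t. t \<in> {0..1} \<Longrightarrow> \<bar>poly p t - f t\<bar> \<le> d"
    using ex_poly_approx[OF f d] by blast
  have "\<bar>poly p t\<bar> \<le> M + d" if "t \<in> {0..1}" for t
    using p[OF that] M[OF that] by linarith
  then have "norm (poly_apply p x) \<le> (M + d) * norm x" by (rule poly_apply_norm)
  moreover have "norm (poly_apply p x - fcal f x) \<le> d * norm x" by (rule fcal[OF f p])
  moreover have "norm (fcal f x) \<le> norm (poly_apply p x) + norm (poly_apply p x - fcal f x)"
    by (metis norm_minus_commute norm_triangle_sub)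
  ultimately have "norm (fcal f x) \<le> M * norm x + 2 * d * norm x" by (simp add: algebra_simps)
  also have "2 * d * norm x \<le> 2 * d * (norm x + 1)" using d by (intro mult_left_mono) auto
  also have "\<dots> = e" using add_nonneg_pos[OF norm_ge_zero[of x] zero_less_one] by (simp add: d_def divide_simps)
  finally show "norm (fcal f x) \<le> M * norm x + e" by simp
qed

lemma fcal_add:
  assumes f: "continuous_on {0..1} f" and g: "continuous_on {0..1} g"
  shows "fcal (\<lambda>t. f t + g t) x = fcal f x + fcal g x"
proof (rule fcal_eqI[where K = "norm x"])
  fix e :: real assume "e > 0"
  then have e2: "e/2 > 0" by simp
  obtain p where p: "\<And>t. t \<in> {0..1} \<Longrightarrow> \<bar>poly p t - f t\<bar> \<le> e/2"
    using ex_poly_approx[OF f e2] by blast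
  obtain q where q: "\<And>t. t \<in> {0..1} \<Longrightarrow> \<bar>poly q t - g t\<bar> \<le> e/2"
    using ex_poly_approx[OF g e2] by blast
  show "\<exists>p d. d \<le> e \<and> (\<forall>t\<in>{0..1}. \<bar>poly p t - (f t + g t)\<bar> \<le> d) \<and>
      norm (poly_apply p x - (fcal f x + fcal g x)) \<le> norm x * e"
  proof (intro exI conjI ballI)
    fix t :: real assume "t \<in> {0..1}"
    from p[OF this] q[OF this] show "\<bar>poly (p + q) t - (f t + g t)\<bar> \<le> e" 
      unfolding poly_add by linarith
  next
    have "poly_apply (p + q) x - (fcal f x + fcal g x) = (poly_apply p x - fcal f x) + (poly_apply q x - fcal g x)"
      by (simp add: poly_apply_add)
    then show "norm (poly_apply (p + q) x - (fcal f x + fcal g x)) \<le> norm x * e"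
      using fcal[OF f p, of x] fcal[OF g q, of x] norm_triangle_ineq[of "poly_apply p x - fcal f x" "poly_apply q x - fcal g x"]
      by (simp add: algebra_simps)
  qed simp
qed (intro continuous_intros f g)

text \<open>If p approximates f, then q p approximates q f with an error enlarged by the supremum C
  of |q|, and q(B) enlarges norms by at most C. The cases used are multiples, powers of \<mu> and
  the factor \<mu>, which becomes B.\<close>

lemma fcal_poly_apply:
  assumes f: "continuous_on {0..1} f"
  shows "fcal (\<lambda>t. poly q t * f t) x = poly_apply q (fcal f x)"
proof -
  have cont: "continuous_on {0..1} (\<lambda>t. poly q t * f t)" by (intro continuous_intros f)
  have "compact ((\<lambda>t. \<bar>poly q t\<bar>) ` {0..1})" by (intro compact_continuous_image continuous_intros) auto
  then obtain C where "\<forall>y\<in>(\<lambda>t. \<bar>poly q t\<bar>) ` {0..1}. norm y \<le> C"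
    using compact_imp_bounded[THEN bounded_iff[THEN iffD1]] by blast
  then have C: "\<And>t. t \<in> {0..1} \<Longrightarrow> \<bar>poly q t\<bar> \<le> C" by simp
  have C0: "C \<ge> 0" using C[of 0] by auto
  show ?thesis
  proof (rule fcal_eqI[OF cont, where K = "norm x"])
    fix e :: real assume "e > 0"
    then have "e / (C + 1) > 0" using C0 by simp
    then obtain p where p: "\<And>t. t \<in> {0..1} \<Longrightarrow> \<bar>poly p t - f t\<bar> \<le> e / (C + 1)"
      using ex_poly_approx[OF f] by blast
    have Ce: "C * (e / (C + 1)) \<le> e" using C0 \<open>e > 0\<close> by (simp add: field_simps)
    show "\<exists>p d. d \<le> e \<and> (\<forall>t\<in>{0..1}. \<bar>poly p t - poly q t * f t\<bar> \<le> d) \<and>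
      norm (poly_apply p x - poly_apply q (fcal f x)) \<le> norm x * e"
    proof (intro exI conjI ballI)
      fix t :: real assume t: "t \<in> {0..1}"
      have "\<bar>poly (q * p) t - poly q t * f t\<bar> = \<bar>poly q t\<bar> * \<bar>poly p t - f t\<bar>"
        by (simp add: abs_mult[symmetric] algebra_simps)
      also have "\<dots> \<le> C * (e / (C + 1))" using C[OF t] p[OF t] C0 by (intro mult_mono) auto
      finally show "\<bar>poly (q * p) t - poly q t * f t\<bar> \<le> C * (e / (C + 1))" .
    next
      have "norm (poly_apply (q * p) x - poly_apply q (fcal f x)) = norm (poly_apply q (poly_apply p x - fcal f x))"
        by (simp add: poly_apply_mult poly_apply_linear)
      also have "\<dots> \<le> C * norm (poly_apply p x - fcal f x)" by (rule poly_apply_norm[OF C])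
      also have "\<dots> \<le> C * (e / (C + 1) * norm x)" by (intro mult_left_mono fcal f p C0)
      also have "\<dots> \<le> norm x * e" using mult_right_mono[OF Ce, of "norm x"] by (simp add: mult_ac)
      finally show "norm (poly_apply (q * p) x - poly_apply q (fcal f x)) \<le> norm x * e" .
    qed (rule Ce)
  qed
qed

lemma fcal_scale:
  "continuous_on {0..1} f \<Longrightarrow> fcal (\<lambda>t. c * f t) x = c *\<^sub>R fcal f x"
  using fcal_poly_apply[of f "[:c:]" x] by (simp add: B_simps)

lemma fcal_B:
  "continuous_on {0..1} f \<Longrightarrow> fcal (\<lambda>t. t * f t) x = B (fcal f x)"
  using fcal_poly_apply[of f "[:0, 1:]" x] by (simp add: B_simps)

lemma fcal_diff:
  assumes "continuous_on {0..1} f" "continuous_on {0..1} g"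
  shows "fcal (\<lambda>t. f t - g t) x = fcal f x - fcal g x"
  using fcal_add[OF assms(1), of "\<lambda>t. (-1) * g t" x] fcal_scale[OF assms(2), of "-1" x] assms(2)
  by (simp add: continuous_on_minus)

lemma fcal_tendsto:
  assumes f: "continuous_on {0..1} f"
  shows "\<exists>q. (\<forall>x. (\<lambda>n. poly_apply (q n) x) \<longlonglongrightarrow> fcal f x)"
proof -
  have "\<exists>p. \<forall>t\<in>{0..1::real}. \<bar>poly p t - f t\<bar> \<le> inverse (Suc n)" for n
    using ex_poly_approx[OF f, of "inverse (Suc n)"] by (metis inverse_positive_iff_positive of_nat_0_less_iff zero_less_Suc)
  then obtain q where q: "\<And>n t. t \<in> {0..1} \<Longrightarrow> \<bar>poly (q n) t - f t\<bar> \<le> inverse (Suc n)"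
    by metis
  have "(\<lambda>n. poly_apply (q n) x) \<longlonglongrightarrow> fcal f x" for x
  proof (rule LIM_zero_cancel, rule Lim_null_comparison)
    show "\<forall>\<^sub>F n in sequentially. norm (poly_apply (q n) x - fcal f x) \<le> inverse (Suc n) * norm x"
      by (intro always_eventually allI fcal f q)
    have "(\<lambda>n. inverse (real (Suc n)) * norm x) \<longlonglongrightarrow> 0 * norm x"
      by (intro tendsto_intros LIMSEQ_inverse_real_of_nat)
    then show "(\<lambda>n. inverse (real (Suc n)) * norm x) \<longlonglongrightarrow> 0" by simp
  qed
  then show ?thesis by blast
qed

lemma fcal_adj:
  assumes f: "continuous_on {0..1} f"
  shows "fcal f x \<bullet> y = x \<bullet> fcal f y"
proof -
  obtain q where q: "\<And>x. (\<lambda>n. poly_apply (q n) x) \<longlonglongrightarrow> fcal f x" using fcal_tendsto[OF f] by blast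
  have "(\<lambda>n. poly_apply (q n) x \<bullet> y) \<longlonglongrightarrow> fcal f x \<bullet> y" by (intro tendsto_intros q)
  moreover have "(\<lambda>n. poly_apply (q n) x \<bullet> y) \<longlonglongrightarrow> x \<bullet> fcal f y"
    unfolding poly_apply_adj by (intro tendsto_intros q)
  ultimately show ?thesis by (rule LIMSEQ_unique)
qed

text \<open>An invariant subspace contains every p(B) x, and closedness adds the limits. Applied to
  \<open>Lset\<close>, this keeps the solution in L2(\<Omega>).\<close>

lemma fcal_mem:
  assumes f: "continuous_on {0..1} f" and S: "subspace S" "closed S" "\<And>x. x \<in> S \<Longrightarrow> B x \<in> S" and x: "x \<in> S"
  shows "fcal f x \<in> S"
proof -
  obtain q where q: "\<And>x. (\<lambda>n. poly_apply (q n) x) \<longlonglongrightarrow> fcal f x" using fcal_tendsto[OF f] by blast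
  have "poly_apply p x \<in> S" for p
    by (induction p) (auto simp: subspace_0 S x intro!: subspace_add subspace_scale)
  then show ?thesis using closed_sequentially[OF S(2) _ q] by blast
qed

end

section \<open>The scalar oscillator\<close>

text \<open>The controlled equation at spectral value \<mu> of B, where A acts as (1 - \<mu>)/\<mu>.
  It is multiplied by \<mu> so that the coefficients remain bounded on [0, 1]; \<rho> stands for the
  entire right-hand side.\<close>

definition oscillator ::
    "real \<Rightarrow> real \<Rightarrow> real \<Rightarrow> real \<Rightarrow> (real \<Rightarrow> real) \<Rightarrow> (real \<Rightarrow> real) \<Rightarrow> (real \<Rightarrow> real) \<Rightarrow> (real \<Rightarrow> real) \<Rightarrow> bool" where
  "oscillator \<delta> a b \<mu> \<rho> R R1 R2 \<longleftrightarrow> R a = 0 \<and> R1 a = 0 \<and>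
     (\<forall>t\<in>{a..b}. (R has_real_derivative R1 t) (at t within {a..b}) \<and>
        (R1 has_real_derivative R2 t) (at t within {a..b}) \<and>
        \<mu> * R2 t + (1 - \<mu>) * (\<delta> * R1 t + R t) = \<rho> t)"

text \<open>The damping term has the favourable sign; the remaining terms are absorbed by Young's
  inequality, and Gronwall's argument with the factor exp (- 2 (t - a)) closes the estimate. The
  explicit dependence on \<mu> is what the uniform bounds later rest on.\<close>

lemma oscillator_energy:
  assumes osc: "oscillator \<delta> a b \<mu> \<rho> R R1 R2"
    and \<mu>: "0 < \<mu>" "\<mu> \<le> 1" and \<delta>: "0 \<le> \<delta>"
    and M: "\<And>t. t \<in> {a..b} \<Longrightarrow> \<bar>\<rho> t\<bar> \<le> M" and t: "t \<in> {a..b}"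
  shows "\<mu> * (R1 t)\<^sup>2 + (R t)\<^sup>2 \<le> exp (2 * (t - a)) * (M\<^sup>2 / \<mu> * (t - a))"
proof -
  \<comment> \<open>The natural potential energy has weight 1 - \<mu> on R^2 and degenerates at
    \<mu> = 1. Weight 1 controls R uniformly, at the cost of the cross term 2 \<mu> R R1 in the
    derivative.\<close>
  define E where "E x = \<mu> * (R1 x)\<^sup>2 + (R x)\<^sup>2" for x
  define E' where "E' x = 2 * \<mu> * R1 x * R2 x + 2 * R x * R1 x" for x
  define h where "h x = exp (- 2 * (x - a)) * E x - M\<^sup>2 / \<mu> * (x - a)" for x
  have R: "(R has_real_derivative R1 x) (at x within {a..b})"
    "(R1 has_real_derivative R2 x) (at x within {a..b})"
    "\<mu> * R2 x + (1 - \<mu>) * (\<delta> * R1 x + R x) = \<rho> x" if "x \<in> {a..b}" for x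
    using osc that by (auto simp: oscillator_def)
  have h: "(h has_real_derivative exp (- 2 * (x - a)) * (E' x - 2 * E x) - M\<^sup>2 / \<mu>) (at x within {a..b})"
    if "x \<in> {a..b}" for x
    unfolding h_def E_def E'_def
    by (rule derivative_eq_intros R that refl | simp)+ (simp add: algebra_simps)
  have E': "E' x - 2 * E x \<le> M\<^sup>2 / \<mu>" if x: "x \<in> {a..b}" for x
  proof -
    have eq: "\<mu> * R2 x = \<rho> x - (1 - \<mu>) * (\<delta> * R1 x + R x)" using R(3)[OF x] by simp
    have "E' x = 2 * R1 x * (\<mu> * R2 x) + 2 * R x * R1 x" by (simp add: E'_def)
    also have "\<dots> = 2 * R1 x * \<rho> x - 2 * ((1 - \<mu>) * \<delta> * (R1 x)\<^sup>2) + 2 * \<mu> * (R x * R1 x)"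
      unfolding eq by (simp add: algebra_simps power2_eq_square)
    finally have E'eq: "E' x = 2 * R1 x * \<rho> x - 2 * ((1 - \<mu>) * \<delta> * (R1 x)\<^sup>2) + 2 * \<mu> * (R x * R1 x)" .
    have 1: "0 \<le> (1 - \<mu>) * \<delta> * (R1 x)\<^sup>2" using \<mu> \<delta> by simp
    \<comment> \<open>Young's inequality, scaled so that the kinetic part is exactly \<mu> R1^2;
      this is the origin of the factor 1 / \<mu> in front of M^2.\<close>
    have "0 \<le> (\<mu> * R1 x - \<rho> x)\<^sup>2 / \<mu>" using \<mu> by simp
    also have "\<dots> = \<mu> * (R1 x)\<^sup>2 - 2 * R1 x * \<rho> x + (\<rho> x)\<^sup>2 / \<mu>"
      using \<mu> by (simp add: field_simps power2_eq_square)
    finally have 2: "2 * R1 x * \<rho> x \<le> \<mu> * (R1 x)\<^sup>2 + (\<rho> x)\<^sup>2 / \<mu>" by simp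
    have "2 * (R x * R1 x) \<le> (R x)\<^sup>2 + (R1 x)\<^sup>2"
      using sum_squares_bound[of "R x" "R1 x"] by simp
    then have 3: "2 * \<mu> * (R x * R1 x) \<le> \<mu> * (R x)\<^sup>2 + \<mu> * (R1 x)\<^sup>2"
      using mult_left_mono[of _ _ \<mu>] \<mu> by (fastforce simp: algebra_simps)
    have 4: "\<mu> * (R x)\<^sup>2 \<le> 1 * (R x)\<^sup>2" using \<mu> by (intro mult_right_mono) auto
    have "(\<rho> x)\<^sup>2 \<le> M\<^sup>2" using M[OF x] by (metis abs_ge_zero power2_abs power_mono)
    then have "(\<rho> x)\<^sup>2 / \<mu> \<le> M\<^sup>2 / \<mu>" using \<mu> by (simp add: divide_right_mono)
    with 1 2 3 4 show ?thesis unfolding E'eq E_def by (smt (verit) zero_le_power2)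
  qed
  have "h t \<le> h a"
  proof (rule DERIV_nonpos_imp_decreasing_open[of a t h])
    show "a \<le> t" using t by simp
    have "continuous_on {a..b} h" using DERIV_continuous_on[OF h] .
    then show "continuous_on {a..t} h" by (rule continuous_on_subset) (use t in auto)
    fix x assume x: "a < x" "x < t"
    then have xab: "x \<in> {a..b}" using t by simp
    have "exp (- 2 * (x - a)) * (E' x - 2 * E x) \<le> exp (- 2 * (x - a)) * (M\<^sup>2 / \<mu>)"
      using E'[OF xab] by (intro mult_left_mono) auto
    also have "\<dots> \<le> 1 * (M\<^sup>2 / \<mu>)" using x \<mu> by (intro mult_right_mono) auto
    finally have "exp (- 2 * (x - a)) * (E' x - 2 * E x) - M\<^sup>2 / \<mu> \<le> 0" by simp
    moreover have "(h has_real_derivative exp (- 2 * (x - a)) * (E' x - 2 * E x) - M\<^sup>2 / \<mu>) (at x)"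
      using h[OF xab] x t by (simp add: at_within_Icc_at)
    ultimately show "\<exists>y. (h has_real_derivative y) (at x) \<and> y \<le> 0" by blast
  qed
  also have "h a = 0" using osc by (simp add: h_def E_def oscillator_def)
  finally have "exp (- 2 * (t - a)) * E t \<le> M\<^sup>2 / \<mu> * (t - a)" by (simp add: h_def)
  then have "exp (2 * (t - a)) * (exp (- 2 * (t - a)) * E t) \<le> exp (2 * (t - a)) * (M\<^sup>2 / \<mu> * (t - a))"
    by (intro mult_left_mono) auto
  then show ?thesis by (simp add: E_def mult.assoc[symmetric] exp_add[symmetric])
qed

lemma oscillator_unique:
  assumes osc: "oscillator \<delta> a b \<mu> \<rho> R R1 R2" "oscillator \<delta> a b \<mu> \<rho> Q Q1 Q2"
    and \<mu>: "0 < \<mu>" "\<mu> \<le> 1" and \<delta>: "0 \<le> \<delta>" and t: "t \<in> {a..b}"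
  shows "R t = Q t" "R1 t = Q1 t" "R2 t = Q2 t"
proof -
  have "oscillator \<delta> a b \<mu> (\<lambda>_. 0) (\<lambda>t. R t - Q t) (\<lambda>t. R1 t - Q1 t) (\<lambda>t. R2 t - Q2 t)"
    unfolding oscillator_def
  proof (intro conjI ballI)
    fix t assume "t \<in> {a..b}"
    then have "\<mu> * R2 t + (1 - \<mu>) * (\<delta> * R1 t + R t) = \<rho> t"
      "\<mu> * Q2 t + (1 - \<mu>) * (\<delta> * Q1 t + Q t) = \<rho> t"
      using osc unfolding oscillator_def by blast+
    moreover have "\<mu> * (R2 t - Q2 t) + (1 - \<mu>) * (\<delta> * (R1 t - Q1 t) + (R t - Q t)) =
        (\<mu> * R2 t + (1 - \<mu>) * (\<delta> * R1 t + R t)) - (\<mu> * Q2 t + (1 - \<mu>) * (\<delta> * Q1 t + Q t))"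
      by (simp add: algebra_simps)
    ultimately show "\<mu> * (R2 t - Q2 t) + (1 - \<mu>) * (\<delta> * (R1 t - Q1 t) + (R t - Q t)) = 0" by simp
  qed (use osc in \<open>auto simp: oscillator_def intro!: DERIV_diff\<close>)
  from oscillator_energy[OF this \<mu> \<delta> _ t, of 0]
  have "\<mu> * (R1 t - Q1 t)\<^sup>2 + (R t - Q t)\<^sup>2 \<le> 0" by simp
  moreover have "0 \<le> \<mu> * (R1 t - Q1 t)\<^sup>2" "0 \<le> (R t - Q t)\<^sup>2" using \<mu> by auto
  ultimately have "\<mu> * (R1 t - Q1 t)\<^sup>2 = 0" "(R t - Q t)\<^sup>2 = 0" by linarith+
  then show *: "R t = Q t" "R1 t = Q1 t" using \<mu> by auto
  have "\<mu> * R2 t = \<mu> * Q2 t" using osc t * unfolding oscillator_def by (metis add_right_cancel)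
  then show "R2 t = Q2 t" using \<mu> by simp
qed

text \<open>Variation of constants: y(t) is exp (r t) times the integral of exp (- r \<tau>)
  h(\<tau>) from 0 to t.\<close>

lemma linear_ode_complex:
  fixes h :: "real \<Rightarrow> complex"
  assumes h: "continuous_on {0..T} h"
  obtains y where "y 0 = 0"
    "\<And>t. t \<in> {0..T} \<Longrightarrow> (y has_vector_derivative (r * y t + h t)) (at t within {0..T})"
proof -
  define g where "g \<tau> = exp (- (of_real \<tau> * r)) * h \<tau>" for \<tau>
  let ?y = "\<lambda>t. exp (of_real t * r) * integral {0..t} g"
  have "(?y has_vector_derivative (r * ?y t + h t)) (at t within {0..T})" if t: "t \<in> {0..T}" for t
  proof -
    have "continuous_on {0..T} g" unfolding g_def by (intro continuous_intros h)
    from integral_has_vector_derivative[OF this t]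
    have 1: "((\<lambda>u. integral {0..u} g) has_vector_derivative g t) (at t within {0..T})" .
    have 2: "((\<lambda>t. exp (of_real t * r)) has_vector_derivative r * exp (of_real t * r)) (at t within {0..T})"
      by (rule has_vector_derivative_real_field) (auto intro!: derivative_eq_intros)
    have "(?y has_vector_derivative (exp (of_real t * r) * g t + r * exp (of_real t * r) * integral {0..t} g)) (at t within {0..T})"
      by (rule has_vector_derivative_mult[OF 2 1])
    moreover have "exp (of_real t * r) * g t = h t"
      by (simp add: g_def mult.assoc[symmetric] exp_add[symmetric])
    ultimately show "(?y has_vector_derivative (r * ?y t + h t)) (at t within {0..T})"
      by (simp add: algebra_simps)
  qed
  then show thesis by (intro that[of ?y]) simp_all
qed

text \<open>Over the complex numbers the operator factors as (D - r2)(D - r1), so two first-order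
  equations are solved in succession. This treats real, complex and coinciding roots alike; the real
  part solves the original equation.\<close>

lemma oscillator_exists:
  assumes \<rho>: "continuous_on {0..T} \<rho>" and \<mu>: "0 < \<mu>"
  shows "\<exists>R R1 R2. oscillator \<delta> 0 T \<mu> \<rho> R R1 R2"
proof -
  define p q where "p = (1 - \<mu>) * \<delta> / \<mu>" and "q = (1 - \<mu>) / \<mu>"
  define d where "d = csqrt (of_real (p\<^sup>2 - 4 * q))"
  define r1 r2 where "r1 = (- of_real p + d) / 2" and "r2 = (- of_real p - d) / 2"
  have dd: "d * d = of_real (p\<^sup>2 - 4 * q)"
    unfolding d_def using power2_csqrt[of "of_real (p\<^sup>2 - 4 * q)"] by (simp add: power2_eq_square)
  have sum: "r1 + r2 = - of_real p" by (simp add: r1_def r2_def field_simps)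
  have "4 * (r1 * r2) = (- of_real p + d) * (- of_real p - d)" by (simp add: r1_def r2_def)
  then have "4 * (r1 * r2) = of_real p * of_real p - d * d" by (simp add: algebra_simps)
  then have prod: "r1 * r2 = of_real q" unfolding dd by (simp add: power2_eq_square)
  have "continuous_on {0..T} (\<lambda>t. of_real (\<rho> t / \<mu>) :: complex)" by (intro continuous_intros \<rho>) (use \<mu> in auto)
  then obtain y where y: "y 0 = 0" "\<And>t. t \<in> {0..T} \<Longrightarrow>
      (y has_vector_derivative (r1 * y t + of_real (\<rho> t / \<mu>))) (at t within {0..T})"
    using linear_ode_complex[of T "\<lambda>t. of_real (\<rho> t / \<mu>)" r1] by blast
  then have "continuous_on {0..T} y" by (meson continuous_on_eq_continuous_within has_vector_derivative_continuous)
  then obtain z where z: "z 0 = 0" "\<And>t. t \<in> {0..T} \<Longrightarrow>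
      (z has_vector_derivative (r2 * z t + y t)) (at t within {0..T})"
    using linear_ode_complex[of T y r2] by blast
  define z1 where "z1 t = r2 * z t + y t" for t
  define z2 where "z2 t = r2 * z1 t + (r1 * y t + of_real (\<rho> t / \<mu>))" for t
  have z1: "(z1 has_vector_derivative z2 t) (at t within {0..T})" if "t \<in> {0..T}" for t
    unfolding z1_def z2_def
    using has_vector_derivative_add[OF has_vector_derivative_mult_right[OF z(2)[OF that], of r2] y(2)[OF that]] by simp
  have Re: "((\<lambda>t. Re (f t)) has_real_derivative Re f') F" if "(f has_vector_derivative f') F" for f f' F
    using bounded_linear.has_vector_derivative[OF bounded_linear_Re that]
    by (simp add: has_real_derivative_iff_has_vector_derivative)
  have eq: "z2 t + of_real p * z1 t + of_real q * z t = of_real (\<rho> t / \<mu>)" for t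
  proof -
    have p: "of_real p = - (r1 + r2)" unfolding sum by simp
    show ?thesis unfolding prod[symmetric] p z2_def z1_def by (simp add: algebra_simps)
  qed
  have "\<mu> * Re (z2 t) + (1 - \<mu>) * (\<delta> * Re (z1 t) + Re (z t)) = \<rho> t" for t
  proof -
    have "Re (z2 t) + p * Re (z1 t) + q * Re (z t) = \<rho> t / \<mu>"
      using arg_cong[OF eq[of t], of Re] by simp
    then have "\<mu> * (Re (z2 t) + p * Re (z1 t) + q * Re (z t)) = \<rho> t" using \<mu> by simp
    moreover have "\<mu> * p = (1 - \<mu>) * \<delta>" "\<mu> * q = 1 - \<mu>" using \<mu> by (simp_all add: p_def q_def)
    ultimately show ?thesis by (simp add: distrib_left mult.assoc[symmetric])
  qed
  then have "oscillator \<delta> 0 T \<mu> \<rho> (\<lambda>t. Re (z t)) (\<lambda>t. Re (z1 t)) (\<lambda>t. Re (z2 t))"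
    unfolding oscillator_def
    using z(1) y(1) Re[OF z(2)] Re[OF z1] by (simp add: z1_def)
  then show ?thesis by blast
qed

text \<open>The defect of the integrated equation has derivative zero, by the equation for Y, and
  vanishes at 0 because \<eta> and the data of Y do. Differentiating the forcing thus corresponds to
  differentiating the solution.\<close>

lemma oscillator_integrate:
  assumes osc: "oscillator \<delta> 0 T \<mu> (\<lambda>t. \<mu> * \<eta>' t) Y Y1 Y2" and T: "0 \<le> T"
    and \<eta>: "\<And>t. t \<in> {0..T} \<Longrightarrow> (\<eta> has_real_derivative \<eta>' t) (at t within {0..T})" "\<eta> 0 = 0"
  shows "oscillator \<delta> 0 T \<mu> (\<lambda>t. \<mu> * \<eta> t) (\<lambda>t. integral {0..t} Y) Y Y1"
proof -
  have Y: "(Y has_real_derivative Y1 t) (at t within {0..T})"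
    "(Y1 has_real_derivative Y2 t) (at t within {0..T})"
    "\<mu> * Y2 t + (1 - \<mu>) * (\<delta> * Y1 t + Y t) = \<mu> * \<eta>' t" if "t \<in> {0..T}" for t
    using osc that by (auto simp: oscillator_def)
  have "continuous_on {0..T} Y" by (rule DERIV_continuous_on[OF Y(1)])
  then have I: "((\<lambda>t. integral {0..t} Y) has_real_derivative Y t) (at t within {0..T})" if "t \<in> {0..T}" for t
    using integral_has_real_derivative that by blast
  define G where "G t = \<mu> * Y1 t + (1 - \<mu>) * (\<delta> * Y t + integral {0..t} Y) - \<mu> * \<eta> t" for t
  have "(G has_real_derivative 0) (at t within {0..T})" if "t \<in> {0..T}" for t
  proof -
    have "(G has_real_derivative \<mu> * Y2 t + (1 - \<mu>) * (\<delta> * Y1 t + Y t) - \<mu> * \<eta>' t) (at t within {0..T})"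
      unfolding G_def by (rule derivative_eq_intros Y I \<eta> that refl | simp)+
    then show ?thesis using Y(3)[OF that] by simp
  qed
  then have "\<exists>c. \<forall>t\<in>{0..T}. G t = c" by (intro has_field_derivative_zero_constant) auto
  moreover have "G 0 = 0" using osc \<eta> by (simp add: G_def oscillator_def)
  ultimately have "G t = 0" if "t \<in> {0..T}" for t using that T by (metis atLeastAtMost_iff order_refl)
  then show ?thesis
    using osc Y(1) I unfolding oscillator_def by (simp add: G_def)
qed

text \<open>Supplies, for all \<mu> in [0, 1] together, a solution with all its time derivatives,
  bounded uniformly and continuous in \<mu>, so that \<open>fcal\<close> may be applied at each
  time. The \<eta> n are meant as the successive derivatives of one forcing that is flat at
  0.\<close>

lemma oscillator_family:
  fixes \<eta> :: "nat \<Rightarrow> real \<Rightarrow> real"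
  assumes T: "0 < T" and \<delta>: "0 \<le> \<delta>"
    and \<eta>: "\<And>n t. (\<eta> n has_real_derivative \<eta> (Suc n) t) (at t)" "\<And>n. \<eta> n 0 = 0"
  obtains W :: "nat \<Rightarrow> real \<Rightarrow> real \<Rightarrow> real" where
    "\<And>n t \<mu>. t \<in> {0..T} \<Longrightarrow> \<mu> \<in> {0..1} \<Longrightarrow>
       ((\<lambda>t. W n t \<mu>) has_real_derivative W (Suc n) t \<mu>) (at t within {0..T})"
    "\<And>n. \<exists>D. \<forall>t\<in>{0..T}. \<forall>\<mu>\<in>{0..1}. \<bar>W n t \<mu>\<bar> \<le> D"
    "\<And>n t. t \<in> {0..T} \<Longrightarrow> continuous_on {0..1} (W n t)"
    "\<And>n t \<mu>. t \<in> {0..T} \<Longrightarrow> \<mu> \<in> {0..1} \<Longrightarrow>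
       \<mu> * W (n + 2) t \<mu> + (1 - \<mu>) * (\<delta> * W (n + 1) t \<mu> + W n t \<mu>) = \<mu> * \<eta> n t"
    "\<And>n \<mu>. \<mu> \<in> {0..1} \<Longrightarrow> W n 0 \<mu> = 0"
    "\<And>n t. W n t 0 = 0"
proof -
  have cont: "continuous_on A (\<eta> n)" for n A
    using DERIV_continuous_on[of A "\<eta> n" "\<eta> (Suc n)"] \<eta>(1) by (blast intro: DERIV_subset)
  have "\<exists>R R1 R2. oscillator \<delta> 0 T \<mu> (\<lambda>t. \<mu> * \<eta> n t) R R1 R2" if "\<mu> > 0" for n \<mu>
    by (intro oscillator_exists continuous_intros cont that)
  note ex = this
  define Q where "Q n \<mu> = (SOME q. oscillator \<delta> 0 T \<mu> (\<lambda>t. \<mu> * \<eta> n t) (fst q) (fst (snd q)) (snd (snd q)))" for n \<mu>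
  define R R1 R2 where "R n \<mu> = fst (Q n \<mu>)" and "R1 n \<mu> = fst (snd (Q n \<mu>))" and "R2 n \<mu> = snd (snd (Q n \<mu>))" for n \<mu>
  have R: "oscillator \<delta> 0 T \<mu> (\<lambda>t. \<mu> * \<eta> n t) (R n \<mu>) (R1 n \<mu>) (R2 n \<mu>)" if "\<mu> > 0" for n \<mu>
  proof -
    have "\<exists>q. oscillator \<delta> 0 T \<mu> (\<lambda>t. \<mu> * \<eta> n t) (fst q) (fst (snd q)) (snd (snd q))"
      using ex[OF that, of n] by (metis fst_conv snd_conv)
    from someI_ex[OF this] show ?thesis unfolding R_def R1_def R2_def Q_def .
  qed
  \<comment> \<open>The solutions were chosen separately for each n; uniqueness together with
    \<open>oscillator_integrate\<close> shows that each is the derivative of the one before.\<close>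
  have eq: "R1 n \<mu> t = R (Suc n) \<mu> t \<and> R2 n \<mu> t = R1 (Suc n) \<mu> t"
    if \<mu>: "0 < \<mu>" "\<mu> \<le> 1" and t: "t \<in> {0..T}" for n \<mu> t
  proof -
    have "oscillator \<delta> 0 T \<mu> (\<lambda>t. \<mu> * \<eta> n t) (\<lambda>t. integral {0..t} (R (Suc n) \<mu>)) (R (Suc n) \<mu>) (R1 (Suc n) \<mu>)"
      using R[OF \<mu>(1)] T \<eta> by (intro oscillator_integrate) (auto intro: DERIV_subset)
    from oscillator_unique[OF R[OF \<mu>(1)] this \<mu> \<delta> t] show ?thesis by simp
  qed
  \<comment> \<open>At \<mu> = 0 the equation reads \<delta> W' + W = 0, and 0 is the value that
    agrees with the initial data and with the limit \<mu> to 0.\<close>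
  define W where "W n t \<mu> = (if \<mu> = 0 then 0 else R n \<mu> t)" for n t \<mu>
  have der: "((\<lambda>t. W n t \<mu>) has_real_derivative W (Suc n) t \<mu>) (at t within {0..T})"
    if "t \<in> {0..T}" "\<mu> \<in> {0..1}" for n t \<mu>
  proof (cases "\<mu> = 0")
    case True then show ?thesis by (simp add: W_def)
  next
    case False
    then have "\<mu> > 0" "\<mu> \<le> 1" using that by auto
    then have "(R n \<mu> has_real_derivative R (Suc n) \<mu> t) (at t within {0..T})"
      using R[of \<mu> n] eq[of \<mu> t n] that(1) unfolding oscillator_def by metis
    then show ?thesis using False by (simp add: W_def)
  qed
  have osc: "oscillator \<delta> 0 T \<mu> (\<lambda>t. \<mu> * \<eta> n t) (\<lambda>t. W n t \<mu>) (\<lambda>t. W (Suc n) t \<mu>) (\<lambda>t. W (Suc (Suc n)) t \<mu>)"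
    if \<mu>: "0 < \<mu>" "\<mu> \<le> 1" for n \<mu>
  proof -
    have W: "W n t \<mu> = R n \<mu> t" for n t using \<mu> by (simp add: W_def)
    show ?thesis
      unfolding oscillator_def
    proof (intro conjI ballI)
      show "W n 0 \<mu> = 0" "W (Suc n) 0 \<mu> = 0" using R[OF \<mu>(1)] unfolding W oscillator_def by auto
      fix t assume t: "t \<in> {0..T}"
      show "((\<lambda>t. W n t \<mu>) has_real_derivative W (Suc n) t \<mu>) (at t within {0..T})"
        "((\<lambda>t. W (Suc n) t \<mu>) has_real_derivative W (Suc (Suc n)) t \<mu>) (at t within {0..T})"
        using \<mu> t by (auto intro!: der)
      have "\<mu> * R2 n \<mu> t + (1 - \<mu>) * (\<delta> * R1 n \<mu> t + R n \<mu> t) = \<mu> * \<eta> n t"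
        using R[OF \<mu>(1), of n] t unfolding oscillator_def by blast
      then show "\<mu> * W (Suc (Suc n)) t \<mu> + (1 - \<mu>) * (\<delta> * W (Suc n) t \<mu> + W n t \<mu>) = \<mu> * \<eta> n t"
        using eq[OF \<mu> t] by (simp add: W)
    qed
  qed
  \<comment> \<open>The forcing carries a factor \<mu>, so the energy bound M^2 / \<mu> becomes
    \<mu> C^2. The resulting decay like the root of \<mu> gives continuity at \<mu> = 0.\<close>
  have bound: "\<exists>D\<ge>0. \<forall>t\<in>{0..T}. \<forall>\<mu>\<in>{0..1}. \<bar>W n t \<mu>\<bar> \<le> D * sqrt \<mu>" for n
  proof -
    have "compact (\<eta> n ` {0..T})" by (intro compact_continuous_image cont) auto
    then obtain C where C: "\<And>t. t \<in> {0..T} \<Longrightarrow> \<bar>\<eta> n t\<bar> \<le> C"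
      using compact_imp_bounded[THEN bounded_iff[THEN iffD1]] by (metis image_eqI real_norm_def)
    have C0: "C \<ge> 0" using C[of 0] T by auto
    define D where "D = sqrt (exp (2 * T) * (C\<^sup>2 * T))"
    have "\<bar>W n t \<mu>\<bar> \<le> D * sqrt \<mu>" if t: "t \<in> {0..T}" and \<mu>: "\<mu> \<in> {0..1}" for t \<mu>
    proof (cases "\<mu> = 0")
      case False
      then have \<mu>: "0 < \<mu>" "\<mu> \<le> 1" using \<mu> by auto
      have b: "\<bar>\<mu> * \<eta> n t\<bar> \<le> \<mu> * C" if "t \<in> {0..T}" for t using C[OF that] \<mu> by (simp add: abs_mult)
      have "\<mu> * (W (Suc n) t \<mu>)\<^sup>2 + (W n t \<mu>)\<^sup>2 \<le> exp (2 * (t - 0)) * ((\<mu> * C)\<^sup>2 / \<mu> * (t - 0))"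
        by (rule oscillator_energy[OF osc[OF \<mu>, of n] \<mu> \<delta> b t])
      then
      have "(W n t \<mu>)\<^sup>2 \<le> exp (2 * t) * ((\<mu> * C)\<^sup>2 / \<mu> * t)"
        using mult_nonneg_nonneg[OF less_imp_le[OF \<mu>(1)] zero_le_power2, of "W (Suc n) t \<mu>"]
        by (simp only: diff_zero)
      also have "(\<mu> * C)\<^sup>2 / \<mu> * t = \<mu> * (C\<^sup>2 * t)" using \<mu> by (simp add: power2_eq_square)
      also have "exp (2 * t) * (\<mu> * (C\<^sup>2 * t)) \<le> exp (2 * T) * (\<mu> * (C\<^sup>2 * T))"
        using t \<mu> by (intro mult_mono) auto
      also have "\<dots> = (D * sqrt \<mu>)\<^sup>2" using \<mu> T by (simp add: D_def power_mult_distrib)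
      finally show ?thesis using T \<mu> by (intro power2_le_iff_abs_le[THEN iffD1]) (simp_all add: D_def)
    qed (simp add: W_def)
    then show ?thesis using T by (intro exI[of _ D]) (auto simp: D_def)
  qed
  have bound': "\<exists>D\<ge>0. \<forall>t\<in>{0..T}. \<forall>\<mu>\<in>{0..1}. \<bar>W n t \<mu>\<bar> \<le> D" for n
  proof -
    obtain D where D: "D \<ge> 0" "\<forall>t\<in>{0..T}. \<forall>\<mu>\<in>{0..1}. \<bar>W n t \<mu>\<bar> \<le> D * sqrt \<mu>" using bound by blast
    have "D * sqrt \<mu> \<le> D" if "\<mu> \<in> {0..1}" for \<mu> using D(1) that by (simp add: mult_left_le)
    with D show ?thesis by (meson order_trans)
  qed
  have contW: "continuous_on {0..1} (W n t)" if t: "t \<in> {0..T}" for n t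
    unfolding continuous_on_def
  proof
    fix \<mu> :: real assume \<mu>1: "\<mu> \<in> {0..1}"
    show "(W n t \<longlongrightarrow> W n t \<mu>) (at \<mu> within {0..1})"
    proof (cases "\<mu> = 0")
      case True
      obtain D where D: "D \<ge> 0" "\<forall>t\<in>{0..T}. \<forall>\<mu>\<in>{0..1}. \<bar>W n t \<mu>\<bar> \<le> D * sqrt \<mu>" using bound by blast
      have "(W n t \<longlongrightarrow> 0) (at \<mu> within {0..1})"
      proof (rule Lim_null_comparison)
        show "\<forall>\<^sub>F \<nu> in at \<mu> within {0..1}. norm (W n t \<nu>) \<le> D * sqrt \<nu>"
          using D(2) t by (auto simp: eventually_at_filter)
        have "((\<lambda>\<nu>. D * sqrt \<nu>) \<longlongrightarrow> D * sqrt \<mu>) (at \<mu> within {0..1})" by (intro tendsto_intros)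
        then show "((\<lambda>\<nu>. D * sqrt \<nu>) \<longlongrightarrow> 0) (at \<mu> within {0..1})" using True by simp
      qed
      then show ?thesis using True by (simp add: W_def)
    next
      case False
      then have \<mu>: "0 < \<mu>" "\<mu> \<le> 1" using \<mu>1 by auto
      have "compact (\<eta> n ` {0..T})" by (intro compact_continuous_image cont) auto
      then obtain C where C: "\<And>t. t \<in> {0..T} \<Longrightarrow> \<bar>\<eta> n t\<bar> \<le> C"
        using compact_imp_bounded[THEN bounded_iff[THEN iffD1]] by (metis image_eqI real_norm_def)
      obtain D0 D1 D2 where
        D0: "\<And>t \<mu>. t\<in>{0..T} \<Longrightarrow> \<mu>\<in>{0..1} \<Longrightarrow> \<bar>W n t \<mu>\<bar> \<le> D0" and
        D1: "\<And>t \<mu>. t\<in>{0..T} \<Longrightarrow> \<mu>\<in>{0..1} \<Longrightarrow> \<bar>W (Suc n) t \<mu>\<bar> \<le> D1" and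
        D2: "\<And>t \<mu>. t\<in>{0..T} \<Longrightarrow> \<mu>\<in>{0..1} \<Longrightarrow> \<bar>W (Suc (Suc n)) t \<mu>\<bar> \<le> D2"
        using bound' by meson
      define K where "K = C + D2 + \<delta> * D1 + D0"
      have est: "\<bar>W n t \<nu> - W n t \<mu>\<bar> \<le> sqrt (exp (2 * T) * (K\<^sup>2 / \<mu> * T)) * \<bar>\<mu> - \<nu>\<bar>" if \<nu>1: "\<nu> \<in> {0..1}" "\<nu> \<noteq> 0" for \<nu>
      proof -
        have \<nu>: "0 < \<nu>" "\<nu> \<le> 1" using that by auto
        \<comment> \<open>Subtracting the equations for \<mu> and \<nu> shows that the difference of
          the two solutions is an oscillator with parameter \<mu> whose forcing is proportional to
          \<mu> - \<nu>.\<close>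
        define \<rho> where "\<rho> t = (\<mu> - \<nu>) * (\<eta> n t - W (Suc (Suc n)) t \<nu> + \<delta> * W (Suc n) t \<nu> + W n t \<nu>)" for t
        have "oscillator \<delta> 0 T \<mu> \<rho> (\<lambda>t. W n t \<mu> - W n t \<nu>) (\<lambda>t. W (Suc n) t \<mu> - W (Suc n) t \<nu>)
            (\<lambda>t. W (Suc (Suc n)) t \<mu> - W (Suc (Suc n)) t \<nu>)"
          unfolding oscillator_def
        proof (intro conjI ballI)
          fix t assume t: "t \<in> {0..T}"
          have "\<mu> * W (Suc (Suc n)) t \<mu> + (1 - \<mu>) * (\<delta> * W (Suc n) t \<mu> + W n t \<mu>) = \<mu> * \<eta> n t"
            "\<nu> * W (Suc (Suc n)) t \<nu> + (1 - \<nu>) * (\<delta> * W (Suc n) t \<nu> + W n t \<nu>) = \<nu> * \<eta> n t"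
            using osc[OF \<mu>, of n] osc[OF \<nu>, of n] t unfolding oscillator_def by blast+
          then show "\<mu> * (W (Suc (Suc n)) t \<mu> - W (Suc (Suc n)) t \<nu>) + (1 - \<mu>) *
              (\<delta> * (W (Suc n) t \<mu> - W (Suc n) t \<nu>) + (W n t \<mu> - W n t \<nu>)) = \<rho> t"
            unfolding \<rho>_def by algebra
        qed (use osc[OF \<mu>, of n] osc[OF \<nu>, of n] in \<open>auto simp: oscillator_def intro!: DERIV_diff\<close>)
        moreover have "\<bar>\<rho> t\<bar> \<le> \<bar>\<mu> - \<nu>\<bar> * K" if t: "t \<in> {0..T}" for t
        proof -
          have "\<bar>\<eta> n t - W (Suc (Suc n)) t \<nu> + \<delta> * W (Suc n) t \<nu> + W n t \<nu>\<bar> \<le>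
              \<bar>\<eta> n t\<bar> + \<bar>W (Suc (Suc n)) t \<nu>\<bar> + \<bar>\<delta> * W (Suc n) t \<nu>\<bar> + \<bar>W n t \<nu>\<bar>" by linarith
          also have "\<dots> \<le> C + D2 + \<delta> * D1 + D0"
            using \<delta> by (intro add_mono C D0 D2 t \<nu>1) (simp add: abs_mult mult_left_mono[OF D1[OF t \<nu>1(1)]])
          finally show ?thesis unfolding \<rho>_def K_def abs_mult by (intro mult_left_mono) auto
        qed
        ultimately have "\<mu> * (W (Suc n) t \<mu> - W (Suc n) t \<nu>)\<^sup>2 + (W n t \<mu> - W n t \<nu>)\<^sup>2 \<le>
            exp (2 * (t - 0)) * ((\<bar>\<mu> - \<nu>\<bar> * K)\<^sup>2 / \<mu> * (t - 0))"
          using oscillator_energy[OF _ \<mu> \<delta> _ t] by blast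
        then have "(W n t \<nu> - W n t \<mu>)\<^sup>2 \<le> exp (2 * t) * ((\<bar>\<mu> - \<nu>\<bar> * K)\<^sup>2 / \<mu> * t)"
          using mult_nonneg_nonneg[OF less_imp_le[OF \<mu>(1)] zero_le_power2, of "W (Suc n) t \<mu> - W (Suc n) t \<nu>"]
          by (simp only: diff_zero power2_commute[of "W n t \<nu>"])
        also have "\<dots> \<le> exp (2 * T) * ((\<bar>\<mu> - \<nu>\<bar> * K)\<^sup>2 / \<mu> * T)"
          using t \<mu> by (intro mult_mono) auto
        also have "\<dots> = (sqrt (exp (2 * T) * (K\<^sup>2 / \<mu> * T)) * \<bar>\<mu> - \<nu>\<bar>)\<^sup>2"
          using \<mu> T by (simp add: power_mult_distrib)
        finally show ?thesis
          using T \<mu> by (intro power2_le_iff_abs_le[THEN iffD1]) auto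
      qed
      show ?thesis
      proof (rule LIM_zero_cancel, rule Lim_null_comparison)
        have "\<forall>\<^sub>F \<nu> in at \<mu> within {0..1}. \<nu> \<noteq> 0"
          by (rule t1_space_class.eventually_neq_at_within)
        then show "\<forall>\<^sub>F \<nu> in at \<mu> within {0..1}. norm (W n t \<nu> - W n t \<mu>) \<le> sqrt (exp (2 * T) * (K\<^sup>2 / \<mu> * T)) * \<bar>\<mu> - \<nu>\<bar>"
          unfolding eventually_at_filter by eventually_elim (use est in auto)
        have "((\<lambda>\<nu>. sqrt (exp (2 * T) * (K\<^sup>2 / \<mu> * T)) * \<bar>\<mu> - \<nu>\<bar>) \<longlongrightarrow> sqrt (exp (2 * T) * (K\<^sup>2 / \<mu> * T)) * \<bar>\<mu> - \<mu>\<bar>) (at \<mu> within {0..1})"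
          by (intro tendsto_intros)
        then show "((\<lambda>\<nu>. sqrt (exp (2 * T) * (K\<^sup>2 / \<mu> * T)) * \<bar>\<mu> - \<nu>\<bar>) \<longlongrightarrow> 0) (at \<mu> within {0..1})" by simp
      qed
    qed
  qed
  show thesis
  proof (rule that[of W])
    show "((\<lambda>t. W n t \<mu>) has_real_derivative W (Suc n) t \<mu>) (at t within {0..T})"
      if "t \<in> {0..T}" "\<mu> \<in> {0..1}" for n t \<mu> using that by (rule der)
    show "\<exists>D. \<forall>t\<in>{0..T}. \<forall>\<mu>\<in>{0..1}. \<bar>W n t \<mu>\<bar> \<le> D" for n using bound' by blast
    show "continuous_on {0..1} (W n t)" if "t \<in> {0..T}" for n t using that by (rule contW)
    show "\<mu> * W (n + 2) t \<mu> + (1 - \<mu>) * (\<delta> * W (n + 1) t \<mu> + W n t \<mu>) = \<mu> * \<eta> n t"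
      if "t \<in> {0..T}" "\<mu> \<in> {0..1}" for n t \<mu>
    proof (cases "\<mu> = 0")
      case False
      then have "0 < \<mu>" "\<mu> \<le> 1" using that by auto
      from osc[OF this, of n] that(1) show ?thesis unfolding oscillator_def by simp
    qed (simp add: W_def)
    show "W n 0 \<mu> = 0" if "\<mu> \<in> {0..1}" for n \<mu>
    proof (cases "\<mu> = 0")
      case False
      then have "0 < \<mu>" "\<mu> \<le> 1" using that by auto
      from osc[OF this, of n] show ?thesis unfolding oscillator_def by simp
    qed (simp add: W_def)
    show "W n t 0 = 0" for n t by (simp add: W_def)
  qed
qed

text \<open>The ansatz \<open>W = \<delta> \<Theta>\<^sub>1 + c \<Theta>\<^sub>2 + R\<close> with \<open>c = 1 - \<delta>\<^sup>2 (1 - \<mu>) / \<mu>\<close> absorbs the singular part of the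
  forcing; the factor \<open>\<mu>\<^sup>2\<close> makes the estimate of the remainder \<open>R\<close> uniform in \<open>\<mu>\<close>.\<close>

lemma oscillator_impulse:
  assumes \<delta>: "0 \<le> \<delta>" and a: "0 \<le> a" "a \<le> T" "T - a \<le> 1" and \<mu>: "0 < \<mu>" "\<mu> \<le> 1"
    and osc: "oscillator \<delta> 0 T \<mu> (\<lambda>t. \<mu> * (\<theta> t + \<delta> * \<theta>' t)) W W1 W2"
    and \<theta>: "\<And>t. (\<theta> has_real_derivative \<theta>' t) (at t)" "\<And>t. t \<in> {0..T} \<Longrightarrow> (\<Theta>1 has_real_derivative \<theta> t) (at t)"
      "\<And>t. t \<in> {0..T} \<Longrightarrow> (\<Theta>2 has_real_derivative \<Theta>1 t) (at t)"
    and zero: "\<And>t. t \<in> {0..a} \<Longrightarrow> \<theta> t = 0 \<and> \<theta>' t = 0 \<and> \<Theta>1 t = 0 \<and> \<Theta>2 t = 0"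
    and \<Theta>1: "\<And>t. t \<in> {a..T} \<Longrightarrow> 0 \<le> \<Theta>1 t \<and> \<Theta>1 t \<le> 1" "\<Theta>1 T = 1" and \<theta>T: "\<theta> T = 0"
  defines "K \<equiv> (1 + \<delta>\<^sup>2) + (\<delta> * (2 + \<delta>\<^sup>2) + (1 + \<delta>\<^sup>2)) * exp 1"
  shows "\<bar>\<mu>\<^sup>2 * W T - \<delta> * \<mu>\<^sup>2\<bar> \<le> K * sqrt (T - a)"
    "\<bar>\<mu>\<^sup>2 * W1 T - (\<mu>\<^sup>2 - \<delta>\<^sup>2 * \<mu> * (1 - \<mu>))\<bar> \<le> K * sqrt (T - a)"
proof -
  define \<epsilon> where "\<epsilon> = T - a"
  define c where "c = 1 - \<delta>\<^sup>2 * (1 - \<mu>) / \<mu>"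
  have \<mu>c: "\<mu> * (1 - c) = \<delta>\<^sup>2 * (1 - \<mu>)" using \<mu> by (simp add: c_def)
  have c1: "\<bar>c\<bar> \<le> (1 + \<delta>\<^sup>2) / \<mu>" "\<bar>1 + c\<bar> \<le> (2 + \<delta>\<^sup>2) / \<mu>"
  proof -
    have "\<mu> * c = \<mu> - \<delta>\<^sup>2 * (1 - \<mu>)" using \<mu>c by (simp add: algebra_simps)
    moreover have "0 \<le> \<delta>\<^sup>2 * (1 - \<mu>)" "\<delta>\<^sup>2 * (1 - \<mu>) \<le> \<delta>\<^sup>2 * 1" using \<mu> by (auto simp: mult_left_le)
    moreover have "\<mu> * (1 + c) = \<mu> + \<mu> * c" by (simp add: algebra_simps)
    ultimately have "\<bar>\<mu> * c\<bar> \<le> 1 + \<delta>\<^sup>2" "\<bar>\<mu> * (1 + c)\<bar> \<le> 2 + \<delta>\<^sup>2" using \<mu> by linarith+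
    then show "\<bar>c\<bar> \<le> (1 + \<delta>\<^sup>2) / \<mu>" "\<bar>1 + c\<bar> \<le> (2 + \<delta>\<^sup>2) / \<mu>"
      using \<mu> by (simp_all add: abs_mult pos_le_divide_eq mult.commute)
  qed
  have Wd: "(W has_real_derivative W1 t) (at t within {0..T})"
    "(W1 has_real_derivative W2 t) (at t within {0..T})"
    "\<mu> * W2 t + (1 - \<mu>) * (\<delta> * W1 t + W t) = \<mu> * (\<theta> t + \<delta> * \<theta>' t)" if "t \<in> {0..T}" for t
    using osc that by (auto simp: oscillator_def)
  \<comment> \<open>Nothing acts before time a, so by uniqueness the oscillator is still at rest
    there and the estimates may start at a.\<close>
  have Wa: "W a = 0" "W1 a = 0"
  proof -
    have "oscillator \<delta> 0 a \<mu> (\<lambda>_. 0) W W1 W2"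
      unfolding oscillator_def
    proof (intro conjI ballI)
      show "W 0 = 0" "W1 0 = 0" using osc by (auto simp: oscillator_def)
      fix t assume t: "t \<in> {0..a}"
      then have tT: "t \<in> {0..T}" using a by simp
      show "(W has_real_derivative W1 t) (at t within {0..a})" "(W1 has_real_derivative W2 t) (at t within {0..a})"
        using Wd(1,2)[OF tT] a by (auto elim!: DERIV_subset)
      show "\<mu> * W2 t + (1 - \<mu>) * (\<delta> * W1 t + W t) = 0" using Wd(3)[OF tT] zero[of t] t by simp
    qed
    moreover have "oscillator \<delta> 0 a \<mu> (\<lambda>_. 0) (\<lambda>_. 0) (\<lambda>_. 0) (\<lambda>_. 0)" by (simp add: oscillator_def)
    moreover have "a \<in> {0..a}" using a by simp
    ultimately show "W a = 0" "W1 a = 0" by (auto dest: oscillator_unique(1,2)[OF _ _ \<mu> \<delta>])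
  qed
  \<comment> \<open>On [a, T] the slope of \<Theta>2 lies between 0 and 1, and the interval has
    length \<epsilon>.\<close>
  have \<Theta>2: "0 \<le> \<Theta>2 t \<and> \<Theta>2 t \<le> \<epsilon>" if t: "t \<in> {a..T}" for t
  proof -
    have "\<Theta>2 a \<le> \<Theta>2 t"
    proof (rule DERIV_nonneg_imp_nondecreasing[of a t \<Theta>2])
      fix x assume "a \<le> x" "x \<le> t"
      then show "\<exists>y. (\<Theta>2 has_real_derivative y) (at x) \<and> 0 \<le> y"
        using \<theta>(3)[of x] \<Theta>1(1)[of x] t a by (intro exI[of _ "\<Theta>1 x"]) auto
    qed (use t in auto)
    moreover have "\<Theta>2 t - t \<le> \<Theta>2 a - a"
    proof (rule DERIV_nonpos_imp_nonincreasing[of a t "\<lambda>t. \<Theta>2 t - t"])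
      fix x assume "a \<le> x" "x \<le> t"
      then show "\<exists>y. ((\<lambda>t. \<Theta>2 t - t) has_real_derivative y) (at x) \<and> y \<le> 0"
        using \<Theta>1(1)[of x] t a by (intro exI[of _ "\<Theta>1 x - 1"]) (auto intro!: derivative_eq_intros \<theta>(3))
    qed (use t in auto)
    ultimately show ?thesis using zero[of a] t a by (auto simp: \<epsilon>_def)
  qed
  define R where "R t = W t - \<delta> * \<Theta>1 t - c * \<Theta>2 t" for t
  define R1 where "R1 t = W1 t - \<delta> * \<theta> t - c * \<Theta>1 t" for t
  define R2 where "R2 t = W2 t - \<delta> * \<theta>' t - c * \<theta> t" for t
  \<comment> \<open>What the ansatz leaves over. The \<theta>' terms cancel through \<delta>
    \<Theta>1, and the \<theta> terms cancel exactly because \<mu> (1 - c) = \<delta>^2 (1 - \<mu>);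
    only the bounded functions \<Theta>1 and \<Theta>2 remain.\<close>
  define \<rho> where "\<rho> t = - (1 - \<mu>) * (\<delta> * (1 + c) * \<Theta>1 t + c * \<Theta>2 t)" for t
  have oscR: "oscillator \<delta> a T \<mu> \<rho> R R1 R2"
    unfolding oscillator_def
  proof (intro conjI ballI)
    show "R a = 0" "R1 a = 0" using Wa zero[of a] a by (simp_all add: R_def R1_def)
    fix t assume t: "t \<in> {a..T}"
    then have tT: "t \<in> {0..T}" using a by simp
    have "(W has_real_derivative W1 t) (at t within {a..T})" "(W1 has_real_derivative W2 t) (at t within {a..T})"
      using Wd(1,2)[OF tT] a by (auto elim!: DERIV_subset)
    then show "(R has_real_derivative R1 t) (at t within {a..T})" "(R1 has_real_derivative R2 t) (at t within {a..T})"
      unfolding R_def[abs_def] R1_def[abs_def] R2_def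
      by (auto intro!: derivative_eq_intros DERIV_subset[OF \<theta>(1)] DERIV_subset[OF \<theta>(2)[OF tT]] DERIV_subset[OF \<theta>(3)[OF tT]])
    show "\<mu> * R2 t + (1 - \<mu>) * (\<delta> * R1 t + R t) = \<rho> t"
      using Wd(3)[OF tT] \<mu>c unfolding R_def R1_def R2_def \<rho>_def by algebra
  qed
  define K0 where "K0 = \<delta> * (2 + \<delta>\<^sup>2) + (1 + \<delta>\<^sup>2)"
  have K0: "K0 \<ge> 0" using \<delta> by (simp add: K0_def)
  have \<rho>b: "\<bar>\<rho> t\<bar> \<le> K0 / \<mu>" if t: "t \<in> {a..T}" for t
  proof -
    have "\<bar>\<delta> * (1 + c) * \<Theta>1 t + c * \<Theta>2 t\<bar> \<le> \<delta> * \<bar>1 + c\<bar> * \<bar>\<Theta>1 t\<bar> + \<bar>c\<bar> * \<bar>\<Theta>2 t\<bar>"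
      using \<delta> by (metis abs_mult abs_of_nonneg abs_triangle_ineq)
    also have "\<dots> \<le> \<delta> * ((2 + \<delta>\<^sup>2) / \<mu>) * 1 + ((1 + \<delta>\<^sup>2) / \<mu>) * 1"
      using c1 \<delta> \<mu> \<Theta>1(1)[OF t] \<Theta>2[OF t] a by (intro add_mono mult_mono) (auto simp: \<epsilon>_def)
    also have "\<dots> = K0 / \<mu>" by (simp add: K0_def add_divide_distrib distrib_left)
    finally have *: "\<bar>\<delta> * (1 + c) * \<Theta>1 t + c * \<Theta>2 t\<bar> \<le> K0 / \<mu>" .
    have "\<bar>\<rho> t\<bar> = (1 - \<mu>) * \<bar>\<delta> * (1 + c) * \<Theta>1 t + c * \<Theta>2 t\<bar>"
      using \<mu> by (simp add: \<rho>_def abs_mult)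
    also have "\<dots> \<le> 1 * (K0 / \<mu>)" using \<mu> * by (intro mult_mono) auto
    finally show ?thesis by simp
  qed
  have "\<mu> * (R1 T)\<^sup>2 + (R T)\<^sup>2 \<le> exp (2 * \<epsilon>) * ((K0 / \<mu>)\<^sup>2 / \<mu> * \<epsilon>)"
    unfolding \<epsilon>_def by (rule oscillator_energy[OF oscR \<mu> \<delta> \<rho>b]) (use a in auto)
  also have "\<dots> \<le> exp 2 * ((K0 / \<mu>)\<^sup>2 / \<mu> * \<epsilon>)"
    using a \<mu> by (intro mult_right_mono) (auto simp: \<epsilon>_def)
  finally have E: "\<mu> * (R1 T)\<^sup>2 + (R T)\<^sup>2 \<le> exp 2 * ((K0 / \<mu>)\<^sup>2 / \<mu> * \<epsilon>)" .
  have \<epsilon>0: "0 \<le> \<epsilon>" "\<epsilon> \<le> 1" using a by (auto simp: \<epsilon>_def)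
  have e2: "exp (2::real) = (exp 1)\<^sup>2" by (simp add: power2_eq_square exp_add[symmetric])
  have K0e: "0 \<le> K0 * exp 1 * sqrt \<epsilon>" using K0 \<epsilon>0 by simp
  \<comment> \<open>By E the derivative R1 is of size \<mu>^(-2) and R of size \<mu>^(-3/2), each
    times the root of \<epsilon>; so \<mu>^2 is the weight that R1 requires, and it covers R as
    well.\<close>
  have R1b: "\<bar>\<mu>\<^sup>2 * R1 T\<bar> \<le> K0 * exp 1 * sqrt \<epsilon>"
  proof -
    have "\<mu> * (R1 T)\<^sup>2 \<le> exp 2 * ((K0 / \<mu>)\<^sup>2 / \<mu> * \<epsilon>)" using E zero_le_power2[of "R T"] by linarith
    then have "\<mu>^3 * (\<mu> * (R1 T)\<^sup>2) \<le> \<mu>^3 * (exp 2 * ((K0 / \<mu>)\<^sup>2 / \<mu> * \<epsilon>))" using \<mu> by (intro mult_left_mono) auto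
    also have "\<dots> = (K0 * exp 1 * sqrt \<epsilon>)\<^sup>2"
      using \<mu> \<epsilon>0 by (simp add: e2 field_simps power2_eq_square power3_eq_cube)
    finally have "(\<mu>\<^sup>2 * R1 T)\<^sup>2 \<le> (K0 * exp 1 * sqrt \<epsilon>)\<^sup>2"
      by (simp add: power2_eq_square power3_eq_cube mult_ac)
    then show ?thesis using K0e by (metis abs_le_square_iff abs_of_nonneg)
  qed
  have Rb: "\<bar>\<mu>\<^sup>2 * R T\<bar> \<le> K0 * exp 1 * sqrt \<epsilon>"
  proof -
    have "(R T)\<^sup>2 \<le> exp 2 * ((K0 / \<mu>)\<^sup>2 / \<mu> * \<epsilon>)"
      using E mult_nonneg_nonneg[OF less_imp_le[OF \<mu>(1)] zero_le_power2, of "R1 T"] by linarith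
    then have "\<mu>^3 * (R T)\<^sup>2 \<le> \<mu>^3 * (exp 2 * ((K0 / \<mu>)\<^sup>2 / \<mu> * \<epsilon>))" using \<mu> by (intro mult_left_mono) auto
    also have "\<dots> = (K0 * exp 1 * sqrt \<epsilon>)\<^sup>2"
      using \<mu> \<epsilon>0 by (simp add: e2 field_simps power2_eq_square power3_eq_cube)
    finally have 1: "\<mu>^3 * (R T)\<^sup>2 \<le> (K0 * exp 1 * sqrt \<epsilon>)\<^sup>2" .
    have "(\<mu>\<^sup>2 * R T)\<^sup>2 = \<mu> * (\<mu>^3 * (R T)\<^sup>2)" by (simp add: power2_eq_square power3_eq_cube)
    also have "\<dots> \<le> 1 * (\<mu>^3 * (R T)\<^sup>2)" using \<mu> by (intro mult_right_mono) auto
    finally show ?thesis using 1 K0e by (metis abs_le_square_iff abs_of_nonneg mult_1 order_trans)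
  qed
  have "\<epsilon> \<le> sqrt \<epsilon>" using \<epsilon>0 by (simp add: real_le_rsqrt power2_eq_square mult_left_le)
  have Th: "\<bar>\<mu>\<^sup>2 * (c * \<Theta>2 T)\<bar> \<le> (1 + \<delta>\<^sup>2) * sqrt \<epsilon>"
  proof -
    have "\<bar>\<mu>\<^sup>2 * (c * \<Theta>2 T)\<bar> = \<mu> * (\<mu> * \<bar>c\<bar>) * \<bar>\<Theta>2 T\<bar>" using \<mu> by (simp add: abs_mult power2_eq_square)
    also have "\<dots> \<le> 1 * (1 + \<delta>\<^sup>2) * sqrt \<epsilon>"
      using \<mu> c1(1) \<Theta>2[of T] a \<open>\<epsilon> \<le> sqrt \<epsilon>\<close>
      by (intro mult_mono) (auto simp: field_simps)
    finally show ?thesis by simp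
  qed
  have "\<mu>\<^sup>2 * W T - \<delta> * \<mu>\<^sup>2 = \<mu>\<^sup>2 * (c * \<Theta>2 T) + \<mu>\<^sup>2 * R T"
    by (simp add: R_def \<Theta>1 algebra_simps)
  then show "\<bar>\<mu>\<^sup>2 * W T - \<delta> * \<mu>\<^sup>2\<bar> \<le> K * sqrt (T - a)"
    using Th Rb unfolding K_def K0_def[symmetric] \<epsilon>_def[symmetric] by (simp add: distrib_right)
  have "\<mu>\<^sup>2 * (1 - c) = \<mu> * (\<mu> * (1 - c))" by (simp add: power2_eq_square)
  then have "\<mu>\<^sup>2 * (1 - c) = \<delta>\<^sup>2 * \<mu> * (1 - \<mu>)" unfolding \<mu>c by simp
  then have "\<mu>\<^sup>2 * W1 T - (\<mu>\<^sup>2 - \<delta>\<^sup>2 * \<mu> * (1 - \<mu>)) = \<mu>\<^sup>2 * R1 T"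
    by (simp add: R1_def \<Theta>1 \<theta>T algebra_simps)
  moreover have "0 \<le> (1 + \<delta>\<^sup>2) * sqrt \<epsilon>" using \<epsilon>0 by simp
  ultimately show "\<bar>\<mu>\<^sup>2 * W1 T - (\<mu>\<^sup>2 - \<delta>\<^sup>2 * \<mu> * (1 - \<mu>))\<bar> \<le> K * sqrt (T - a)"
    using R1b unfolding K_def K0_def[symmetric] \<epsilon>_def[symmetric] by (simp add: distrib_right)
qed

section \<open>Smooth bump functions\<close>

lemma k_times_cont_diff_SucI:
  assumes "\<And>x. (f has_derivative F x) (at x)" "\<And>b. b \<in> Basis \<Longrightarrow> k_times_cont_diff k (\<lambda>x. F x b)"
  shows "k_times_cont_diff (Suc k) f"
proof -
  have "frechet_derivative f (at x) = F x" for x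
    using frechet_derivative_at[OF assms(1)] by simp
  then show ?thesis
    using assms by (auto simp: differentiable_on_def differentiable_def intro: has_derivative_at_withinI)
qed

lemma k_times_cont_diff_SucD:
  assumes "k_times_cont_diff (Suc k) f"
  shows "(f has_derivative frechet_derivative f (at x)) (at x)"
    "b \<in> Basis \<Longrightarrow> k_times_cont_diff k (\<lambda>x. frechet_derivative f (at x) b)"
  using assms by (auto simp: differentiable_on_def frechet_derivative_works[symmetric])

lemma k_times_cont_diff_lower: "k_times_cont_diff (Suc k) f \<Longrightarrow> k_times_cont_diff k f"
proof (induction k arbitrary: f)
  case 0
  then show ?case by (simp add: differentiable_imp_continuous_on)
next
  case (Suc k)
  then show ?case
    by (intro k_times_cont_diff_SucI[OF k_times_cont_diff_SucD(1)[OF Suc.prems]])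
      (rule Suc.IH, rule k_times_cont_diff_SucD(2)[OF Suc.prems])
qed

lemma k_times_cont_diff_const: "k_times_cont_diff k (\<lambda>x. c)"
proof (induction k arbitrary: c)
  case (Suc k)
  then show ?case by (intro k_times_cont_diff_SucI[of _ "\<lambda>_ _. 0"]) (auto intro!: derivative_eq_intros)
qed simp

lemma k_times_cont_diff_linear: "bounded_linear f \<Longrightarrow> k_times_cont_diff k f"
proof (cases k)
  case 0
  assume "bounded_linear f"
  then show ?thesis using 0 by (simp add: linear_continuous_on)
next
  case (Suc n)
  assume "bounded_linear f"
  then show ?thesis unfolding Suc
    by (intro k_times_cont_diff_SucI[of _ "\<lambda>_. f"] k_times_cont_diff_const bounded_linear_imp_has_derivative)
qed

lemma k_times_cont_diff_add:
  "k_times_cont_diff k f \<Longrightarrow> k_times_cont_diff k g \<Longrightarrow> k_times_cont_diff k (\<lambda>x. f x + g x)"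
proof (induction k arbitrary: f g)
  case (Suc k)
  show ?case
    by (intro k_times_cont_diff_SucI[OF has_derivative_add[OF
          k_times_cont_diff_SucD(1)[OF Suc.prems(1)] k_times_cont_diff_SucD(1)[OF Suc.prems(2)]]] Suc.IH
          k_times_cont_diff_SucD(2) Suc.prems)
qed (auto intro: continuous_intros)

lemma k_times_cont_diff_mult:
  "k_times_cont_diff k f \<Longrightarrow> k_times_cont_diff k g \<Longrightarrow> k_times_cont_diff k (\<lambda>x. f x * g x)"
proof (induction k arbitrary: f g)
  case (Suc k)
  show ?case
    by (intro k_times_cont_diff_SucI[OF has_derivative_mult[OF
          k_times_cont_diff_SucD(1)[OF Suc.prems(1)] k_times_cont_diff_SucD(1)[OF Suc.prems(2)]]]
          k_times_cont_diff_add Suc.IH k_times_cont_diff_lower[OF Suc.prems(1)] k_times_cont_diff_lower[OF Suc.prems(2)]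
          k_times_cont_diff_SucD(2) Suc.prems)
qed (auto intro: continuous_intros)

lemma k_times_cont_diff_sum:
  "(\<And>i. i \<in> I \<Longrightarrow> k_times_cont_diff k (f i)) \<Longrightarrow> k_times_cont_diff k (\<lambda>x. \<Sum>i\<in>I. f i x)"
  by (induction I rule: infinite_finite_induct) (auto simp: k_times_cont_diff_const intro!: k_times_cont_diff_add)

text \<open>Carrying the whole sequence of derivatives of the outer function closes the induction on
  k: the derivative of D n (f x) is D (n+1) (f x) times a derivative of f.\<close>

lemma k_times_cont_diff_compose:
  assumes D: "\<And>n t. (D n has_real_derivative D (Suc n) t) (at t)"
  shows "k_times_cont_diff k f \<Longrightarrow> k_times_cont_diff k (\<lambda>x. D n (f x))"
proof (induction k arbitrary: f n)
  case 0
  have "continuous_on UNIV (D n)"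
    using D by (meson DERIV_continuous_on has_field_derivative_at_within)
  with 0 show ?case by (auto intro: continuous_on_compose2)
next
  case (Suc k)
  have "((\<lambda>x. D n (f x)) has_derivative (\<lambda>h. D (Suc n) (f x) * frechet_derivative f (at x) h)) (at x)" for x
    using has_derivative_compose[OF k_times_cont_diff_SucD(1)[OF Suc.prems] D[of n, unfolded has_field_derivative_def]] .
  then show ?case
    by (rule k_times_cont_diff_SucI)
      (rule k_times_cont_diff_mult[OF Suc.IH[OF k_times_cont_diff_lower[OF Suc.prems]] k_times_cont_diff_SucD(2)[OF Suc.prems]])
qed

text \<open>The derivatives of \<open>exp (- 1 / z)\<close> for \<open>z > 0\<close> are of this form, with \<open>P\<close> replaced by
  \<open>X\<^sup>2 (P - P')\<close> at each step.\<close>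

definition flat :: "real poly \<Rightarrow> real \<Rightarrow> real" where
  "flat P z = (if z > 0 then poly P (1 / z) * exp (- (1 / z)) else 0)"

lemma poly_exp_tendsto_0: "((\<lambda>u. poly P u * exp (- u)) \<longlongrightarrow> (0::real)) at_top"
proof -
  have "((\<lambda>u. \<Sum>i\<le>degree P. coeff P i * (u ^ i / exp u)) \<longlongrightarrow> (\<Sum>i\<le>degree P. coeff P i * 0)) (at_top :: real filter)"
    by (intro tendsto_intros tendsto_power_div_exp_0)
  then show ?thesis
    by (simp add: poly_altdef exp_minus sum_distrib_right divide_inverse mult.assoc)
qed

text \<open>Only the origin is delicate: from the right the difference quotient is u P(u) exp (- u)
  with u = 1/h, which tends to 0, and from the left it is 0.\<close>

lemma flat_has_derivative:
  "(flat P has_real_derivative flat ([:0, 0, 1:] * (P - pderiv P)) z) (at z)"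
proof (cases z "0::real" rule: linorder_cases)
  case less
  have "(flat P has_real_derivative 0) (at z)"
  proof (rule has_field_derivative_transform_within_open[of "\<lambda>_. 0" _ _ "{..<0}"])
    show "((\<lambda>_. 0) has_real_derivative 0) (at z)" by simp
  qed (use less in \<open>auto simp: flat_def\<close>)
  with less show ?thesis by (simp add: flat_def)
next
  case greater
  have "(flat P has_real_derivative poly ([:0, 0, 1:] * (P - pderiv P)) (1 / z) * exp (- (1 / z))) (at z)"
  proof (rule has_field_derivative_transform_within_open[of "\<lambda>z. poly P (1 / z) * exp (- (1 / z))" _ _ "{0<..}"])
    have d: "((\<lambda>z. 1 / z) has_real_derivative - ((1 / z)\<^sup>2)) (at z)"
      using greater by (auto intro!: derivative_eq_intros simp: power2_eq_square)
    show "((\<lambda>z. poly P (1 / z) * exp (- (1 / z))) has_real_derivative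
        poly ([:0, 0, 1:] * (P - pderiv P)) (1 / z) * exp (- (1 / z))) (at z)"
      by (rule derivative_eq_intros DERIV_chain2[OF poly_DERIV d] d refl)+
        (simp add: power2_eq_square algebra_simps)
  qed (use greater in \<open>auto simp: flat_def\<close>)
  with greater show ?thesis by (simp add: flat_def)
next
  case equal
  have lim: "((\<lambda>h. poly ([:0, 1:] * P) (inverse h) * exp (- inverse h)) \<longlongrightarrow> (0::real)) (at_right 0)"
    by (rule filterlim_compose[OF poly_exp_tendsto_0 filterlim_inverse_at_top_right])
  have right: "((\<lambda>h. (flat P (0 + h) - flat P 0) / h) \<longlongrightarrow> 0) (at_right 0)"
    by (rule Lim_transform_eventually[OF lim])
      (auto simp: flat_def eventually_at_filter divide_inverse)
  have left: "((\<lambda>h. (flat P (0 + h) - flat P 0) / h) \<longlongrightarrow> 0) (at_left 0)"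
    by (rule Lim_transform_eventually[OF tendsto_const])
      (auto simp: flat_def eventually_at_filter)
  have "(flat P has_real_derivative 0) (at 0)"
    unfolding DERIV_def using filterlim_split_at[OF left right] .
  then show ?thesis using equal by (simp add: flat_def)
qed

definition bump :: "real \<Rightarrow> real" where "bump = flat 1"

lemma bump_nonneg: "0 \<le> bump z" and bump_nonzero_iff: "bump z \<noteq> 0 \<longleftrightarrow> 0 < z"
  by (auto simp: bump_def flat_def)

lemma bump_compose: "k_times_cont_diff k f \<Longrightarrow> k_times_cont_diff k (\<lambda>x. bump (f x))"
  unfolding bump_def
  using k_times_cont_diff_compose[of "\<lambda>n. flat (((\<lambda>P. [:0, 0, 1:] * (P - pderiv P)) ^^ n) 1)" k f 0]
    flat_has_derivative by simp

lemma k_times_cont_diff_quadratic: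
  assumes "bounded_linear (L :: 'a::euclidean_space \<Rightarrow> 'b::euclidean_space)"
  shows "k_times_cont_diff k (\<lambda>x. r - (norm (L x - c))\<^sup>2)"
proof -
  have "(norm (L x - c))\<^sup>2 = (\<Sum>b\<in>Basis. (L x \<bullet> b + - (c \<bullet> b)) * (L x \<bullet> b + - (c \<bullet> b)))" for x
    unfolding power2_norm_eq_inner euclidean_inner[of "L x - c" "L x - c"] by (simp add: inner_diff_left)
  then have eq: "(\<lambda>x. r - (norm (L x - c))\<^sup>2) =
      (\<lambda>x. r + (-1) * (\<Sum>b\<in>Basis. (L x \<bullet> b + - (c \<bullet> b)) * (L x \<bullet> b + - (c \<bullet> b))))"
    by auto
  show ?thesis
    unfolding eq
    by (intro k_times_cont_diff_add k_times_cont_diff_mult k_times_cont_diff_sum k_times_cont_diff_const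
        k_times_cont_diff_linear bounded_linear_compose[OF bounded_linear_inner_left assms])
qed

section \<open>Smooth impulses in time and product controls\<close>

definition smooth :: "(real \<Rightarrow> real) \<Rightarrow> bool" where
  "smooth f \<longleftrightarrow> (\<forall>k. k_times_cont_diff k f)"

lemma smooth_deriv:
  assumes "smooth f"
  shows "(f has_real_derivative deriv f t) (at t)" "smooth (deriv f)"
proof -
  have d: "(f has_derivative frechet_derivative f (at x)) (at x)" for x
    using assms by (intro k_times_cont_diff_SucD(1)[of 0]) (auto simp: smooth_def)
  have eq: "frechet_derivative f (at x) = (*) (frechet_derivative f (at x) 1)" for x
  proof
    fix h
    have "frechet_derivative f (at x) (h *\<^sub>R 1) = h *\<^sub>R frechet_derivative f (at x) 1"
      by (rule linear_scale[OF has_derivative_linear[OF d[of x]]])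
    then show "frechet_derivative f (at x) h = frechet_derivative f (at x) 1 * h" by (simp add: mult.commute)
  qed
  have f: "(f has_real_derivative frechet_derivative f (at x) 1) (at x)" for x
    unfolding has_field_derivative_def eq[symmetric] by (rule d)
  then have "deriv f = (\<lambda>x. frechet_derivative f (at x) 1)" by (auto intro: DERIV_imp_deriv)
  with f show "(f has_real_derivative deriv f t) (at t)" by simp
  show "smooth (deriv f)"
    unfolding smooth_def \<open>deriv f = _\<close>
    using assms k_times_cont_diff_SucD(2)[of _ f 1] by (auto simp: smooth_def)
qed

lemma smooth_iterated_deriv:
  assumes "smooth f"
  shows "smooth ((deriv ^^ n) f)" "((deriv ^^ n) f has_real_derivative (deriv ^^ Suc n) f t) (at t)"
proof -
  show *: "smooth ((deriv ^^ n) f)" for n using assms by (induction n) (auto intro: smooth_deriv)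
  show "((deriv ^^ n) f has_real_derivative (deriv ^^ Suc n) f t) (at t)"
    using smooth_deriv(1)[OF *] by simp
qed

lemma deriv_eq_0_if_locally_0:
  fixes f :: "real \<Rightarrow> real"
  assumes "open A" "t \<in> A" "\<And>x. x \<in> A \<Longrightarrow> f x = 0"
  shows "deriv f t = 0"
proof -
  have "(f has_real_derivative 0) (at t)"
    by (rule has_field_derivative_transform_within_open[of "\<lambda>_. 0" _ _ A]) (use assms in auto)
  then show ?thesis by (rule DERIV_imp_deriv)
qed

lemma iterated_deriv_eq_0_outside:
  fixes f :: "real \<Rightarrow> real"
  assumes "\<And>x. x \<notin> {a..b} \<Longrightarrow> f x = 0" "t \<notin> {a..b}"
  shows "(deriv ^^ n) f t = 0"
  using assms(2)
proof (induction n arbitrary: t)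
  case (Suc n)
  have "deriv ((deriv ^^ n) f) t = 0"
  proof (rule deriv_eq_0_if_locally_0[of "- {a..b}"])
    show "open (- {a..b})" by (simp only: open_Compl closed_atLeastAtMost)
    show "(deriv ^^ n) f x = 0" if "x \<in> - {a..b}" for x using Suc.IH[of x] that by blast
  qed (use Suc.prems in blast)
  then show ?case by simp
qed (use assms in auto)

lemma smooth_bump: "smooth (\<lambda>t. c * bump (r - (t - m)\<^sup>2))"
  unfolding smooth_def
  using k_times_cont_diff_quadratic[OF bounded_linear_ident, of _ r m]
  by (auto intro!: k_times_cont_diff_mult k_times_cont_diff_const bump_compose)

text \<open>A bump of unit mass with two antiderivatives from 0, in the form that
  \<open>oscillator_impulse\<close> requires. It ends at T - \<epsilon>/2, so that the resulting
  control has compact support before T and vanishes near the final time.\<close>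

lemma impulse:
  assumes \<epsilon>: "0 < \<epsilon>" "\<epsilon> < T"
  obtains \<theta> \<Theta>1 \<Theta>2 where "smooth \<theta>" "\<And>t. t \<notin> {T - \<epsilon>..T - \<epsilon>/2} \<Longrightarrow> \<theta> t = 0"
    "\<And>t. t \<in> {0..T} \<Longrightarrow> (\<Theta>1 has_real_derivative \<theta> t) (at t)"
    "\<And>t. t \<in> {0..T} \<Longrightarrow> (\<Theta>2 has_real_derivative \<Theta>1 t) (at t)"
    "\<And>t. t \<in> {0..T - \<epsilon>} \<Longrightarrow> \<Theta>1 t = 0" "\<And>t. t \<in> {0..T - \<epsilon>} \<Longrightarrow> \<Theta>2 t = 0"
    "\<And>t. t \<in> {0..T} \<Longrightarrow> 0 \<le> \<Theta>1 t \<and> \<Theta>1 t \<le> 1" "\<Theta>1 T = 1"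
proof -
  \<comment> \<open>The midpoint of [T - \<epsilon>, T - \<epsilon>/2], whose half-length is
    \<epsilon>/4.\<close>
  define m where "m = T - 3 * \<epsilon> / 4"
  define \<beta> where "\<beta> t = bump ((\<epsilon>/4)\<^sup>2 - (t - m)\<^sup>2)" for t
  have \<beta>_iff: "\<beta> t \<noteq> 0 \<longleftrightarrow> \<bar>t - m\<bar> < \<epsilon>/4" for t
    using \<epsilon> abs_le_square_iff[of "\<epsilon>/4" "t - m"] by (auto simp: \<beta>_def bump_nonzero_iff not_less[symmetric])
  have \<beta>0: "\<beta> t = 0" if "t \<notin> {T - \<epsilon>..T - \<epsilon>/2}" for t
    using \<beta>_iff[of t] that \<epsilon> by (force simp: m_def abs_if split: if_splits)
  have \<beta>s: "smooth \<beta>" using smooth_bump[of 1] by (simp add: \<beta>_def[abs_def])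
  \<comment> \<open>The enlarged interval makes 0 and T interior points, so the derivatives there
    are two-sided.\<close>
  have anti: "\<exists>F. F 0 = 0 \<and> (\<forall>t\<in>{0..T}. (F has_real_derivative f t) (at t)) \<and> continuous_on {-1..T+1} F"
    if f: "continuous_on {-1..T+1} f" for f :: "real \<Rightarrow> real"
  proof -
    obtain G where G: "\<And>x. x \<in> {-1..T+1} \<Longrightarrow> (G has_vector_derivative f x) (at x within {-1..T+1})"
      using antiderivative_continuous[OF f] by blast
    define F where "F t = G t - G 0" for t
    have F: "(F has_real_derivative f x) (at x within {-1..T+1})" if "x \<in> {-1..T+1}" for x
      using G[OF that] unfolding F_def[abs_def]
      by (auto simp: has_real_derivative_iff_has_vector_derivative intro!: derivative_eq_intros)
    have "(F has_real_derivative f t) (at t)" if "t \<in> {0..T}" for t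
    proof -
      have "at t within {-1..T+1} = at t" by (rule at_within_Icc_at) (use that in auto)
      then show ?thesis using F[of t] that by simp
    qed
    then show ?thesis using DERIV_continuous_on[OF F] by (intro exI[of _ F]) (auto simp: F_def)
  qed
  have c\<beta>: "continuous_on A \<beta>" for A
  proof -
    have "k_times_cont_diff 0 \<beta>" using \<beta>s unfolding smooth_def by blast
    then show ?thesis using continuous_on_subset[of UNIV \<beta> A] by simp
  qed
  obtain F1 where F1: "F1 0 = 0" "\<And>t. t\<in>{0..T} \<Longrightarrow> (F1 has_real_derivative \<beta> t) (at t)" "continuous_on {-1..T+1} F1"
    using anti[OF c\<beta>] by blast
  obtain F2 where F2: "F2 0 = 0" "\<And>t. t\<in>{0..T} \<Longrightarrow> (F2 has_real_derivative F1 t) (at t)"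
    using anti[OF F1(3)] by blast
  have mono: "F1 x \<le> F1 y" if "0 \<le> x" "x \<le> y" "y \<le> T" for x y
  proof (rule DERIV_nonneg_imp_nondecreasing[of x y F1])
    fix t assume "x \<le> t" "t \<le> y"
    then show "\<exists>d. (F1 has_real_derivative d) (at t) \<and> 0 \<le> d"
      using F1(2)[of t] that bump_nonneg by (intro exI[of _ "\<beta> t"]) (auto simp: \<beta>_def)
  qed (use that in simp)
  have const: "F t = 0" if F: "F 0 = 0" "\<And>t. t\<in>{0..T} \<Longrightarrow> (F has_real_derivative f t) (at t)"
      "\<And>t. t\<in>{0..T - \<epsilon>} \<Longrightarrow> f t = 0" and t: "t \<in> {0..T - \<epsilon>}" for F f t
  proof -
    have "\<exists>c. \<forall>x\<in>{0..T - \<epsilon>}. F x = c"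
    proof (rule has_field_derivative_zero_constant)
      fix x assume x: "x \<in> {0..T - \<epsilon>}"
      then show "(F has_real_derivative 0) (at x within {0..T - \<epsilon>})"
        using F(2)[of x] F(3)[OF x] \<epsilon> by (auto intro: has_field_derivative_at_within)
    qed simp
    then show ?thesis using F(1) t \<epsilon> by (metis atLeastAtMost_iff diff_ge_0_iff_ge less_imp_le order_refl)
  qed
  have F1z: "F1 t = 0" if "t \<in> {0..T - \<epsilon>}" for t
  proof (rule const[OF F1(1,2) _ that])
    fix t assume "t \<in> {0..T - \<epsilon>}" then show "\<beta> t = 0" using \<beta>_iff[of t] \<epsilon> by (auto simp: m_def)
  qed
  have F2z: "F2 t = 0" if "t \<in> {0..T - \<epsilon>}" for t
    by (rule const[OF F2(1,2) _ that]) (use F1z in auto)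
  \<comment> \<open>Otherwise the nondecreasing F1 would vanish on all of [0, T], and so would its
    derivative \<beta> at m, where the bump is positive. Positivity allows the division that
    normalises the mass.\<close>
  have "F1 T > 0"
  proof (rule ccontr)
    assume "\<not> F1 T > 0"
    then have z: "F1 t = 0" if "t \<in> {0..T}" for t
      using mono[of 0 t] mono[of t T] that F1(1) \<epsilon> by auto
    have mT: "m \<in> {0<..<T}" using \<epsilon> by (auto simp: m_def)
    have "(F1 has_real_derivative 0) (at m)"
      by (rule has_field_derivative_transform_within_open[of "\<lambda>_. 0" _ _ "{0<..<T}"]) (use z mT in auto)
    then have "\<beta> m = 0" using F1(2)[of m] mT DERIV_unique by fastforce
    then show False using \<beta>_iff[of m] \<epsilon> by simp
  qed
  define \<kappa> where "\<kappa> = 1 / F1 T"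
  show thesis
  proof (rule that[of "\<lambda>t. \<kappa> * \<beta> t" "\<lambda>t. \<kappa> * F1 t" "\<lambda>t. \<kappa> * F2 t"])
    show "smooth (\<lambda>t. \<kappa> * \<beta> t)" unfolding \<beta>_def by (rule smooth_bump)
    show "0 \<le> \<kappa> * F1 t \<and> \<kappa> * F1 t \<le> 1" if "t \<in> {0..T}" for t
      using mono[of 0 t] mono[of t T] that F1(1) \<open>F1 T > 0\<close> by (auto simp: \<kappa>_def)
    show "((\<lambda>t. \<kappa> * F1 t) has_real_derivative \<kappa> * \<beta> t) (at t)" "((\<lambda>t. \<kappa> * F2 t) has_real_derivative \<kappa> * F1 t) (at t)"
      if "t \<in> {0..T}" for t using F1(2)[OF that] F2(2)[OF that] by (auto intro!: derivative_eq_intros)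
    show "\<kappa> * F1 T = 1" using \<open>F1 T > 0\<close> by (simp add: \<kappa>_def)
    show "\<kappa> * \<beta> t = 0" if "t \<notin> {T - \<epsilon>..T - \<epsilon>/2}" for t by (simp add: \<beta>0[OF that])
    show "\<kappa> * F1 t = 0" "\<kappa> * F2 t = 0" if "t \<in> {0..T - \<epsilon>}" for t
      using F1z[OF that] F2z[OF that] by simp_all
  qed
qed

lemma test_function_product:
  fixes c :: "'a::euclidean_space"
  assumes \<theta>: "smooth \<theta>" "\<And>t. t \<notin> {a..b} \<Longrightarrow> \<theta> t = 0" and ab: "{a..b} \<subseteq> {0<..<T}" and r: "0 \<le> r" and c: "cball c r \<subseteq> A"
  shows "(\<lambda>(x, t). bump (r\<^sup>2 - (norm (x - c))\<^sup>2) * \<theta> t) \<in> test_functions (A \<times> {0<..<T})"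
proof -
  let ?g = "\<lambda>(x, t). bump (r\<^sup>2 - (norm (x - c))\<^sup>2) * \<theta> t"
  have "k_times_cont_diff k ?g" for k
  proof -
    have "k_times_cont_diff k (\<lambda>p::'a \<times> real. bump (r\<^sup>2 - (norm (fst p - c))\<^sup>2) * (deriv ^^ 0) \<theta> (snd p))"
      by (rule k_times_cont_diff_mult[OF bump_compose[OF k_times_cont_diff_quadratic[OF bounded_linear_fst]]
          k_times_cont_diff_compose[where D = "\<lambda>n. (deriv ^^ n) \<theta>", OF smooth_iterated_deriv(2)[OF \<theta>(1)] k_times_cont_diff_linear[OF bounded_linear_snd]]])
    then show ?thesis by (simp add: case_prod_beta')
  qed
  moreover have sub: "closure {z. ?g z \<noteq> 0} \<subseteq> cball c r \<times> {a..b}"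
  proof (rule closure_minimal)
    have "x \<in> cball c r" if "bump (r\<^sup>2 - (norm (x - c))\<^sup>2) \<noteq> 0" for x
      using that r by (simp add: bump_nonzero_iff dist_norm norm_minus_commute power2_less_imp_less less_imp_le)
    then show "{z. ?g z \<noteq> 0} \<subseteq> cball c r \<times> {a..b}"
      using \<theta>(2) by (auto simp del: atLeastAtMost_iff mem_cball) blast
  qed (intro closed_Times closed_cball closed_atLeastAtMost)
  moreover have "compact (closure {z. ?g z \<noteq> 0})"
    using closed_Int_compact[OF closed_closure compact_Times[OF compact_cball compact_Icc], of "{z. ?g z \<noteq> 0}" c r a b] sub
    by (simp add: Int_absorb2)
  moreover have "cball c r \<times> {a..b} \<subseteq> A \<times> {0<..<T}" using ab c by blast
  ultimately show ?thesis unfolding test_functions_def by blast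
qed

lemma test_functions_add:
  assumes "f \<in> test_functions W" "g \<in> test_functions W"
  shows "(\<lambda>x. f x + g x) \<in> test_functions W"
proof -
  have "{z. f z + g z \<noteq> 0} \<subseteq> closure {z. f z \<noteq> 0} \<union> closure {z. g z \<noteq> 0}"
  proof
    fix z assume "z \<in> {z. f z + g z \<noteq> 0}"
    then have "z \<in> {z. f z \<noteq> 0} \<or> z \<in> {z. g z \<noteq> 0}" by auto
    then show "z \<in> closure {z. f z \<noteq> 0} \<union> closure {z. g z \<noteq> 0}"
      by (elim disjE) (rule UnI1 UnI2, erule subsetD[OF closure_subset])+
  qed
  then have sub: "closure {z. f z + g z \<noteq> 0} \<subseteq> closure {z. f z \<noteq> 0} \<union> closure {z. g z \<noteq> 0}"
    by (rule closure_minimal) auto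
  moreover have "compact (closure {z. f z + g z \<noteq> 0})"
  proof -
    have "compact (closure {z. f z \<noteq> 0} \<union> closure {z. g z \<noteq> 0})"
      using assms by (intro compact_Un) (auto simp: test_functions_def)
    from closed_Int_compact[OF closed_closure this, of "{z. f z + g z \<noteq> 0}"] show ?thesis
      using sub by (simp only: Int_absorb2)
  qed
  ultimately show ?thesis
    using assms by (auto simp: test_functions_def k_times_cont_diff_add)
qed

section \<open>Fractional Sobolev spaces\<close>

lemma square_integrable_borel: "square_integrable f \<Longrightarrow> f \<in> borel_measurable borel"
  by (simp add: square_integrable_def)

text \<open>The product of a null set with the whole space is null. Together with its mirror image
  this transfers almost everywhere statements on functions to their difference quotients in two
  variables.\<close>

lemma AE_lborel_fst:
  assumes "AE x in (lborel :: 'a::euclidean_space measure). P x"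
  shows "AE p in (lborel :: ('a \<times> 'b::euclidean_space) measure). P (fst p)"
proof -
  obtain N where "N \<in> null_sets lborel" "\<And>x. x \<in> space lborel - N \<Longrightarrow> P x"
    using AE_E3[OF assms] by blast
  then have N: "N \<in> null_sets lborel" "{x. \<not> P x} \<subseteq> N" by auto
  then have [measurable]: "N \<in> sets borel" by auto
  have m: "fst \<in> (borel :: ('a \<times> 'b) measure) \<rightarrow>\<^sub>M borel" by (intro borel_measurable_continuous_onI continuous_intros)
  have "{p \<in> space (lborel \<Otimes>\<^sub>M lborel :: ('a \<times> 'b) measure). fst p \<notin> N} \<in> sets (lborel \<Otimes>\<^sub>M lborel)"
    unfolding lborel_prod using m by measurable
  then have "AE p in (lborel \<Otimes>\<^sub>M lborel :: ('a \<times> 'b) measure). fst p \<notin> N"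
    by (rule lborel_pair.AE_pair_measure) (use AE_not_in[OF N(1)] in \<open>auto elim: eventually_mono\<close>)
  then show ?thesis unfolding lborel_prod
    by eventually_elim (use N(2) in auto)
qed

lemma AE_lborel_snd:
  assumes "AE x in (lborel :: 'b::euclidean_space measure). P x"
  shows "AE p in (lborel :: ('a::euclidean_space \<times> 'b) measure). P (snd p)"
proof -
  obtain N where "N \<in> null_sets lborel" "\<And>x. x \<in> space lborel - N \<Longrightarrow> P x"
    using AE_E3[OF assms] by blast
  then have N: "N \<in> null_sets lborel" "{x. \<not> P x} \<subseteq> N" by auto
  then have [measurable]: "N \<in> sets borel" by auto
  have m: "snd \<in> (borel :: ('a \<times> 'b) measure) \<rightarrow>\<^sub>M borel" by (intro borel_measurable_continuous_onI continuous_intros)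
  have "{p \<in> space (lborel \<Otimes>\<^sub>M lborel :: ('a \<times> 'b) measure). snd p \<notin> N} \<in> sets (lborel \<Otimes>\<^sub>M lborel)"
    unfolding lborel_prod using m by measurable
  then have "AE p in (lborel \<Otimes>\<^sub>M lborel :: ('a \<times> 'b) measure). snd p \<notin> N"
    by (rule lborel_pair.AE_pair_measure) (use AE_not_in[OF N(1)] in \<open>auto elim: eventually_mono\<close>)
  then show ?thesis unfolding lborel_prod
    by eventually_elim (use N(2) in auto)
qed

lemma measurable_fst_snd_borel:
  fixes f :: "'a::euclidean_space \<Rightarrow> real"
  assumes "f \<in> borel_measurable borel"
  shows "(\<lambda>p::'a \<times> 'b::euclidean_space. f (fst p)) \<in> borel_measurable borel"
    "(\<lambda>p::'b \<times> 'a. f (snd p)) \<in> borel_measurable borel"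
  by (rule measurable_compose[OF _ assms], intro borel_measurable_continuous_onI continuous_intros)+

text \<open>A substitute for polar coordinates: the kernel is dominated by a series of multiples of
  indicators of balls, whose integrals are volumes.\<close>

lemma shell_sum_finite:
  fixes k :: "'a::euclidean_space \<Rightarrow> real"
  assumes k: "\<And>z. z \<noteq> 0 \<Longrightarrow> 0 < k z \<Longrightarrow> \<exists>n. norm z < \<rho> n \<and> k z \<le> a n"
    and a: "\<And>n. 0 \<le> a n" "\<And>n. 0 \<le> \<rho> n" and sum: "summable (\<lambda>n. a n * \<rho> n ^ DIM('a))"
  shows "(\<integral>\<^sup>+z. ennreal (k z) \<partial>lborel) < \<infinity>"
proof -
  have "(\<integral>\<^sup>+z. ennreal (k z) \<partial>lborel) \<le> (\<integral>\<^sup>+z. (\<Sum>n. ennreal (a n) * indicator (ball (0::'a) (\<rho> n)) z) \<partial>lborel)"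
  proof (rule nn_integral_mono_AE)
    have "AE z in (lborel :: 'a measure). z \<noteq> 0" by (rule AE_lborel_singleton)
    then show "AE z in lborel. ennreal (k z) \<le> (\<Sum>n. ennreal (a n) * indicator (ball 0 (\<rho> n)) z)"
    proof eventually_elim
      case (elim z)
      show ?case
      proof (cases "k z > 0")
        case False
        then show ?thesis by (simp add: ennreal_neg)
      next
        case True
        then obtain n where n: "norm z < \<rho> n" "k z \<le> a n" using k elim by blast
        have "ennreal (k z) \<le> ennreal (a n) * indicator (ball 0 (\<rho> n)) z"
          using n by (simp add: ennreal_leI)
        also have "\<dots> \<le> (\<Sum>n. ennreal (a n) * indicator (ball 0 (\<rho> n)) z)"
        proof -
          have "(\<Sum>n\<in>{n}. ennreal (a n) * indicator (ball 0 (\<rho> n)) z) \<le> (\<Sum>n. ennreal (a n) * indicator (ball 0 (\<rho> n)) z)"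
            by (intro sum_le_suminf summableI) auto
          then show ?thesis by (simp only: sum.insert sum.empty finite.emptyI empty_iff not_False_eq_True add_0_right)
        qed
        finally show ?thesis .
      qed
    qed
  qed
  also have "\<dots> = (\<Sum>n. ennreal (a n) * emeasure lborel (ball (0::'a) (\<rho> n)))"
  proof -
    have b [measurable]: "ball (0::'a) r \<in> sets lborel" for r by simp
    have "(\<integral>\<^sup>+z. (\<Sum>n. ennreal (a n) * indicator (ball (0::'a) (\<rho> n)) z) \<partial>lborel) =
        (\<Sum>n. \<integral>\<^sup>+z. ennreal (a n) * indicator (ball (0::'a) (\<rho> n)) z \<partial>lborel)"
      by (rule nn_integral_suminf) (intro borel_measurable_times_ennreal borel_measurable_const borel_measurable_indicator b)
    then show ?thesis by (simp only: nn_integral_cmult_indicator[OF b])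
  qed
  also have "\<dots> = (\<Sum>n. ennreal (unit_ball_vol (DIM('a)) * (a n * \<rho> n ^ DIM('a))))"
    using a by (simp add: emeasure_ball ennreal_mult[symmetric] mult_ac)
  also have "\<dots> = ennreal (\<Sum>n. unit_ball_vol (DIM('a)) * (a n * \<rho> n ^ DIM('a)))"
    by (rule suminf_ennreal_eq) (use a sum in \<open>auto intro!: summable_sums summable_mult mult_nonneg_nonneg\<close>)
  also have "\<dots> < \<infinity>" by simp
  finally show ?thesis .
qed

lemma ex_dyadic:
  fixes x :: real
  assumes "x > 0"
  shows "(\<exists>n. (1/2) ^ Suc n \<le> x \<and> x < (1/2) ^ n) \<or> (\<exists>n. 2 ^ n \<le> x \<and> x < 2 ^ Suc n)"
proof (cases "x < 1")
  case True
  obtain m where "(1/2) ^ m < x" using real_arch_pow_inv[OF assms, of "1/2"] by auto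
  then have ex: "\<exists>m. (1/2) ^ m \<le> x" by (auto intro: less_imp_le)
  define m where "m = (LEAST m. (1/2) ^ m \<le> x)"
  have m: "(1/2) ^ m \<le> x" unfolding m_def by (rule LeastI_ex[OF ex])
  then obtain n where n: "m = Suc n" using True by (cases m) auto
  have "\<not> (1/2) ^ n \<le> x" using not_less_Least[of n "\<lambda>m. (1/2) ^ m \<le> x"] n unfolding m_def by simp
  then show ?thesis using m n by auto
next
  case False
  obtain m where "x < 2 ^ m" using real_arch_pow[of 2 x] by auto
  then have ex: "\<exists>m. x < 2 ^ m" by blast
  define m where "m = (LEAST m. x < 2 ^ m)"
  have m: "x < 2 ^ m" unfolding m_def by (rule LeastI_ex[OF ex])
  then obtain n where n: "m = Suc n" using False by (cases m) auto
  have "\<not> x < 2 ^ n" using not_less_Least[of n "\<lambda>m. x < 2 ^ m"] n unfolding m_def by simp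
  then show ?thesis using m n by auto
qed

text \<open>Cut into dyadic shells. Near the origin the numerator gains |z|^2 and leaves |z|^(2 -
  q); far away the constant bound leaves |z|^(- q).\<close>

lemma singular_kernel_finite:
  fixes q s :: real
  assumes s: "0 < s" "s < 1" and q: "q = real (DIM('a::euclidean_space)) + 2 * s" and A: "0 \<le> A" "0 \<le> C"
  shows "(\<integral>\<^sup>+z. ennreal (min (A * (norm z)\<^sup>2) C / norm (z::'a) powr q) \<partial>lborel) < \<infinity>"
proof -
  let ?N = "DIM('a)" and ?k = "\<lambda>z::'a. min (A * (norm z)\<^sup>2) C / norm z powr q"
  have q0: "q > 0" using s q by simp
  \<comment> \<open>The ratios of the two geometric series, near the origin and at infinity; they
    are below 1 because s < 1 and because s > 0, respectively.\<close>
  have sq: "(2::real) powr (2 * s - 2) < 1" "(2::real) powr (- 2 * s) < 1"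
    using s by (simp_all add: powr_less_one)
  define k1 where "k1 z = (if norm z < 1 then ?k z else 0)" for z
  define k2 where "k2 z = (if norm z < 1 then 0 else ?k z)" for z
  have "(\<integral>\<^sup>+z. ennreal (k1 z) \<partial>lborel) < \<infinity>"
  proof (rule shell_sum_finite)
    fix z :: 'a assume z: "z \<noteq> 0" "0 < k1 z"
    then have "norm z < 1" by (auto simp: k1_def split: if_splits)
    moreover have "\<not> 2 ^ n \<le> norm z" for n using \<open>norm z < 1\<close> one_le_power[of 2 n] by (smt (verit))
    ultimately obtain n where n: "(1/2) ^ Suc n \<le> norm z" "norm z < (1/2) ^ n"
      using ex_dyadic[of "norm z"] z by auto
    have "k1 z \<le> (A * (norm z)\<^sup>2) * norm z powr (- q)"
      using A by (auto simp: k1_def powr_minus_divide intro!: divide_right_mono)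
    also have "\<dots> \<le> (A * ((1/2) ^ n)\<^sup>2) * ((1/2) ^ Suc n) powr (- q)"
      using n A q0 by (intro mult_mono mult_left_mono power_mono powr_mono2') auto
    finally show "\<exists>n. norm z < (1/2) ^ n \<and> k1 z \<le> (A * ((1/2) ^ n)\<^sup>2) * ((1/2) ^ Suc n) powr (- q)"
      using n by blast
  next
    have e: "(A * ((1/2) ^ n)\<^sup>2) * ((1/2) ^ Suc n) powr (- q) * ((1/2) ^ n) ^ ?N = A * 2 powr q * (2 powr (2 * s - 2)) ^ n" for n
    proof -
      have h: "(1/2::real) ^ k = 2 powr (- real k)" for k
        by (simp add: powr_minus powr_realpow power_divide inverse_eq_divide)
      have "((1/2) ^ n)\<^sup>2 * ((1/2) ^ Suc n) powr (- q) * ((1/2) ^ n) ^ ?N =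
          2 powr (- 2 * real n + real (Suc n) * q - real n * ?N)"
        unfolding h power2_eq_square
        by (simp add: powr_powr powr_add[symmetric] powr_realpow[symmetric] algebra_simps del: of_nat_Suc)
      also have "- 2 * real n + real (Suc n) * q - real n * ?N = q + (2 * s - 2) * real n"
        by (simp add: q algebra_simps)
      also have "2 powr (q + (2 * s - 2) * real n) = 2 powr q * (2 powr (2 * s - 2)) ^ n"
        by (simp add: powr_add powr_powr[symmetric] powr_realpow)
      finally show ?thesis by (simp add: mult.assoc)
    qed
    show "summable (\<lambda>n. (A * ((1/2) ^ n)\<^sup>2) * ((1/2) ^ Suc n) powr (- q) * ((1/2) ^ n) ^ ?N)"
      unfolding e using sq by (intro summable_mult summable_geometric) simp
  qed (use A in auto)
  moreover have "(\<integral>\<^sup>+z. ennreal (k2 z) \<partial>lborel) < \<infinity>"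
  proof (rule shell_sum_finite)
    fix z :: 'a assume z: "z \<noteq> 0" "0 < k2 z"
    then have "norm z \<ge> 1" by (auto simp: k2_def split: if_splits)
    moreover have "\<not> norm z < (1/2) ^ n" for n
      using \<open>norm z \<ge> 1\<close> power_le_one[of "1/2::real" n] by (smt (verit) field_sum_of_halves)
    ultimately obtain n where n: "2 ^ n \<le> norm z" "norm z < 2 ^ Suc n"
      using ex_dyadic[of "norm z"] z by auto
    have "k2 z \<le> C * norm z powr (- q)"
      using A by (auto simp: k2_def powr_minus_divide intro!: divide_right_mono)
    also have "\<dots> \<le> C * (2 ^ n) powr (- q)"
      using n A q0 by (intro mult_left_mono powr_mono2') auto
    finally show "\<exists>n. norm z < 2 ^ Suc n \<and> k2 z \<le> C * (2 ^ n) powr (- q)" using n by blast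
  next
    have o: "C * (2 ^ n) powr (- q) * (2 ^ Suc n) ^ ?N = C * 2 ^ ?N * (2 powr (- 2 * s)) ^ n" for n
    proof -
      have "C * (2 ^ n) powr (- q) * (2 ^ Suc n) ^ ?N = C * 2 ^ ?N * ((2 ^ n) powr (- q) * (2 ^ n) ^ ?N)"
        by (simp add: power_mult_distrib mult_ac)
      also have "(2 ^ n) powr (- q) * (2 ^ n) ^ ?N = 2 powr (real n * (- q) + real n * ?N)"
        by (simp add: powr_powr powr_add[symmetric] powr_realpow[symmetric] algebra_simps)
      also have "real n * (- q) + real n * ?N = (- 2 * s) * real n" by (simp add: q algebra_simps)
      also have "2 powr ((- 2 * s) * real n) = (2 powr (- 2 * s)) powr real n"
        by (simp only: powr_powr)
      also have "\<dots> = (2 powr (- 2 * s)) ^ n" by (simp add: powr_realpow)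
      finally show ?thesis .
    qed
    show "summable (\<lambda>n. C * (2 ^ n) powr (- q) * (2 ^ Suc n) ^ ?N)"
      unfolding o using sq by (intro summable_mult summable_geometric) simp
  qed (use A in auto)
  moreover have "(\<integral>\<^sup>+z. ennreal (?k z) \<partial>lborel) = (\<integral>\<^sup>+z. ennreal (k1 z) \<partial>lborel) + (\<integral>\<^sup>+z. ennreal (k2 z) \<partial>lborel)"
    unfolding k1_def k2_def
    by (subst nn_integral_add[symmetric]) (auto intro!: nn_integral_cong)
  ultimately show ?thesis by (simp add: ennreal_add_eq_top less_top)
qed

text \<open>The square root \<open>(f x - f y) / |x - y|\<^sup>q\<^sup>/\<^sup>2\<close> of the Gagliardo integrand embeds the Sobolev space
  isometrically in a product of two \<open>L\<^sup>2\<close> spaces.\<close>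

definition gagliardo :: "real \<Rightarrow> (real^'n \<Rightarrow> real) \<Rightarrow> (real^'n) \<times> (real^'n) \<Rightarrow> real" where
  "gagliardo s u p = sqrt (frac_const CARD('n) s / 2) * (u (fst p) - u (snd p)) /
     norm (fst p - snd p) powr ((real CARD('n) + 2 * s) / 2)"

definition sobolev_embed :: "real \<Rightarrow> (real^'n \<Rightarrow> real) \<Rightarrow> (real^'n) l2 \<times> ((real^'n) \<times> (real^'n)) l2" where
  "sobolev_embed s u = (mk_l2 u, mk_l2 (gagliardo s u))"

lemma frac_const_pos: "0 < s \<Longrightarrow> s < 1 \<Longrightarrow> 0 < frac_const N s"
  unfolding frac_const_def by (intro divide_pos_pos mult_pos_pos Gamma_real_pos) (auto simp: add_pos_nonneg)

lemma powr_half_mult_self: "a powr (q / 2) * a powr (q / 2) = a powr q" for a :: real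
  by (simp add: powr_add[symmetric])

lemma gagliardo_mult:
  fixes u v :: "real^'n \<Rightarrow> real"
  assumes "0 < s" "s < 1"
  shows "gagliardo s u p * gagliardo s v p = frac_const CARD('n) s / 2 *
    ((u (fst p) - u (snd p)) * (v (fst p) - v (snd p)) / norm (fst p - snd p) powr (real CARD('n) + 2 * s))"
proof -
  let ?c = "frac_const CARD('n) s / 2" and ?d = "norm (fst p - snd p)" and ?q = "real CARD('n) + 2 * s"
  have c: "sqrt ?c * sqrt ?c = ?c" using frac_const_pos[OF assms, of "CARD('n)"] by simp
  have "gagliardo s u p * gagliardo s v p = (sqrt ?c * sqrt ?c) *
    ((u (fst p) - u (snd p)) * (v (fst p) - v (snd p)) / (?d powr (?q / 2) * ?d powr (?q / 2)))"
    by (simp add: gagliardo_def mult_ac)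
  then show ?thesis unfolding c powr_half_mult_self .
qed

lemma gagliardo_measurable:
  assumes "u \<in> borel_measurable borel"
  shows "gagliardo s u \<in> borel_measurable borel"
proof -
  note measurable_fst_snd_borel[OF assms, measurable]
  have [measurable]: "(\<lambda>p::(real^'a) \<times> (real^'a). norm (fst p - snd p)) \<in> borel_measurable borel"
    by (intro borel_measurable_continuous_onI continuous_intros)
  show ?thesis unfolding gagliardo_def[abs_def] by measurable
qed

lemma sobolev_iff:
  fixes u :: "real^'n \<Rightarrow> real"
  assumes s: "0 < s" "s < 1"
  shows "u \<in> sobolev s \<longleftrightarrow> square_integrable u \<and> square_integrable (gagliardo s u)"
proof -
  have "u \<in> L2 UNIV \<longleftrightarrow> square_integrable u"
    by (simp add: L2_def square_integrable_def set_borel_measurable_def set_integrable_def)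
  moreover have "integrable (lborel \<Otimes>\<^sub>M lborel) (\<lambda>(x, y). (u x - u y)\<^sup>2 / norm (x - y) powr (real CARD('n) + 2 * s)) \<longleftrightarrow> square_integrable (gagliardo s u)"
    if "square_integrable u"
  proof -
    define c where "c = frac_const CARD('n) s / 2"
    have c: "c \<noteq> 0" using frac_const_pos[OF s, of "CARD('n)"] by (simp add: c_def)
    have m: "gagliardo s u \<in> borel_measurable lborel" using gagliardo_measurable[OF square_integrable_borel[OF that]] by simp
    have eq: "(gagliardo s u p)\<^sup>2 = c * ((u (fst p) - u (snd p))\<^sup>2 / norm (fst p - snd p) powr (real CARD('n) + 2 * s))" for p
      unfolding power2_eq_square[of "gagliardo s u _"] gagliardo_mult[OF s] c_def by (simp add: power2_eq_square)
    have "integrable lborel (\<lambda>p. (gagliardo s u p)\<^sup>2) \<longleftrightarrow>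
        integrable lborel (\<lambda>p. (u (fst p) - u (snd p))\<^sup>2 / norm (fst p - snd p) powr (real CARD('n) + 2 * s))"
      unfolding eq using c by (subst integrable_mult_left_iff) auto
    with m show ?thesis unfolding square_integrable_def lborel_prod by (simp add: case_prod_beta')
  qed
  ultimately show ?thesis unfolding sobolev_def by auto
qed

text \<open>The constant in \<open>gagliardo\<close> is chosen for this identity: the inner product
  of the embedded pairs is the bilinear form of 1 + A. Riesz representation in this inner product
  therefore produces (1 + A)^(-1).\<close>

lemma inner_sobolev_embed:
  fixes u v :: "real^'n \<Rightarrow> real"
  assumes s: "0 < s" "s < 1" and uv: "u \<in> sobolev s" "v \<in> sobolev s"
  shows "sobolev_embed s u \<bullet> sobolev_embed s v = (LINT x|lborel. u x * v x) + frac_laplacian s u v"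
proof -
  have "frac_laplacian s u v = (LINT p|lborel. gagliardo s u p * gagliardo s v p)"
    unfolding frac_laplacian_def gagliardo_mult[OF s] lborel_prod
    by (simp only: case_prod_beta' integral_mult_right_zero)
  then show ?thesis
    using uv by (simp add: sobolev_iff[OF s] sobolev_embed_def inner_mk_l2)
qed

text \<open>The Sobolev norm carries no constant in front of the double integral, so it is
  equivalent, and in general not equal, to the norm of the embedded pair.\<close>

lemma sobolev_norm_eq:
  fixes u :: "real^'n \<Rightarrow> real"
  assumes s: "0 < s" "s < 1" and u: "u \<in> sobolev s"
  shows "(sobolev_norm s u)\<^sup>2 = (norm (mk_l2 u))\<^sup>2 + 2 / frac_const CARD('n) s * (norm (mk_l2 (gagliardo s u)))\<^sup>2"
proof -
  have "(norm (mk_l2 (gagliardo s u)))\<^sup>2 = frac_const CARD('n) s / 2 * (LINT (x, y)|(lborel \<Otimes>\<^sub>M lborel).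
        (u x - u y)\<^sup>2 / norm (x - y) powr (real CARD('n) + 2 * s))"
    using u unfolding sobolev_iff[OF s]
    by (simp only: norm_mk_l2 power2_eq_square[of "gagliardo s u _"] gagliardo_mult[OF s] lborel_prod case_prod_beta'
        power2_eq_square[of "u _ - u _"] integral_mult_right_zero)
  moreover have "0 \<le> (LINT x|lborel. (u x)\<^sup>2)" "0 \<le> (LINT (x, y)|(lborel \<Otimes>\<^sub>M lborel).
        (u x - u y)\<^sup>2 / norm (x - y) powr (real CARD('n) + 2 * s))"
    by (auto intro!: Bochner_Integration.integral_nonneg)
  ultimately show ?thesis
    using u frac_const_pos[OF s, of "CARD('n)"] unfolding sobolev_iff[OF s]
    by (simp add: sobolev_norm_def norm_mk_l2 field_simps)
qed

lemma gagliardo_cong_AE: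
  assumes "AE x in lborel. u x = v x"
  shows "AE p in lborel. gagliardo s u p = gagliardo s v p"
  using AE_lborel_fst[OF assms] AE_lborel_snd[OF assms]
  by eventually_elim (simp add: gagliardo_def)

lemma square_integrable_cong_AE:
  assumes "square_integrable f" "g \<in> borel_measurable lborel" "AE x in lborel. f x = g x"
  shows "square_integrable g"
  by (rule square_integrable_bound[OF assms(2,1)]) (use assms(3) in \<open>auto elim: eventually_mono\<close>)

lemma sobolev_cong_AE:
  assumes s: "0 < s" "s < 1" and u: "u \<in> sobolev s" and v: "v \<in> borel_measurable borel"
    and eq: "AE x in lborel. u x = v x"
  shows "v \<in> sobolev s" "sobolev_embed s v = sobolev_embed s u"
proof -
  have u': "square_integrable u" "square_integrable (gagliardo s u)" using u by (auto simp: sobolev_iff[OF s])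
  have v': "square_integrable v" "square_integrable (gagliardo s v)"
    using square_integrable_cong_AE[OF u'(1) _ eq] square_integrable_cong_AE[OF u'(2) _ gagliardo_cong_AE[OF eq]] v gagliardo_measurable[OF v, of s]
    by auto
  then show "v \<in> sobolev s" by (simp add: sobolev_iff[OF s])
  show "sobolev_embed s v = sobolev_embed s u"
    using eq gagliardo_cong_AE[OF eq, of s] u' v' by (auto simp: sobolev_embed_def mk_l2_eq_iff elim: eventually_mono)
qed

lemma square_integrable_indicator_bounded:
  fixes A :: "'a::euclidean_space set"
  assumes "A \<in> sets borel" "bounded A" shows "square_integrable (indicator A)"
  unfolding square_integrable_def
proof
  have "integrable lborel (indicator A :: 'a \<Rightarrow> real)"
    using assms emeasure_bounded_finite[OF assms(2)] by (intro integrable_real_indicator) auto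
  moreover have "(\<lambda>x. (indicator A x :: real)\<^sup>2) = indicator A" by (auto simp: indicator_def)
  ultimately show "integrable lborel (\<lambda>x. (indicator A x :: real)\<^sup>2)" by simp
qed (use assms in auto)

lemma gagliardo_linear:
  "gagliardo s (\<lambda>x. u x + v x) p = gagliardo s u p + gagliardo s v p"
  "gagliardo s (\<lambda>x. c * u x) p = c * gagliardo s u p"
  by (simp_all add: gagliardo_def add_divide_distrib[symmetric] algebra_simps)

lemma sobolev_add:
  assumes s: "0 < s" "s < 1" and "u \<in> sobolev s" "v \<in> sobolev s"
  shows "(\<lambda>x. u x + v x) \<in> sobolev s" "sobolev_embed s (\<lambda>x. u x + v x) = sobolev_embed s u + sobolev_embed s v"
  using assms(3,4) unfolding sobolev_iff[OF s] sobolev_embed_def gagliardo_linear[abs_def]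
  by (auto simp: square_integrable_add mk_l2_add)

lemma sobolev_scale:
  assumes s: "0 < s" "s < 1" and "u \<in> sobolev s"
  shows "(\<lambda>x. c * u x) \<in> sobolev s" "sobolev_embed s (\<lambda>x. c * u x) = c *\<^sub>R sobolev_embed s u"
  using assms(3) unfolding sobolev_iff[OF s] sobolev_embed_def gagliardo_linear[abs_def]
  by (auto simp: square_integrable_scale mk_l2_scale)

text \<open>The difference quotient vanishes unless one of the two points lies in the ball of radius
  R. For a fixed such point, translation invariance bounds the integral over the other one by the
  finite integral of the singular kernel.\<close>

lemma Lipschitz_imp_sobolev:
  fixes u :: "real^'n \<Rightarrow> real"
  assumes s: "0 < s" "s < 1" and u: "u \<in> borel_measurable borel"
    and L: "\<And>x y. \<bar>u x - u y\<bar> \<le> L * norm (x - y)" and M: "\<And>x. \<bar>u x\<bar> \<le> M"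
    and R: "\<And>x. norm x \<ge> R \<Longrightarrow> u x = 0"
  shows "u \<in> sobolev s"
proof -
  let ?q = "real CARD('n) + 2 * s"
  \<comment> \<open>Two bounds for (u x - u y)^2 in one: the Lipschitz bound tames the singularity
    at the diagonal, the bound on u gives decay at infinity.\<close>
  define k where "k z = min (L\<^sup>2 * (norm z)\<^sup>2) ((2 * M)\<^sup>2) / norm z powr ?q" for z :: "real^'n"
  define I where "I = (\<integral>\<^sup>+z. ennreal (k z) \<partial>lborel)"
  have I: "I < \<infinity>" unfolding I_def k_def by (rule singular_kernel_finite[OF s]) auto
  have km [measurable]: "k \<in> borel_measurable borel" unfolding k_def by measurable
  let ?B = "ball (0::real^'n) R"
  have u1: "square_integrable u"
  proof (rule square_integrable_bound[of _ "\<lambda>x. M * indicator ?B x"])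
    show "square_integrable (\<lambda>x. M * indicator ?B x)"
      by (intro square_integrable_scale square_integrable_indicator_bounded) auto
    show "AE x in lborel. \<bar>u x\<bar> \<le> \<bar>M * indicator ?B x\<bar>"
      using R M by (intro AE_I2) (auto simp: indicator_def dist_norm intro: order_trans[OF M abs_ge_self])
  qed (use u in auto)
  have est: "(u x - u y)\<^sup>2 / norm (x - y) powr ?q \<le> indicator ?B x * k (x - y) + indicator ?B y * k (x - y)" for x y
  proof (cases "x \<in> ?B \<or> y \<in> ?B")
    case True
    have "\<bar>u x - u y\<bar>\<^sup>2 \<le> (L * norm (x - y))\<^sup>2" by (intro power_mono L) auto
    moreover have "\<bar>u x - u y\<bar>\<^sup>2 \<le> (2 * M)\<^sup>2" using M[of x] M[of y] by (intro power_mono) auto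
    ultimately have "(u x - u y)\<^sup>2 / norm (x - y) powr ?q \<le> k (x - y)"
      unfolding k_def by (intro divide_right_mono) (auto simp: power_mult_distrib)
    moreover have "0 \<le> k (x - y)" unfolding k_def by simp
    ultimately show ?thesis using True by (auto simp: indicator_def)
  next
    case False
    then have "u x = 0" "u y = 0" using R by (auto simp: dist_norm)
    then show ?thesis by (simp add: k_def)
  qed
  have kint: "(\<integral>\<^sup>+y. ennreal (k (x - y)) \<partial>lborel) = I" for x
  proof -
    have "k (x - y) = k (- x + y)" for y unfolding k_def by (simp add: norm_minus_commute[of x y])
    then have "(\<integral>\<^sup>+y. ennreal (k (x - y)) \<partial>lborel) = (\<integral>\<^sup>+y. ennreal (k (- x + y)) \<partial>lborel)" by simp
    also have "\<dots> = (\<integral>\<^sup>+y. ennreal (k y) \<partial>(distr lborel borel ((+) (- x))))"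
      by (subst nn_integral_distr) auto
    finally show ?thesis unfolding lborel_distr_plus I_def .
  qed
  have kint': "(\<integral>\<^sup>+x. ennreal (k (x - y)) \<partial>lborel) = I" for y
  proof -
    have "k (x - y) = k (y - x)" for x unfolding k_def by (simp add: norm_minus_commute[of x y])
    then show ?thesis using kint[of y] by simp
  qed
  have Bfin: "emeasure lborel ?B < \<infinity>" by (rule emeasure_bounded_finite) simp
  have [measurable]: "(\<lambda>p::(real^'n) \<times> (real^'n). k (fst p - snd p)) \<in> borel_measurable (lborel \<Otimes>\<^sub>M lborel)"
    by measurable
  have B [measurable]: "?B \<in> sets borel" by simp
  have [measurable]: "(\<lambda>p::(real^'n) \<times> (real^'n). indicator ?B (fst p) :: real) \<in> borel_measurable (lborel \<Otimes>\<^sub>M lborel)"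
      "(\<lambda>p::(real^'n) \<times> (real^'n). indicator ?B (snd p) :: real) \<in> borel_measurable (lborel \<Otimes>\<^sub>M lborel)"
    unfolding lborel_prod using measurable_fst_snd_borel[of "indicator ?B"] by auto
  have m12: "(\<lambda>p::(real^'n) \<times> (real^'n). ennreal (indicator ?B (fst p) * k (fst p - snd p))) \<in> borel_measurable (lborel \<Otimes>\<^sub>M lborel)"
      "(\<lambda>p::(real^'n) \<times> (real^'n). ennreal (indicator ?B (snd p) * k (fst p - snd p))) \<in> borel_measurable (lborel \<Otimes>\<^sub>M lborel)"
    by measurable
  have 1: "(\<integral>\<^sup>+p. ennreal (indicator ?B (fst p) * k (fst p - snd p)) \<partial>(lborel \<Otimes>\<^sub>M lborel)) = emeasure lborel ?B * I"
    (is "?J1 = _")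
  proof -
    have "?J1 = (\<integral>\<^sup>+x. \<integral>\<^sup>+y. ennreal (indicator ?B x * k (x - y)) \<partial>lborel \<partial>lborel)"
      using lborel.nn_integral_fst[OF m12(1)] by simp
    also have "\<dots> = (\<integral>\<^sup>+x. I * indicator ?B x \<partial>lborel)"
      by (rule nn_integral_cong) (auto simp: indicator_def kint)
    finally show ?thesis by (simp add: nn_integral_cmult_indicator mult.commute)
  qed
  have 2: "(\<integral>\<^sup>+p. ennreal (indicator ?B (snd p) * k (fst p - snd p)) \<partial>(lborel \<Otimes>\<^sub>M lborel)) = emeasure lborel ?B * I"
    (is "?J2 = _")
  proof -
    have "?J2 = (\<integral>\<^sup>+y. \<integral>\<^sup>+x. ennreal (indicator ?B y * k (x - y)) \<partial>lborel \<partial>lborel)"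
      using lborel_pair.nn_integral_snd[OF m12(2)] by simp
    also have "\<dots> = (\<integral>\<^sup>+x. I * indicator ?B x \<partial>lborel)"
      by (rule nn_integral_cong) (auto simp: indicator_def kint')
    finally show ?thesis by (simp add: nn_integral_cmult_indicator mult.commute)
  qed
  have "integrable (lborel \<Otimes>\<^sub>M lborel) (\<lambda>p. (u (fst p) - u (snd p))\<^sup>2 / norm (fst p - snd p) powr ?q)"
  proof (rule integrableI_bounded)
    show "(\<lambda>p. (u (fst p) - u (snd p))\<^sup>2 / norm (fst p - snd p) powr ?q) \<in> borel_measurable (lborel \<Otimes>\<^sub>M lborel)"
      using u by measurable
    have "(\<integral>\<^sup>+p. ennreal (norm ((u (fst p) - u (snd p))\<^sup>2 / norm (fst p - snd p) powr ?q)) \<partial>(lborel \<Otimes>\<^sub>M lborel))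
      \<le> (\<integral>\<^sup>+p. ennreal (indicator ?B (fst p) * k (fst p - snd p)) + ennreal (indicator ?B (snd p) * k (fst p - snd p)) \<partial>(lborel \<Otimes>\<^sub>M lborel))"
      by (rule nn_integral_mono) (use est in \<open>auto simp: ennreal_plus[symmetric] k_def simp del: ennreal_plus intro!: ennreal_leI\<close>)
    also have "\<dots> = emeasure lborel ?B * I + emeasure lborel ?B * I"
      using nn_integral_add[OF m12] unfolding 1 2 by simp
    also have "\<dots> < \<infinity>" using Bfin I by (simp add: ennreal_mult_less_top)
    finally show "(\<integral>\<^sup>+p. ennreal (norm ((u (fst p) - u (snd p))\<^sup>2 / norm (fst p - snd p) powr ?q)) \<partial>(lborel \<Otimes>\<^sub>M lborel)) < \<infinity>" .
  qed
  then show ?thesis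
    using u1 by (simp add: sobolev_def L2_def square_integrable_def set_borel_measurable_def set_integrable_def case_prod_beta')
qed

section \<open>The Dirichlet resolvent\<close>

lemma null_set_if_compact_subsets_null:
  fixes P :: "'a::euclidean_space set"
  assumes P: "P \<in> sets borel" "bounded P" and null: "\<And>K. compact K \<Longrightarrow> K \<subseteq> P \<Longrightarrow> emeasure lborel K = 0"
  shows "emeasure lborel P = 0"
proof -
  have PL: "P \<in> sets lebesgue" using P by simp
  have "emeasure lborel P \<le> ennreal e" if e: "e > 0" for e
  proof -
    obtain K where K: "closed K" "K \<subseteq> P" "P - K \<in> lmeasurable" "emeasure lebesgue (P - K) < ennreal e"
      using sets_lebesgue_inner_closed[OF PL e] .
    have Kc: "compact K" using K P bounded_subset compact_eq_bounded_closed by blast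
    have Kb: "K \<in> sets borel" using K by simp
    have "emeasure lborel P = emeasure lborel (K \<union> (P - K))" using K(2) by (simp add: Un_absorb1)
    also have "\<dots> \<le> emeasure lborel K + emeasure lborel (P - K)"
      by (rule emeasure_subadditive) (simp_all only: sets_lborel Kb P sets.Diff)
    also have "\<dots> = emeasure lebesgue (P - K)"
    proof -
      have "P - K \<in> sets lborel" using Kb P by simp
      then show ?thesis by (simp add: null[OF Kc K(2)])
    qed
    also have "\<dots> \<le> ennreal e" using K(4) by (rule less_imp_le)
    finally show ?thesis .
  qed
  note le = this
  have "emeasure lborel P \<le> 0"
  proof (rule ennreal_le_epsilon)
    fix e :: real assume "0 < e"
    from le[OF this] show "emeasure lborel P \<le> 0 + ennreal e" by simp
  qed
  then show ?thesis by simp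
qed

text \<open>The cutoffs are Lipschitz, vanish outside \<open>\<Omega>\<close> for large \<open>n\<close>, and decrease to the indicator
  function of \<open>K\<close>.\<close>

definition cutoff :: "'a::metric_space set \<Rightarrow> nat \<Rightarrow> 'a \<Rightarrow> real" where
  "cutoff K n x = max 0 (1 - real n * infdist x K)"

lemma cutoff_bounds: "0 \<le> cutoff K n x" "cutoff K n x \<le> 1"
  by (auto simp: cutoff_def infdist_nonneg)

lemma cutoff_continuous: "continuous_on A (cutoff K n)"
  unfolding cutoff_def[abs_def] by (intro continuous_intros)

lemma cutoff_Lipschitz: "\<bar>cutoff K n x - cutoff K n y\<bar> \<le> real n * dist x y"
proof -
  have "\<bar>cutoff K n x - cutoff K n y\<bar> \<le> \<bar>(1 - real n * infdist x K) - (1 - real n * infdist y K)\<bar>"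
    unfolding cutoff_def by linarith
  also have "(1 - real n * infdist x K) - (1 - real n * infdist y K) = real n * (infdist y K - infdist x K)"
    by (simp add: algebra_simps)
  also have "\<bar>\<dots>\<bar> = real n * \<bar>infdist x K - infdist y K\<bar>" by (simp add: abs_mult abs_minus_commute)
  also have "\<dots> \<le> real n * dist x y" by (intro mult_left_mono infdist_triangle_abs) auto
  finally show ?thesis .
qed

lemma cutoff_eventually_0:
  fixes K \<Omega> :: "'a::euclidean_space set"
  assumes K: "compact K" "K \<noteq> {}" "K \<subseteq> \<Omega>" and "open \<Omega>"
  shows "\<exists>n0. \<forall>n\<ge>n0. \<forall>x. x \<notin> \<Omega> \<longrightarrow> cutoff K n x = 0"
proof -
  obtain d where d: "d > 0" "\<And>x y. x \<in> K \<Longrightarrow> y \<in> - \<Omega> \<Longrightarrow> d \<le> dist x y"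
  proof -
    have "K \<inter> - \<Omega> = {}" using K(3) by blast
    then show thesis
      using separate_compact_closed[OF K(1), of "- \<Omega>"] assms(4) that by (auto simp: closed_Compl)
  qed
  obtain n0 where n0: "1 / d < real n0" using reals_Archimedean2 by blast
  have "cutoff K n x = 0" if "n \<ge> n0" "x \<notin> \<Omega>" for n x
  proof -
    have "d \<le> infdist x K" unfolding infdist_notempty[OF K(2)]
      using d(2) that K(2) by (intro cINF_greatest) (auto simp: dist_commute)
    moreover have "1 / d \<le> real n" using that n0 by linarith
    ultimately have "1 / d * d \<le> real n * infdist x K" using d(1) by (intro mult_mono) auto
    then show ?thesis using d(1) by (simp add: cutoff_def)
  qed
  then show ?thesis by blast
qed

lemma cutoff_tendsto:
  assumes K: "closed K" "K \<noteq> {}"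
  shows "(\<lambda>n. cutoff K n x) \<longlonglongrightarrow> indicator K x"
proof (cases "x \<in> K")
  case False
  then have "infdist x K > 0"
    using K by (simp add: infdist_pos_not_in_closed)
  then obtain n0 where "1 / infdist x K < real n0" using reals_Archimedean2 by blast
  have "cutoff K n x = 0" if "n \<ge> n0" for n
  proof -
    have "1 / infdist x K \<le> real n" using that \<open>1 / infdist x K < real n0\<close> by linarith
    then have "1 \<le> real n * infdist x K" using \<open>infdist x K > 0\<close> by (simp add: field_simps)
    then show ?thesis by (simp add: cutoff_def)
  qed
  then have "\<forall>\<^sub>F n in sequentially. cutoff K n x = indicator K x"
    using False by (intro eventually_sequentiallyI[of n0]) simp
  then show ?thesis by (rule tendsto_eventually)
qed (simp add: cutoff_def)

text \<open>Dominated convergence passes from cutoffs to indicators of compact sets; then the sets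
  where \<phi> has a fixed sign contain only compact sets of measure zero, and inner regularity
  makes them null. Cutoffs are continuous as well as Sobolev functions, so one criterion serves both
  kinds of test spaces below.\<close>

lemma AE_0_if_orthogonal_to_cutoffs:
  fixes \<phi> :: "'a::euclidean_space \<Rightarrow> real"
  assumes \<Omega>: "open \<Omega>" "bounded \<Omega>" and \<phi>: "integrable lborel \<phi>" "AE x in lborel. x \<notin> \<Omega> \<longrightarrow> \<phi> x = 0"
    and orth: "\<And>K n. compact K \<Longrightarrow> K \<noteq> {} \<Longrightarrow> K \<subseteq> \<Omega> \<Longrightarrow> (\<And>x. x \<notin> \<Omega> \<Longrightarrow> cutoff K n x = 0) \<Longrightarrow>
      (LINT x|lborel. \<phi> x * cutoff K n x) = 0"
  shows "AE x in lborel. \<phi> x = 0"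
proof -
  have [measurable]: "\<phi> \<in> borel_measurable borel" using \<phi>(1) by auto
  have K0: "(LINT x|lborel. \<phi> x * indicator K x) = 0" if K: "compact K" "K \<subseteq> \<Omega>" for K
  proof (cases "K = {}")
    case False
    have [measurable]: "K \<in> sets borel" using K(1) by (simp add: compact_imp_closed)
    have "(\<lambda>n. LINT x|lborel. \<phi> x * cutoff K n x) \<longlonglongrightarrow> (LINT x|lborel. \<phi> x * indicator K x)"
    proof (rule integral_dominated_convergence[where w = "\<lambda>x. norm (\<phi> x)"])
      show "(\<lambda>x. \<phi> x * indicator K x) \<in> borel_measurable lborel" by measurable
      show "(\<lambda>x. \<phi> x * cutoff K n x) \<in> borel_measurable lborel" for n
        using borel_measurable_continuous_onI[OF cutoff_continuous[of UNIV K n]] by measurable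
      show "AE x in lborel. (\<lambda>n. \<phi> x * cutoff K n x) \<longlonglongrightarrow> \<phi> x * indicator K x"
        using cutoff_tendsto[OF compact_imp_closed[OF K(1)] False] by (intro AE_I2 tendsto_intros)
      show "AE x in lborel. norm (\<phi> x * cutoff K n x) \<le> norm (\<phi> x)" for n
        using cutoff_bounds[of K n] by (intro AE_I2) (auto simp: abs_mult intro!: mult_left_le)
    qed (use \<phi> in auto)
    moreover obtain n0 where "\<forall>n\<ge>n0. \<forall>x. x \<notin> \<Omega> \<longrightarrow> cutoff K n x = 0"
      using cutoff_eventually_0[OF K(1) False K(2) \<Omega>(1)] by blast
    then have "\<forall>\<^sub>F n in sequentially. (LINT x|lborel. \<phi> x * cutoff K n x) = 0"
      using orth[OF K(1) False K(2)] by (intro eventually_sequentiallyI[of n0]) auto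
    then have "(\<lambda>n. LINT x|lborel. \<phi> x * cutoff K n x) \<longlonglongrightarrow> 0" by (rule tendsto_eventually)
    ultimately show ?thesis using LIMSEQ_unique by blast
  qed simp
  \<comment> \<open>The values c = 1 and c = -1 treat the positive and the negative part of
    \<phi>.\<close>
  have null: "emeasure lborel {x \<in> \<Omega>. 0 < c * \<phi> x} = 0" if c: "c \<noteq> 0" for c
  proof (rule null_set_if_compact_subsets_null)
    show "{x \<in> \<Omega>. 0 < c * \<phi> x} \<in> sets borel" using \<Omega>(1) by measurable
    show "bounded {x \<in> \<Omega>. 0 < c * \<phi> x}" using \<Omega>(2) by (rule bounded_subset) auto
    fix K assume K: "compact K" "K \<subseteq> {x \<in> \<Omega>. 0 < c * \<phi> x}"
    have Kb: "K \<in> sets borel" using K by (simp add: compact_imp_closed)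
    have "integrable lborel (\<lambda>x. \<phi> x * indicator K x)"
      using integrable_mult_indicator[of K lborel \<phi>] \<phi>(1) Kb by (simp add: mult.commute)
    then have int: "integrable lborel (\<lambda>x. c * (\<phi> x * indicator K x))" by simp
    have "(LINT x|lborel. c * (\<phi> x * indicator K x)) = 0" using K0[of K] K by auto
    then have "AE x in lborel. c * (\<phi> x * indicator K x) = 0"
      using integral_nonneg_eq_0_iff_AE[OF int] K(2) by (force simp: indicator_def intro: AE_I2)
    then have "AE x in lborel. x \<notin> K"
      by eventually_elim (use K(2) in \<open>force simp: indicator_def\<close>)
    then show "emeasure lborel K = 0" using Kb by (simp add: AE_iff_null_sets null_setsD1)
  qed
  have "AE x in lborel. x \<notin> {x \<in> \<Omega>. 0 < c * \<phi> x}" if "c \<noteq> 0" for c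
    using \<Omega>(1) by (intro AE_not_in null_setsI null that) measurable
  from this[of 1] this[of "-1"] \<phi>(2) show ?thesis
    by (auto elim!: eventually_elim2 simp: not_less intro: antisym)
qed

lemma norm_le_if_square_le: "norm z * norm z \<le> a * norm z \<Longrightarrow> 0 \<le> a \<Longrightarrow> norm z \<le> a"
  by (cases "norm z = 0") auto

locale frac_dirichlet =
  fixes \<Omega> :: "(real^'n) set" and s :: real
  assumes bounded_domain: "bounded \<Omega>" and open_domain: "open \<Omega>" and s: "0 < s" "s < 1"
begin

text \<open>L2(\<Omega>), realised as the closed subspace of functions on the whole space that
  vanish almost everywhere outside \<Omega>.\<close>

definition Lset :: "(real^'n) l2 set" where
  "Lset = {p. AE x in lborel. x \<notin> \<Omega> \<longrightarrow> rep_l2 p x = 0}"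

text \<open>The form domain of A, represented by pairs of a function and its Gagliardo quotient. As
  a closed subspace of a product of two L2 spaces it is itself a Hilbert space, with the form of 1 +
  A as inner product.\<close>

definition Vset :: "((real^'n) l2 \<times> ((real^'n) \<times> (real^'n)) l2) set" where
  "Vset = sobolev_embed s ` sobolev0 s \<Omega>"

lemma sets_domain [measurable]: "\<Omega> \<in> sets borel"
  using open_domain by simp

lemma mk_mem_Lset: "square_integrable f \<Longrightarrow> mk_l2 f \<in> Lset \<longleftrightarrow> (AE x in lborel. x \<notin> \<Omega> \<longrightarrow> f x = 0)"
proof -
  assume "square_integrable f"
  note eq = AE_rep_mk_l2[OF this]
  show ?thesis unfolding Lset_def mem_Collect_eq
  proof
    assume "AE x in lborel. x \<notin> \<Omega> \<longrightarrow> rep_l2 (mk_l2 f) x = 0"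
    with eq show "AE x in lborel. x \<notin> \<Omega> \<longrightarrow> f x = 0" by eventually_elim simp
  next
    assume "AE x in lborel. x \<notin> \<Omega> \<longrightarrow> f x = 0"
    with eq show "AE x in lborel. x \<notin> \<Omega> \<longrightarrow> rep_l2 (mk_l2 f) x = 0" by eventually_elim simp
  qed
qed

lemma subspace_Lset: "subspace Lset"
  unfolding subspace_def
proof (intro conjI ballI allI)
  show "0 \<in> Lset" using mk_mem_Lset[OF square_integrable_zero] by (simp add: mk_l2_zero)
next
  fix p q assume "p \<in> Lset" "q \<in> Lset"
  then show "p + q \<in> Lset" unfolding Lset_def mem_Collect_eq
    using AE_rep_add[of p q] by eventually_elim simp
next
  fix c p assume "p \<in> Lset"
  then show "c *\<^sub>R p \<in> Lset" unfolding Lset_def mem_Collect_eq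
    using AE_rep_scale[of c p] by eventually_elim simp
qed

lemma closed_Lset: "closed Lset"
  unfolding closed_sequential_limits
proof safe
  fix X p assume X: "\<forall>n. X n \<in> Lset" "X \<longlonglongrightarrow> p"
  obtain r where r: "AE x in lborel. (\<lambda>n. rep_l2 (X (r n)) x) \<longlonglongrightarrow> rep_l2 p x"
    using l2_tendsto_AE_subseq[OF X(2)] by blast
  have "AE x in lborel. \<forall>n. x \<notin> \<Omega> \<longrightarrow> rep_l2 (X n) x = 0"
    unfolding AE_all_countable using X(1) by (simp add: Lset_def)
  with r show "p \<in> Lset" unfolding Lset_def mem_Collect_eq
    by eventually_elim (auto simp: LIMSEQ_const_iff)
qed

lemma sobolev0D: "u \<in> sobolev0 s \<Omega> \<Longrightarrow> u \<in> sobolev s"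
  "u \<in> sobolev0 s \<Omega> \<Longrightarrow> AE x in lborel. x \<notin> \<Omega> \<longrightarrow> u x = 0"
  "u \<in> sobolev0 s \<Omega> \<Longrightarrow> square_integrable u" "u \<in> sobolev0 s \<Omega> \<Longrightarrow> square_integrable (gagliardo s u)"
  by (auto simp: sobolev0_def sobolev_iff[OF s])

lemma sobolev0_cong_AE:
  assumes "u \<in> sobolev0 s \<Omega>" "v \<in> borel_measurable borel" "AE x in lborel. u x = v x"
  shows "v \<in> sobolev0 s \<Omega>" "sobolev_embed s v = sobolev_embed s u"
proof -
  note u = sobolev0D[OF assms(1)]
  show "sobolev_embed s v = sobolev_embed s u" by (rule sobolev_cong_AE[OF s u(1) assms(2,3)])
  have "v \<in> sobolev s" by (rule sobolev_cong_AE[OF s u(1) assms(2,3)])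
  moreover have "AE x in lborel. x \<notin> \<Omega> \<longrightarrow> v x = 0"
    using u(2) assms(3) by eventually_elim simp
  ultimately show "v \<in> sobolev0 s \<Omega>" by (simp add: sobolev0_def)
qed

lemma sobolev0_add:
  assumes "u \<in> sobolev0 s \<Omega>" "v \<in> sobolev0 s \<Omega>" shows "(\<lambda>x. u x + v x) \<in> sobolev0 s \<Omega>"
  using assms sobolev_add(1)[OF s] unfolding sobolev0_def by (auto elim: eventually_elim2)

lemma sobolev0_scale:
  assumes "u \<in> sobolev0 s \<Omega>" shows "(\<lambda>x. c * u x) \<in> sobolev0 s \<Omega>"
  using assms sobolev_scale(1)[OF s] unfolding sobolev0_def by (auto elim: eventually_mono)

lemma sobolev0_zero: "(\<lambda>x. 0) \<in> sobolev0 s \<Omega>"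
  unfolding sobolev0_def by (auto simp: sobolev_iff[OF s] square_integrable_zero gagliardo_def[abs_def])

text \<open>The first component determines the pair, since functions that agree almost everywhere
  have almost everywhere equal quotients. So a form domain element may be recovered from its L2
  class.\<close>

lemma Vset_rep:
  assumes "z \<in> Vset"
  shows "rep_l2 (fst z) \<in> sobolev0 s \<Omega>" "sobolev_embed s (rep_l2 (fst z)) = z"
proof -
  obtain u where u: "u \<in> sobolev0 s \<Omega>" "z = sobolev_embed s u" using assms by (auto simp: Vset_def)
  have "AE x in lborel. u x = rep_l2 (fst z) x"
    using AE_rep_mk_l2[OF sobolev0D(3)[OF u(1)]] u(2) by (auto simp: sobolev_embed_def elim: eventually_mono)
  from sobolev0_cong_AE[OF u(1) _ this] u(2)
  show "rep_l2 (fst z) \<in> sobolev0 s \<Omega>" "sobolev_embed s (rep_l2 (fst z)) = z" by auto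
qed

lemma Vset_fst_Lset: "z \<in> Vset \<Longrightarrow> fst z \<in> Lset"
  using sobolev0D(2)[OF Vset_rep(1)] by (simp add: Lset_def)

lemma subspace_Vset: "subspace Vset"
  unfolding subspace_def Vset_def
proof (intro conjI ballI allI)
  show "0 \<in> sobolev_embed s ` sobolev0 s \<Omega>"
  proof (rule image_eqI[OF _ sobolev0_zero])
    have "gagliardo s (\<lambda>x::real^'n. 0) = (\<lambda>_. 0)" by (auto simp: gagliardo_def)
    then show "0 = sobolev_embed s (\<lambda>x::real^'n. 0)" by (simp add: sobolev_embed_def mk_l2_zero zero_prod_def)
  qed
next
  fix p q assume "p \<in> sobolev_embed s ` sobolev0 s \<Omega>" "q \<in> sobolev_embed s ` sobolev0 s \<Omega>"
  then obtain u v where u: "u \<in> sobolev0 s \<Omega>" "p = sobolev_embed s u" and v: "v \<in> sobolev0 s \<Omega>" "q = sobolev_embed s v"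
    by blast
  show "p + q \<in> sobolev_embed s ` sobolev0 s \<Omega>"
    unfolding u(2) v(2) sobolev_add(2)[OF s sobolev0D(1)[OF u(1)] sobolev0D(1)[OF v(1)], symmetric]
    by (intro imageI sobolev0_add u v)
next
  fix c p assume "p \<in> sobolev_embed s ` sobolev0 s \<Omega>"
  then obtain u where u: "u \<in> sobolev0 s \<Omega>" "p = sobolev_embed s u" by blast
  show "c *\<^sub>R p \<in> sobolev_embed s ` sobolev0 s \<Omega>"
    unfolding u(2) sobolev_scale(2)[OF s sobolev0D(1)[OF u(1)], symmetric]
    by (intro imageI sobolev0_scale u)
qed

text \<open>Completeness of the Sobolev space. Passing to subsequences twice makes both components
  converge pointwise, and the quotient is continuous in the function values, so the limit of the
  quotients is the quotient of the limit.\<close>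

lemma closed_Vset: "closed Vset"
  unfolding closed_sequential_limits
proof safe
  fix X and p :: "(real^'n) l2" and q assume X: "\<forall>n. X n \<in> Vset" "X \<longlonglongrightarrow> (p, q)"
  have Xf: "(\<lambda>n. fst (X n)) \<longlonglongrightarrow> p" and Xs: "(\<lambda>n. snd (X n)) \<longlonglongrightarrow> q"
    using tendsto_fst[OF X(2)] tendsto_snd[OF X(2)] by auto
  define u where "u n = rep_l2 (fst (X n))" for n
  have u: "u n \<in> sobolev0 s \<Omega>" "sobolev_embed s (u n) = X n" for n
    using Vset_rep X(1) by (auto simp: u_def)
  obtain r where r: "strict_mono r" "AE x in lborel. (\<lambda>n. u (r n) x) \<longlonglongrightarrow> rep_l2 p x"
    using l2_tendsto_AE_subseq[OF Xf] unfolding u_def by blast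
  have "(\<lambda>n. snd (X (r n))) \<longlonglongrightarrow> q" using LIMSEQ_subseq_LIMSEQ[OF Xs r(1)] by (simp add: o_def)
  then obtain r' where r': "strict_mono r'"
      "AE x in lborel. (\<lambda>n. rep_l2 (snd (X (r (r' n)))) x) \<longlonglongrightarrow> rep_l2 q x"
    using l2_tendsto_AE_subseq by blast
  have g: "AE x in lborel. \<forall>n. rep_l2 (snd (X n)) x = gagliardo s (u n) x"
    unfolding AE_all_countable
  proof
    fix n
    have "snd (X n) = mk_l2 (gagliardo s (u n))" using u(2)[of n, symmetric] by (simp add: sobolev_embed_def)
    then show "AE x in lborel. rep_l2 (snd (X n)) x = gagliardo s (u n) x"
      using AE_rep_mk_l2[OF sobolev0D(4)[OF u(1)]] by simp
  qed
  have gq: "AE x in lborel. rep_l2 q x = gagliardo s (rep_l2 p) x"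
    using r'(2) g AE_lborel_fst[OF r(2)] AE_lborel_snd[OF r(2)]
  proof eventually_elim
    case (elim x)
    have "(\<lambda>n. u (r (r' n)) (fst x)) \<longlonglongrightarrow> rep_l2 p (fst x)" "(\<lambda>n. u (r (r' n)) (snd x)) \<longlonglongrightarrow> rep_l2 p (snd x)"
      using LIMSEQ_subseq_LIMSEQ[OF elim(3) r'(1)] LIMSEQ_subseq_LIMSEQ[OF elim(4) r'(1)] by (auto simp: o_def)
    then have "(\<lambda>n. gagliardo s (u (r (r' n))) x) \<longlonglongrightarrow> gagliardo s (rep_l2 p) x"
      unfolding gagliardo_def divide_inverse by (intro tendsto_intros)
    then show ?case using elim(1,2) LIMSEQ_unique by auto
  qed
  have sg: "square_integrable (gagliardo s (rep_l2 p))"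
    using square_integrable_cong_AE[OF rep_l2(1) _ gq] gagliardo_measurable[OF square_integrable_borel[OF rep_l2(1)[of p]], of s] by simp
  have "mk_l2 (rep_l2 q) = mk_l2 (gagliardo s (rep_l2 p))" using mk_l2_eq_iff[OF rep_l2(1) sg] gq by simp
  then have q: "q = mk_l2 (gagliardo s (rep_l2 p))" by (simp add: rep_l2(2))
  have "p \<in> Lset" using closed_sequentially[OF closed_Lset _ Xf] Vset_fst_Lset X(1) by blast
  then have "rep_l2 p \<in> sobolev0 s \<Omega>"
    using sg rep_l2(1) by (simp add: sobolev0_def sobolev_iff[OF s] Lset_def)
  moreover have "sobolev_embed s (rep_l2 p) = (p, q)" using q rep_l2(2) by (simp add: sobolev_embed_def)
  ultimately show "(p, q) \<in> Vset" unfolding Vset_def by (metis imageI)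
qed

text \<open>The weak solution z of (1 + A) z = f with exterior value zero, kept as a pair so that
  its membership in the form domain is not lost; \<open>B\<close> below is its first
  component.\<close>

definition resolv :: "(real^'n) l2 \<Rightarrow> (real^'n) l2 \<times> ((real^'n) \<times> (real^'n)) l2" where
  "resolv f = (SOME z. z \<in> Vset \<and> (\<forall>q\<in>Vset. f \<bullet> fst q = z \<bullet> q))"

lemma norm_fst_l2_le: "norm (fst z) \<le> norm z" for z :: "(real^'n) l2 \<times> ((real^'n) \<times> (real^'n)) l2"
  by (simp add: norm_prod_def real_le_rsqrt)

lemma resolv: "resolv f \<in> Vset" "q \<in> Vset \<Longrightarrow> f \<bullet> fst q = resolv f \<bullet> q"
proof -
  have "\<exists>z\<in>Vset. \<forall>q\<in>Vset. f \<bullet> fst q = z \<bullet> q"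
  proof (rule riesz_representation[OF subspace_Vset closed_Vset, where K = "norm f"])
    fix p :: "(real^'n) l2 \<times> ((real^'n) \<times> (real^'n)) l2"
    have "\<bar>f \<bullet> fst p\<bar> \<le> norm f * norm (fst p)" by (rule Cauchy_Schwarz_ineq2)
    also have "\<dots> \<le> norm f * norm p" by (intro mult_left_mono norm_fst_l2_le) auto
    finally show "\<bar>f \<bullet> fst p\<bar> \<le> norm f * norm p" .
  qed (auto simp: inner_simps)
  then have "\<exists>z. z \<in> Vset \<and> (\<forall>q\<in>Vset. f \<bullet> fst q = z \<bullet> q)" by blast
  from someI_ex[OF this] show "resolv f \<in> Vset" "q \<in> Vset \<Longrightarrow> f \<bullet> fst q = resolv f \<bullet> q"
    unfolding resolv_def by auto
qed

lemma resolv_unique: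
  assumes "z \<in> Vset" "\<And>q. q \<in> Vset \<Longrightarrow> f \<bullet> fst q = z \<bullet> q"
  shows "resolv f = z"
proof -
  have d: "resolv f - z \<in> Vset" by (intro subspace_diff subspace_Vset resolv assms)
  have "(resolv f - z) \<bullet> (resolv f - z) = resolv f \<bullet> (resolv f - z) - z \<bullet> (resolv f - z)"
    by (simp add: inner_diff_left)
  also have "\<dots> = 0" using resolv(2)[OF d, of f] assms(2)[OF d] by simp
  finally show ?thesis by simp
qed

lemma resolv_add: "resolv (f + g) = resolv f + resolv g"
  by (rule resolv_unique) (auto simp: inner_add_left resolv intro!: subspace_add subspace_Vset resolv)

lemma resolv_scale: "resolv (c *\<^sub>R f) = c *\<^sub>R resolv f"
  by (rule resolv_unique) (auto simp: resolv intro!: subspace_scale subspace_Vset resolv)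

lemma norm_resolv: "norm (resolv f) \<le> norm f"
proof (rule norm_le_if_square_le)
  have "norm (resolv f) * norm (resolv f) = f \<bullet> fst (resolv f)"
    using resolv(2)[OF resolv(1), of f f] by (simp add: power2_norm_eq_inner[symmetric] power2_eq_square)
  also have "\<dots> \<le> norm f * norm (fst (resolv f))" by (rule norm_cauchy_schwarz)
  also have "\<dots> \<le> norm f * norm (resolv f)" by (intro mult_left_mono norm_fst_l2_le) auto
  finally show "norm (resolv f) * norm (resolv f) \<le> norm f * norm (resolv f)" .
qed simp

definition B :: "(real^'n) l2 \<Rightarrow> (real^'n) l2" where "B f = fst (resolv f)"

text \<open>Testing the equation for y with the solution for x expresses
  \<open>B x \<bullet> y\<close> as the inner product of \<open>resolv y\<close> and
  \<open>resolv x\<close>. Symmetry and both bounds of the quadratic form are read off from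
  this.\<close>

sublocale positive_contraction B
proof (rule positive_contraction.intro)
  show "bounded_linear B"
    by (rule bounded_linear_intro[where K = 1])
      (auto simp: B_def resolv_add resolv_scale intro: order_trans[OF norm_fst_l2_le norm_resolv])
  have sym: "B x \<bullet> y = resolv y \<bullet> resolv x" for x y
    using resolv(2)[OF resolv(1), of y x] by (simp add: B_def inner_commute)
  show "B x \<bullet> y = x \<bullet> B y" for x y
    using sym[of x y] sym[of y x] by (simp add: inner_commute)
  show "0 \<le> B x \<bullet> x" for x by (simp add: sym)
  show "B x \<bullet> x \<le> x \<bullet> x" for x
  proof -
    have "B x \<bullet> x = (norm (resolv x))\<^sup>2" by (simp add: sym power2_norm_eq_inner)
    also have "\<dots> \<le> (norm x)\<^sup>2" by (intro power_mono norm_resolv) auto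
    finally show ?thesis by (simp add: power2_norm_eq_inner)
  qed
qed

lemma B_mem_Lset: "B f \<in> Lset"
  unfolding B_def by (intro Vset_fst_Lset resolv)

lemma Lset_integrable:
  assumes "\<phi> \<in> Lset" shows "integrable lborel (rep_l2 \<phi>)"
proof -
  have "integrable lborel (\<lambda>x. rep_l2 \<phi> x * indicator \<Omega> x)"
    by (rule square_integrable_mult_integrable[OF rep_l2(1) square_integrable_indicator_bounded[OF sets_domain bounded_domain]])
  moreover have "AE x in lborel. rep_l2 \<phi> x * indicator \<Omega> x = rep_l2 \<phi> x"
    using assms unfolding Lset_def mem_Collect_eq by eventually_elim (auto simp: indicator_def)
  ultimately show ?thesis
    using integrable_cong_AE[of "\<lambda>x. rep_l2 \<phi> x * indicator \<Omega> x" lborel "rep_l2 \<phi>"]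
    by (metis borel_measurable_integrable rep_l2_measurable)
qed

lemma Lset_eq_0:
  assumes \<phi>: "\<phi> \<in> Lset"
    and orth: "\<And>K n. compact K \<Longrightarrow> K \<noteq> {} \<Longrightarrow> K \<subseteq> \<Omega> \<Longrightarrow> (\<And>x. x \<notin> \<Omega> \<Longrightarrow> cutoff K n x = 0) \<Longrightarrow>
      (LINT x|lborel. rep_l2 \<phi> x * cutoff K n x) = 0"
  shows "\<phi> = 0"
proof -
  have z: "AE x in lborel. x \<notin> \<Omega> \<longrightarrow> rep_l2 \<phi> x = 0" using \<phi> by (simp add: Lset_def)
  have "AE x in lborel. rep_l2 \<phi> x = 0"
    by (rule AE_0_if_orthogonal_to_cutoffs[OF open_domain bounded_domain Lset_integrable[OF \<phi>] z orth])
  then have "mk_l2 (rep_l2 \<phi>) = mk_l2 (\<lambda>_. 0)" by (subst mk_l2_eq_iff) (auto simp: rep_l2 square_integrable_zero)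
  then show ?thesis by (simp add: rep_l2 mk_l2_zero)
qed

lemma cutoff_mem_sobolev0:
  assumes "\<And>x. x \<notin> \<Omega> \<Longrightarrow> cutoff K n x = 0"
  shows "cutoff K n \<in> sobolev0 s \<Omega>"
proof -
  obtain R where R: "\<And>x. x \<in> \<Omega> \<Longrightarrow> norm x < R"
    using bounded_domain unfolding bounded_iff by (metis gt_ex le_less_trans)
  have "cutoff K n \<in> sobolev s"
  proof (rule Lipschitz_imp_sobolev[OF s, of _ "real n" 1 R])
    show "\<bar>cutoff K n x - cutoff K n y\<bar> \<le> real n * norm (x - y)" for x y
      using cutoff_Lipschitz[of K n x y] by (simp add: dist_norm)
    show "cutoff K n x = 0" if "R \<le> norm x" for x using assms[of x] R[of x] that by force
  qed (use cutoff_bounds[of K n] in \<open>auto intro!: borel_measurable_continuous_onI cutoff_continuous\<close>)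
  then show ?thesis using assms by (simp add: sobolev0_def)
qed

text \<open>Density of the form domain in L2(\<Omega>): the cutoffs that vanish outside \<Omega>
  belong to it and already separate.\<close>

lemma Lset_eq_0_if_orthogonal_Vset:
  assumes \<phi>: "\<phi> \<in> Lset" and orth: "\<And>q. q \<in> Vset \<Longrightarrow> \<phi> \<bullet> fst q = 0"
  shows "\<phi> = 0"
proof (rule Lset_eq_0[OF \<phi>])
  fix K n assume "\<And>x. x \<notin> \<Omega> \<Longrightarrow> cutoff K n x = 0"
  then have c: "cutoff K n \<in> sobolev0 s \<Omega>" by (rule cutoff_mem_sobolev0)
  then have "\<phi> \<bullet> mk_l2 (cutoff K n) = 0"
    using orth[of "sobolev_embed s (cutoff K n)"] by (auto simp: Vset_def sobolev_embed_def)
  then show "(LINT x|lborel. rep_l2 \<phi> x * cutoff K n x) = 0"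
    using inner_mk_l2[OF rep_l2(1) sobolev0D(3)[OF c], of \<phi>] by (simp add: rep_l2)
qed

text \<open>\<open>f \<bullet> B f\<close> is the squared norm of \<open>resolv f\<close>; if it
  vanishes, f is orthogonal to the dense form domain.\<close>

lemma B_injective:
  assumes "f \<in> Lset" "B f = 0" shows "f = 0"
proof (rule Lset_eq_0_if_orthogonal_Vset[OF assms(1)])
  have "resolv f \<bullet> resolv f = f \<bullet> B f" using resolv(2)[OF resolv(1), of f f] by (simp add: B_def)
  then have "resolv f = 0" using assms by simp
  then show "f \<bullet> fst q = 0" if "q \<in> Vset" for q using resolv(2)[OF that, of f] by simp
qed

text \<open>If z is orthogonal to the range, test with the solution whose right-hand side is the
  first component of z: the result is the squared norm of that component, and a pair with first
  component zero is zero.\<close>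

lemma Vset_subset_closure_resolv: "Vset \<subseteq> closure (resolv ` Lset)"
proof (rule dense_if_no_orthogonal)
  have "linear resolv" by (intro linearI resolv_add resolv_scale)
  then show "subspace (resolv ` Lset)" using linear_subspace_image subspace_Lset by blast
  fix z assume z: "z \<in> Vset" and orth: "\<And>m. m \<in> resolv ` Lset \<Longrightarrow> z \<bullet> m = 0"
  have "fst z \<bullet> fst z = resolv (fst z) \<bullet> z" using resolv(2)[OF z] by blast
  also have "\<dots> = 0" using orth[of "resolv (fst z)"] Vset_fst_Lset[OF z] by (simp add: inner_commute)
  finally have 0: "fst z = 0" by simp
  have "AE x in lborel. rep_l2 (0::(real^'n) l2) x = 0"
    using AE_rep_mk_l2[OF square_integrable_zero] by (simp add: mk_l2_zero)
  then have "sobolev_embed s (\<lambda>x::real^'n. 0) = z"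
    using sobolev0_cong_AE(2)[OF Vset_rep(1)[OF z], of "\<lambda>_. 0"] Vset_rep(2)[OF z] 0 by simp
  moreover have "gagliardo s (\<lambda>x::real^'n. 0) = (\<lambda>_. 0)" by (auto simp: gagliardo_def)
  ultimately show "z = 0" by (auto simp: sobolev_embed_def mk_l2_zero zero_prod_def)
qed (auto intro: resolv subspace_Vset closed_Vset)

section \<open>Equivalent norms and density of L2 in the dual space\<close>

lemma norm_embed_le:
  "\<exists>C>0. \<forall>u\<in>sobolev s. norm (sobolev_embed s (u :: real^'n \<Rightarrow> real)) \<le> C * sobolev_norm s u"
proof -
  define c where "c = frac_const CARD('n) s / 2"
  have c: "c > 0" using frac_const_pos[OF s, of "CARD('n)"] by (simp add: c_def)
  have "norm (sobolev_embed s u) \<le> sqrt (1 + c) * sobolev_norm s u" if u: "u \<in> sobolev s" for u :: "real^'n \<Rightarrow> real"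
  proof (rule power2_le_imp_le)
    have "0 \<le> norm (mk_l2 (gagliardo s u)) ^ 2 / c" "0 \<le> c * norm (mk_l2 u) ^ 2" using c by auto
    moreover have "(sobolev_norm s u)\<^sup>2 = (norm (mk_l2 u))\<^sup>2 + (norm (mk_l2 (gagliardo s u)))\<^sup>2 / c"
      unfolding sobolev_norm_eq[OF s u] by (simp add: c_def)
    moreover have "(norm (sobolev_embed s u))\<^sup>2 = (norm (mk_l2 u))\<^sup>2 + (norm (mk_l2 (gagliardo s u)))\<^sup>2"
      by (simp add: sobolev_embed_def norm_prod_def)
    moreover have "(sqrt (1 + c) * sobolev_norm s u)\<^sup>2 = (1 + c) * (sobolev_norm s u)\<^sup>2"
      using c by (simp add: power_mult_distrib)
    ultimately show "(norm (sobolev_embed s u))\<^sup>2 \<le> (sqrt (1 + c) * sobolev_norm s u)\<^sup>2"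
      using c by (simp add: algebra_simps add_divide_distrib)
  qed (use c in \<open>simp add: sobolev_norm_def Bochner_Integration.integral_nonneg case_prod_beta'\<close>)
  then show ?thesis using c by (intro exI[of _ "sqrt (1 + c)"]) auto
qed

lemma sobolev_norm_le_embed:
  "\<exists>C>0. \<forall>u\<in>sobolev s. sobolev_norm s u \<le> C * norm (sobolev_embed s (u :: real^'n \<Rightarrow> real))"
proof -
  define c where "c = 2 / frac_const CARD('n) s"
  have c: "c > 0" using frac_const_pos[OF s, of "CARD('n)"] by (simp add: c_def)
  have "sobolev_norm s u \<le> sqrt (1 + c) * norm (sobolev_embed s u)" if u: "u \<in> sobolev s" for u :: "real^'n \<Rightarrow> real"
  proof (rule power2_le_imp_le)
    have "0 \<le> norm (mk_l2 (gagliardo s u)) ^ 2" "0 \<le> c * norm (mk_l2 u) ^ 2" using c by auto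
    moreover have "(sobolev_norm s u)\<^sup>2 = (norm (mk_l2 u))\<^sup>2 + c * (norm (mk_l2 (gagliardo s u)))\<^sup>2"
      unfolding sobolev_norm_eq[OF s u] by (simp add: c_def)
    moreover have "(norm (sobolev_embed s u))\<^sup>2 = (norm (mk_l2 u))\<^sup>2 + (norm (mk_l2 (gagliardo s u)))\<^sup>2"
      by (simp add: sobolev_embed_def norm_prod_def)
    moreover have "(sqrt (1 + c) * norm (sobolev_embed s u))\<^sup>2 = (1 + c) * (norm (sobolev_embed s u))\<^sup>2"
      using c by (simp add: power_mult_distrib)
    ultimately show "(sobolev_norm s u)\<^sup>2 \<le> (sqrt (1 + c) * norm (sobolev_embed s u))\<^sup>2"
      by (simp add: algebra_simps)
  qed (use c in simp)
  then show ?thesis using c by (intro exI[of _ "sqrt (1 + c)"]) auto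
qed

lemma norm_mk_le_sobolev_norm:
  assumes "u \<in> sobolev s" shows "norm (mk_l2 u) \<le> sobolev_norm s (u :: real^'n \<Rightarrow> real)"
proof (rule power2_le_imp_le)
  show "(norm (mk_l2 u))\<^sup>2 \<le> (sobolev_norm s u)\<^sup>2"
    unfolding sobolev_norm_eq[OF s assms] using frac_const_pos[OF s, of "CARD('n)"] by simp
qed (simp add: sobolev_norm_def Bochner_Integration.integral_nonneg case_prod_beta')

text \<open>Riesz represents F by some z in the form domain, and z is approximated by
  \<open>resolv f\<close>. Pairing \<open>resolv f\<close> with a test function is the L2 pairing
  with f, so L2(\<Omega>) is dense in the dual space.\<close>

lemma dual_approx:
  assumes F: "F \<in> sobolev_dual s \<Omega>" and e: "\<epsilon> > 0"
  shows "\<exists>f\<in>Lset. \<forall>\<zeta>\<in>sobolev0 s \<Omega>. sobolev_norm s \<zeta> \<le> 1 \<longrightarrow> \<bar>f \<bullet> mk_l2 \<zeta> - F \<zeta>\<bar> \<le> \<epsilon>"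
proof -
  from F obtain K where Fadd: "\<And>\<zeta> \<eta>. \<zeta> \<in> sobolev0 s \<Omega> \<Longrightarrow> \<eta> \<in> sobolev0 s \<Omega> \<Longrightarrow> F (\<lambda>x. \<zeta> x + \<eta> x) = F \<zeta> + F \<eta>"
    and Fscale: "\<And>\<zeta> c. \<zeta> \<in> sobolev0 s \<Omega> \<Longrightarrow> F (\<lambda>x. c * \<zeta> x) = c * F \<zeta>"
    and K: "\<And>\<zeta>. \<zeta> \<in> sobolev0 s \<Omega> \<Longrightarrow> \<bar>F \<zeta>\<bar> \<le> K * sobolev_norm s \<zeta>"
    unfolding sobolev_dual_def by blast
  obtain C1 where C1: "C1 > 0" "\<And>u. u \<in> sobolev s \<Longrightarrow> norm (sobolev_embed s (u :: real^'n \<Rightarrow> real)) \<le> C1 * sobolev_norm s u"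
    using norm_embed_le by blast
  obtain C2 where C2: "C2 > 0" "\<And>u. u \<in> sobolev s \<Longrightarrow> sobolev_norm s u \<le> C2 * norm (sobolev_embed s (u :: real^'n \<Rightarrow> real))"
    using sobolev_norm_le_embed by blast
  have bound: "\<bar>F \<zeta>\<bar> \<le> \<bar>K\<bar> * C2 * norm (sobolev_embed s \<zeta>)" if "\<zeta> \<in> sobolev0 s \<Omega>" for \<zeta>
  proof -
    have "0 \<le> sobolev_norm s \<zeta>" by (simp add: sobolev_norm_def Bochner_Integration.integral_nonneg case_prod_beta')
    then have "K * sobolev_norm s \<zeta> \<le> \<bar>K\<bar> * sobolev_norm s \<zeta>" by (intro mult_right_mono) auto
    also have "\<dots> \<le> \<bar>K\<bar> * (C2 * norm (sobolev_embed s \<zeta>))" using C2 sobolev0D(1)[OF that] by (intro mult_left_mono) auto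
    finally show ?thesis using K[OF that] by simp
  qed
  \<comment> \<open>F is given on functions, Riesz acts on classes. The bound on F forces equal
    values on functions with equal embeddings, so F descends to \<open>Vset\<close>.\<close>
  have cong: "F \<zeta> = F \<eta>" if z: "\<zeta> \<in> sobolev0 s \<Omega>" "\<eta> \<in> sobolev0 s \<Omega>" "sobolev_embed s \<zeta> = sobolev_embed s \<eta>" for \<zeta> \<eta>
  proof -
    have m: "(\<lambda>x. (-1) * \<eta> x) \<in> sobolev0 s \<Omega>" using sobolev0_scale[OF z(2), of "-1"] .
    have "sobolev_embed s (\<lambda>x. \<zeta> x + (-1) * \<eta> x) = 0"
      using z(3) sobolev_add(2)[OF s sobolev0D(1)[OF z(1)] sobolev0D(1)[OF m]] sobolev_scale(2)[OF s sobolev0D(1)[OF z(2)], of "-1"] by simp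
    then have "F (\<lambda>x. \<zeta> x + (-1) * \<eta> x) = 0" using bound[OF sobolev0_add[OF z(1) m]] by simp
    then show ?thesis using Fadd[OF z(1) m] Fscale[OF z(2), of "-1"] by simp
  qed
  define F' where "F' z = F (rep_l2 (fst z))" for z :: "(real^'n) l2 \<times> ((real^'n) \<times> (real^'n)) l2"
  have F': "F' (sobolev_embed s \<zeta>) = F \<zeta>" if "\<zeta> \<in> sobolev0 s \<Omega>" for \<zeta>
  proof -
    have "sobolev_embed s \<zeta> \<in> Vset" using that by (simp add: Vset_def)
    from Vset_rep[OF this] show ?thesis unfolding F'_def using that by (intro cong) auto
  qed
  have "\<exists>z\<in>Vset. \<forall>q\<in>Vset. F' q = z \<bullet> q"
  proof (rule riesz_representation[OF subspace_Vset closed_Vset, where K = "\<bar>K\<bar> * C2"])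
    fix p q assume "p \<in> Vset" "q \<in> Vset"
    then obtain \<zeta> \<eta> where z: "\<zeta> \<in> sobolev0 s \<Omega>" "\<eta> \<in> sobolev0 s \<Omega>" "p = sobolev_embed s \<zeta>" "q = sobolev_embed s \<eta>"
      by (auto simp: Vset_def)
    have "p + q = sobolev_embed s (\<lambda>x. \<zeta> x + \<eta> x)"
      unfolding z(3,4) by (rule sobolev_add(2)[OF s sobolev0D(1)[OF z(1)] sobolev0D(1)[OF z(2)], symmetric])
    then show "F' (p + q) = F' p + F' q" using F' z Fadd sobolev0_add by simp
  next
    fix p and c :: real assume "p \<in> Vset"
    then obtain \<zeta> where z: "\<zeta> \<in> sobolev0 s \<Omega>" "p = sobolev_embed s \<zeta>" by (auto simp: Vset_def)
    have "c *\<^sub>R p = sobolev_embed s (\<lambda>x. c * \<zeta> x)"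
      unfolding z(2) by (rule sobolev_scale(2)[OF s sobolev0D(1)[OF z(1)], symmetric])
    then show "F' (c *\<^sub>R p) = c * F' p" using F' z Fscale sobolev0_scale by simp
  next
    fix p assume "p \<in> Vset"
    then show "\<bar>F' p\<bar> \<le> \<bar>K\<bar> * C2 * norm p" using F' bound by (auto simp: Vset_def)
  qed
  then obtain z where z: "z \<in> Vset" "\<And>q. q \<in> Vset \<Longrightarrow> F' q = z \<bullet> q" by blast
  have "z \<in> closure (resolv ` Lset)" using Vset_subset_closure_resolv z by blast
  then obtain f where f: "f \<in> Lset" "dist (resolv f) z < \<epsilon> / C1"
    unfolding closure_approachable using e C1 by (metis divide_pos_pos imageE)
  show ?thesis
  proof (intro bexI[OF _ f(1)] ballI impI)
    fix \<zeta> assume \<zeta>: "\<zeta> \<in> sobolev0 s \<Omega>" "sobolev_norm s \<zeta> \<le> 1"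
    have V: "sobolev_embed s \<zeta> \<in> Vset" using \<zeta> by (simp add: Vset_def)
    have "f \<bullet> mk_l2 \<zeta> - F \<zeta> = (resolv f - z) \<bullet> sobolev_embed s \<zeta>"
      using resolv(2)[OF V, of f] z(2)[OF V] F'[OF \<zeta>(1)] by (simp add: inner_diff_left sobolev_embed_def)
    also have "\<bar>\<dots>\<bar> \<le> norm (resolv f - z) * norm (sobolev_embed s \<zeta>)" by (rule Cauchy_Schwarz_ineq2)
    also have "\<dots> \<le> (\<epsilon> / C1) * (C1 * 1)"
    proof (rule mult_mono)
      show "norm (sobolev_embed s \<zeta>) \<le> C1 * 1"
        using C1(2)[OF sobolev0D(1)[OF \<zeta>(1)]] mult_left_mono[OF \<zeta>(2), of C1] C1(1) by linarith
    qed (use f(2) e C1 in \<open>auto simp: dist_norm\<close>)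
    finally show "\<bar>f \<bullet> mk_l2 \<zeta> - F \<zeta>\<bar> \<le> \<epsilon>" using C1 by simp
  qed
qed

end

section \<open>Gaussian averages of densities\<close>

text \<open>Distances between U and \<Omega> stay in [d, R], so any kernel that is continuous away
  from the origin is bounded there and may be differentiated under the integral.\<close>

locale separated_density =
  fixes f :: "'a::euclidean_space \<Rightarrow> real" and U \<Omega> :: "'a set" and d R :: real
  assumes f: "integrable lborel f" "\<And>y. y \<notin> \<Omega> \<Longrightarrow> f y = 0"
    and U: "open U" and d: "0 < d"
    and sep: "\<And>x y. x \<in> U \<Longrightarrow> y \<in> \<Omega> \<Longrightarrow> d \<le> norm (x - y) \<and> norm (x - y) \<le> R"
begin

lemma f_measurable [measurable]: "f \<in> borel_measurable borel"
  using f(1) by auto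

lemma kernel_bounded:
  assumes "continuous_on (- {0}) P"
  obtains C where "0 \<le> C" "\<And>x y. x \<in> U \<Longrightarrow> y \<in> \<Omega> \<Longrightarrow> \<bar>P (x - y)\<bar> \<le> (C::real)"
proof -
  have "compact (cball 0 R - ball (0::'a) d)" by (intro compact_diff compact_cball open_ball)
  moreover have "continuous_on (cball 0 R - ball (0::'a) d) P"
    by (rule continuous_on_subset[OF assms]) (use d in auto)
  ultimately have "bounded (P ` (cball 0 R - ball (0::'a) d))"
    by (intro compact_imp_bounded compact_continuous_image)
  then obtain C where C: "\<And>z. z \<in> cball 0 R - ball 0 d \<Longrightarrow> \<bar>P z\<bar> \<le> C"
    unfolding bounded_iff by (auto simp del: mem_cball mem_ball Diff_iff)
  show thesis
  proof (rule that[of "max C 0"])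
    show "\<bar>P (x - y)\<bar> \<le> max C 0" if "x \<in> U" "y \<in> \<Omega>" for x y
      using C[of "x - y"] sep[OF that] by (auto simp: dist_norm norm_minus_commute)
  qed simp
qed

lemma kernel_integrable:
  assumes P: "continuous_on (- {0}) P" and [measurable]: "P \<in> borel_measurable borel" and x: "x \<in> U"
  shows "integrable lborel (\<lambda>y. f y * P (x - y))"
proof -
  obtain C where C: "0 \<le> C" "\<And>x y. x \<in> U \<Longrightarrow> y \<in> \<Omega> \<Longrightarrow> \<bar>P (x - y)\<bar> \<le> C"
    using kernel_bounded[OF P] by blast
  show ?thesis
  proof (rule Bochner_Integration.integrable_bound[of _ "\<lambda>y. C * f y"])
    show "AE y in lborel. norm (f y * P (x - y)) \<le> norm (C * f y)"
    proof (rule AE_I2)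
      fix y show "norm (f y * P (x - y)) \<le> norm (C * f y)"
        using C(1) C(2)[OF x, of y] f(2)[of y]
        by (cases "y \<in> \<Omega>") (auto simp: abs_mult mult.commute[of "\<bar>f y\<bar>"] intro!: mult_right_mono)
    qed
  qed (use f in auto)
qed

text \<open>The integral of the difference quotient vanishes for small steps since U is open. The
  mean value theorem dominates the quotient by a bound of Q, and dominated convergence gives the
  claim.\<close>

lemma differentiate_kernel:
  assumes P: "continuous_on (- {0}) P" "P \<in> borel_measurable borel"
    and Q: "continuous_on (- {0}) Q" "Q \<in> borel_measurable borel"
    and deriv: "\<And>z t. z + t *\<^sub>R e \<noteq> 0 \<Longrightarrow> ((\<lambda>t. P (z + t *\<^sub>R e)) has_real_derivative Q (z + t *\<^sub>R e)) (at t)"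
    and zero: "\<And>x. x \<in> U \<Longrightarrow> (LINT y|lborel. f y * P (x - y)) = 0" and x: "x \<in> U"
  shows "(LINT y|lborel. f y * Q (x - y)) = 0"
proof -
  note P(2)[measurable] Q(2)[measurable]
  obtain \<epsilon> where \<epsilon>: "\<epsilon> > 0" "ball x \<epsilon> \<subseteq> U" using U x open_contains_ball by blast
  define \<tau> where "\<tau> = \<epsilon> / (norm e + 1)"
  have e1: "0 < norm e + 1" by (simp add: add_nonneg_pos)
  have \<tau>: "\<tau> > 0" using \<epsilon> e1 by (simp add: \<tau>_def)
  have mem: "x + t *\<^sub>R e \<in> U" if "0 \<le> t" "t < \<tau>" for t
  proof -
    have "t * norm e \<le> t * (norm e + 1)" using that by (intro mult_left_mono) auto
    also have "\<dots> < \<epsilon>" using that e1 by (simp add: \<tau>_def pos_less_divide_eq)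
    finally show ?thesis using \<epsilon>(2) that by (auto simp: dist_norm)
  qed
  \<comment> \<open>The double \<open>Suc\<close> keeps every step strictly below \<tau>, inside the
    range where x + t e stays in U.\<close>
  define t where "t n = \<tau> * inverse (real (Suc (Suc n)))" for n
  have t: "0 < t n" "t n < \<tau>" for n
  proof -
    have "inverse (real (Suc (Suc n))) < 1" by (subst inverse_less_1_iff) auto
    then show "0 < t n" "t n < \<tau>" using \<tau> by (auto simp: t_def)
  qed
  have t0: "t \<longlonglongrightarrow> 0"
    using tendsto_mult[OF tendsto_const[of \<tau>] LIMSEQ_Suc[OF LIMSEQ_inverse_real_of_nat]] by (simp add: t_def[abs_def])
  have nz: "x + t *\<^sub>R e - y \<noteq> 0" if "0 \<le> t" "t < \<tau>" "y \<in> \<Omega>" for t y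
    using sep[OF mem[OF that(1,2)] that(3)] d by auto
  have deriv': "((\<lambda>t. P (x - y + t *\<^sub>R e)) has_real_derivative Q (x - y + t *\<^sub>R e)) (at t)"
    if "0 \<le> t" "t < \<tau>" "y \<in> \<Omega>" for t y
    using nz[OF that] by (intro deriv) (simp add: algebra_simps)
  obtain C where C: "0 \<le> C" "\<And>x y. x \<in> U \<Longrightarrow> y \<in> \<Omega> \<Longrightarrow> \<bar>Q (x - y)\<bar> \<le> C"
    using kernel_bounded[OF Q(1)] by blast
  define q where "q n y = f y * ((P (x + t n *\<^sub>R e - y) - P (x - y)) / t n)" for n y
  have "(\<lambda>n. LINT y|lborel. q n y) \<longlonglongrightarrow> (LINT y|lborel. f y * Q (x - y))"
  proof (rule integral_dominated_convergence[where w = "\<lambda>y. C * \<bar>f y\<bar>"])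
    show "(\<lambda>y. f y * Q (x - y)) \<in> borel_measurable lborel" by measurable
    show "q n \<in> borel_measurable lborel" for n unfolding q_def by measurable
    show "integrable lborel (\<lambda>y. C * \<bar>f y\<bar>)" using f by auto
    show "AE y in lborel. (\<lambda>n. q n y) \<longlonglongrightarrow> f y * Q (x - y)"
    proof (rule AE_I2)
      fix y
      show "(\<lambda>n. q n y) \<longlonglongrightarrow> f y * Q (x - y)"
      proof (cases "y \<in> \<Omega>")
        case True
        have "((\<lambda>h. (P (x - y + h *\<^sub>R e) - P (x - y)) / h) \<longlongrightarrow> Q (x - y)) (at 0)"
          using deriv'[OF order_refl \<tau> True] unfolding DERIV_def by simp
        moreover have "filterlim t (at 0) sequentially"
          using t0 t(1) by (auto simp: filterlim_at intro!: always_eventually) (metis less_irrefl)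
        ultimately have "(\<lambda>n. (P (x - y + t n *\<^sub>R e) - P (x - y)) / t n) \<longlonglongrightarrow> Q (x - y)"
          by (rule filterlim_compose)
        then show ?thesis unfolding q_def by (intro tendsto_mult tendsto_const) (simp add: algebra_simps)
      qed (simp add: q_def f)
    qed
    show "AE y in lborel. norm (q n y) \<le> C * \<bar>f y\<bar>" for n
    proof (rule AE_I2)
      fix y
      show "norm (q n y) \<le> C * \<bar>f y\<bar>"
      proof (cases "y \<in> \<Omega>")
        case True
        obtain z where z: "0 < z" "z < t n"
          "P (x - y + t n *\<^sub>R e) - P (x - y + 0 *\<^sub>R e) = (t n - 0) * Q (x - y + z *\<^sub>R e)"
          using MVT2[of 0 "t n" "\<lambda>t. P (x - y + t *\<^sub>R e)" "\<lambda>t. Q (x - y + t *\<^sub>R e)"] deriv'[OF _ _ True] t[of n]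
          by force
        have "q n y = f y * Q (x + z *\<^sub>R e - y)"
          using z(3) t(1)[of n] by (simp add: q_def algebra_simps)
        moreover have "\<bar>Q (x + z *\<^sub>R e - y)\<bar> \<le> C" using z t(2)[of n] by (intro C(2) mem True) auto
        ultimately show ?thesis by (simp add: abs_mult mult.commute[of C] mult_left_mono)
      qed (simp add: q_def f)
    qed
  qed
  moreover have "(LINT y|lborel. q n y) = 0" for n
  proof -
    have m: "x + t n *\<^sub>R e \<in> U" using t[of n] by (intro mem) auto
    have "q n y = (f y * P (x + t n *\<^sub>R e - y) - f y * P (x - y)) * inverse (t n)" for y
      by (simp add: q_def algebra_simps divide_inverse)
    then show ?thesis
      using kernel_integrable[OF P m] kernel_integrable[OF P x] zero[OF m] zero[OF x] by simp
  qed
  ultimately show ?thesis by (simp add: LIMSEQ_const_iff)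
qed

text \<open>The kernel |z|^(- 2 a). Written with the inner product it is a power of a polynomial,
  and raising a by 1 raises the exponent of 1/|z| by 2.\<close>

definition rad :: "real \<Rightarrow> 'a \<Rightarrow> real" where "rad a z = (z \<bullet> z) powr (- a)"

lemma rad_measurable [measurable]: "rad a \<in> borel_measurable borel"
  unfolding rad_def by measurable

lemma rad_continuous: "continuous_on (- {0}) (rad a)"
  unfolding rad_def[abs_def] by (intro continuous_intros) auto

lemma rad_mult: "z \<noteq> 0 \<Longrightarrow> (z \<bullet> z) * rad (a + 1) z = rad a z"
proof -
  assume "z \<noteq> 0"
  then have "(z \<bullet> z) * rad (a + 1) z = (z \<bullet> z) powr 1 * (z \<bullet> z) powr (- (a + 1))" by (simp add: rad_def)
  also have "\<dots> = rad a z" unfolding powr_add[symmetric] by (simp add: rad_def)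
  finally show ?thesis .
qed

lemma rad_deriv:
  assumes "z + t *\<^sub>R e \<noteq> 0"
  shows "((\<lambda>t. rad a (z + t *\<^sub>R e)) has_real_derivative - 2 * a * ((z + t *\<^sub>R e) \<bullet> e) * rad (a + 1) (z + t *\<^sub>R e)) (at t)"
proof -
  have pos: "(z + t *\<^sub>R e) \<bullet> (z + t *\<^sub>R e) > 0" using assms by simp
  have g: "((\<lambda>t. (z + t *\<^sub>R e) \<bullet> (z + t *\<^sub>R e)) has_real_derivative 2 * ((z + t *\<^sub>R e) \<bullet> e)) (at t)"
  proof -
    have eq: "(\<lambda>t. (z + t *\<^sub>R e) \<bullet> (z + t *\<^sub>R e)) = (\<lambda>t. z \<bullet> z + t * (2 * (z \<bullet> e)) + t * t * (e \<bullet> e))"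
      by (auto simp: inner_simps inner_commute algebra_simps)
    show ?thesis unfolding eq by (auto intro!: derivative_eq_intros simp: inner_simps algebra_simps)
  qed
  have e: "- a - 1 = - (a + 1)" by simp
  show ?thesis
    using DERIV_chain2[OF has_real_derivative_powr[OF pos, of "- a"] g] unfolding rad_def e by (simp only: mult_ac mult_minus_left mult_minus_right)
qed

text \<open>The Laplacian of |z|^(- 2 a) is 2 a (2 a + 2 - N) |z|^(- 2 a - 2) away from the origin.
  The hypotheses on a make the factor nonzero, so the vanishing passes on to the next power.\<close>

lemma rad_iterate:
  assumes a: "2 * a + 2 > real (DIM('a))" "a > 0"
    and zero: "\<And>x. x \<in> U \<Longrightarrow> (LINT y|lborel. f y * rad a (x - y)) = 0" and x: "x \<in> U"
  shows "(LINT y|lborel. f y * rad (a + 1) (x - y)) = 0"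
proof -
  \<comment> \<open>Q1 and Q2 are the first and second derivatives of \<open>rad a\<close> in
    direction e.\<close>
  define Q1 where "Q1 e z = - 2 * a * (z \<bullet> e) * rad (a + 1) z" for e z
  define Q2 where "Q2 e z = - 2 * a * ((e \<bullet> e) * rad (a + 1) z - 2 * (a + 1) * (z \<bullet> e)\<^sup>2 * rad (a + 2) z)" for e z
  have Q1c: "continuous_on (- {0}) (Q1 e)" "Q1 e \<in> borel_measurable borel" for e
    unfolding Q1_def[abs_def] by (intro continuous_intros rad_continuous, measurable)
  have Q2c: "continuous_on (- {0}) (Q2 e)" "Q2 e \<in> borel_measurable borel" for e
    unfolding Q2_def[abs_def] by (intro continuous_intros rad_continuous, measurable)
  have 1: "(LINT y|lborel. f y * Q1 e (x - y)) = 0" if "x \<in> U" for x e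
    using differentiate_kernel[OF rad_continuous rad_measurable Q1c, of e] rad_deriv zero that
    unfolding Q1_def by blast
  have d2: "((\<lambda>t. Q1 e (z + t *\<^sub>R e)) has_real_derivative Q2 e (z + t *\<^sub>R e)) (at t)" if "z + t *\<^sub>R e \<noteq> 0" for z t e
  proof -
    have l: "((\<lambda>t. (z + t *\<^sub>R e) \<bullet> e) has_real_derivative e \<bullet> e) (at t)"
      by (auto intro!: derivative_eq_intros simp: inner_simps)
    have r: "((\<lambda>t. rad (a + 1) (z + t *\<^sub>R e)) has_real_derivative
        - 2 * (a + 1) * ((z + t *\<^sub>R e) \<bullet> e) * rad (a + 2) (z + t *\<^sub>R e)) (at t)"
      using rad_deriv[OF that, of "a + 1"] by (simp add: add.assoc)
    show ?thesis unfolding Q1_def Q2_def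
      by (rule derivative_eq_intros l r refl)+ (simp add: algebra_simps power2_eq_square)
  qed
  have 2: "(LINT y|lborel. f y * Q2 e (x - y)) = 0" for e
    using differentiate_kernel[OF Q1c Q2c d2 1 x] by blast
  have lap: "(\<Sum>e\<in>Basis. Q2 e z) = 2 * a * (2 * a + 2 - real (DIM('a))) * rad (a + 1) z" if "z \<noteq> 0" for z
  proof -
    have "(\<Sum>e\<in>Basis. Q2 e z) = (\<Sum>e\<in>Basis. - 2 * a * rad (a + 1) z + 4 * a * (a + 1) * rad (a + 2) z * (z \<bullet> e)\<^sup>2)"
      by (rule sum.cong) (auto simp: Q2_def algebra_simps)
    also have "\<dots> = - 2 * a * rad (a + 1) z * real (DIM('a)) + 4 * a * (a + 1) * rad (a + 2) z * (\<Sum>e\<in>Basis. (z \<bullet> e)\<^sup>2)"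
      unfolding sum.distrib sum_distrib_left by simp
    also have "(\<Sum>e\<in>Basis. (z \<bullet> e)\<^sup>2) = z \<bullet> z"
      by (simp add: euclidean_inner[of z z] power2_eq_square)
    also have "4 * a * (a + 1) * rad (a + 2) z * (z \<bullet> z) = 4 * a * (a + 1) * rad (a + 1) z"
      using rad_mult[OF that, of "a + 1"] by (simp add: add.assoc mult.commute mult.left_commute)
    finally show ?thesis by (simp add: algebra_simps)
  qed
  have "0 = (\<Sum>e\<in>Basis. LINT y|lborel. f y * Q2 e (x - y))" by (simp add: 2)
  also have "\<dots> = (LINT y|lborel. (\<Sum>e\<in>Basis. f y * Q2 e (x - y)))"
    by (rule Bochner_Integration.integral_sum[symmetric]) (intro kernel_integrable Q2c x)
  also have "\<dots> = (LINT y|lborel. 2 * a * (2 * a + 2 - real (DIM('a))) * (f y * rad (a + 1) (x - y)))"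
  proof (rule Bochner_Integration.integral_cong[OF refl])
    fix y
    show "(\<Sum>e\<in>Basis. f y * Q2 e (x - y)) = 2 * a * (2 * a + 2 - real (DIM('a))) * (f y * rad (a + 1) (x - y))"
    proof (cases "y \<in> \<Omega>")
      case True
      then have "x - y \<noteq> 0" using sep[OF x True] d by auto
      then show ?thesis unfolding sum_distrib_left[symmetric] lap[OF \<open>x - y \<noteq> 0\<close>] by simp
    qed (simp add: f)
  qed
  also have "\<dots> = 2 * a * (2 * a + 2 - real (DIM('a))) * (LINT y|lborel. f y * rad (a + 1) (x - y))" by simp
  finally show ?thesis using a by auto
qed

lemma rad_all:
  assumes a: "2 * a + 2 > real (DIM('a))" "a > 0"
    and zero: "\<And>x. x \<in> U \<Longrightarrow> (LINT y|lborel. f y * rad a (x - y)) = 0"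
  shows "x \<in> U \<Longrightarrow> (LINT y|lborel. f y * rad (a + real k) (x - y)) = 0"
proof (induction k arbitrary: x)
  case 0
  then show ?case using zero by simp
next
  case (Suc k)
  have "(LINT y|lborel. f y * rad (a + real k + 1) (x - y)) = 0"
    by (rule rad_iterate[OF _ _ Suc.IH Suc.prems]) (use a in auto)
  then show ?case by (simp add: algebra_simps)
qed

text \<open>With u = |x - y|^(-2), which ranges over a compact interval away from 0, the Gaussian is
  u^a h(u), where h(u) = u^(- a) exp (- c / u). Replacing h by a polynomial gives a combination of
  the kernels with exponents a + i, each of which integrates to zero.\<close>

lemma gaussian_orthogonal:
  assumes zero: "\<And>k. (LINT y|lborel. f y * rad (a + real k) (x - y)) = 0" and x: "x \<in> U" and R: "0 < R"
  shows "(LINT y|lborel. f y * exp (- c * (norm (x - y))\<^sup>2)) = 0"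
proof -
  define \<alpha> \<beta> where "\<alpha> = inverse (R\<^sup>2)" and "\<beta> = inverse (d\<^sup>2)"
  have \<alpha>: "\<alpha> > 0" using R by (simp add: \<alpha>_def)
  define h where "h u = u powr (- a) * exp (- c / u)" for u :: real
  have hc: "continuous_on {\<alpha>..\<beta>} h" unfolding h_def[abs_def] using \<alpha> by (intro continuous_intros) auto
  have ec: "continuous_on (- {0}) (\<lambda>z::'a. exp (- c * (norm z)\<^sup>2))" "(\<lambda>z::'a. exp (- c * (norm z)\<^sup>2)) \<in> borel_measurable borel"
    by (intro continuous_intros, measurable)
  obtain C where C: "0 \<le> C" "\<And>x y. x \<in> U \<Longrightarrow> y \<in> \<Omega> \<Longrightarrow> \<bar>rad a (x - y)\<bar> \<le> C"
    using kernel_bounded[OF rad_continuous] by blast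
  define I where "I = (LINT y|lborel. \<bar>f y\<bar>)"
  have I: "0 \<le> I" by (simp add: I_def)
  have small: "\<bar>LINT y|lborel. f y * exp (- c * (norm (x - y))\<^sup>2)\<bar> \<le> e * (C * I)" if e: "e > 0" for e
  proof -
    obtain g where g: "real_polynomial_function g" "\<And>u. u \<in> {\<alpha>..\<beta>} \<Longrightarrow> \<bar>h u - g u\<bar> < e"
      using Stone_Weierstrass_real_polynomial_function[OF _ hc e] by auto
    then obtain b n where b: "g = (\<lambda>u. \<Sum>i\<le>n. b i * u ^ i)" by (auto simp: real_polynomial_function_iff_sum)
    define G where "G z = (\<Sum>i\<le>n. b i * rad (a + real i) z)" for z
    have Gc: "continuous_on (- {0}) G" "G \<in> borel_measurable borel"
      unfolding G_def[abs_def] by (intro continuous_intros rad_continuous, measurable)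
    have "(LINT y|lborel. f y * G (x - y)) = (LINT y|lborel. (\<Sum>i\<le>n. b i * (f y * rad (a + real i) (x - y))))"
      by (simp add: G_def sum_distrib_left mult_ac)
    also have "\<dots> = (\<Sum>i\<le>n. LINT y|lborel. b i * (f y * rad (a + real i) (x - y)))"
      by (rule Bochner_Integration.integral_sum)
        (intro integrable_mult_right kernel_integrable rad_continuous rad_measurable x)
    also have "\<dots> = 0" by (simp add: zero)
    finally have G0: "(LINT y|lborel. f y * G (x - y)) = 0" .
    have "(LINT y|lborel. f y * exp (- c * (norm (x - y))\<^sup>2)) =
        (LINT y|lborel. f y * exp (- c * (norm (x - y))\<^sup>2) - f y * G (x - y))"
      using kernel_integrable[OF ec x] kernel_integrable[OF Gc x] G0 by simp
    also have "\<bar>\<dots>\<bar> \<le> (LINT y|lborel. e * C * \<bar>f y\<bar>)"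
    proof (rule order_trans[OF integral_abs_bound integral_mono])
      show "integrable lborel (\<lambda>y. \<bar>f y * exp (- c * (norm (x - y))\<^sup>2) - f y * G (x - y)\<bar>)"
        using kernel_integrable[OF ec x] kernel_integrable[OF Gc x] by auto
      show "integrable lborel (\<lambda>y. e * C * \<bar>f y\<bar>)" using f by auto
      fix y
      show "\<bar>f y * exp (- c * (norm (x - y))\<^sup>2) - f y * G (x - y)\<bar> \<le> e * C * \<bar>f y\<bar>"
      proof (cases "y \<in> \<Omega>")
        case True
        define r where "r = norm (x - y)"
        have r: "d \<le> r" "r \<le> R" using sep[OF x True] by (auto simp: r_def)
        then have r0: "r > 0" using d by simp
        define u where "u = inverse (r\<^sup>2)"
        have u: "u \<in> {\<alpha>..\<beta>}" unfolding u_def \<alpha>_def \<beta>_def using r d r0 by (auto intro!: le_imp_inverse_le power_mono)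
        have u0: "u > 0" using r0 by (simp add: u_def)
        have rad: "rad (a + real i) (x - y) = rad a (x - y) * u ^ i" for i
        proof -
          have "rad (a + real i) (x - y) = (r\<^sup>2) powr (- a) * (r\<^sup>2) powr (- real i)"
            unfolding rad_def power2_norm_eq_inner[symmetric] r_def[symmetric] powr_add[symmetric] by simp
          also have "(r\<^sup>2) powr (- real i) = u ^ i"
            using r0 by (simp add: u_def powr_minus powr_realpow power_inverse)
          finally show ?thesis unfolding rad_def power2_norm_eq_inner[symmetric] r_def[symmetric] .
        qed
        have Gu: "G (x - y) = rad a (x - y) * g u"
          unfolding G_def rad b by (simp add: sum_distrib_left mult_ac)
        have radu: "rad a (x - y) = u powr a"
          unfolding rad_def power2_norm_eq_inner[symmetric] r_def[symmetric] u_def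
          using r0 by (simp add: powr_minus inverse_powr)
        have "exp (- c * r\<^sup>2) = rad a (x - y) * h u"
          using u0 r0 unfolding radu h_def by (simp add: powr_add[symmetric] mult.assoc[symmetric] u_def divide_inverse)
        then have "f y * exp (- c * (norm (x - y))\<^sup>2) - f y * G (x - y) = f y * (rad a (x - y) * (h u - g u))"
          unfolding Gu r_def by (simp add: algebra_simps)
        also have "\<bar>\<dots>\<bar> = \<bar>f y\<bar> * (\<bar>rad a (x - y)\<bar> * \<bar>h u - g u\<bar>)" by (simp add: abs_mult)
        also have "\<dots> \<le> \<bar>f y\<bar> * (C * e)"
          using C(1) C(2)[OF x True] g(2)[OF u] by (intro mult_left_mono mult_mono) auto
        finally show ?thesis by (simp add: mult_ac)
      qed (simp add: f)
    qed
    also have "\<dots> = e * (C * I)" by (simp add: I_def)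
    finally show ?thesis .
  qed
  have "\<bar>LINT y|lborel. f y * exp (- c * (norm (x - y))\<^sup>2)\<bar> \<le> 0"
  proof (rule field_le_epsilon)
    fix e :: real assume "e > 0"
    have CI: "0 \<le> C * I" using C I by simp
    have "\<bar>LINT y|lborel. f y * exp (- c * (norm (x - y))\<^sup>2)\<bar> \<le> e / (C * I + 1) * (C * I)"
      using \<open>e > 0\<close> CI by (intro small) auto
    also have "\<dots> \<le> e / (C * I + 1) * (C * I + 1)" using \<open>e > 0\<close> CI by (intro mult_left_mono) auto
    also have "\<dots> = e" using CI by simp
    finally show "\<bar>LINT y|lborel. f y * exp (- c * (norm (x - y))\<^sup>2)\<bar> \<le> 0 + e" by simp
  qed
  then show ?thesis by simp
qed

end

text \<open>Finite sums of scaled Gaussians with centres in U; c = 0 contributes the constants.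
  Products are not built in, they stay in the set by completing the square.\<close>

inductive_set gaussians :: "'a::euclidean_space set \<Rightarrow> ('a \<Rightarrow> real) set" for U where
  gaussian: "0 \<le> c \<Longrightarrow> x \<in> U \<Longrightarrow> (\<lambda>y. a * exp (- c * (norm (x - y))\<^sup>2)) \<in> gaussians U"
| gaussian_add: "g \<in> gaussians U \<Longrightarrow> h \<in> gaussians U \<Longrightarrow> (\<lambda>y. g y + h y) \<in> gaussians U"

text \<open>Completing the square: the new centre is the mean of the two centres with weights c and
  e, and the remaining exponent does not depend on y.\<close>

lemma gaussian_mult:
  fixes x y z :: "'a::euclidean_space"
  assumes "0 < c + e"
  shows "exp (- c * (norm (x - y))\<^sup>2) * exp (- e * (norm (z - y))\<^sup>2) =
    exp (- (c * e / (c + e)) * (norm (x - z))\<^sup>2) *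
    exp (- (c + e) * (norm ((1 / (c + e)) *\<^sub>R (c *\<^sub>R x + e *\<^sub>R z) - y))\<^sup>2)"
proof -
  define m where "m = (1 / (c + e)) *\<^sub>R (c *\<^sub>R x + e *\<^sub>R z)"
  have m: "(c + e) *\<^sub>R m = c *\<^sub>R x + e *\<^sub>R z" using assms by (simp add: m_def)
  have mm: "(c + e) * (m \<bullet> v) = c * (x \<bullet> v) + e * (z \<bullet> v)" for v
    using arg_cong[OF m, of "\<lambda>w. w \<bullet> v"] by (simp add: inner_simps)
  have "(c + e) * ((c + e) * (m \<bullet> m)) = c * (c * (x \<bullet> x) + e * (z \<bullet> x)) + e * (c * (x \<bullet> z) + e * (z \<bullet> z))"
    using mm[of m] mm[of x] mm[of z] by (simp add: inner_commute distrib_left mult.left_commute)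
  then have "(c + e) * (c * (x \<bullet> x) + e * (z \<bullet> z)) - (c + e) * ((c + e) * (m \<bullet> m)) = c * e * ((x - z) \<bullet> (x - z))"
    by (simp add: inner_simps inner_commute algebra_simps)
  then have "c * (x \<bullet> x) + e * (z \<bullet> z) - (c + e) * (m \<bullet> m) = c * e / (c + e) * ((x - z) \<bullet> (x - z))"
    using assms by (simp add: field_simps)
  moreover have "c * ((x - y) \<bullet> (x - y)) + e * ((z - y) \<bullet> (z - y)) - (c + e) * ((m - y) \<bullet> (m - y)) =
      c * (x \<bullet> x) + e * (z \<bullet> z) - (c + e) * (m \<bullet> m)"
    using mm[of y] by (simp add: inner_simps inner_commute algebra_simps)
  ultimately have "c * (norm (x - y))\<^sup>2 + e * (norm (z - y))\<^sup>2 = c * e / (c + e) * (norm (x - z))\<^sup>2 + (c + e) * (norm (m - y))\<^sup>2"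
    unfolding power2_norm_eq_inner by linarith
  then show ?thesis unfolding m_def[symmetric] exp_add[symmetric] by (simp add: algebra_simps)
qed

text \<open>The centre of a product is a weighted mean of centres, which is why U has to be convex.
  When both rates are zero there is no mean, but the product is a constant.\<close>

lemma gaussians_mult:
  assumes U: "convex U" and "g \<in> gaussians U" "h \<in> gaussians U"
  shows "(\<lambda>y. g y * h y) \<in> gaussians U"
  using assms(2)
proof induction
  case (gaussian c x a)
  note cx = gaussian
  show ?case using assms(3)
  proof induction
    case (gaussian e z b)
    show ?case
    proof (cases "c + e = 0")
      case True
      then have "c = 0" "e = 0" using cx gaussian by auto
      then show ?thesis using gaussians.gaussian[OF order_refl cx(2), of "a * b"] by simp
    next
      case False
      then have ce: "c + e > 0" using cx gaussian by auto
      have "(1 / (c + e)) *\<^sub>R (c *\<^sub>R x + e *\<^sub>R z) = (c / (c + e)) *\<^sub>R x + (e / (c + e)) *\<^sub>R z"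
        by (simp add: scaleR_add_right)
      also have "\<dots> \<in> U" using cx gaussian ce
        by (intro convexD[OF U]) (auto simp: add_divide_distrib[symmetric])
      finally have "(\<lambda>y. (a * b * exp (- (c * e / (c + e)) * (norm (x - z))\<^sup>2)) *
          exp (- (c + e) * (norm ((1 / (c + e)) *\<^sub>R (c *\<^sub>R x + e *\<^sub>R z) - y))\<^sup>2)) \<in> gaussians U"
        using ce by (intro gaussians.gaussian) auto
      note mem = this
      have eq: "a * exp (- c * (norm (x - y))\<^sup>2) * (b * exp (- e * (norm (z - y))\<^sup>2)) =
          (a * b * exp (- (c * e / (c + e)) * (norm (x - z))\<^sup>2)) *
          exp (- (c + e) * (norm ((1 / (c + e)) *\<^sub>R (c *\<^sub>R x + e *\<^sub>R z) - y))\<^sup>2)" for y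
      proof -
        have "a * exp (- c * (norm (x - y))\<^sup>2) * (b * exp (- e * (norm (z - y))\<^sup>2)) =
            a * b * (exp (- c * (norm (x - y))\<^sup>2) * exp (- e * (norm (z - y))\<^sup>2))"
          by (simp only: mult_ac)
        then show ?thesis unfolding gaussian_mult[OF ce, of x y z] by (simp only: mult.assoc)
      qed
      show ?thesis unfolding eq by (rule mem)
    qed
  next
    case (gaussian_add g h)
    then show ?case using gaussians.gaussian_add by (force simp: distrib_left)
  qed
next
  case (gaussian_add g' h')
  then show ?case using gaussians.gaussian_add by (force simp: distrib_right)
qed

lemma gaussians_continuous: "g \<in> gaussians U \<Longrightarrow> continuous_on A g"
  by (induction rule: gaussians.induct) (auto intro!: continuous_intros)

text \<open>Two centres x and w in U are chosen with w - x parallel to y - z. If y and z were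
  equidistant from both, w - x would be orthogonal to y - z.\<close>

lemma gaussians_separate:
  assumes U: "open U" "U \<noteq> {}" and y: "y \<noteq> z"
  shows "\<exists>g\<in>gaussians U. g y \<noteq> g z"
proof -
  obtain x where x: "x \<in> U" using U by blast
  obtain \<epsilon> where \<epsilon>: "\<epsilon> > 0" "ball x \<epsilon> \<subseteq> U" using U x open_contains_ball by blast
  define w where "w = x + (\<epsilon> / (2 * norm (y - z))) *\<^sub>R (y - z)"
  have w: "w \<in> U" using \<epsilon> y by (auto simp: w_def dist_norm intro!: subsetD[OF \<epsilon>(2)])
  have "norm (x - y) \<noteq> norm (x - z) \<or> norm (w - y) \<noteq> norm (w - z)"
  proof (rule ccontr)
    assume "\<not> ?thesis"
    then have eq: "(x - y) \<bullet> (x - y) = (x - z) \<bullet> (x - z)" "(w - y) \<bullet> (w - y) = (w - z) \<bullet> (w - z)"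
      unfolding power2_norm_eq_inner[symmetric] by auto
    then have "(w - x) \<bullet> (y - z) = 0" by (simp add: inner_simps inner_commute algebra_simps)
    then have "\<epsilon> / (2 * norm (y - z)) * ((y - z) \<bullet> (y - z)) = 0" by (simp add: w_def)
    then show False using \<epsilon> y by simp
  qed
  then obtain v where v: "v \<in> U" "norm (v - y) \<noteq> norm (v - z)" using x w by blast
  have "(\<lambda>y. 1 * exp (- 1 * (norm (v - y))\<^sup>2)) \<in> gaussians U" using v by (intro gaussians.gaussian) auto
  moreover have "1 * exp (- 1 * (norm (v - y))\<^sup>2) \<noteq> 1 * exp (- 1 * (norm (v - z))\<^sup>2)"
    using v by (simp add: power2_eq_iff_nonneg)
  ultimately show ?thesis by (intro bexI[of _ "\<lambda>y. 1 * exp (- 1 * (norm (v - y))\<^sup>2)"])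
qed

text \<open>The density vanishes outside \<Omega>, so uniform approximation on the compact closure
  of \<Omega> suffices, and there the algebra of Gaussians is dense by Stone--Weierstrass.\<close>

lemma (in separated_density) orthogonal_continuous:
  assumes \<Omega>: "bounded \<Omega>" and R: "0 < R" and Uc: "convex U" "U \<noteq> {}" and a: "2 * a + 2 > real (DIM('a))" "a > 0"
    and zero: "\<And>x. x \<in> U \<Longrightarrow> (LINT y|lborel. f y * rad a (x - y)) = 0"
    and h: "continuous_on UNIV h"
  shows "(LINT y|lborel. f y * h y) = 0"
proof -
  have g0: "integrable lborel (\<lambda>y. f y * g y) \<and> (LINT y|lborel. f y * g y) = 0" if "g \<in> gaussians U" for g
    using that
  proof induction
    case (gaussian c x b)
    have "integrable lborel (\<lambda>y. f y * exp (- c * (norm (x - y))\<^sup>2))"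
      by (rule kernel_integrable[OF _ _ gaussian(2)]) (intro continuous_intros, measurable)
    then have "integrable lborel (\<lambda>y. b * (f y * exp (- c * (norm (x - y))\<^sup>2)))" by simp
    moreover have "(LINT y|lborel. b * (f y * exp (- c * (norm (x - y))\<^sup>2))) = 0"
      using gaussian_orthogonal[OF rad_all[OF a zero gaussian(2)] gaussian(2) R] by simp
    moreover have "(\<lambda>y. b * (f y * exp (- c * (norm (x - y))\<^sup>2))) = (\<lambda>y. f y * (b * exp (- c * (norm (x - y))\<^sup>2)))"
      by auto
    ultimately show ?case by (simp only:)
  next
    case (gaussian_add g h)
    then show ?case by (auto simp: distrib_left)
  qed
  let ?K = "closure \<Omega>"
  interpret function_ring_on "gaussians U" ?K
  proof
    show "compact ?K" using \<Omega> by (simp add: compact_closure)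
    show "(\<lambda>_. c) \<in> gaussians U" for c
      using Uc(2) gaussians.gaussian[OF order_refl, of _ U c] by auto
    show "\<exists>g\<in>gaussians U. g x \<noteq> g y" if "x \<noteq> y" for x y using gaussians_separate[OF U Uc(2) that] .
  qed (auto intro: gaussians_continuous gaussians_mult[OF Uc(1)] gaussians.gaussian_add)
  define I where "I = (LINT y|lborel. \<bar>f y\<bar>)"
  have I: "0 \<le> I" by (simp add: I_def)
  have hK: "continuous_on ?K h" by (rule continuous_on_subset[OF h]) auto
  have [measurable]: "h \<in> borel_measurable borel" using h by (rule borel_measurable_continuous_onI)
  have "compact (h ` ?K)" using \<Omega> hK by (intro compact_continuous_image) (auto simp: compact_closure)
  then obtain C where C: "\<And>y. y \<in> ?K \<Longrightarrow> \<bar>h y\<bar> \<le> C"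
    using compact_imp_bounded[THEN bounded_iff[THEN iffD1]] by (metis image_eqI real_norm_def)
  have hi: "integrable lborel (\<lambda>y. f y * h y)"
  proof (rule Bochner_Integration.integrable_bound[of _ "\<lambda>y. C * f y"])
    show "AE y in lborel. norm (f y * h y) \<le> norm (C * f y)"
    proof (rule AE_I2)
      fix y show "norm (f y * h y) \<le> norm (C * f y)"
        using C[of y] f(2)[of y] closure_subset[of \<Omega>]
        by (cases "y \<in> \<Omega>") (auto simp: abs_mult mult.commute[of "\<bar>f y\<bar>"] intro!: mult_right_mono)
    qed
  qed (use f in auto)
  have small: "\<bar>LINT y|lborel. f y * h y\<bar> \<le> e * I" if e: "e > 0" for e
  proof -
    obtain g where g: "g \<in> gaussians U" "\<And>y. y \<in> ?K \<Longrightarrow> \<bar>h y - g y\<bar> < e"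
      using Stone_Weierstrass_basic[OF hK e] by blast
    note gi = g0[OF g(1)]
    have "(LINT y|lborel. f y * h y) = (LINT y|lborel. f y * h y - f y * g y)" using hi gi by simp
    also have "\<bar>\<dots>\<bar> \<le> (LINT y|lborel. e * \<bar>f y\<bar>)"
    proof (rule order_trans[OF integral_abs_bound integral_mono])
      show "integrable lborel (\<lambda>y. \<bar>f y * h y - f y * g y\<bar>)" using hi gi by auto
      show "integrable lborel (\<lambda>y. e * \<bar>f y\<bar>)" using f by auto
      fix y
      show "\<bar>f y * h y - f y * g y\<bar> \<le> e * \<bar>f y\<bar>"
      proof (cases "y \<in> \<Omega>")
        case True
        then have "\<bar>h y - g y\<bar> \<le> e" using g(2)[of y] closure_subset[of \<Omega>] by force
        then show ?thesis unfolding right_diff_distrib[symmetric] abs_mult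
          by (simp add: mult.commute[of e] mult_left_mono)
      qed (simp add: f)
    qed
    also have "\<dots> = e * I" by (simp add: I_def)
    finally show ?thesis .
  qed
  have "\<bar>LINT y|lborel. f y * h y\<bar> \<le> 0"
  proof (rule field_le_epsilon)
    fix e :: real assume "e > 0"
    have "\<bar>LINT y|lborel. f y * h y\<bar> \<le> e / (I + 1) * I" using \<open>e > 0\<close> I by (intro small) auto
    also have "\<dots> \<le> e / (I + 1) * (I + 1)" using \<open>e > 0\<close> I by (intro mult_left_mono) auto
    also have "\<dots> = e" using I by simp
    finally show "\<bar>LINT y|lborel. f y * h y\<bar> \<le> 0 + e" by simp
  qed
  then show ?thesis by simp
qed

section \<open>The source term of an exterior control\<close>

text \<open>The derivative is 0 on the negative half-line and bounded on the compact interval up to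
  \<rho>, so a bound from above on the arguments is enough.\<close>

lemma bump_Lipschitz:
  "\<exists>L\<ge>0. \<forall>a b. a \<le> \<rho> \<longrightarrow> b \<le> \<rho> \<longrightarrow> \<bar>bump a - bump b\<bar> \<le> L * \<bar>a - b\<bar>"
proof -
  define D where "D = flat ([:0, 0, 1:] * (1 - pderiv 1))"
  have D: "(bump has_real_derivative D z) (at z)" for z
    unfolding bump_def D_def by (rule flat_has_derivative)
  have "continuous_on UNIV D"
    unfolding D_def by (rule DERIV_continuous_on) (rule has_field_derivative_at_within[OF flat_has_derivative])
  then have "compact (D ` {0..\<rho>})" by (intro compact_continuous_image) (auto intro: continuous_on_subset)
  then obtain C where C: "\<And>z. z \<in> {0..\<rho>} \<Longrightarrow> \<bar>D z\<bar> \<le> C"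
    using compact_imp_bounded[THEN bounded_iff[THEN iffD1]] by (metis image_eqI real_norm_def)
  have C': "\<bar>D z\<bar> \<le> max C 0" if "z \<le> \<rho>" for z
    using C[of z] that by (cases "z > 0") (auto simp: D_def flat_def)
  have less: "\<bar>bump a - bump b\<bar> \<le> max C 0 * \<bar>a - b\<bar>" if ab: "a < b" "b \<le> \<rho>" for a b
  proof -
    obtain z where z: "a < z" "z < b" "bump b - bump a = (b - a) * D z"
      using MVT2[OF ab(1), of bump D] D by blast
    then have "\<bar>bump a - bump b\<bar> = \<bar>a - b\<bar> * \<bar>D z\<bar>"
      by (simp add: abs_minus_commute[of "bump a"] abs_minus_commute[of a] abs_mult)
    also have "\<dots> \<le> \<bar>a - b\<bar> * max C 0" using z ab by (intro mult_left_mono C') auto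
    finally show ?thesis by (simp add: mult.commute)
  qed
  have "\<bar>bump a - bump b\<bar> \<le> max C 0 * \<bar>a - b\<bar>" if "a \<le> \<rho>" "b \<le> \<rho>" for a b
    using less[of a b] less[of b a] that
    by (cases a b rule: linorder_cases) (auto simp: abs_minus_commute)
  then show ?thesis by (intro exI[of _ "max C 0"]) auto
qed

definition spatial_bump :: "'a::real_normed_vector \<Rightarrow> real \<Rightarrow> 'a \<Rightarrow> real" where
  "spatial_bump c r x = bump (r\<^sup>2 - (norm (x - c))\<^sup>2)"

lemma spatial_bump_nonneg: "0 \<le> spatial_bump c r x"
  by (simp add: spatial_bump_def bump_nonneg)

lemma spatial_bump_le_1: "spatial_bump c r x \<le> 1"
  by (simp add: spatial_bump_def bump_def flat_def)

lemma spatial_bump_nonzero_iff: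
  assumes "0 \<le> r" shows "spatial_bump c r x \<noteq> 0 \<longleftrightarrow> norm (x - c) < r"
  using power_mono_iff[OF assms norm_ge_zero, of 2 "x - c"]
  unfolding spatial_bump_def bump_nonzero_iff by (simp add: not_le[symmetric])

lemma bump_continuous: "continuous_on A bump"
  unfolding bump_def by (rule DERIV_continuous_on) (rule has_field_derivative_at_within[OF flat_has_derivative])

lemma spatial_bump_continuous: "continuous_on A (spatial_bump c r)"
  unfolding spatial_bump_def[abs_def]
  by (rule continuous_on_compose2[OF bump_continuous[of UNIV]]) (auto intro!: continuous_intros)

lemma spatial_bump_measurable [measurable]:
  "spatial_bump (c::'a::euclidean_space) r \<in> borel_measurable borel"
  by (intro borel_measurable_continuous_onI spatial_bump_continuous)

lemma spatial_bump_integrable: 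
  fixes c :: "'a::euclidean_space"
  assumes "0 \<le> r" shows "integrable lborel (spatial_bump c r)"
proof (rule Bochner_Integration.integrable_bound)
  show "integrable lborel (indicator (cball c r) :: 'a \<Rightarrow> real)"
    using emeasure_bounded_finite[of "cball c r"] by (intro integrable_real_indicator) auto
  show "AE x in lborel. norm (spatial_bump c r x) \<le> norm (indicator (cball c r) x :: real)"
  proof (rule AE_I2)
    fix x
    show "norm (spatial_bump c r x) \<le> norm (indicator (cball c r) x :: real)"
      using spatial_bump_nonzero_iff[OF assms, of c x] spatial_bump_nonneg[of c r x] spatial_bump_le_1[of c r x]
      by (cases "x \<in> cball c r") (auto simp: dist_norm norm_minus_commute)
  qed
qed simp

lemma spatial_bump_sobolev:
  fixes c :: "real^'n"
  assumes s: "0 < s" "s < 1" and r: "0 \<le> r"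
  shows "spatial_bump c r \<in> sobolev s"
proof -
  obtain L where L: "L \<ge> 0" "\<And>a b. a \<le> r\<^sup>2 \<Longrightarrow> b \<le> r\<^sup>2 \<Longrightarrow> \<bar>bump a - bump b\<bar> \<le> L * \<bar>a - b\<bar>"
    using bump_Lipschitz[of "r\<^sup>2"] by blast
  \<comment> \<open>Truncating the distance at r leaves the bump unchanged, since it vanishes from
    there on, and makes the squared distance globally Lipschitz.\<close>
  define m where "m x = min (norm (x - c)) r" for x
  have eq: "spatial_bump c r x = bump (r\<^sup>2 - (m x)\<^sup>2)" for x
  proof (cases "norm (x - c) \<le> r")
    case False
    then have "spatial_bump c r x = 0" using spatial_bump_nonzero_iff[OF r, of c x] by auto
    moreover have "m x = r" using False by (simp add: m_def)
    ultimately show ?thesis by (simp add: bump_def flat_def)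
  qed (simp add: m_def spatial_bump_def)
  have Lip: "\<bar>spatial_bump c r x - spatial_bump c r y\<bar> \<le> L * (2 * r) * norm (x - y)" for x y
  proof -
    have m: "0 \<le> m x" "m x \<le> r" "0 \<le> m y" "m y \<le> r" using r by (auto simp: m_def)
    have "\<bar>m x - m y\<bar> \<le> \<bar>norm (x - c) - norm (y - c)\<bar>" unfolding m_def by linarith
    also have "\<dots> \<le> norm (x - y)" using norm_triangle_ineq3[of "x - c" "y - c"] by simp
    finally have mm: "\<bar>m x - m y\<bar> \<le> norm (x - y)" .
    have "\<bar>spatial_bump c r x - spatial_bump c r y\<bar> \<le> L * \<bar>(r\<^sup>2 - (m x)\<^sup>2) - (r\<^sup>2 - (m y)\<^sup>2)\<bar>"
      unfolding eq by (intro L) auto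
    also have "(r\<^sup>2 - (m x)\<^sup>2) - (r\<^sup>2 - (m y)\<^sup>2) = (m y + m x) * (m y - m x)"
      by (simp add: power2_eq_square algebra_simps)
    also have "L * \<bar>(m y + m x) * (m y - m x)\<bar> \<le> L * ((2 * r) * norm (x - y))"
      unfolding abs_mult using m mm L by (intro mult_left_mono mult_mono) auto
    finally show ?thesis by (simp add: mult.assoc)
  qed
  have "spatial_bump c r x = 0" if "norm x \<ge> norm c + r" for x
    using spatial_bump_nonzero_iff[OF r, of c x] norm_triangle_sub[of x c] that by force
  moreover have "\<bar>spatial_bump c r x\<bar> \<le> 1" for x
    using spatial_bump_nonneg[of c r x] spatial_bump_le_1[of c r x] by simp
  ultimately show ?thesis
    using Lipschitz_imp_sobolev[OF s spatial_bump_measurable Lip] by blast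
qed

lemma integrable_tensor:
  fixes f g :: "'a::euclidean_space \<Rightarrow> real"
  assumes f: "integrable lborel f" and g: "integrable lborel g"
  shows "integrable (lborel \<Otimes>\<^sub>M lborel) (\<lambda>p. f (fst p) * g (snd p))"
proof (rule lborel_pair.Fubini_integrable)
  have [measurable]: "f \<in> borel_measurable lborel" "g \<in> borel_measurable lborel" using f g by auto
  show "(\<lambda>p. f (fst p) * g (snd p)) \<in> borel_measurable (lborel \<Otimes>\<^sub>M lborel)" by measurable
  show "integrable lborel (\<lambda>x. LINT y|lborel. norm (f (fst (x, y)) * g (snd (x, y))))"
    using f by (simp add: abs_mult)
  show "AE x in lborel. integrable lborel (\<lambda>y. f (fst (x, y)) * g (snd (x, y)))"
    using g by simp
qed

context frac_dirichlet
begin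

definition frac_order :: real where "frac_order = real CARD('n) + 2 * s"

definition source :: "real^'n \<Rightarrow> real \<Rightarrow> real^'n \<Rightarrow> real" where
  "source c r y = frac_const CARD('n) s * indicator \<Omega> y *
     (LINT x|lborel. spatial_bump c r x / norm (x - y) powr frac_order)"

lemma frac_order_pos: "frac_order > 0"
  using s by (simp add: frac_order_def add_nonneg_pos)

lemma measurable_kernel [measurable]:
  "(\<lambda>p::(real^'n) \<times> (real^'n). norm (fst p - snd p) powr frac_order) \<in> borel_measurable (lborel \<Otimes>\<^sub>M lborel)"
  by measurable

text \<open>The separation bounds the kernel, so Fubini applies. The identity is used twice: with a
  Sobolev test function to compute the forcing, and with an orthogonal density for unique
  continuation.\<close>

lemma kernel_tensor:
  fixes g :: "real^'n \<Rightarrow> real"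
  assumes r: "0 \<le> r" and g: "integrable lborel g" "\<And>y. y \<notin> \<Omega> \<Longrightarrow> g y = 0" and d: "0 < d"
    and sep: "\<And>x y. x \<in> cball c r \<Longrightarrow> y \<in> \<Omega> \<Longrightarrow> d \<le> norm (x - y)"
  shows "integrable (lborel \<Otimes>\<^sub>M lborel) (\<lambda>(x, y). spatial_bump c r x * g y / norm (x - y) powr frac_order)"
    "(LINT (x, y)|(lborel \<Otimes>\<^sub>M lborel). spatial_bump c r x * g y / norm (x - y) powr frac_order) * frac_const CARD('n) s
      = (LINT y|lborel. source c r y * g y)"
proof -
  have gm [measurable]: "g \<in> borel_measurable lborel" using g by auto
  show int: "integrable (lborel \<Otimes>\<^sub>M lborel) (\<lambda>(x, y). spatial_bump c r x * g y / norm (x - y) powr frac_order)"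
  proof (rule Bochner_Integration.integrable_bound)
    show "integrable (lborel \<Otimes>\<^sub>M lborel) (\<lambda>p. d powr (- frac_order) * (spatial_bump c r (fst p) * g (snd p)))"
      by (intro integrable_mult_right integrable_tensor spatial_bump_integrable r g)
    show "(\<lambda>(x, y). spatial_bump c r x * g y / norm (x - y) powr frac_order) \<in> borel_measurable (lborel \<Otimes>\<^sub>M lborel)"
      unfolding case_prod_beta' by measurable
    show "AE p in lborel \<Otimes>\<^sub>M lborel. norm (case p of (x, y) \<Rightarrow> spatial_bump c r x * g y / norm (x - y) powr frac_order)
        \<le> norm (d powr (- frac_order) * (spatial_bump c r (fst p) * g (snd p)))"
    proof (rule AE_I2)
      fix p :: "(real^'n) \<times> (real^'n)"
      obtain x y where p: "p = (x, y)" by (cases p)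
      show "norm (case p of (x, y) \<Rightarrow> spatial_bump c r x * g y / norm (x - y) powr frac_order)
        \<le> norm (d powr (- frac_order) * (spatial_bump c r (fst p) * g (snd p)))"
      proof (cases "x \<in> cball c r \<and> y \<in> \<Omega>")
        case True
        have "norm (x - y) powr (- frac_order) \<le> d powr (- frac_order)"
          using sep[of x y] True d frac_order_pos by (intro powr_mono2') auto
        then have "norm (x - y) powr (- frac_order) * \<bar>spatial_bump c r x * g y\<bar> \<le> d powr (- frac_order) * \<bar>spatial_bump c r x * g y\<bar>"
          by (rule mult_right_mono) simp
        then show ?thesis by (simp add: p abs_mult powr_minus_divide)
      next
        case False
        then have "spatial_bump c r x * g y = 0"
          using g(2)[of y] spatial_bump_nonzero_iff[OF r, of c x] by (auto simp: dist_norm norm_minus_commute)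
        then show ?thesis by (simp only: p prod.case fst_conv snd_conv) simp
      qed
    qed
  qed
  have "(LINT (x, y)|(lborel \<Otimes>\<^sub>M lborel). spatial_bump c r x * g y / norm (x - y) powr frac_order)
      = (LINT y|lborel. LINT x|lborel. spatial_bump c r x * g y / norm (x - y) powr frac_order)"
    by (rule lborel_pair.integral_snd[OF int, symmetric])
  also have "\<dots> = (LINT y|lborel. (LINT x|lborel. spatial_bump c r x / norm (x - y) powr frac_order) * g y)"
  proof (rule Bochner_Integration.integral_cong[OF refl])
    fix y
    have "(\<lambda>x. spatial_bump c r x * g y / norm (x - y) powr frac_order) = (\<lambda>x. spatial_bump c r x / norm (x - y) powr frac_order * g y)"
      by auto
    then show "(LINT x|lborel. spatial_bump c r x * g y / norm (x - y) powr frac_order) =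
        (LINT x|lborel. spatial_bump c r x / norm (x - y) powr frac_order) * g y"
      by (simp only: integral_mult_left_zero)
  qed
  also have "\<dots> * frac_const CARD('n) s = (LINT y|lborel. source c r y * g y)"
  proof (rule trans[OF integral_mult_left_zero[symmetric] Bochner_Integration.integral_cong[OF refl]])
    fix y show "(LINT x|lborel. spatial_bump c r x / norm (x - y) powr frac_order) * g y * frac_const CARD('n) s = source c r y * g y"
      using g(2)[of y] by (cases "y \<in> \<Omega>") (auto simp: source_def)
  qed
  finally show "(LINT (x, y)|(lborel \<Otimes>\<^sub>M lborel). spatial_bump c r x * g y / norm (x - y) powr frac_order) * frac_const CARD('n) s
      = (LINT y|lborel. source c r y * g y)" .
qed

lemma square_integrable_source:
  assumes r: "0 \<le> r" and d: "0 < d"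
    and sep: "\<And>x y. x \<in> cball c r \<Longrightarrow> y \<in> \<Omega> \<Longrightarrow> d \<le> norm (x - y)"
  shows "square_integrable (source c r)"
proof -
  define M where "M = frac_const CARD('n) s * (d powr (- frac_order) * (LINT x|lborel. spatial_bump c r x))"
  have [measurable]: "source c r \<in> borel_measurable lborel"
    unfolding source_def by measurable
  show ?thesis
  proof (rule square_integrable_bound[OF _ square_integrable_scale[OF square_integrable_indicator_bounded[OF sets_domain bounded_domain], of M]])
    show "AE y in lborel. \<bar>source c r y\<bar> \<le> \<bar>M * indicator \<Omega> y\<bar>"
    proof (rule AE_I2)
      fix y
      show "\<bar>source c r y\<bar> \<le> \<bar>M * indicator \<Omega> y\<bar>"
      proof (cases "y \<in> \<Omega>")
        case True
        have le: "spatial_bump c r x / norm (x - y) powr frac_order \<le> d powr (- frac_order) * spatial_bump c r x" for x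
        proof (cases "x \<in> cball c r")
          case x: True
          have "norm (x - y) powr (- frac_order) \<le> d powr (- frac_order)"
            using sep[OF x True] d frac_order_pos by (intro powr_mono2') auto
          from mult_right_mono[OF this spatial_bump_nonneg[of c r x]] show ?thesis
            by (simp add: powr_minus_divide)
        next
          case False
          then have "spatial_bump c r x = 0"
            using spatial_bump_nonzero_iff[OF r, of c x] by (auto simp: dist_norm norm_minus_commute)
          then show ?thesis by simp
        qed
        have int: "integrable lborel (\<lambda>x. d powr (- frac_order) * spatial_bump c r x)"
          by (intro integrable_mult_right spatial_bump_integrable r)
        have nn: "0 \<le> spatial_bump c r x / norm (x - y) powr frac_order" for x
          by (simp add: spatial_bump_nonneg)
        have "integrable lborel (\<lambda>x. spatial_bump c r x / norm (x - y) powr frac_order)"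
          by (rule Bochner_Integration.integrable_bound[OF int])
            (measurable, rule AE_I2, metis abs_ge_self abs_of_nonneg le nn order_trans real_norm_def)
        from integral_mono[OF this int le]
        have "(LINT x|lborel. spatial_bump c r x / norm (x - y) powr frac_order) \<le> d powr (- frac_order) * (LINT x|lborel. spatial_bump c r x)"
          by simp
        moreover have "0 \<le> (LINT x|lborel. spatial_bump c r x / norm (x - y) powr frac_order)"
          by (intro Bochner_Integration.integral_nonneg nn)
        ultimately have "\<bar>source c r y\<bar> \<le> M"
          using True frac_const_pos[OF s, of "CARD('n)"] by (simp add: source_def M_def)
        then show ?thesis using True by simp
      qed (simp add: source_def)
    qed
  qed simp
qed

text \<open>The supports are disjoint, so of the product of differences only the two mixed terms
  survive. They have equal integrals by the exchange of x and y, which cancels the factor 1/2 and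
  leaves the minus sign.\<close>

lemma frac_laplacian_spatial_bump:
  assumes r: "0 \<le> r" and d: "0 < d"
    and sep: "\<And>x y. x \<in> cball c r \<Longrightarrow> y \<in> \<Omega> \<Longrightarrow> d \<le> norm (x - y)"
    and \<zeta>: "\<zeta> \<in> sobolev0 s \<Omega>"
  shows "frac_laplacian s (spatial_bump c r) \<zeta> = - (LINT y|lborel. source c r y * \<zeta> y)"
proof -
  let ?\<psi> = "spatial_bump c r"
  \<comment> \<open>A version of the test function that vanishes everywhere outside \<Omega>, not
    merely almost everywhere, so that mixed products can be handled pointwise.\<close>
  define g where "g y = \<zeta> y * indicator \<Omega> y" for y
  have g: "integrable lborel g" "\<And>y. y \<notin> \<Omega> \<Longrightarrow> g y = 0"
    unfolding g_def by (intro square_integrable_mult_integrable sobolev0D(3)[OF \<zeta>] square_integrable_indicator_bounded[OF sets_domain bounded_domain]) auto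
  have [measurable]: "g \<in> borel_measurable lborel" "\<zeta> \<in> borel_measurable lborel"
    using g sobolev0D(3)[OF \<zeta>] by (auto dest: square_integrable_borel)
  have gz: "AE x in lborel. \<zeta> x = g x"
    using sobolev0D(2)[OF \<zeta>] by eventually_elim (auto simp: g_def)
  define F where "F p = ?\<psi> (fst p) * g (snd p) / norm (fst p - snd p) powr frac_order" for p
  define G where "G p = F (snd p, fst p)" for p
  note int = kernel_tensor[where c = c, OF r g d sep]
  have F: "integrable (lborel \<Otimes>\<^sub>M lborel) F" "integral\<^sup>L (lborel \<Otimes>\<^sub>M lborel) F * frac_const CARD('n) s = (LINT y|lborel. source c r y * g y)"
    using int by (simp_all add: F_def[abs_def] case_prod_beta')
  have G: "integrable (lborel \<Otimes>\<^sub>M lborel) G" "integral\<^sup>L (lborel \<Otimes>\<^sub>M lborel) G = integral\<^sup>L (lborel \<Otimes>\<^sub>M lborel) F"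
    using lborel_pair.integrable_product_swap[OF F(1)] lborel_pair.integral_product_swap[OF borel_measurable_integrable[OF F(1)]]
    by (simp_all add: G_def[abs_def] case_prod_beta')
  have \<psi>g: "?\<psi> x * g x = 0" for x
    using sep[of x x] d g(2)[of x] spatial_bump_nonzero_iff[OF r, of c x]
    by (cases "x \<in> \<Omega>") (auto simp: dist_norm norm_minus_commute)
  have "(LINT p|(lborel \<Otimes>\<^sub>M lborel). (?\<psi> (fst p) - ?\<psi> (snd p)) * (\<zeta> (fst p) - \<zeta> (snd p)) / norm (fst p - snd p) powr frac_order)
      = (LINT p|(lborel \<Otimes>\<^sub>M lborel). - F p - G p)"
  proof (rule integral_cong_AE)
    show "AE p in lborel \<Otimes>\<^sub>M lborel. (?\<psi> (fst p) - ?\<psi> (snd p)) * (\<zeta> (fst p) - \<zeta> (snd p)) / norm (fst p - snd p) powr frac_order = - F p - G p"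
      unfolding lborel_prod using AE_lborel_fst[OF gz] AE_lborel_snd[OF gz]
    proof eventually_elim
      case (elim p)
      have "(?\<psi> (fst p) - ?\<psi> (snd p)) * (g (fst p) - g (snd p)) = - (?\<psi> (fst p) * g (snd p)) - ?\<psi> (snd p) * g (fst p)"
      proof -
        have "(?\<psi> (fst p) - ?\<psi> (snd p)) * (g (fst p) - g (snd p)) =
            ?\<psi> (fst p) * g (fst p) + ?\<psi> (snd p) * g (snd p) - ?\<psi> (fst p) * g (snd p) - ?\<psi> (snd p) * g (fst p)"
          by (simp add: algebra_simps)
        then show ?thesis unfolding \<psi>g by simp
      qed
      then show ?case unfolding elim
        by (simp add: F_def G_def diff_divide_distrib norm_minus_commute[of "snd p"])
    qed
    show "(\<lambda>p. - F p - G p) \<in> borel_measurable (lborel \<Otimes>\<^sub>M lborel)" using F(1) G(1) by auto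
  qed measurable
  also have "\<dots> = - 2 * integral\<^sup>L (lborel \<Otimes>\<^sub>M lborel) F" using F(1) G by simp
  finally have "frac_laplacian s ?\<psi> \<zeta> = - (integral\<^sup>L (lborel \<Otimes>\<^sub>M lborel) F * frac_const CARD('n) s)"
    unfolding frac_laplacian_def frac_order_def by (simp add: case_prod_beta')
  also have "\<dots> = - (LINT y|lborel. source c r y * g y)" by (simp only: F)
  also have "(LINT y|lborel. source c r y * g y) = (LINT y|lborel. source c r y * \<zeta> y)"
    by (rule Bochner_Integration.integral_cong) (auto simp: g_def source_def indicator_def)
  finally show ?thesis .
qed

text \<open>By Fubini, orthogonality to the sources says that the potential \<Phi> of \<phi> has
  zero integral against all small bumps. As \<Phi> is continuous, it vanishes on the ball, and the
  Gaussian argument applies with kernel exponent 2 a = N + 2 s.\<close>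

lemma source_unique_continuation:
  assumes \<phi>: "\<phi> \<in> Lset" and \<rho>: "0 < \<rho>" and d: "0 < d" and R: "0 < R"
    and sep: "\<And>x y. x \<in> ball x0 \<rho> \<Longrightarrow> y \<in> \<Omega> \<Longrightarrow> d \<le> norm (x - y) \<and> norm (x - y) \<le> R"
    and orth: "\<And>c r. 0 < r \<Longrightarrow> cball c r \<subseteq> ball x0 \<rho> \<Longrightarrow> (LINT y|lborel. source c r y * rep_l2 \<phi> y) = 0"
  shows "\<phi> = 0"
proof -
  define f where "f y = rep_l2 \<phi> y * indicator \<Omega> y" for y
  define a where "a = frac_order / 2"
  have fint: "integrable lborel f" and f0: "\<And>y. y \<notin> \<Omega> \<Longrightarrow> f y = 0"
    unfolding f_def by (intro square_integrable_mult_integrable rep_l2 square_integrable_indicator_bounded[OF sets_domain bounded_domain]) auto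
  interpret separated_density f "ball x0 \<rho>" \<Omega> d R
    by unfold_locales (use fint f0 d sep in auto)
  have rad: "rad a z = 1 / norm z powr frac_order" for z
  proof -
    have "rad a z = (norm z * norm z) powr (- (frac_order / 2))"
      by (simp add: rad_def a_def power2_norm_eq_inner[symmetric] power2_eq_square)
    also have "\<dots> = norm z powr (- (frac_order / 2)) * norm z powr (- (frac_order / 2))"
      by (rule powr_mult)
    also have "\<dots> = norm z powr (- frac_order)" by (simp add: powr_add[symmetric])
    finally show ?thesis by (simp add: powr_minus_divide)
  qed
  define \<Phi> where "\<Phi> x = (LINT y|lborel. f y * rad a (x - y))" for x
  obtain C where C: "0 \<le> C" "\<And>x y. x \<in> ball x0 \<rho> \<Longrightarrow> y \<in> \<Omega> \<Longrightarrow> \<bar>rad a (x - y)\<bar> \<le> C"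
    using kernel_bounded[OF rad_continuous] by blast
  have cont: "continuous_on (ball x0 \<rho>) \<Phi>"
    unfolding continuous_on_sequentially
  proof (intro allI ballI impI, elim conjE)
    fix X x assume x: "x \<in> ball x0 \<rho>" and X: "\<forall>n. X n \<in> ball x0 \<rho>" "X \<longlonglongrightarrow> x"
    show "(\<Phi> \<circ> X) \<longlonglongrightarrow> \<Phi> x"
      unfolding \<Phi>_def o_def
    proof (rule integral_dominated_convergence[where w = "\<lambda>y. C * \<bar>f y\<bar>"])
      show "AE y in lborel. (\<lambda>n. f y * rad a (X n - y)) \<longlonglongrightarrow> f y * rad a (x - y)"
      proof (rule AE_I2)
        fix y
        show "(\<lambda>n. f y * rad a (X n - y)) \<longlonglongrightarrow> f y * rad a (x - y)"
        proof (cases "y \<in> \<Omega>")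
          case True
          then have "x - y \<in> - {0}" using sep[OF x True] d by auto
          then have "isCont (rad a) (x - y)"
            using rad_continuous[of a] continuous_on_eq_continuous_at[of "- {0}" "rad a"] by (simp add: open_Compl)
          then have "(\<lambda>n. rad a (X n - y)) \<longlonglongrightarrow> rad a (x - y)"
            by (rule isCont_tendsto_compose) (intro tendsto_intros X)
          then show ?thesis by (intro tendsto_intros)
        qed (simp add: f0)
      qed
      show "AE y in lborel. norm (f y * rad a (X n - y)) \<le> C * \<bar>f y\<bar>" for n
      proof (rule AE_I2)
        fix y show "norm (f y * rad a (X n - y)) \<le> C * \<bar>f y\<bar>"
          using C(2)[OF X(1)[rule_format], of y n] f0[of y]
          by (cases "y \<in> \<Omega>") (auto simp: abs_mult mult.commute[of C] intro!: mult_left_mono)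
      qed
    qed (use fint in auto)
  qed
  have zero: "\<Phi> x = 0" if x: "x \<in> ball x0 \<rho>" for x
  proof (rule ccontr)
    assume nz: "\<Phi> x \<noteq> 0"
    \<comment> \<open>Multiplied by its sign at x, the potential is positive on a whole ball around
      x, and a bump supported there detects it.\<close>
    define \<sigma> where "\<sigma> = sgn (\<Phi> x)"
    have "open (ball x0 \<rho> \<inter> (\<lambda>z. \<sigma> * \<Phi> z) -` {0<..})"
      by (intro continuous_open_preimage continuous_intros cont) auto
    moreover have "x \<in> ball x0 \<rho> \<inter> (\<lambda>z. \<sigma> * \<Phi> z) -` {0<..}"
      using x nz by (auto simp: \<sigma>_def sgn_if)
    ultimately obtain r where r: "r > 0" "cball x r \<subseteq> ball x0 \<rho> \<inter> (\<lambda>z. \<sigma> * \<Phi> z) -` {0<..}"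
      using open_contains_cball by blast
    then have r0: "0 \<le> r" by simp
    have sepr: "d \<le> norm (z - y)" if "z \<in> cball x r" "y \<in> \<Omega>" for z y using sep[of z y] r that by blast
    have pos: "0 < \<sigma> * \<Phi> z" if "z \<in> cball x r" for z using r(2) that by auto
    note T = kernel_tensor[where c = x, OF r0 fint f0 d sepr]
    have "(LINT y|lborel. source x r y * f y) = (LINT y|lborel. source x r y * rep_l2 \<phi> y)"
      by (rule Bochner_Integration.integral_cong) (auto simp: f_def source_def indicator_def)
    also have "\<dots> = 0" by (rule orth) (use r in auto)
    finally have "(LINT (z, y)|(lborel \<Otimes>\<^sub>M lborel). spatial_bump x r z * f y / norm (z - y) powr frac_order) = 0"
      using T(2) frac_const_pos[OF s, of "CARD('n)"] by simp
    moreover have inner: "(LINT y|lborel. spatial_bump x r z * f y / norm (z - y) powr frac_order) = spatial_bump x r z * \<Phi> z" for z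
    proof -
      have "(\<lambda>y. spatial_bump x r z * f y / norm (z - y) powr frac_order) = (\<lambda>y. spatial_bump x r z * (f y * rad a (z - y)))"
        by (simp add: rad)
      then show ?thesis unfolding \<Phi>_def by (simp only: integral_mult_right_zero)
    qed
    ultimately have int0: "(LINT z|lborel. spatial_bump x r z * \<Phi> z) = 0"
      using lborel_pair.integral_fst[OF T(1)] by simp
    have int: "integrable lborel (\<lambda>z. spatial_bump x r z * \<Phi> z)"
      using lborel_pair.integrable_fst[OF T(1)] unfolding inner .
    have nn: "0 \<le> \<sigma> * (spatial_bump x r z * \<Phi> z)" for z
    proof (cases "z \<in> cball x r")
      case True
      then show ?thesis using mult_nonneg_nonneg[OF spatial_bump_nonneg[of x r z] less_imp_le[OF pos[OF True]]]
        by (simp add: mult.left_commute)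
    next
      case False
      then have "spatial_bump x r z = 0" using spatial_bump_nonzero_iff[OF r0, of x z] by (auto simp: dist_norm norm_minus_commute)
      then show ?thesis by simp
    qed
    have "AE z in lborel. \<sigma> * (spatial_bump x r z * \<Phi> z) = 0"
      using integral_nonneg_eq_0_iff_AE[of lborel "\<lambda>z. \<sigma> * (spatial_bump x r z * \<Phi> z)"] int int0 nn by simp
    then have "AE z in lborel. z \<notin> ball x r"
    proof eventually_elim
      case (elim z)
      show ?case
      proof
        assume z: "z \<in> ball x r"
        then have "spatial_bump x r z \<noteq> 0" using spatial_bump_nonzero_iff[OF r0, of x z] by (simp add: dist_norm norm_minus_commute)
        moreover have "\<sigma> * \<Phi> z \<noteq> 0" using pos[of z] z by auto
        ultimately show False using elim by auto
      qed
    qed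
    then have "emeasure lborel (ball x r) = 0" by (simp add: AE_iff_null_sets null_setsD1)
    moreover have "0 < unit_ball_vol (real CARD('n)) * r ^ CARD('n)"
      using r(1) by (intro mult_pos_pos unit_ball_vol_pos) auto
    ultimately show False using r(1) by (simp add: emeasure_ball ennreal_eq_0_iff)
  qed
  have "2 * a = real CARD('n) + 2 * s" unfolding a_def frac_order_def by simp
  moreover have "real DIM(real^'n) = real CARD('n)" by simp
  ultimately have a: "2 * a + 2 > real DIM(real^'n)" "a > 0"
    using s by linarith+
  show ?thesis
  proof (rule Lset_eq_0[OF \<phi>])
    fix K n
    have "(LINT y|lborel. f y * cutoff K n y) = 0"
      by (rule orthogonal_continuous[OF bounded_domain R convex_ball _ a zero[unfolded \<Phi>_def] cutoff_continuous])
        (use \<rho> in auto)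
    moreover have "(LINT y|lborel. f y * cutoff K n y) = (LINT y|lborel. rep_l2 \<phi> y * cutoff K n y)"
    proof (rule integral_cong_AE)
      show "AE y in lborel. f y * cutoff K n y = rep_l2 \<phi> y * cutoff K n y"
        using \<phi> unfolding Lset_def mem_Collect_eq by eventually_elim (auto simp: f_def indicator_def)
    qed (use borel_measurable_continuous_onI[OF cutoff_continuous[of UNIV K n]] in measurable)
    ultimately show "(LINT y|lborel. rep_l2 \<phi> y * cutoff K n y) = 0" by simp
  qed
qed

end

section \<open>Weak solutions\<close>

context positive_contraction
begin

text \<open>The bound on the second derivative is uniform in \<mu>, hence so is the error of the
  first-order Taylor expansion, and \<open>fcal_norm\<close> turns this uniform error into a norm
  estimate.\<close>

lemma fcal_curve_derivative:
  assumes T: "0 < T" and t: "t \<in> {0..T}"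
    and W: "\<And>n t \<mu>. t \<in> {0..T} \<Longrightarrow> \<mu> \<in> {0..1} \<Longrightarrow>
       ((\<lambda>t. W n t \<mu>) has_real_derivative W (Suc n) t \<mu>) (at t within {0..T})"
    and bound: "\<And>n. \<exists>D. \<forall>t\<in>{0..T}. \<forall>\<mu>\<in>{0..1}. \<bar>W n t \<mu>\<bar> \<le> D"
    and cont: "\<And>n t. t \<in> {0..T} \<Longrightarrow> continuous_on {0..1} (W n t)"
  shows "((\<lambda>t. fcal (W n t) x) has_vector_derivative fcal (W (Suc n) t) x) (at t within {0..T})"
proof -
  obtain D where D: "\<And>t \<mu>. t \<in> {0..T} \<Longrightarrow> \<mu> \<in> {0..1} \<Longrightarrow> \<bar>W (n + 2) t \<mu>\<bar> \<le> D" using bound by blast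
  have D0: "0 \<le> D" using D[OF t, of 0] by auto
  have lip: "\<bar>W (Suc n) r \<mu> - W (Suc n) t \<mu>\<bar> \<le> D * \<bar>r - t\<bar>" if "r \<in> {0..T}" "\<mu> \<in> {0..1}" for r \<mu>
    using field_differentiable_bound[of "{0..T}" "\<lambda>t. W (Suc n) t \<mu>" "\<lambda>t. W (n + 2) t \<mu>" D r t] W[of _ \<mu> "Suc n"] D that t
    by (simp add: convex_real_interval)
  have taylor: "\<bar>W n r \<mu> - W n t \<mu> - (r - t) * W (Suc n) t \<mu>\<bar> \<le> D * \<bar>r - t\<bar> * \<bar>r - t\<bar>"
    if r: "r \<in> {0..T}" and \<mu>: "\<mu> \<in> {0..1}" for r \<mu>
  proof -
    \<comment> \<open>The interval between r and t in either order, so that the derivative at its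
      points stays within distance |r - t| of t.\<close>
    let ?S = "{min r t..max r t}"
    have sub: "?S \<subseteq> {0..T}" using r t by auto
    have "norm ((\<lambda>\<xi>. W n \<xi> \<mu> - \<xi> * W (Suc n) t \<mu>) r - (\<lambda>\<xi>. W n \<xi> \<mu> - \<xi> * W (Suc n) t \<mu>) t) \<le> (D * \<bar>r - t\<bar>) * norm (r - t)"
    proof (rule field_differentiable_bound[of ?S _ "\<lambda>\<xi>. W (Suc n) \<xi> \<mu> - W (Suc n) t \<mu>"])
      fix \<xi> assume \<xi>: "\<xi> \<in> ?S"
      then have \<xi>T: "\<xi> \<in> {0..T}" using sub by blast
      show "((\<lambda>\<xi>. W n \<xi> \<mu> - \<xi> * W (Suc n) t \<mu>) has_real_derivative W (Suc n) \<xi> \<mu> - W (Suc n) t \<mu>) (at \<xi> within ?S)"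
        using DERIV_subset[OF W[OF \<xi>T \<mu>, of n] sub] by (auto intro!: derivative_eq_intros)
      have "\<bar>\<xi> - t\<bar> \<le> \<bar>r - t\<bar>" using \<xi> by auto
      then show "norm (W (Suc n) \<xi> \<mu> - W (Suc n) t \<mu>) \<le> D * \<bar>r - t\<bar>"
        using lip[OF \<xi>T \<mu>] mult_left_mono[OF _ D0] by fastforce
    qed (auto simp: convex_real_interval)
    then show ?thesis by (simp add: algebra_simps)
  qed
  have norm: "norm (fcal (W n r) x - fcal (W n t) x - (r - t) *\<^sub>R fcal (W (Suc n) t) x) \<le> D * \<bar>r - t\<bar> * \<bar>r - t\<bar> * norm x"
    if r: "r \<in> {0..T}" for r
  proof -
    have "fcal (W n r) x - fcal (W n t) x - (r - t) *\<^sub>R fcal (W (Suc n) t) x =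
        fcal (\<lambda>\<mu>. W n r \<mu> - W n t \<mu> - (r - t) * W (Suc n) t \<mu>) x"
      using r t by (simp add: fcal_diff fcal_scale cont continuous_on_diff continuous_on_mult_left)
    also have "norm \<dots> \<le> (D * \<bar>r - t\<bar> * \<bar>r - t\<bar>) * norm x"
      using r t by (intro fcal_norm taylor continuous_intros cont)
    finally show ?thesis .
  qed
  show ?thesis
    unfolding has_vector_derivative_def has_derivative_iff_norm
  proof
    show "((\<lambda>r. norm (fcal (W n r) x - fcal (W n t) x - (r - t) *\<^sub>R fcal (W (Suc n) t) x) / norm (r - t)) \<longlongrightarrow> 0) (at t within {0..T})"
    proof (rule Lim_null_comparison)
      show "\<forall>\<^sub>F r in at t within {0..T}. norm (norm (fcal (W n r) x - fcal (W n t) x - (r - t) *\<^sub>R fcal (W (Suc n) t) x) / norm (r - t))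
          \<le> D * \<bar>r - t\<bar> * norm x"
        unfolding eventually_at_filter
      proof (rule always_eventually, intro allI impI)
        fix r assume "r \<noteq> t" "r \<in> {0..T}"
        then show "norm (norm (fcal (W n r) x - fcal (W n t) x - (r - t) *\<^sub>R fcal (W (Suc n) t) x) / norm (r - t)) \<le> D * \<bar>r - t\<bar> * norm x"
          using norm[of r] by (simp add: divide_le_eq mult_ac)
      qed
      have "((\<lambda>r. D * \<bar>r - t\<bar> * norm x) \<longlongrightarrow> D * \<bar>t - t\<bar> * norm x) (at t within {0..T})" by (intro tendsto_intros)
      then show "((\<lambda>r. D * \<bar>r - t\<bar> * norm x) \<longlongrightarrow> 0) (at t within {0..T})" by simp
    qed
  qed (rule bounded_linear_scaleR_left)
qed

end

lemma test_functions_scale: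
  assumes "g \<in> test_functions W" shows "(\<lambda>z. c * g z) \<in> test_functions W"
proof (cases "c = 0")
  case True
  then show ?thesis by (simp add: test_functions_def k_times_cont_diff_const)
next
  case False
  then show ?thesis using assms
    by (auto simp: test_functions_def intro!: k_times_cont_diff_mult k_times_cont_diff_const)
qed

context frac_dirichlet
begin

lemma frac_laplacian_inner:
  fixes u v :: "real^'n \<Rightarrow> real"
  assumes "u \<in> sobolev s" "v \<in> sobolev s"
  shows "frac_laplacian s u v = mk_l2 (gagliardo s u) \<bullet> mk_l2 (gagliardo s v)"
  using inner_sobolev_embed[OF s assms] assms by (simp add: sobolev_iff[OF s] sobolev_embed_def inner_mk_l2)

lemma frac_laplacian_linear:
  fixes u v \<zeta> :: "real^'n \<Rightarrow> real"
  assumes "u \<in> sobolev s" "v \<in> sobolev s" "\<zeta> \<in> sobolev s"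
  shows "frac_laplacian s (\<lambda>x. u x + v x) \<zeta> = frac_laplacian s u \<zeta> + frac_laplacian s v \<zeta>"
    "frac_laplacian s (\<lambda>x. c * u x) \<zeta> = c * frac_laplacian s u \<zeta>"
proof -
  note sob = assms[unfolded sobolev_iff[OF s]]
  show "frac_laplacian s (\<lambda>x. u x + v x) \<zeta> = frac_laplacian s u \<zeta> + frac_laplacian s v \<zeta>"
    using sobolev_add(1)[OF s assms(1,2)] sob
    by (simp add: frac_laplacian_inner assms gagliardo_linear[abs_def] mk_l2_add inner_add_left)
  show "frac_laplacian s (\<lambda>x. c * u x) \<zeta> = c * frac_laplacian s u \<zeta>"
    using sobolev_scale(1)[OF s assms(1)] sob
    by (simp add: frac_laplacian_inner assms gagliardo_linear[abs_def] mk_l2_scale)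
qed

lemma inner_mk_sobolev0:
  assumes "\<zeta> \<in> sobolev0 s \<Omega>" shows "p \<bullet> mk_l2 \<zeta> = (LINT x|lborel. rep_l2 p x * \<zeta> x)"
  using inner_mk_l2[OF rep_l2(1) sobolev0D(3)[OF assms], of p] by (simp add: rep_l2)

lemma L2_to_dual_rep:
  assumes \<zeta>: "\<zeta> \<in> sobolev0 s \<Omega>" and f: "\<And>x. x \<in> \<Omega> \<Longrightarrow> f x = rep_l2 p x"
  shows "L2_to_dual \<Omega> f \<zeta> = p \<bullet> mk_l2 \<zeta>"
proof -
  have [measurable]: "\<zeta> \<in> borel_measurable borel" using sobolev0D(3)[OF \<zeta>] by (rule square_integrable_borel)
  show ?thesis
    unfolding L2_to_dual_def inner_mk_sobolev0[OF \<zeta>] set_lebesgue_integral_def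
  proof (rule trans[OF Bochner_Integration.integral_cong[OF refl] integral_cong_AE])
    show "indicat_real \<Omega> x *\<^sub>R (f x * \<zeta> x) = indicat_real \<Omega> x * (rep_l2 p x * \<zeta> x)" for x
      using f by (auto simp: indicator_def)
    show "AE x in lborel. indicat_real \<Omega> x * (rep_l2 p x * \<zeta> x) = rep_l2 p x * \<zeta> x"
      using sobolev0D(2)[OF \<zeta>] by eventually_elim (auto simp: indicator_def)
  qed measurable
qed

text \<open>Continuity and derivatives of curves in L2 carry over to the dual norm by the upper
  bound. The sign needs an argument because the norm is a supremum of reals: the set is bounded and
  contains the value at the zero function.\<close>

lemma dual_norm_inner:
  assumes "\<And>\<zeta>. \<zeta> \<in> sobolev0 s \<Omega> \<Longrightarrow> F \<zeta> = p \<bullet> mk_l2 \<zeta>"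
  shows "0 \<le> sobolev_dual_norm s \<Omega> F" "sobolev_dual_norm s \<Omega> F \<le> norm p"
proof -
  let ?A = "{\<zeta> \<in> sobolev0 s \<Omega>. sobolev_norm s \<zeta> \<le> 1}"
  have le: "\<bar>F \<zeta>\<bar> \<le> norm p" if "\<zeta> \<in> ?A" for \<zeta>
  proof -
    have "\<bar>p \<bullet> mk_l2 \<zeta>\<bar> \<le> norm p * norm (mk_l2 \<zeta>)" by (rule Cauchy_Schwarz_ineq2)
    also have "\<dots> \<le> norm p * 1"
      using norm_mk_le_sobolev_norm[of \<zeta>] that sobolev0D(1)[of \<zeta>] by (intro mult_left_mono) auto
    finally show ?thesis using assms that by simp
  qed
  have z: "(\<lambda>x. 0) \<in> ?A" using sobolev0_zero by (simp add: sobolev_norm_def case_prod_beta')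
  then have ne: "?A \<noteq> {}" by blast
  show "sobolev_dual_norm s \<Omega> F \<le> norm p"
    unfolding sobolev_dual_norm_def by (rule cSUP_least[OF ne le])
  have "\<bar>F (\<lambda>x. 0)\<bar> \<le> sobolev_dual_norm s \<Omega> F"
    unfolding sobolev_dual_norm_def by (rule cSUP_upper[OF z]) (use le in \<open>auto intro!: bdd_aboveI2\<close>)
  then show "0 \<le> sobolev_dual_norm s \<Omega> F" by simp
qed

lemma inner_mem_dual: "(\<lambda>\<zeta>. p \<bullet> mk_l2 \<zeta>) \<in> sobolev_dual s \<Omega>"
  unfolding sobolev_dual_def
proof (intro CollectI conjI ballI allI exI)
  fix \<zeta> assume z: "\<zeta> \<in> sobolev0 s \<Omega>"
  show "p \<bullet> mk_l2 (\<lambda>x. \<zeta> x + \<eta> x) = p \<bullet> mk_l2 \<zeta> + p \<bullet> mk_l2 \<eta>" if "\<eta> \<in> sobolev0 s \<Omega>" for \<eta>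
    using sobolev0D(3)[OF z] sobolev0D(3)[OF that] by (simp add: mk_l2_add inner_add_right)
  show "p \<bullet> mk_l2 (\<lambda>x. c * \<zeta> x) = c * (p \<bullet> mk_l2 \<zeta>)" for c
    using sobolev0D(3)[OF z] by (simp add: mk_l2_scale)
  have "\<bar>p \<bullet> mk_l2 \<zeta>\<bar> \<le> norm p * norm (mk_l2 \<zeta>)" by (rule Cauchy_Schwarz_ineq2)
  also have "\<dots> \<le> norm p * sobolev_norm s \<zeta>"
    using norm_mk_le_sobolev_norm[OF sobolev0D(1)[OF z]] by (intro mult_left_mono) auto
  finally show "\<bar>p \<bullet> mk_l2 \<zeta>\<bar> \<le> norm p * sobolev_norm s \<zeta>" .
qed

lemma dual_curve_continuous:
  assumes "continuous_on I p" "\<And>t \<zeta>. t \<in> I \<Longrightarrow> \<zeta> \<in> sobolev0 s \<Omega> \<Longrightarrow> F t \<zeta> = p t \<bullet> mk_l2 \<zeta>"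
  shows "curve_continuous_on (sobolev_dual_norm s \<Omega>) I F"
  unfolding curve_continuous_on_def
proof
  fix t assume t: "t \<in> I"
  show "((\<lambda>r. sobolev_dual_norm s \<Omega> (\<lambda>z. F r z - F t z)) \<longlongrightarrow> 0) (at t within I)"
  proof (rule Lim_null_comparison)
    show "\<forall>\<^sub>F r in at t within I. norm (sobolev_dual_norm s \<Omega> (\<lambda>z. F r z - F t z)) \<le> norm (p r - p t)"
      unfolding eventually_at_filter
    proof (rule always_eventually, intro allI impI)
      fix r assume "r \<in> I"
      then show "norm (sobolev_dual_norm s \<Omega> (\<lambda>z. F r z - F t z)) \<le> norm (p r - p t)"
        using dual_norm_inner[of "\<lambda>z. F r z - F t z" "p r - p t"] assms(2) t by (simp add: inner_diff_left)
    qed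
    have "((\<lambda>r. norm (p r - p t)) \<longlongrightarrow> norm (p t - p t)) (at t within I)"
      using assms(1) t by (intro tendsto_intros) (auto simp: continuous_on_def)
    then show "((\<lambda>r. norm (p r - p t)) \<longlongrightarrow> 0) (at t within I)" by simp
  qed
qed

lemma dual_curve_derivative:
  assumes "\<And>t. t \<in> I \<Longrightarrow> (p has_vector_derivative q t) (at t within I)"
    and "\<And>t \<zeta>. t \<in> I \<Longrightarrow> \<zeta> \<in> sobolev0 s \<Omega> \<Longrightarrow> F t \<zeta> = p t \<bullet> mk_l2 \<zeta>"
    and "\<And>t \<zeta>. t \<in> I \<Longrightarrow> \<zeta> \<in> sobolev0 s \<Omega> \<Longrightarrow> G t \<zeta> = q t \<bullet> mk_l2 \<zeta>"
  shows "curve_has_derivative_on (sobolev_dual_norm s \<Omega>) I F G"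
  unfolding curve_has_derivative_on_def
proof
  fix t assume t: "t \<in> I"
  show "((\<lambda>r. sobolev_dual_norm s \<Omega> (\<lambda>z. (F r z - F t z) / (r - t) - G t z)) \<longlongrightarrow> 0) (at t within I)"
  proof (rule Lim_null_comparison)
    show "\<forall>\<^sub>F r in at t within I. norm (sobolev_dual_norm s \<Omega> (\<lambda>z. (F r z - F t z) / (r - t) - G t z))
        \<le> norm (p r - p t - (r - t) *\<^sub>R q t) / norm (r - t)"
      unfolding eventually_at_filter
    proof (rule always_eventually, intro allI impI)
      fix r assume r: "r \<noteq> t" "r \<in> I"
      have "norm (sobolev_dual_norm s \<Omega> (\<lambda>z. (F r z - F t z) / (r - t) - G t z))
          \<le> norm ((1 / (r - t)) *\<^sub>R (p r - p t - (r - t) *\<^sub>R q t))"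
        using dual_norm_inner[of "\<lambda>z. (F r z - F t z) / (r - t) - G t z" "(1 / (r - t)) *\<^sub>R (p r - p t - (r - t) *\<^sub>R q t)"]
          assms(2,3) t r by (simp add: inner_diff_left diff_divide_distrib)
      then show "norm (sobolev_dual_norm s \<Omega> (\<lambda>z. (F r z - F t z) / (r - t) - G t z))
          \<le> norm (p r - p t - (r - t) *\<^sub>R q t) / norm (r - t)" by simp
    qed
    show "((\<lambda>r. norm (p r - p t - (r - t) *\<^sub>R q t) / norm (r - t)) \<longlongrightarrow> 0) (at t within I)"
      using assms(1)[OF t] unfolding has_vector_derivative_def has_derivative_iff_norm by blast
  qed
qed

lemma L2_norm_rep:
  assumes p: "p \<in> Lset" and f: "AE x in lborel. x \<in> \<Omega> \<longrightarrow> f x = rep_l2 p x" and m: "set_borel_measurable lborel \<Omega> f"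
  shows "L2_norm \<Omega> f = norm p"
proof -
  have [measurable]: "(\<lambda>x. indicator \<Omega> x * f x) \<in> borel_measurable lborel"
    using m by (simp add: set_borel_measurable_def)
  have "(LINT x:\<Omega>|lborel. (f x)\<^sup>2) = (LINT x|lborel. (indicator \<Omega> x * f x)\<^sup>2)"
    unfolding set_lebesgue_integral_def
    by (rule Bochner_Integration.integral_cong) (auto simp: indicator_def)
  also have "\<dots> = (LINT x|lborel. (rep_l2 p x)\<^sup>2)"
  proof (rule integral_cong_AE)
    show "AE x in lborel. (indicator \<Omega> x * f x)\<^sup>2 = (rep_l2 p x)\<^sup>2"
      using f p unfolding Lset_def mem_Collect_eq by eventually_elim (auto simp: indicator_def)
  qed measurable
  finally show ?thesis by (simp add: L2_norm_def norm_l2_rep[symmetric])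
qed

end

locale exterior_control = frac_dirichlet \<Omega> s for \<Omega> :: "(real^'n) set" and s +
  fixes \<O> :: "(real^'n) set" and \<delta> T :: real
  assumes \<O>: "open \<O>" "\<O> \<noteq> {}" "\<O> \<subseteq> - \<Omega>" and \<delta>: "0 \<le> \<delta>" and T: "0 < T"
begin

text \<open>\<open>w n\<close> is the \<open>n\<close>-th time derivative of the solution in \<open>\<Omega>\<close>, \<open>g'\<close> is the time derivative of the control
  \<open>g\<close>, and \<open>h\<close> is the forcing that \<open>g\<close> induces in \<open>\<Omega>\<close>.\<close>

definition controlled where
  "controlled g g' w h \<longleftrightarrow>
     g \<in> test_functions (\<O> \<times> {0<..<T}) \<and>
     (\<forall>x t. ((\<lambda>\<tau>. g (x, \<tau>)) has_real_derivative g' (x, t)) (at t)) \<and>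
     (\<forall>t. (\<lambda>x. g (x, t) + \<delta> * g' (x, t)) \<in> sobolev s) \<and>
     (\<forall>t. \<forall>x\<in>\<Omega>. g (x, t) = 0 \<and> g' (x, t) = 0) \<and>
     (\<forall>t. \<forall>\<zeta>\<in>sobolev0 s \<Omega>. frac_laplacian s (\<lambda>x. g (x, t) + \<delta> * g' (x, t)) \<zeta> = - (h t \<bullet> mk_l2 \<zeta>)) \<and>
     (\<forall>n. \<forall>t\<in>{0..T}. w n t \<in> Lset \<and> (w n has_vector_derivative w (Suc n) t) (at t within {0..T})) \<and>
     w 0 0 = 0 \<and> w (Suc 0) 0 = 0 \<and>
     (\<forall>t\<in>{0..T}. w 0 t + \<delta> *\<^sub>R w (Suc 0) t = B (h t - w (Suc (Suc 0)) t + (w 0 t + \<delta> *\<^sub>R w (Suc 0) t)))"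

lemma controlledD:
  assumes "controlled g g' w h"
  shows "g \<in> test_functions (\<O> \<times> {0<..<T})"
    "((\<lambda>\<tau>. g (x, \<tau>)) has_real_derivative g' (x, t)) (at t)"
    "(\<lambda>x. g (x, t) + \<delta> * g' (x, t)) \<in> sobolev s"
    "x \<in> \<Omega> \<Longrightarrow> g (x, t) = 0" "x \<in> \<Omega> \<Longrightarrow> g' (x, t) = 0"
    "\<zeta> \<in> sobolev0 s \<Omega> \<Longrightarrow> frac_laplacian s (\<lambda>x. g (x, t) + \<delta> * g' (x, t)) \<zeta> = - (h t \<bullet> mk_l2 \<zeta>)"
    "t \<in> {0..T} \<Longrightarrow> w n t \<in> Lset"
    "t \<in> {0..T} \<Longrightarrow> (w n has_vector_derivative w (Suc n) t) (at t within {0..T})"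
    "w 0 0 = 0" "w (Suc 0) 0 = 0"
    "t \<in> {0..T} \<Longrightarrow> w 0 t + \<delta> *\<^sub>R w (Suc 0) t = B (h t - w (Suc (Suc 0)) t + (w 0 t + \<delta> *\<^sub>R w (Suc 0) t))"
  using assms unfolding controlled_def by blast+

lemma controlled_zero: "controlled (\<lambda>_. 0) (\<lambda>_. 0) (\<lambda>_ _. 0) (\<lambda>_. 0)"
proof -
  have "frac_laplacian s (\<lambda>x::real^'n. 0) \<zeta> = 0" for \<zeta> by (simp add: frac_laplacian_def case_prod_beta')
  then show ?thesis
    unfolding controlled_def
    using sobolev0D(1)[OF sobolev0_zero] subspace_0[OF subspace_Lset]
    by (auto simp: test_functions_def k_times_cont_diff_const B_simps)
qed

text \<open>All clauses are linear. Sums and multiples make the final states a subspace, to which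
  the orthogonality criterion for density applies.\<close>

lemma controlled_add:
  assumes "controlled g g' w h" "controlled k k' v j"
  shows "controlled (\<lambda>z. g z + k z) (\<lambda>z. g' z + k' z) (\<lambda>n t. w n t + v n t) (\<lambda>t. h t + j t)"
proof -
  note 1 = controlledD[OF assms(1)] and 2 = controlledD[OF assms(2)]
  have eq: "(\<lambda>x. g (x, t) + k (x, t) + \<delta> * (g' (x, t) + k' (x, t))) =
      (\<lambda>x. (g (x, t) + \<delta> * g' (x, t)) + (k (x, t) + \<delta> * k' (x, t)))" for t
    by (simp add: algebra_simps)
  show ?thesis
    unfolding controlled_def
  proof (intro conjI allI ballI)
    show "(\<lambda>z. g z + k z) \<in> test_functions (\<O> \<times> {0<..<T})" by (rule test_functions_add[OF 1(1) 2(1)])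
    fix t
    show "((\<lambda>\<tau>. g (x, \<tau>) + k (x, \<tau>)) has_real_derivative g' (x, t) + k' (x, t)) (at t)" for x
      by (rule DERIV_add[OF 1(2) 2(2)])
    show "(\<lambda>x. g (x, t) + k (x, t) + \<delta> * (g' (x, t) + k' (x, t))) \<in> sobolev s"
      unfolding eq by (rule sobolev_add(1)[OF s 1(3) 2(3)])
    show "frac_laplacian s (\<lambda>x. g (x, t) + k (x, t) + \<delta> * (g' (x, t) + k' (x, t))) \<zeta> = - ((h t + j t) \<bullet> mk_l2 \<zeta>)"
      if \<zeta>: "\<zeta> \<in> sobolev0 s \<Omega>" for \<zeta>
    proof -
      have "frac_laplacian s (\<lambda>x. g (x, t) + k (x, t) + \<delta> * (g' (x, t) + k' (x, t))) \<zeta> =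
          frac_laplacian s (\<lambda>x. g (x, t) + \<delta> * g' (x, t)) \<zeta> + frac_laplacian s (\<lambda>x. k (x, t) + \<delta> * k' (x, t)) \<zeta>"
        unfolding eq by (rule frac_laplacian_linear(1)[OF 1(3) 2(3) sobolev0D(1)[OF \<zeta>]])
      also have "\<dots> = - (h t \<bullet> mk_l2 \<zeta>) + - (j t \<bullet> mk_l2 \<zeta>)" by (simp only: 1(6)[OF \<zeta>] 2(6)[OF \<zeta>])
      finally show ?thesis by (simp add: inner_add_left)
    qed
  next
    fix t and x assume "x \<in> \<Omega>"
    note z = 1(4,5)[OF this] 2(4,5)[OF this]
    show "g (x, t) + k (x, t) = 0" "g' (x, t) + k' (x, t) = 0" by (simp_all add: z)
  next
    fix n t assume t: "t \<in> {0..T}"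
    show "w n t + v n t \<in> Lset" by (rule subspace_add[OF subspace_Lset 1(7)[OF t] 2(7)[OF t]])
    show "((\<lambda>t. w n t + v n t) has_vector_derivative w (Suc n) t + v (Suc n) t) (at t within {0..T})"
      by (rule has_vector_derivative_add[OF 1(8)[OF t] 2(8)[OF t]])
  next
    show "w 0 0 + v 0 0 = 0" "w (Suc 0) 0 + v (Suc 0) 0 = 0" by (simp_all add: 1(9,10) 2(9,10))
  next
    fix t assume t: "t \<in> {0..T}"
    have "w 0 t + \<delta> *\<^sub>R w (Suc 0) t + (v 0 t + \<delta> *\<^sub>R v (Suc 0) t) =
        B (h t - w (Suc (Suc 0)) t + (w 0 t + \<delta> *\<^sub>R w (Suc 0) t)) + B (j t - v (Suc (Suc 0)) t + (v 0 t + \<delta> *\<^sub>R v (Suc 0) t))"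
      using 1(11)[OF t] 2(11)[OF t] by (rule arg_cong2[where f = "(+)"])
    also have "\<dots> = B (h t + j t - (w (Suc (Suc 0)) t + v (Suc (Suc 0)) t) + (w 0 t + v 0 t + \<delta> *\<^sub>R (w (Suc 0) t + v (Suc 0) t)))"
      unfolding B_simps(1)[symmetric] by (simp add: algebra_simps)
    finally show "w 0 t + v 0 t + \<delta> *\<^sub>R (w (Suc 0) t + v (Suc 0) t) =
        B (h t + j t - (w (Suc (Suc 0)) t + v (Suc (Suc 0)) t) + (w 0 t + v 0 t + \<delta> *\<^sub>R (w (Suc 0) t + v (Suc 0) t)))"
      by (simp add: algebra_simps)
  qed
qed

lemma controlled_scale:
  assumes "controlled g g' w h"
  shows "controlled (\<lambda>z. c * g z) (\<lambda>z. c * g' z) (\<lambda>n t. c *\<^sub>R w n t) (\<lambda>t. c *\<^sub>R h t)"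
proof -
  note 1 = controlledD[OF assms]
  have eq: "(\<lambda>x. c * g (x, t) + \<delta> * (c * g' (x, t))) = (\<lambda>x. c * (g (x, t) + \<delta> * g' (x, t)))" for t
    by (simp add: algebra_simps)
  show ?thesis
    unfolding controlled_def
  proof (intro conjI allI ballI)
    show "(\<lambda>z. c * g z) \<in> test_functions (\<O> \<times> {0<..<T})" by (rule test_functions_scale[OF 1(1)])
    fix t
    show "((\<lambda>\<tau>. c * g (x, \<tau>)) has_real_derivative c * g' (x, t)) (at t)" for x
      by (rule DERIV_cmult[OF 1(2)])
    show "(\<lambda>x. c * g (x, t) + \<delta> * (c * g' (x, t))) \<in> sobolev s"
      unfolding eq by (rule sobolev_scale(1)[OF s 1(3)])
    show "frac_laplacian s (\<lambda>x. c * g (x, t) + \<delta> * (c * g' (x, t))) \<zeta> = - ((c *\<^sub>R h t) \<bullet> mk_l2 \<zeta>)"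
      if \<zeta>: "\<zeta> \<in> sobolev0 s \<Omega>" for \<zeta>
    proof -
      have "frac_laplacian s (\<lambda>x. c * g (x, t) + \<delta> * (c * g' (x, t))) \<zeta> = c * frac_laplacian s (\<lambda>x. g (x, t) + \<delta> * g' (x, t)) \<zeta>"
        unfolding eq by (rule frac_laplacian_linear(2)[OF 1(3) 1(3) sobolev0D(1)[OF \<zeta>]])
      also have "frac_laplacian s (\<lambda>x. g (x, t) + \<delta> * g' (x, t)) \<zeta> = - (h t \<bullet> mk_l2 \<zeta>)" by (rule 1(6)[OF \<zeta>])
      finally show ?thesis by simp
    qed
  next
    fix t and x assume "x \<in> \<Omega>"
    note z = 1(4,5)[OF this]
    show "c * g (x, t) = 0" "c * g' (x, t) = 0" by (simp_all add: z)
  next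
    fix n t assume t: "t \<in> {0..T}"
    show "c *\<^sub>R w n t \<in> Lset" by (rule subspace_scale[OF subspace_Lset 1(7)[OF t]])
    show "((\<lambda>t. c *\<^sub>R w n t) has_vector_derivative c *\<^sub>R w (Suc n) t) (at t within {0..T})"
      by (rule bounded_linear.has_vector_derivative[OF bounded_linear_scaleR_right 1(8)[OF t]])
  next
    show "c *\<^sub>R w 0 0 = 0" "c *\<^sub>R w (Suc 0) 0 = 0" by (simp_all add: 1(9,10))
  next
    fix t assume t: "t \<in> {0..T}"
    have "c *\<^sub>R (w 0 t + \<delta> *\<^sub>R w (Suc 0) t) = c *\<^sub>R B (h t - w (Suc (Suc 0)) t + (w 0 t + \<delta> *\<^sub>R w (Suc 0) t))"
      using 1(11)[OF t] by (rule arg_cong)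
    also have "\<dots> = B (c *\<^sub>R h t - c *\<^sub>R w (Suc (Suc 0)) t + (c *\<^sub>R w 0 t + \<delta> *\<^sub>R c *\<^sub>R w (Suc 0) t))"
      unfolding B_simps(3)[symmetric] by (simp add: algebra_simps)
    finally show "c *\<^sub>R w 0 t + \<delta> *\<^sub>R c *\<^sub>R w (Suc 0) t = B (c *\<^sub>R h t - c *\<^sub>R w (Suc (Suc 0)) t + (c *\<^sub>R w 0 t + \<delta> *\<^sub>R c *\<^sub>R w (Suc 0) t))"
      by (simp add: algebra_simps)
  qed
qed

text \<open>With q = w + \<delta> w', the last clause of \<open>controlled\<close> says (1 + A) q =
  h - w'' + q, that is w'' + A q = h. Being a value of B, q lies in the form domain, so q plus the
  exterior part is a Sobolev function; the exterior part contributes - h to the weak form.\<close>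

lemma controlled_weak_solution:
  assumes "controlled g g' w h"
  defines "u \<equiv> \<lambda>t x. indicator \<Omega> x * rep_l2 (w 0 t) x + g (x, t)" and "v \<equiv> \<lambda>t \<zeta>. w (Suc 0) t \<bullet> mk_l2 \<zeta>"
  shows "weak_solution s \<delta> T \<Omega> \<O> g u v"
proof -
  note c = controlledD[OF assms(1)]
  note gt = c(1) and dg = c(2) and sg = c(3) and g0 = c(4,5) and fl = c(6) and wL = c(7) and wd = c(8)
    and w0 = c(9,10) and wB = c(11)
  have wc: "continuous_on {0..T} (w n)" for n
    using wd by (meson continuous_on_eq_continuous_within has_vector_derivative_continuous)
  have wd': "(w n has_vector_derivative w (Suc n) t) (at t within {0<..<T})" if "t \<in> {0<..<T}" for n t
    using that by (intro has_vector_derivative_within_subset[OF wd]) auto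
  \<comment> \<open>The support of g lies in \<O> x (0, T), so the datum agrees with g at all times
    and its time derivative is g'.\<close>
  have ext: "exterior_datum \<O> T g t x = g (x, t)" for t x
  proof (cases "g (x, t) = 0")
    case False
    then have "(x, t) \<in> closure {z. g z \<noteq> 0}" using closure_subset by (intro subsetD[OF closure_subset]) simp
    then have "(x, t) \<in> \<O> \<times> {0<..<T}" using gt by (auto simp: test_functions_def)
    then show ?thesis by (simp add: exterior_datum_def)
  qed (simp add: exterior_datum_def)
  have ext': "deriv (\<lambda>\<tau>. exterior_datum \<O> T g \<tau> x) t = g' (x, t)" for x t
    unfolding ext using DERIV_imp_deriv[OF dg] .
  have u\<Omega>: "u t x = rep_l2 (w 0 t) x" if "x \<in> \<Omega>" for t x using g0 that by (simp add: u_def)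
  have um: "set_borel_measurable lborel \<Omega> (u t)" for t
  proof -
    have "(\<lambda>x. indicator \<Omega> x * u t x) = (\<lambda>x. indicator \<Omega> x * rep_l2 (w 0 t) x)"
      using u\<Omega> by (auto simp: indicator_def)
    then show ?thesis by (simp add: set_borel_measurable_def)
  qed
  have uL2: "u t \<in> L2 \<Omega>" for t
  proof -
    have "(\<lambda>x. indicator \<Omega> x * (u t x)\<^sup>2) = (\<lambda>x. (indicator \<Omega> x * rep_l2 (w 0 t) x)\<^sup>2)"
      using u\<Omega> by (auto simp: indicator_def)
    moreover have "integrable lborel (\<lambda>x. (indicator \<Omega> x * rep_l2 (w 0 t) x)\<^sup>2)"
      by (intro square_integrable_integrable square_integrable_indicator rep_l2 sets_domain)
    ultimately show ?thesis using um by (simp add: L2_def set_integrable_def)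
  qed
  have uc: "curve_continuous_on (L2_norm \<Omega>) {0..T} u"
    unfolding curve_continuous_on_def
  proof
    fix t assume t: "t \<in> {0..T}"
    have eq: "L2_norm \<Omega> (\<lambda>x. u r x - u t x) = norm (w 0 r - w 0 t)" if r: "r \<in> {0..T}" for r
    proof (rule L2_norm_rep)
      show "w 0 r - w 0 t \<in> Lset" by (intro subspace_diff subspace_Lset wL r t)
      show "AE x in lborel. x \<in> \<Omega> \<longrightarrow> u r x - u t x = rep_l2 (w 0 r - w 0 t) x"
        using AE_rep_diff[of "w 0 r" "w 0 t"] by eventually_elim (simp add: u\<Omega>)
      show "set_borel_measurable lborel \<Omega> (\<lambda>x. u r x - u t x)"
        using um[of r] um[of t] unfolding set_borel_measurable_def by (simp add: right_diff_distrib)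
    qed
    have "((\<lambda>r. norm (w 0 r - w 0 t)) \<longlongrightarrow> norm (w 0 t - w 0 t)) (at t within {0..T})"
      using wc[of 0] t by (intro tendsto_intros) (auto simp: continuous_on_def)
    then have lim: "((\<lambda>r. norm (w 0 r - w 0 t)) \<longlongrightarrow> 0) (at t within {0..T})" by simp
    show "((\<lambda>r. L2_norm \<Omega> (\<lambda>x. u r x - u t x)) \<longlongrightarrow> 0) (at t within {0..T})"
      by (rule Lim_transform_eventually[OF lim]) (auto simp: eventually_at_filter eq)
  qed
  define q where "q t = w 0 t + \<delta> *\<^sub>R w (Suc 0) t" for t
  define f where "f t x = rep_l2 (q t) x + (g (x, t) + \<delta> * g' (x, t))" for t x
  define a where "a t \<zeta> = w (Suc (Suc 0)) t \<bullet> mk_l2 \<zeta>" for t and \<zeta> :: "real^'n \<Rightarrow> real"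
  \<comment> \<open>q occurs on both sides because B inverts 1 + A and not A.\<close>
  have qz: "q t = fst (resolv (h t - w (Suc (Suc 0)) t + q t))" if "t \<in> {0..T}" for t
    using wB[OF that] by (simp add: q_def B_def)
  have q0: "rep_l2 (q t) \<in> sobolev0 s \<Omega>" if "t \<in> {0..T}" for t
    using Vset_rep(1)[OF resolv(1), of "h t - w (Suc (Suc 0)) t + q t"] qz[OF that] by simp
  have fs: "f t \<in> sobolev s" if "t \<in> {0..T}" for t
    unfolding f_def[abs_def] by (rule sobolev_add(1)[OF s sobolev0D(1)[OF q0[OF that]] sg])
  have fd: "L2_to_dual \<Omega> (f t) \<zeta> = L2_to_dual \<Omega> (u t) \<zeta> + \<delta> * v t \<zeta>" if \<zeta>: "\<zeta> \<in> sobolev0 s \<Omega>" for t \<zeta>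
  proof -
    have "L2_to_dual \<Omega> (f t) \<zeta> = q t \<bullet> mk_l2 \<zeta>" by (rule L2_to_dual_rep[OF \<zeta>]) (simp add: f_def g0)
    also have "\<dots> = w 0 t \<bullet> mk_l2 \<zeta> + \<delta> * v t \<zeta>" by (simp add: q_def v_def inner_add_left)
    also have "w 0 t \<bullet> mk_l2 \<zeta> = L2_to_dual \<Omega> (u t) \<zeta>" by (rule L2_to_dual_rep[OF \<zeta>, symmetric]) (rule u\<Omega>)
    finally show ?thesis .
  qed
  have fe: "AE x in lborel. x \<notin> \<Omega> \<longrightarrow> f t x = exterior_datum \<O> T g t x + \<delta> * deriv (\<lambda>\<tau>. exterior_datum \<O> T g \<tau> x) t"
    if "t \<in> {0..T}" for t
    unfolding ext' unfolding ext using sobolev0D(2)[OF q0[OF that]] by eventually_elim (simp add: f_def)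
  have eqn: "a t \<zeta> + frac_laplacian s (f t) \<zeta> = 0" if t: "t \<in> {0..T}" and \<zeta>: "\<zeta> \<in> sobolev0 s \<Omega>" for t \<zeta>
  proof -
    define z where "z = resolv (h t - w (Suc (Suc 0)) t + q t)"
    have V: "sobolev_embed s \<zeta> \<in> Vset" using \<zeta> by (simp add: Vset_def)
    have zq: "sobolev_embed s (rep_l2 (q t)) = z" using Vset_rep(2)[OF resolv(1), of "h t - w (Suc (Suc 0)) t + q t"]
      unfolding z_def by (simp only: qz[OF t, symmetric])
    have "(h t - w (Suc (Suc 0)) t + q t) \<bullet> mk_l2 \<zeta> = z \<bullet> sobolev_embed s \<zeta>"
      using resolv(2)[OF V] by (simp add: z_def sobolev_embed_def)
    also have "\<dots> = q t \<bullet> mk_l2 \<zeta> + frac_laplacian s (rep_l2 (q t)) \<zeta>"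
      unfolding zq[symmetric] inner_sobolev_embed[OF s sobolev0D(1)[OF q0[OF t]] sobolev0D(1)[OF \<zeta>]]
      by (simp add: inner_mk_sobolev0[OF \<zeta>])
    finally have "frac_laplacian s (rep_l2 (q t)) \<zeta> = h t \<bullet> mk_l2 \<zeta> - a t \<zeta>"
      by (simp add: a_def inner_add_left inner_diff_left)
    moreover have "frac_laplacian s (f t) \<zeta> = frac_laplacian s (rep_l2 (q t)) \<zeta> + - (h t \<bullet> mk_l2 \<zeta>)"
      unfolding f_def[abs_def] fl[OF \<zeta>, symmetric]
      by (rule frac_laplacian_linear(1)[OF sobolev0D(1)[OF q0[OF t]] sg sobolev0D(1)[OF \<zeta>]])
    ultimately show ?thesis by simp
  qed
  show ?thesis
    unfolding weak_solution_def
  proof (intro conjI)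
    show "\<forall>t\<in>{0..T}. u t \<in> L2 \<Omega>" using uL2 by blast
    show "curve_continuous_on (L2_norm \<Omega>) {0..T} u" by (rule uc)
    show "\<forall>t\<in>{0..T}. v t \<in> sobolev_dual s \<Omega>" unfolding v_def using inner_mem_dual by blast
    show "curve_has_derivative_on (sobolev_dual_norm s \<Omega>) {0..T} (\<lambda>t. L2_to_dual \<Omega> (u t)) v"
      by (rule dual_curve_derivative[OF wd[of _ 0]]) (auto simp: v_def intro!: L2_to_dual_rep u\<Omega>)
    show "curve_continuous_on (sobolev_dual_norm s \<Omega>) {0..T} v"
      by (rule dual_curve_continuous[OF wc[of "Suc 0"]]) (simp add: v_def)
    show "\<exists>a f. (\<forall>t\<in>{0<..<T}. a t \<in> sobolev_dual s \<Omega>) \<and>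
        curve_has_derivative_on (sobolev_dual_norm s \<Omega>) {0<..<T} v a \<and>
        curve_continuous_on (sobolev_dual_norm s \<Omega>) {0<..<T} a \<and>
        (AE t in lborel. t \<in> {0<..<T} \<longrightarrow> f t \<in> sobolev s \<and>
           (\<forall>\<zeta>\<in>sobolev0 s \<Omega>. L2_to_dual \<Omega> (f t) \<zeta> = L2_to_dual \<Omega> (u t) \<zeta> + \<delta> * v t \<zeta>) \<and>
           (AE x in lborel. x \<notin> \<Omega> \<longrightarrow>
              f t x = exterior_datum \<O> T g t x + \<delta> * deriv (\<lambda>\<tau>. exterior_datum \<O> T g \<tau> x) t)) \<and>
        (\<forall>\<zeta>\<in>sobolev0 s \<Omega>. AE t in lborel. t \<in> {0<..<T} \<longrightarrow> a t \<zeta> + frac_laplacian s (f t) \<zeta> = 0)"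
    proof (intro exI[of _ a] exI[of _ f] conjI ballI)
      show "a t \<in> sobolev_dual s \<Omega>" for t unfolding a_def by (rule inner_mem_dual)
      show "curve_has_derivative_on (sobolev_dual_norm s \<Omega>) {0<..<T} v a"
        by (rule dual_curve_derivative[OF wd'[of _ "Suc 0"]]) (auto simp: v_def a_def)
      show "curve_continuous_on (sobolev_dual_norm s \<Omega>) {0<..<T} a"
        by (rule dual_curve_continuous[OF continuous_on_subset[OF wc[of "Suc (Suc 0)"]]]) (auto simp: a_def)
      show "AE t in lborel. t \<in> {0<..<T} \<longrightarrow> f t \<in> sobolev s \<and>
           (\<forall>\<zeta>\<in>sobolev0 s \<Omega>. L2_to_dual \<Omega> (f t) \<zeta> = L2_to_dual \<Omega> (u t) \<zeta> + \<delta> * v t \<zeta>) \<and>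
           (AE x in lborel. x \<notin> \<Omega> \<longrightarrow>
              f t x = exterior_datum \<O> T g t x + \<delta> * deriv (\<lambda>\<tau>. exterior_datum \<O> T g \<tau> x) t)"
        using fs fd fe by (intro AE_I2) auto
      show "AE t in lborel. t \<in> {0<..<T} \<longrightarrow> a t \<zeta> + frac_laplacian s (f t) \<zeta> = 0" if "\<zeta> \<in> sobolev0 s \<Omega>" for \<zeta>
        using eqn that by (intro AE_I2) auto
    qed
    show "AE x in lborel. x \<in> \<Omega> \<longrightarrow> u 0 x = 0"
    proof -
      have "AE x in lborel. rep_l2 (0::(real^'n) l2) x = 0"
        using AE_rep_mk_l2[OF square_integrable_zero] by (simp add: mk_l2_zero)
      then show ?thesis by eventually_elim (simp add: u\<Omega> w0)
    qed
    show "\<forall>\<zeta>\<in>sobolev0 s \<Omega>. v 0 \<zeta> = 0" by (simp add: v_def w0)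
    show "\<forall>t\<in>{0<..<T}. AE x in lborel. x \<notin> \<Omega> \<longrightarrow> u t x = exterior_datum \<O> T g t x"
      by (auto intro!: AE_I2 simp: u_def ext)
  qed
qed

end

section \<open>Approximate controllability\<close>

context exterior_control
begin

text \<open>Separating variables: the forcing is a scalar function of time times a fixed source, so
  the solution is the scalar solution evaluated at B and applied to that source.\<close>

lemma controlled_elementary:
  assumes \<theta>: "smooth \<theta>" "\<And>t. t \<notin> {a..b} \<Longrightarrow> \<theta> t = 0" and ab: "{a..b} \<subseteq> {0<..<T}"
    and r: "0 \<le> r" and c: "cball c r \<subseteq> \<O>" and d: "0 < d"
    and sep: "\<And>x y. x \<in> cball c r \<Longrightarrow> y \<in> \<Omega> \<Longrightarrow> d \<le> norm (x - y)"
    and W: "\<And>n t \<mu>. t \<in> {0..T} \<Longrightarrow> \<mu> \<in> {0..1} \<Longrightarrow>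
       ((\<lambda>t. W n t \<mu>) has_real_derivative W (Suc n) t \<mu>) (at t within {0..T})"
    "\<And>n. \<exists>D. \<forall>t\<in>{0..T}. \<forall>\<mu>\<in>{0..1}. \<bar>W n t \<mu>\<bar> \<le> D"
    "\<And>n t. t \<in> {0..T} \<Longrightarrow> continuous_on {0..1} (W n t)"
    "\<And>t \<mu>. t \<in> {0..T} \<Longrightarrow> \<mu> \<in> {0..1} \<Longrightarrow>
       \<mu> * W (Suc (Suc 0)) t \<mu> + (1 - \<mu>) * (\<delta> * W (Suc 0) t \<mu> + W 0 t \<mu>) = \<mu> * (\<theta> t + \<delta> * deriv \<theta> t)"
    "\<And>n \<mu>. \<mu> \<in> {0..1} \<Longrightarrow> W n 0 \<mu> = 0"
  shows "controlled (\<lambda>(x, t). spatial_bump c r x * \<theta> t) (\<lambda>(x, t). spatial_bump c r x * deriv \<theta> t)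
    (\<lambda>n t. fcal (W n t) (mk_l2 (source c r))) (\<lambda>t. (\<theta> t + \<delta> * deriv \<theta> t) *\<^sub>R mk_l2 (source c r))"
proof -
  let ?\<psi> = "spatial_bump c r" and ?S = "mk_l2 (source c r)"
  have src: "square_integrable (source c r)" by (rule square_integrable_source[OF r d sep])
  have SL: "?S \<in> Lset" unfolding mk_mem_Lset[OF src] by (simp add: source_def)
  have \<psi>\<Omega>: "?\<psi> x = 0" if "x \<in> \<Omega>" for x
    using sep[of x x] that d spatial_bump_nonzero_iff[OF r, of c x] by (auto simp: dist_norm norm_minus_commute)
  have \<psi>s: "?\<psi> \<in> sobolev s" by (rule spatial_bump_sobolev[OF s r])
  have eq: "(\<lambda>x. (case (x, t) of (x, t) \<Rightarrow> ?\<psi> x * \<theta> t) + \<delta> * (case (x, t) of (x, t) \<Rightarrow> ?\<psi> x * deriv \<theta> t)) =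
      (\<lambda>x. (\<theta> t + \<delta> * deriv \<theta> t) * ?\<psi> x)" for t by (simp add: algebra_simps)
  have T0: "0 \<in> {0..T}" using T by simp
  have zero: "fcal (W n 0) ?S = 0" for n
    using fcal_norm[OF W(3)[OF T0, of n], of 0 ?S] W(5)[of _ n] by simp
  show ?thesis
    unfolding controlled_def
  proof (intro conjI allI ballI)
    show "(\<lambda>(x, t). ?\<psi> x * \<theta> t) \<in> test_functions (\<O> \<times> {0<..<T})"
      unfolding spatial_bump_def by (rule test_function_product[OF \<theta> ab r c])
    fix t
    show "((\<lambda>\<tau>. case (x, \<tau>) of (x, t) \<Rightarrow> ?\<psi> x * \<theta> t) has_real_derivative (case (x, t) of (x, t) \<Rightarrow> ?\<psi> x * deriv \<theta> t)) (at t)" for x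
      using DERIV_cmult[OF smooth_deriv(1)[OF \<theta>(1), of t], of "?\<psi> x"] by simp
    show "(\<lambda>x. (case (x, t) of (x, t) \<Rightarrow> ?\<psi> x * \<theta> t) + \<delta> * (case (x, t) of (x, t) \<Rightarrow> ?\<psi> x * deriv \<theta> t)) \<in> sobolev s"
      unfolding eq by (rule sobolev_scale(1)[OF s \<psi>s])
    show "frac_laplacian s (\<lambda>x. (case (x, t) of (x, t) \<Rightarrow> ?\<psi> x * \<theta> t) + \<delta> * (case (x, t) of (x, t) \<Rightarrow> ?\<psi> x * deriv \<theta> t)) \<zeta>
        = - (((\<theta> t + \<delta> * deriv \<theta> t) *\<^sub>R ?S) \<bullet> mk_l2 \<zeta>)" if \<zeta>: "\<zeta> \<in> sobolev0 s \<Omega>" for \<zeta>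
    proof -
      have "frac_laplacian s ?\<psi> \<zeta> = - (LINT y|lborel. source c r y * \<zeta> y)"
        by (rule frac_laplacian_spatial_bump[OF r d _ \<zeta>]) (rule sep)
      then show ?thesis
        unfolding eq frac_laplacian_linear(2)[OF \<psi>s \<psi>s sobolev0D(1)[OF \<zeta>]]
        by (simp add: inner_mk_l2[OF src sobolev0D(3)[OF \<zeta>]])
    qed
    fix x assume "x \<in> \<Omega>"
    then show "(case (x, t) of (x, t) \<Rightarrow> ?\<psi> x * \<theta> t) = 0" "(case (x, t) of (x, t) \<Rightarrow> ?\<psi> x * deriv \<theta> t) = 0"
      using \<psi>\<Omega> by simp_all
  next
    fix n t assume t: "t \<in> {0..T}"
    show "fcal (W n t) ?S \<in> Lset"
      by (rule fcal_mem[OF W(3)[OF t] subspace_Lset closed_Lset B_mem_Lset SL])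
    show "((\<lambda>t. fcal (W n t) ?S) has_vector_derivative fcal (W (Suc n) t) ?S) (at t within {0..T})"
      by (rule fcal_curve_derivative[where W = W, OF T t W(1-3)])
  next
    show "fcal (W 0 0) ?S = 0" "fcal (W (Suc 0) 0) ?S = 0" by (rule zero)+
  next
    fix t assume t: "t \<in> {0..T}"
    define e where "e = \<theta> t + \<delta> * deriv \<theta> t"
    define Q where "Q \<mu> = W 0 t \<mu> + \<delta> * W (Suc 0) t \<mu>" for \<mu>
    note Wc = W(3)[OF t]
    have Qc: "continuous_on {0..1} Q" unfolding Q_def[abs_def] by (intro continuous_intros Wc)
    have cc: "continuous_on {0..1} (\<lambda>_. e)" by (intro continuous_intros)
    have Rc: "continuous_on {0..1} (\<lambda>\<mu>. e - W (Suc (Suc 0)) t \<mu> + Q \<mu>)"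
      by (intro continuous_on_add continuous_on_diff cc Wc Qc)
    have q: "fcal (W 0 t) ?S + \<delta> *\<^sub>R fcal (W (Suc 0) t) ?S = fcal Q ?S"
      unfolding Q_def[abs_def]
      by (simp add: fcal_add[OF Wc continuous_on_mult_left[OF Wc]] fcal_scale[OF Wc])
    have ce: "fcal (\<lambda>_. e) ?S = e *\<^sub>R ?S"
    proof -
      have "poly [:e:] = (\<lambda>_. e)" by auto
      then show ?thesis using fcal_poly[of "[:e:]" ?S] by (simp add: B_simps)
    qed
    have "fcal (\<lambda>\<mu>. e - W (Suc (Suc 0)) t \<mu> + Q \<mu>) ?S = fcal (\<lambda>\<mu>. e - W (Suc (Suc 0)) t \<mu>) ?S + fcal Q ?S"
      by (rule fcal_add[OF continuous_on_diff[OF cc Wc] Qc])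
    also have "fcal (\<lambda>\<mu>. e - W (Suc (Suc 0)) t \<mu>) ?S = e *\<^sub>R ?S - fcal (W (Suc (Suc 0)) t) ?S"
      by (simp only: fcal_diff[OF cc Wc] ce)
    finally have sum: "fcal (\<lambda>\<mu>. e - W (Suc (Suc 0)) t \<mu> + Q \<mu>) ?S = e *\<^sub>R ?S - fcal (W (Suc (Suc 0)) t) ?S + fcal Q ?S" .
    \<comment> \<open>The oscillator equation rearranged as Q = \<mu> (e - W'' + Q), valid for every
      \<mu> in [0, 1]; the calculus turns the factor \<mu> into B and yields the resolvent form of
      the equation.\<close>
    have "fcal (\<lambda>\<mu>. \<mu> * (e - W (Suc (Suc 0)) t \<mu> + Q \<mu>)) ?S = fcal Q ?S"
    proof -
      have "norm (fcal (\<lambda>\<mu>. \<mu> * (e - W (Suc (Suc 0)) t \<mu> + Q \<mu>) - Q \<mu>) ?S) \<le> 0 * norm ?S"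
      proof (rule fcal_norm)
        fix \<mu> :: real assume "\<mu> \<in> {0..1}"
        from W(4)[OF t this] have "\<mu> * (e - W (Suc (Suc 0)) t \<mu> + Q \<mu>) - Q \<mu> = 0"
          unfolding e_def Q_def by algebra
        then show "\<bar>\<mu> * (e - W (Suc (Suc 0)) t \<mu> + Q \<mu>) - Q \<mu>\<bar> \<le> 0" by simp
      qed (intro continuous_on_diff continuous_on_mult continuous_on_id Rc Qc)
      then show ?thesis
        using fcal_diff[OF continuous_on_mult[OF continuous_on_id Rc] Qc, of ?S] by simp
    qed
    then have "fcal Q ?S = B (e *\<^sub>R ?S - fcal (W (Suc (Suc 0)) t) ?S + fcal Q ?S)"
      unfolding fcal_B[OF Rc] sum by simp
    then show "fcal (W 0 t) ?S + \<delta> *\<^sub>R fcal (W (Suc 0) t) ?S =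
        B ((\<theta> t + \<delta> * deriv \<theta> t) *\<^sub>R ?S - fcal (W (Suc (Suc 0)) t) ?S + (fcal (W 0 t) ?S + \<delta> *\<^sub>R fcal (W (Suc 0) t) ?S))"
      unfolding q e_def .
  qed
qed

definition final_states :: "((real^'n) l2 \<times> (real^'n) l2) set" where
  "final_states = {(w 0 T, w (Suc 0) T) | g g' w h. controlled g g' w h}"

lemma subspace_final_states: "subspace final_states"
  unfolding subspace_def
proof (intro conjI ballI allI)
  show "0 \<in> final_states" unfolding final_states_def zero_prod_def using controlled_zero by force
next
  fix p q assume "p \<in> final_states" "q \<in> final_states"
  then obtain g g' w h k k' v j where p: "p = (w 0 T, w (Suc 0) T)" "controlled g g' w h"
    and q: "q = (v 0 T, v (Suc 0) T)" "controlled k k' v j"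
    unfolding final_states_def by blast
  show "p + q \<in> final_states"
    unfolding final_states_def using controlled_add[OF p(2) q(2)] p(1) q(1) by force
next
  fix c p assume "p \<in> final_states"
  then obtain g g' w h where p: "p = (w 0 T, w (Suc 0) T)" "controlled g g' w h"
    unfolding final_states_def by blast
  show "c *\<^sub>R p \<in> final_states"
    unfolding final_states_def using controlled_scale[OF p(2)] p(1) by force
qed

text \<open>Half the radius of a ball inside \<O> keeps the smaller ball at a positive distance from
  \<Omega>.\<close>

lemma ex_separated_ball:
  obtains x0 \<rho> d R where "0 < \<rho>" "0 < d" "0 < R" "ball x0 \<rho> \<subseteq> \<O>"
    "\<And>x y. x \<in> ball x0 \<rho> \<Longrightarrow> y \<in> \<Omega> \<Longrightarrow> d \<le> norm (x - y) \<and> norm (x - y) \<le> R"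
proof -
  obtain x0 where "x0 \<in> \<O>" using \<O>(2) by blast
  then obtain \<epsilon> where \<epsilon>: "\<epsilon> > 0" "ball x0 \<epsilon> \<subseteq> \<O>" using \<O>(1) open_contains_ball by blast
  obtain R where R: "\<And>y. y \<in> \<Omega> \<Longrightarrow> norm y \<le> R" using bounded_domain by (auto simp: bounded_iff)
  have "\<epsilon>/2 \<le> norm (x - y) \<and> norm (x - y) \<le> norm x0 + \<epsilon> + \<bar>R\<bar>" if x: "x \<in> ball x0 (\<epsilon>/2)" and y: "y \<in> \<Omega>" for x y
  proof
    have "y \<notin> ball x0 \<epsilon>" using \<epsilon>(2) \<O>(3) y by blast
    then show "\<epsilon>/2 \<le> norm (x - y)" using x dist_triangle[of x0 y x] by (simp add: dist_norm)
    have "norm (x - y) \<le> norm x + norm y" by (rule norm_triangle_ineq4)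
    moreover have "norm x \<le> norm x0 + norm (x - x0)" using norm_triangle_ineq[of x0 "x - x0"] by simp
    moreover have "norm (x - x0) < \<epsilon>/2" using x by (simp add: dist_norm norm_minus_commute)
    ultimately show "norm (x - y) \<le> norm x0 + \<epsilon> + \<bar>R\<bar>"
      using R[OF y] abs_ge_self[of R] \<epsilon>(1) by linarith
  qed
  moreover have "ball x0 (\<epsilon>/2) \<subseteq> \<O>" using \<epsilon> subset_ball[of "\<epsilon>/2" \<epsilon> x0] by auto
  moreover have "0 < norm x0 + \<epsilon> + \<bar>R\<bar>" using \<epsilon> by (simp add: add_nonneg_pos add_pos_nonneg)
  ultimately show thesis using \<epsilon>(1) that[of "\<epsilon>/2" "\<epsilon>/2" "norm x0 + \<epsilon> + \<bar>R\<bar>" x0] by auto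
qed

text \<open>Self-adjointness moves the functions of B from the source to \<phi> and \<psi>. The
  combination obtained is orthogonal to all sources in a small ball and vanishes by unique
  continuation.\<close>

lemma orthogonal_final_states_fcal:
  assumes \<phi>: "\<phi> \<in> Lset" "\<psi> \<in> Lset" and orth: "\<And>m. m \<in> final_states \<Longrightarrow> (\<phi>, \<psi>) \<bullet> m = 0"
    and \<theta>: "smooth \<theta>" "\<And>t. t \<notin> {a..b} \<Longrightarrow> \<theta> t = 0" and ab: "{a..b} \<subseteq> {0<..<T}"
    and W: "\<And>n t \<mu>. t \<in> {0..T} \<Longrightarrow> \<mu> \<in> {0..1} \<Longrightarrow>
       ((\<lambda>t. W n t \<mu>) has_real_derivative W (Suc n) t \<mu>) (at t within {0..T})"
    "\<And>n. \<exists>D. \<forall>t\<in>{0..T}. \<forall>\<mu>\<in>{0..1}. \<bar>W n t \<mu>\<bar> \<le> D"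
    "\<And>n t. t \<in> {0..T} \<Longrightarrow> continuous_on {0..1} (W n t)"
    "\<And>t \<mu>. t \<in> {0..T} \<Longrightarrow> \<mu> \<in> {0..1} \<Longrightarrow>
       \<mu> * W (Suc (Suc 0)) t \<mu> + (1 - \<mu>) * (\<delta> * W (Suc 0) t \<mu> + W 0 t \<mu>) = \<mu> * (\<theta> t + \<delta> * deriv \<theta> t)"
    "\<And>n \<mu>. \<mu> \<in> {0..1} \<Longrightarrow> W n 0 \<mu> = 0"
  shows "fcal (W 0 T) \<phi> + fcal (W (Suc 0) T) \<psi> = 0"
proof -
  obtain x0 \<rho> d R where ball: "0 < \<rho>" "0 < d" "0 < R" "ball x0 \<rho> \<subseteq> \<O>"
    and sep: "\<And>x y. x \<in> ball x0 \<rho> \<Longrightarrow> y \<in> \<Omega> \<Longrightarrow> d \<le> norm (x - y) \<and> norm (x - y) \<le> R"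
    by (rule ex_separated_ball) (rule that; assumption)
  have TT: "T \<in> {0..T}" using T by simp
  note Wc = W(3)[OF TT]
  let ?\<chi> = "fcal (W 0 T) \<phi> + fcal (W (Suc 0) T) \<psi>"
  show ?thesis
  proof (rule source_unique_continuation[OF _ ball(1-3) sep])
    show "?\<chi> \<in> Lset"
      by (intro subspace_add[OF subspace_Lset] fcal_mem[OF Wc subspace_Lset closed_Lset B_mem_Lset] \<phi>)
    fix c r assume r: "(0::real) < r" and c: "cball c r \<subseteq> ball x0 \<rho>"
    have r0: "0 \<le> r" using r by simp
    have cO: "cball c r \<subseteq> \<O>" using c ball(4) by blast
    have sep': "d \<le> norm (x - y)" if "x \<in> cball c r" "y \<in> \<Omega>" for x y using sep[of x y] c that by blast
    note src = square_integrable_source[OF r0 ball(2) sep']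
    have "(fcal (W 0 T) (mk_l2 (source c r)), fcal (W (Suc 0) T) (mk_l2 (source c r))) \<in> final_states"
      unfolding final_states_def
    proof (intro CollectI exI conjI)
      show "controlled (\<lambda>(x, t). spatial_bump c r x * \<theta> t) (\<lambda>(x, t). spatial_bump c r x * deriv \<theta> t)
        (\<lambda>n t. fcal (W n t) (mk_l2 (source c r))) (\<lambda>t. (\<theta> t + \<delta> * deriv \<theta> t) *\<^sub>R mk_l2 (source c r))"
        by (rule controlled_elementary[where W = W, OF \<theta> ab r0 cO ball(2) sep' W])
    qed simp
    from orth[OF this] have "\<phi> \<bullet> fcal (W 0 T) (mk_l2 (source c r)) + \<psi> \<bullet> fcal (W (Suc 0) T) (mk_l2 (source c r)) = 0"
      by simp
    then have "mk_l2 (source c r) \<bullet> ?\<chi> = 0"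
      by (simp only: inner_commute[of "mk_l2 (source c r)"] inner_add_left fcal_adj[OF Wc])
    then show "(LINT y|lborel. source c r y * rep_l2 ?\<chi> y) = 0"
      using inner_mk_l2[OF src rep_l2(1)[of ?\<chi>]] by (simp add: rep_l2)
  qed auto
qed

lemma fcal_limit:
  assumes f: "continuous_on {0..1} f1" "continuous_on {0..1} f2"
    and p: "\<And>t. t \<in> {0..1} \<Longrightarrow> \<bar>poly p1 t - f1 t\<bar> \<le> e" "\<And>t. t \<in> {0..1} \<Longrightarrow> \<bar>poly p2 t - f2 t\<bar> \<le> e"
    and z: "fcal f1 \<phi> + fcal f2 \<psi> = 0"
  shows "norm (poly_apply p1 \<phi> + poly_apply p2 \<psi>) \<le> e * (norm \<phi> + norm \<psi>)"
proof -
  have "poly_apply p1 \<phi> + poly_apply p2 \<psi> = (poly_apply p1 \<phi> - fcal f1 \<phi>) + (poly_apply p2 \<psi> - fcal f2 \<psi>)"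
    using z by (simp add: algebra_simps)
  also have "norm \<dots> \<le> e * norm \<phi> + e * norm \<psi>"
    by (rule order_trans[OF norm_triangle_ineq add_mono[OF fcal[OF f(1) p(1)] fcal[OF f(2) p(2)]]])
  finally show ?thesis by (simp add: distrib_left)
qed

text \<open>Impulses near the final time: \<open>\<theta>\<close> approximates the Dirac mass at \<open>T\<close>, and \<open>deriv \<theta>\<close> its derivative.\<close>

lemma orthogonal_final_states_eq_0:
  assumes \<phi>: "\<phi> \<in> Lset" "\<psi> \<in> Lset" and orth: "\<And>m. m \<in> final_states \<Longrightarrow> (\<phi>, \<psi>) \<bullet> m = 0"
  shows "\<phi> = 0" "\<psi> = 0"
proof -
  \<comment> \<open>\<open>p11\<close> and \<open>p12\<close> are the impulse limits of \<mu>^2 W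
    and \<mu>^2 W' at T, namely \<mu>^2 times \<delta> and times c = 1 - \<delta>^2 (1 -
    \<mu>)/\<mu>.\<close>
  define p11 where "p11 = [:0, 0, \<delta>:]"
  define p12 where "p12 = [:0, - \<delta>\<^sup>2, 1 + \<delta>\<^sup>2:]"
  \<comment> \<open>The second row belongs to the control with \<theta> replaced by its derivative,
    whose final state is (W', W''). The forcing is zero at T, so the equation expresses \<mu> W''
    there by W and W'; one more factor \<mu> is spent on this.\<close>
  define p21 where "p21 = [:0, 1:] * p12"
  define p22 where "p22 = - ([:1, -1:] * (smult \<delta> p12 + p11))"
  define K where "K = (1 + \<delta>\<^sup>2) + (\<delta> * (2 + \<delta>\<^sup>2) + (1 + \<delta>\<^sup>2)) * exp 1"
  have K: "0 \<le> K" using \<delta> by (simp add: K_def)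
  have est: "norm (poly_apply p11 \<phi> + poly_apply p12 \<psi>) \<le> K * sqrt \<epsilon> * (norm \<phi> + norm \<psi>) \<and>
      norm (poly_apply p21 \<phi> + poly_apply p22 \<psi>) \<le> (1 + \<delta>) * K * sqrt \<epsilon> * (norm \<phi> + norm \<psi>)"
    if \<epsilon>: "0 < \<epsilon>" "\<epsilon> < T" "\<epsilon> \<le> 1" for \<epsilon>
  proof -
    obtain \<theta> \<Theta>1 \<Theta>2 where \<theta>: "smooth \<theta>" "\<And>t. t \<notin> {T - \<epsilon>..T - \<epsilon>/2} \<Longrightarrow> \<theta> t = 0"
      and \<Theta>1d: "\<And>t. t \<in> {0..T} \<Longrightarrow> (\<Theta>1 has_real_derivative \<theta> t) (at t)"
      and \<Theta>2d: "\<And>t. t \<in> {0..T} \<Longrightarrow> (\<Theta>2 has_real_derivative \<Theta>1 t) (at t)"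
      and \<Theta>z: "\<And>t. t \<in> {0..T - \<epsilon>} \<Longrightarrow> \<Theta>1 t = 0" "\<And>t. t \<in> {0..T - \<epsilon>} \<Longrightarrow> \<Theta>2 t = 0"
      and \<Theta>1: "\<And>t. t \<in> {0..T} \<Longrightarrow> 0 \<le> \<Theta>1 t \<and> \<Theta>1 t \<le> 1" "\<Theta>1 T = 1"
      by (rule impulse[OF \<epsilon>(1,2)]) (rule that; assumption)
    define D where "D n = (deriv ^^ n) \<theta>" for n
    have D: "(D n has_real_derivative D (Suc n) t) (at t)" for n t
      unfolding D_def by (rule smooth_iterated_deriv(2)[OF \<theta>(1)])
    have Dz: "D n t = 0" if "t \<notin> {T - \<epsilon>..T - \<epsilon>/2}" for n t
      unfolding D_def by (rule iterated_deriv_eq_0_outside[OF \<theta>(2) that])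
    have D0: "D 0 = \<theta>" "D (Suc 0) = deriv \<theta>" "D (Suc (Suc 0)) = deriv (deriv \<theta>)" by (simp_all add: D_def)
    have ab: "{T - \<epsilon>..T - \<epsilon>/2} \<subseteq> {0<..<T}" using \<epsilon> by auto
    have \<eta>0: "D n 0 + \<delta> * D (Suc n) 0 = 0" for n using Dz[of 0] \<epsilon> by simp
    have \<eta>d: "((\<lambda>t. D n t + \<delta> * D (Suc n) t) has_real_derivative D (Suc n) t + \<delta> * D (Suc (Suc n)) t) (at t)" for n t
      by (intro DERIV_add DERIV_cmult D)
    obtain W where
      W1: "\<And>n t \<mu>. t \<in> {0..T} \<Longrightarrow> \<mu> \<in> {0..1} \<Longrightarrow>
        ((\<lambda>t. W n t \<mu>) has_real_derivative W (Suc n) t \<mu>) (at t within {0..T})"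
      and W2: "\<And>n. \<exists>D. \<forall>t\<in>{0..T}. \<forall>\<mu>\<in>{0..1}. \<bar>W n t \<mu>\<bar> \<le> D"
      and W3: "\<And>n t. t \<in> {0..T} \<Longrightarrow> continuous_on {0..1} (W n t)"
      and W4: "\<And>n t \<mu>. t \<in> {0..T} \<Longrightarrow> \<mu> \<in> {0..1} \<Longrightarrow>
        \<mu> * W (n + 2) t \<mu> + (1 - \<mu>) * (\<delta> * W (n + 1) t \<mu> + W n t \<mu>) = \<mu> * (D n t + \<delta> * D (Suc n) t)"
      and W5: "\<And>n \<mu>. \<mu> \<in> {0..1} \<Longrightarrow> W n 0 \<mu> = 0"
      and W6: "\<And>n t. W n t 0 = 0"
      by (rule oscillator_family[of T \<delta> "\<lambda>n t. D n t + \<delta> * D (Suc n) t", OF T \<delta> \<eta>d \<eta>0]) (rule that; assumption)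
    have TT: "T \<in> {0..T}" using T by simp
    note Wc = W3[OF TT]
    have eqA: "fcal (W 0 T) \<phi> + fcal (W (Suc 0) T) \<psi> = 0"
    proof (rule orthogonal_final_states_fcal[where W = W, OF \<phi> orth \<theta> ab W1 W2 W3 _ W5])
      show "\<mu> * W (Suc (Suc 0)) t \<mu> + (1 - \<mu>) * (\<delta> * W (Suc 0) t \<mu> + W 0 t \<mu>) = \<mu> * (\<theta> t + \<delta> * deriv \<theta> t)"
        if "t \<in> {0..T}" "\<mu> \<in> {0..1}" for t \<mu>
        using W4[OF that, of 0] by (simp add: D0 numeral_2_eq_2)
    qed
    \<comment> \<open>The family shifted by one index solves the problem with \<theta> replaced by
      its derivative, which is again an admissible profile.\<close>
    have eqB: "fcal (W (Suc 0) T) \<phi> + fcal (W (Suc (Suc 0)) T) \<psi> = 0"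
    proof (rule orthogonal_final_states_fcal[where W = "\<lambda>n. W (Suc n)" and \<theta> = "deriv \<theta>", OF \<phi> orth smooth_deriv(2)[OF \<theta>(1)] _ ab W1 W2 W3 _ W5])
      show "\<mu> * W (Suc (Suc (Suc 0))) t \<mu> + (1 - \<mu>) * (\<delta> * W (Suc (Suc 0)) t \<mu> + W (Suc 0) t \<mu>) = \<mu> * (deriv \<theta> t + \<delta> * deriv (deriv \<theta>) t)"
        if "t \<in> {0..T}" "\<mu> \<in> {0..1}" for t \<mu>
        using W4[OF that, of 1] by (simp add: D0 numeral_2_eq_2 numeral_3_eq_3)
      show "deriv \<theta> t = 0" if "t \<notin> {T - \<epsilon>..T - \<epsilon>/2}" for t using Dz[OF that, of 1] by (simp add: D0)
    qed
    have imp: "\<bar>poly p11 \<mu> - \<mu>\<^sup>2 * W 0 T \<mu>\<bar> \<le> K * sqrt \<epsilon>" "\<bar>poly p12 \<mu> - \<mu>\<^sup>2 * W (Suc 0) T \<mu>\<bar> \<le> K * sqrt \<epsilon>"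
      if \<mu>: "\<mu> \<in> {0..1}" for \<mu>
    proof -
      have p: "poly p11 \<mu> = \<delta> * \<mu>\<^sup>2" "poly p12 \<mu> = \<mu>\<^sup>2 - \<delta>\<^sup>2 * \<mu> * (1 - \<mu>)"
        by (simp_all add: p11_def p12_def power2_eq_square algebra_simps)
      have "\<bar>poly p11 \<mu> - \<mu>\<^sup>2 * W 0 T \<mu>\<bar> \<le> K * sqrt \<epsilon> \<and> \<bar>poly p12 \<mu> - \<mu>\<^sup>2 * W (Suc 0) T \<mu>\<bar> \<le> K * sqrt \<epsilon>"
      proof (cases "\<mu> = 0")
        case True
        then show ?thesis using p K \<epsilon> by simp
      next
        case False
        then have \<mu>0: "0 < \<mu>" "\<mu> \<le> 1" using \<mu> by auto
        have osc: "oscillator \<delta> 0 T \<mu> (\<lambda>t. \<mu> * (\<theta> t + \<delta> * D (Suc 0) t)) (\<lambda>t. W 0 t \<mu>) (\<lambda>t. W (Suc 0) t \<mu>) (\<lambda>t. W (Suc (Suc 0)) t \<mu>)"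
          unfolding oscillator_def
          using W1[OF _ \<mu>] W5[OF \<mu>] W4[OF _ \<mu>, of _ 0] by (auto simp: D0 numeral_2_eq_2)
        have a: "0 \<le> T - \<epsilon>" "T - \<epsilon> \<le> T" "T - (T - \<epsilon>) \<le> 1" using \<epsilon> by auto
        have z: "\<theta> t = 0 \<and> D (Suc 0) t = 0 \<and> \<Theta>1 t = 0 \<and> \<Theta>2 t = 0" if "t \<in> {0..T - \<epsilon>}" for t
        proof -
          \<comment> \<open>At the left endpoint T - \<epsilon> of the support interval the
            derivatives vanish by continuity from the left.\<close>
          have "D n t = 0" for n
          proof (cases "t = T - \<epsilon>")
            case True
            have "continuous (at (T - \<epsilon>)) (D n)" using DERIV_isCont[OF D] by blast
            then have "(D n \<longlongrightarrow> D n (T - \<epsilon>)) (at_left (T - \<epsilon>))"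
              unfolding continuous_at by (rule tendsto_mono[rotated]) (simp add: at_le)
            moreover have "(D n \<longlongrightarrow> 0) (at_left (T - \<epsilon>))"
              by (rule tendsto_eventually) (auto simp: eventually_at_filter Dz)
            ultimately show ?thesis using True tendsto_unique[of "at_left (T - \<epsilon>)"] by force
          qed (use that in \<open>auto intro!: Dz\<close>)
          from this[of 0] this[of "Suc 0"] show ?thesis using \<Theta>z that by (simp add: D0)
        qed
        have \<theta>T: "\<theta> T = 0" using \<theta>(2)[of T] \<epsilon> by auto
        have "\<bar>\<mu>\<^sup>2 * W 0 T \<mu> - \<delta> * \<mu>\<^sup>2\<bar> \<le> K * sqrt (T - (T - \<epsilon>)) \<and>
            \<bar>\<mu>\<^sup>2 * W (Suc 0) T \<mu> - (\<mu>\<^sup>2 - \<delta>\<^sup>2 * \<mu> * (1 - \<mu>))\<bar> \<le> K * sqrt (T - (T - \<epsilon>))"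
          unfolding K_def
          using oscillator_impulse[OF \<delta> a \<mu>0 osc _ \<Theta>1d \<Theta>2d z _ \<Theta>1(2) \<theta>T] D[of 0] \<Theta>1(1) a by (auto simp: D0)
        then show ?thesis unfolding p by (simp add: abs_minus_commute)
      qed
      then show "\<bar>poly p11 \<mu> - \<mu>\<^sup>2 * W 0 T \<mu>\<bar> \<le> K * sqrt \<epsilon>" "\<bar>poly p12 \<mu> - \<mu>\<^sup>2 * W (Suc 0) T \<mu>\<bar> \<le> K * sqrt \<epsilon>" by auto
    qed
    have powf: "continuous_on {0..1} f \<Longrightarrow> fcal (\<lambda>t. t ^ k * f t) x = poly_apply ([:0, 1:] ^ k) (fcal f x)" for k f x
      using fcal_poly_apply[of f "[:0, 1:] ^ k" x] by (simp add: poly_power)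
    have c2: "continuous_on {0..1} (\<lambda>t. t ^ k * W n T t)" for k n by (intro continuous_intros Wc)
    have A2: "fcal (\<lambda>t. t\<^sup>2 * W 0 T t) \<phi> + fcal (\<lambda>t. t\<^sup>2 * W (Suc 0) T t) \<psi> = 0"
      unfolding powf[OF Wc] poly_apply_linear(1)[symmetric] eqA using poly_apply_linear(2)[of _ 0 0] by simp
    have B3: "fcal (\<lambda>t. t^3 * W (Suc 0) T t) \<phi> + fcal (\<lambda>t. t^3 * W (Suc (Suc 0)) T t) \<psi> = 0"
      unfolding powf[OF Wc] poly_apply_linear(1)[symmetric] eqB using poly_apply_linear(2)[of _ 0 0] by simp
    have Ke: "0 \<le> K * sqrt \<epsilon>" using K \<epsilon> by simp
    have imp3: "\<bar>poly p21 \<mu> - \<mu>^3 * W (Suc 0) T \<mu>\<bar> \<le> (1 + \<delta>) * K * sqrt \<epsilon>"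
      "\<bar>poly p22 \<mu> - \<mu>^3 * W (Suc (Suc 0)) T \<mu>\<bar> \<le> (1 + \<delta>) * K * sqrt \<epsilon>" if \<mu>: "\<mu> \<in> {0..1}" for \<mu>
    proof -
      have "poly p21 \<mu> - \<mu>^3 * W (Suc 0) T \<mu> = \<mu> * (poly p12 \<mu> - \<mu>\<^sup>2 * W (Suc 0) T \<mu>)"
        by (simp add: p21_def power2_eq_square power3_eq_cube algebra_simps)
      also have "\<bar>\<dots>\<bar> \<le> 1 * (K * sqrt \<epsilon>)" unfolding abs_mult using \<mu> imp(2)[OF \<mu>] by (intro mult_mono) auto
      also have "\<dots> \<le> (1 + \<delta>) * (K * sqrt \<epsilon>)" using \<delta> Ke by (intro mult_right_mono) auto
      finally show "\<bar>poly p21 \<mu> - \<mu>^3 * W (Suc 0) T \<mu>\<bar> \<le> (1 + \<delta>) * K * sqrt \<epsilon>" by (simp add: mult.assoc)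
      have "D 0 T + \<delta> * D (Suc 0) T = 0" using Dz[of T] \<epsilon> by simp
      then have "\<mu> * W (Suc (Suc 0)) T \<mu> = - ((1 - \<mu>) * (\<delta> * W (Suc 0) T \<mu> + W 0 T \<mu>))"
        using W4[OF TT \<mu>, of 0] by (simp add: numeral_2_eq_2)
      then have "\<mu>\<^sup>2 * (\<mu> * W (Suc (Suc 0)) T \<mu>) = \<mu>\<^sup>2 * - ((1 - \<mu>) * (\<delta> * W (Suc 0) T \<mu> + W 0 T \<mu>))" by simp
      then have "poly p22 \<mu> - \<mu>^3 * W (Suc (Suc 0)) T \<mu> =
          - ((1 - \<mu>) * (\<delta> * (poly p12 \<mu> - \<mu>\<^sup>2 * W (Suc 0) T \<mu>) + (poly p11 \<mu> - \<mu>\<^sup>2 * W 0 T \<mu>)))"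
        by (simp add: p22_def power2_eq_square power3_eq_cube algebra_simps)
      also have "\<bar>\<dots>\<bar> = (1 - \<mu>) * \<bar>\<delta> * (poly p12 \<mu> - \<mu>\<^sup>2 * W (Suc 0) T \<mu>) + (poly p11 \<mu> - \<mu>\<^sup>2 * W 0 T \<mu>)\<bar>"
        using \<mu> by (simp add: abs_mult)
      also have "\<dots> \<le> 1 * (\<delta> * (K * sqrt \<epsilon>) + K * sqrt \<epsilon>)"
      proof (rule mult_mono)
        have "\<bar>\<delta> * (poly p12 \<mu> - \<mu>\<^sup>2 * W (Suc 0) T \<mu>)\<bar> \<le> \<delta> * (K * sqrt \<epsilon>)"
          unfolding abs_mult abs_of_nonneg[OF \<delta>] by (intro mult_left_mono imp \<mu> \<delta>)
        then show "\<bar>\<delta> * (poly p12 \<mu> - \<mu>\<^sup>2 * W (Suc 0) T \<mu>) + (poly p11 \<mu> - \<mu>\<^sup>2 * W 0 T \<mu>)\<bar> \<le> \<delta> * (K * sqrt \<epsilon>) + K * sqrt \<epsilon>"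
          using imp(1)[OF \<mu>] by linarith
      qed (use \<mu> in auto)
      finally show "\<bar>poly p22 \<mu> - \<mu>^3 * W (Suc (Suc 0)) T \<mu>\<bar> \<le> (1 + \<delta>) * K * sqrt \<epsilon>" by (simp add: algebra_simps)
    qed
    show ?thesis
      using fcal_limit[OF c2 c2 imp A2] fcal_limit[OF c2 c2 imp3 B3] by simp
  qed
  \<comment> \<open>The vectors estimated in \<open>est\<close> do not depend on \<epsilon>, so
    letting \<epsilon> tend to 0 shows that they vanish.\<close>
  have vanish: "x = 0" if "\<And>\<epsilon>. 0 < \<epsilon> \<Longrightarrow> \<epsilon> < T \<Longrightarrow> \<epsilon> \<le> 1 \<Longrightarrow> norm x \<le> C * sqrt \<epsilon> * N" "0 \<le> C" "0 \<le> N" for x :: "(real^'n) l2" and C N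
  proof -
    have "norm x \<le> 0"
    proof (rule tendsto_lowerbound)
      have "((\<lambda>\<epsilon>. C * sqrt \<epsilon> * N) \<longlongrightarrow> C * sqrt 0 * N) (at_right 0)" by (intro tendsto_intros)
      then show "((\<lambda>\<epsilon>. C * sqrt \<epsilon> * N) \<longlongrightarrow> 0) (at_right 0)" by simp
      have "\<forall>\<^sub>F \<epsilon> in at_right (0::real). \<epsilon> \<in> {0<..<min T 1}" using T by (intro eventually_at_right_real) simp
      then show "\<forall>\<^sub>F \<epsilon> in at_right 0. norm x \<le> C * sqrt \<epsilon> * N"
        by eventually_elim (use that(1) in auto)
    qed simp
    then show ?thesis by simp
  qed
  have a: "poly_apply p11 \<phi> + poly_apply p12 \<psi> = 0"
    using est K by (intro vanish[of _ K "norm \<phi> + norm \<psi>"]) auto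
  have b: "poly_apply p21 \<phi> + poly_apply p22 \<psi> = 0"
    using est K \<delta> by (intro vanish[of _ "(1 + \<delta>) * K" "norm \<phi> + norm \<psi>"]) auto
  \<comment> \<open>Let k = (1 - \<mu>)/\<mu>, so that \<delta>^2 k = 1 - c. Up to powers of \<mu>
    the rows are (\<delta>, c) and (c, - k \<delta> (1 + c)), and the expression is c^2 + \<delta>^2
    k (1 + c) = c^2 + (1 - c)(1 + c) = 1. Only the clearing factor \<mu>^2 \<mu>^3 remains.\<close>
  have det: "p12 * p21 - p11 * p22 = [:0, 0, 0, 0, 0, 1:]"
  proof (rule poly_eq_poly_eq_iff[THEN iffD1], rule ext)
    fix x
    show "poly (p12 * p21 - p11 * p22) x = poly [:0, 0, 0, 0, 0, 1:] x"
      unfolding p11_def p12_def p21_def p22_def by (simp add: algebra_simps power2_eq_square)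
  qed
  have comm: "poly_apply (p * q) x = poly_apply q (poly_apply p x)" for p q x
    unfolding mult.commute[of p] by (rule poly_apply_mult)
  \<comment> \<open>Cramer's rule for commuting entries: eliminating \<psi> from the two relations
    leaves the determinant applied to \<phi>.\<close>
  have "poly_apply [:0, 0, 0, 0, 0, 1:] \<phi> = poly_apply p12 (poly_apply p21 \<phi>) - poly_apply p22 (poly_apply p11 \<phi>)"
    unfolding det[symmetric] poly_apply_diff poly_apply_mult[of p12] comm[of p11 p22] ..
  also have "poly_apply p21 \<phi> = - poly_apply p22 \<psi>" using b by (simp add: eq_neg_iff_add_eq_0)
  also have "poly_apply p11 \<phi> = - poly_apply p12 \<psi>" using a by (simp add: eq_neg_iff_add_eq_0)
  also have "poly_apply p12 (- poly_apply p22 \<psi>) - poly_apply p22 (- poly_apply p12 \<psi>) = 0"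
    using poly_apply_linear(2)[of p12 "-1"] poly_apply_linear(2)[of p22 "-1"] poly_apply_mult[of p12 p22 \<psi>] comm[of p12 p22 \<psi>] by simp
  finally have B5: "poly_apply [:0, 0, 0, 0, 0, 1:] \<phi> = 0" .
  have "poly_apply [:0, 0, 0, 0, 0, 1:] \<psi> = poly_apply p21 (poly_apply p12 \<psi>) - poly_apply p11 (poly_apply p22 \<psi>)"
    unfolding det[symmetric] poly_apply_diff poly_apply_mult[of p11] comm[of p12 p21] ..
  also have "poly_apply p22 \<psi> = - poly_apply p21 \<phi>" using b by (simp add: eq_neg_iff_add_eq_0 add.commute)
  also have "poly_apply p12 \<psi> = - poly_apply p11 \<phi>" using a by (simp add: eq_neg_iff_add_eq_0 add.commute)
  also have "poly_apply p21 (- poly_apply p11 \<phi>) - poly_apply p11 (- poly_apply p21 \<phi>) = 0"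
    using poly_apply_linear(2)[of p21 "-1"] poly_apply_linear(2)[of p11 "-1"] poly_apply_mult[of p11 p21 \<phi>] comm[of p11 p21 \<phi>] by simp
  finally have B5': "poly_apply [:0, 0, 0, 0, 0, 1:] \<psi> = 0" .
  \<comment> \<open>The determinant acts as the fifth power of B, and B is injective on L2(\<Omega>)
    and maps into it.\<close>
  have inj: "x = 0" if "x \<in> Lset" "poly_apply [:0, 0, 0, 0, 0, 1:] x = 0" for x
  proof -
    have "B (B (B (B (B x)))) = 0" using that(2) by (simp add: B_simps)
    then show ?thesis using B_injective B_mem_Lset that(1) by metis
  qed
  show "\<phi> = 0" "\<psi> = 0" using inj \<phi> B5 B5' by auto
qed

lemma final_states_dense: "Lset \<times> Lset \<subseteq> closure final_states"
proof (rule dense_if_no_orthogonal[OF subspace_final_states])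
  have TT: "T \<in> {0..T}" using T by simp
  show "final_states \<subseteq> Lset \<times> Lset" unfolding final_states_def using controlledD(7)[OF _ TT] by blast
  show "subspace (Lset \<times> Lset)" by (intro subspace_Times subspace_Lset)
  show "closed (Lset \<times> Lset)" by (intro closed_Times closed_Lset)
  fix p assume "p \<in> Lset \<times> Lset" "\<And>m. m \<in> final_states \<Longrightarrow> p \<bullet> m = 0"
  then show "p = 0" using orthogonal_final_states_eq_0 by (cases p) (auto simp: zero_prod_def)
qed

text \<open>The prescribed velocity F is first replaced by an L2 function f, and then (w, f) by a
  final state. Since the L2 norm dominates the dual norm, the two errors of \<epsilon>/3 add up to
  less than \<epsilon>.\<close>

lemma reachable_set_dense: "dense_in_L2_dual s \<Omega> (reachable_set s \<delta> T \<Omega> \<O>)"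
  unfolding dense_in_L2_dual_def
proof (intro conjI ballI allI impI)
  show "reachable_set s \<delta> T \<Omega> \<O> \<subseteq> L2 \<Omega> \<times> sobolev_dual s \<Omega>"
    using T by (auto simp: reachable_set_def weak_solution_def)
  fix w :: "real^'n \<Rightarrow> real" and F and \<epsilon> :: real
  assume w: "w \<in> L2 \<Omega>" and F: "F \<in> sobolev_dual s \<Omega>" and \<epsilon>: "0 < \<epsilon>"
  \<comment> \<open>The target is given only on \<Omega>; its extension by zero represents it in
    \<open>Lset\<close>.\<close>
  define w0 where "w0 x = indicator \<Omega> x * w x" for x
  have sqw: "(\<lambda>x. (w0 x)\<^sup>2) = (\<lambda>x. indicator \<Omega> x * (w x)\<^sup>2)" by (auto simp: w0_def indicator_def)
  have w0: "square_integrable w0"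
    using w unfolding square_integrable_def sqw by (simp add: L2_def set_borel_measurable_def set_integrable_def w0_def[abs_def])
  have p: "mk_l2 w0 \<in> Lset" unfolding mk_mem_Lset[OF w0] by (simp add: w0_def)
  obtain f where f: "f \<in> Lset" "\<And>\<zeta>. \<zeta> \<in> sobolev0 s \<Omega> \<Longrightarrow> sobolev_norm s \<zeta> \<le> 1 \<Longrightarrow> \<bar>f \<bullet> mk_l2 \<zeta> - F \<zeta>\<bar> \<le> \<epsilon>/3"
    using dual_approx[OF F, of "\<epsilon>/3"] \<epsilon> by auto
  have "(mk_l2 w0, f) \<in> closure final_states" using final_states_dense p f by blast
  then obtain m where m: "m \<in> final_states" "dist m (mk_l2 w0, f) < \<epsilon>/3"
    unfolding closure_approachable using \<epsilon> by (meson divide_pos_pos zero_less_numeral)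
  then obtain g g' W h where W: "m = (W 0 T, W (Suc 0) T)" and c: "controlled g g' W h"
    unfolding final_states_def by blast
  have TT: "T \<in> {0..T}" using T by simp
  have "norm (W 0 T - mk_l2 w0) \<le> dist m (mk_l2 w0, f)" "norm (W (Suc 0) T - f) \<le> dist m (mk_l2 w0, f)"
    unfolding W by (simp_all add: dist_prod_def dist_norm real_le_rsqrt)
  with m(2) have n1: "norm (W 0 T - mk_l2 w0) < \<epsilon>/3" and n2: "norm (W (Suc 0) T - f) < \<epsilon>/3" by auto
  define u where "u t x = indicator \<Omega> x * rep_l2 (W 0 t) x + g (x, t)" for t x
  define v where "v t \<zeta> = W (Suc 0) t \<bullet> mk_l2 \<zeta>" for t and \<zeta> :: "real^'n \<Rightarrow> real"
  have ws: "weak_solution s \<delta> T \<Omega> \<O> g u v"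
    unfolding u_def[abs_def] v_def[abs_def] by (rule controlled_weak_solution[OF c])
  then have reach: "(u T, v T) \<in> reachable_set s \<delta> T \<Omega> \<O>"
    unfolding reachable_set_def using controlledD(1)[OF c] by blast
  have "L2_norm \<Omega> (\<lambda>x. u T x - w x) = norm (W 0 T - mk_l2 w0)"
  proof (rule L2_norm_rep)
    show "W 0 T - mk_l2 w0 \<in> Lset" by (intro subspace_diff subspace_Lset p controlledD(7)[OF c TT])
    show "AE x in lborel. x \<in> \<Omega> \<longrightarrow> u T x - w x = rep_l2 (W 0 T - mk_l2 w0) x"
      using AE_rep_diff[of "W 0 T" "mk_l2 w0"] AE_rep_mk_l2[OF w0]
      by eventually_elim (simp add: u_def w0_def controlledD(4)[OF c])
    have "(\<lambda>x. indicator \<Omega> x * (u T x - w x)) = (\<lambda>x. indicator \<Omega> x * rep_l2 (W 0 T) x - w0 x)"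
      by (auto simp: indicator_def u_def w0_def controlledD(4)[OF c])
    then show "set_borel_measurable lborel \<Omega> (\<lambda>x. u T x - w x)"
      using square_integrable_borel[OF w0] by (simp add: set_borel_measurable_def)
  qed
  then have 1: "L2_norm \<Omega> (\<lambda>x. u T x - w x) < \<epsilon>" using n1 \<epsilon> by simp
  have "sobolev_dual_norm s \<Omega> (\<lambda>\<zeta>. v T \<zeta> - F \<zeta>) \<le> 2 * \<epsilon> / 3"
    unfolding sobolev_dual_norm_def
  proof (rule cSUP_least)
    show "{\<zeta> \<in> sobolev0 s \<Omega>. sobolev_norm s \<zeta> \<le> 1} \<noteq> {}"
      using sobolev0_zero by (auto simp: sobolev_norm_def case_prod_beta' intro!: exI[of _ "\<lambda>_. 0"])
    fix \<zeta> assume "\<zeta> \<in> {\<zeta> \<in> sobolev0 s \<Omega>. sobolev_norm s \<zeta> \<le> 1}"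
    then have \<zeta>: "\<zeta> \<in> sobolev0 s \<Omega>" "sobolev_norm s \<zeta> \<le> 1" by auto
    have "\<bar>(W (Suc 0) T - f) \<bullet> mk_l2 \<zeta>\<bar> \<le> norm (W (Suc 0) T - f) * norm (mk_l2 \<zeta>)" by (rule Cauchy_Schwarz_ineq2)
    also have "\<dots> \<le> \<epsilon>/3 * 1"
      using n2 norm_mk_le_sobolev_norm[OF sobolev0D(1)[OF \<zeta>(1)]] \<zeta>(2) \<epsilon> by (intro mult_mono) auto
    finally have "\<bar>(W (Suc 0) T - f) \<bullet> mk_l2 \<zeta>\<bar> \<le> \<epsilon>/3" by simp
    moreover have "v T \<zeta> - F \<zeta> = (W (Suc 0) T - f) \<bullet> mk_l2 \<zeta> + (f \<bullet> mk_l2 \<zeta> - F \<zeta>)"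
      by (simp add: v_def inner_diff_left)
    ultimately show "\<bar>v T \<zeta> - F \<zeta>\<bar> \<le> 2 * \<epsilon> / 3" using f(2)[OF \<zeta>] by linarith
  qed
  then have 2: "sobolev_dual_norm s \<Omega> (\<lambda>\<zeta>. v T \<zeta> - F \<zeta>) < \<epsilon>" using \<epsilon> by linarith
  show "\<exists>(v, G)\<in>reachable_set s \<delta> T \<Omega> \<O>. L2_norm \<Omega> (\<lambda>x. v x - w x) < \<epsilon> \<and> sobolev_dual_norm s \<Omega> (\<lambda>\<zeta>. G \<zeta> - F \<zeta>) < \<epsilon>"
    using reach 1 2 by (intro bexI[of _ "(u T, v T)"]) auto
qed

end

theorem theorem2p5:
  fixes \<Omega> \<O> :: "(real^'n) set" and s \<delta> T :: real
  assumes "bounded \<Omega>" and "open \<Omega>" and "lipschitz_boundary \<Omega>"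
    and "0 < s" and "s < 1" and "0 \<le> \<delta>" and "0 < T"
    and "open \<O>" and "\<O> \<noteq> {}" and "\<O> \<subseteq> - \<Omega>"
  shows "dense_in_L2_dual s \<Omega> (reachable_set s \<delta> T \<Omega> \<O>)"
proof -
  interpret exterior_control \<Omega> s \<O> \<delta> T
    by unfold_locales (use assms in auto)
  show ?thesis by (rule reachable_set_dense)
qed

end
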